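(* Let $\mathcal C$ be a small regular Cartesian Reedy category with a terminal object. The functor $Q:\Delta\int\widehat{\mathcal C}\to\mathrm{Cat}_{\mathrm{Psh}_\Delta(\mathcal C)}$ factors (up to natural isomorphism) as the composite $$\Delta\textstyle\int\widehat{\mathcal C}\xrightarrow{\ V\ }\widehat{\Theta[\mathcal C]}\xrightarrow{\ \mathfrak C\ }\mathrm{Cat}_{\mathrm{Psh}_\Delta(\mathcal C)} .$$
   Context: Regular Cartesian Reedy categories. A skeletal category is a small category $\mathcal A$ with subcategories $\mathcal A^+,\mathcal A^-$ and $\dim:\operatorname{Ob}\mathcal A\to\mathbb N$ such that: (i) isomorphisms lie in $\mathcal A^+$ and in $\mathcal A^-$, and isomorphic objects have equal dimension; (ii) a non-invertible arrow $A\to A'$ in $\mathcal A^+$ (resp. $\mathcal A^-$) satisfies $\dim A<\dim A'$ (resp. $\dim A>\dim A'$); (iii) every arrow factors, uniquely up to unique isomorphism, as $\delta\circ\pi$ with $\pi\in\mathcal A^-$, $\delta\in\mathcal A^+$; (iv) every arrow of $\mathcal A^-$ has a section, and two parallel arrows of $\mathcal A^-$ are equal iff they have the same sections. It is normal if its objects have no nontrivial automorphisms. A section $h_a\to X$ of a presheaf ($h_a$ the representable presheaf, often written $a$) is nondegenerate if it does not factor as $h_a\to h_{a'}\to X$ with $\dim a'<\dim a$. A presheaf is regular if all its nondegenerate sections are monic; $\mathcal A$ is regular skeletal if it is normal and all representables are regular. A regular Cartesian Reedy category is a small regular skeletal category $\mathcal C$ with (CR1) regular presheaves on $\mathcal C$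 are closed under finite products; (CR2) if $I$ is finite and $c\to\prod_{i\in I}c_i$ is a nondegenerate section then $\dim c\le\sum_{i\in I}\dim c_i$. $\widehat{\mathcal C}$ is the category of presheaves of sets on $\mathcal C$. The category $\Delta\int\widehat{\mathcal C}$ has objects $[n](X_1,\dots,X_n)$ with $n\ge0$ and $X_i\in\widehat{\mathcal C}$; a morphism $[n](X_1,\dots,X_n)\to[m](Y_1,\dots,Y_m)$ is an order-preserving $\gamma:[n]\to[m]$ together with maps $f_i:X_i\to\prod_{\gamma(i-1)<j\le\gamma(i)}Y_j$, $1\le i\le n$. $\Theta[\mathcal C]$ is the full subcategory on the $[n](h_{c_1},\dots,h_{c_n})=:[n](c_1,\dots,c_n)$, $c_i\in\mathcal C$, and $\widehat{\Theta[\mathcal C]}$ is the category of presheaves of sets on it ($\mathcal C$-cellular sets). $V$ sends $[n](X_1,\dots,X_n)$ to the $\mathcal C$-cellular set $V[n](X_1,\dots,X_n)=\operatorname{Hom}_{\Delta\int\widehat{\mathcal C}}(-,[n](X_1,\dots,X_n))|_{\Theta[\mathcal C]}$. $\mathrm{Psh}_\Delta(\mathcal C)$ is the category of simplicial presheaves on $\mathcal C$ and $\mathrm{Cat}_{\mathrm{Psh}_\Delta(\mathcal C)}$ that of small categories enriched in it (with Cartesian product); equivalently, $\mathcal C^{\mathrm{op}}$-indexed simplicially enriched categories with constant object set. Let $\mathfrak C_\Delta$ be the usual left adjoint of the homotopy coherent nerve (from simplicial sets to simplicially enriched categories). Let $k:\Delta\times\mathcal C\to\Theta[\mathcal C]$,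 $([n],c)\mapsto[n](c,\dots,c)$. The coherent realization $\mathfrak C:\widehat{\Theta[\mathcal C]}\to\mathrm{Cat}_{\mathrm{Psh}_\Delta(\mathcal C)}$ is given by $\mathfrak C(X)_c=\mathfrak C_\Delta((k^*X)_c)$, i.e. it has object set $X_{[0]}$ and $\mathfrak C(X)(x,y)_c=\mathfrak C_\Delta((k^*X)_c)(x,y)$. The functor $Q$: (simplicial sets and presheaves on $\mathcal C$ are regarded as constant, resp. discrete, simplicial presheaves). $Q([n](X_1,\dots,X_n))$ has objects $0,\dots,n$, with $\operatorname{Hom}(i,j)=\varnothing$ for $i>j$, the terminal object for $i=j$, and $X_{i+1}\times\Delta^1\times X_{i+2}\times\cdots\times\Delta^1\times X_j$ for $i<j$, where the $j-i-1$ factors $\Delta^1$ are indexed by the intermediate vertices $i+1,\dots,j-1$. Composition $\operatorname{Hom}(i,j)\times\operatorname{Hom}(j,k)\to\operatorname{Hom}(i,k)$ for $i<j<k$ is the inclusion of the face with coordinate $1$ at the vertex $j$. On a morphism $(\gamma,\mathbf f):[n](X_1,\dots,X_n)\to[m](Y_1,\dots,Y_m)$, $Q$ acts on objects by $\gamma$, and on $\operatorname{Hom}(i,j)\to\operatorname{Hom}(\gamma(i),\gamma(j))$ it is given on presheaf factors by $\prod_{i<k\le j}f_k:\prod_{i<k\le j}X_k\to\prod_{\gamma(i)<l\le\gamma(j)}Y_l$, while on cube coordinates the coordinate at $l$ ($\gamma(i)<l<\gamma(j)$) of the image of $(t_k)_{i<k<j}$ is $\max\{t_k:\gamma(k)=l\}$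 (and $0$ if no $k$ satisfies $\gamma(k)=l$). *)

theory Defs
  imports Main "HOL-Library.FuncSet"
begin

section \<open>Categories, functors, presheaves\<close>

text \<open>
  Maps between sets are represented by extensional functions throughout
  (equal to undefined outside the carrier), so that equality of arrows is HOL equality.
  The order of \<^term>\<open>Cmp C g f\<close> is that of composition of functions.
\<close>

record ('o, 'a) cat =
  Ob :: "'o set"
  Ar :: "'a set"
  Dom :: "'a \<Rightarrow> 'o"
  Cod :: "'a \<Rightarrow> 'o"
  Idn :: "'o \<Rightarrow> 'a"
  Cmp :: "'a \<Rightarrow> 'a \<Rightarrow> 'a"

definition category :: "('o, 'a) cat \<Rightarrow> bool" where
  "category C \<longleftrightarrow>
     (\<forall>u\<in>Ar C. Dom C u \<in> Ob C \<and> Cod C u \<in> Ob C) \<and>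
     (\<forall>a\<in>Ob C. Idn C a \<in> Ar C \<and> Dom C (Idn C a) = a \<and> Cod C (Idn C a) = a) \<and>
     (\<forall>u\<in>Ar C. \<forall>v\<in>Ar C. Cod C u = Dom C v \<longrightarrow>
        Cmp C v u \<in> Ar C \<and> Dom C (Cmp C v u) = Dom C u \<and> Cod C (Cmp C v u) = Cod C v) \<and>
     (\<forall>u\<in>Ar C. Cmp C u (Idn C (Dom C u)) = u \<and> Cmp C (Idn C (Cod C u)) u = u) \<and>
     (\<forall>u\<in>Ar C. \<forall>v\<in>Ar C. \<forall>w\<in>Ar C. Cod C u = Dom C v \<longrightarrow> Cod C v = Dom C w \<longrightarrow>
        Cmp C w (Cmp C v u) = Cmp C (Cmp C w v) u)"

text \<open>Arrows are tagged with domain and codomain.\<close>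

definition hom_cat ::
  "'x set \<Rightarrow> ('x \<Rightarrow> 'x \<Rightarrow> 'm set) \<Rightarrow> ('x \<Rightarrow> 'm) \<Rightarrow> ('x \<Rightarrow> 'x \<Rightarrow> 'x \<Rightarrow> 'm \<Rightarrow> 'm \<Rightarrow> 'm)
    \<Rightarrow> ('x, 'x \<times> 'm \<times> 'x) cat" where
  "hom_cat S H i k =
     \<lparr>Ob = S, Ar = {(x, f, y). x \<in> S \<and> y \<in> S \<and> f \<in> H x y},
      Dom = (\<lambda>(x, f, y). x), Cod = (\<lambda>(x, f, y). y), Idn = (\<lambda>x. (x, i x, x)),
      Cmp = (\<lambda>(y, g, z) (x, f, y'). (x, k x y z g f, z))\<rparr>"

definition prod_cat :: "('o, 'a) cat \<Rightarrow> ('p, 'b) cat \<Rightarrow> ('o \<times> 'p, 'a \<times> 'b) cat" where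
  "prod_cat A B =
     \<lparr>Ob = Ob A \<times> Ob B, Ar = Ar A \<times> Ar B,
      Dom = (\<lambda>(u, v). (Dom A u, Dom B v)), Cod = (\<lambda>(u, v). (Cod A u, Cod B v)),
      Idn = (\<lambda>(a, b). (Idn A a, Idn B b)),
      Cmp = (\<lambda>(u, v) (u', v'). (Cmp A u u', Cmp B v v'))\<rparr>"

definition full_subcat :: "('o, 'a) cat \<Rightarrow> 'o set \<Rightarrow> ('o, 'a) cat" where
  "full_subcat A S = A\<lparr>Ob := S, Ar := {u \<in> Ar A. Dom A u \<in> S \<and> Cod A u \<in> S}\<rparr>"

definition is_functor ::
  "('o, 'a) cat \<Rightarrow> ('p, 'b) cat \<Rightarrow> ('o \<Rightarrow> 'p) \<times> ('a \<Rightarrow> 'b) \<Rightarrow> bool" where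
  "is_functor A B F \<longleftrightarrow> category A \<and> category B \<and>
     (\<forall>a\<in>Ob A. fst F a \<in> Ob B \<and> snd F (Idn A a) = Idn B (fst F a)) \<and>
     (\<forall>u\<in>Ar A. snd F u \<in> Ar B \<and>
        Dom B (snd F u) = fst F (Dom A u) \<and> Cod B (snd F u) = fst F (Cod A u)) \<and>
     (\<forall>u\<in>Ar A. \<forall>v\<in>Ar A. Cod A u = Dom A v \<longrightarrow>
        snd F (Cmp A v u) = Cmp B (snd F v) (snd F u))"

definition functor_comp ::
  "('p \<Rightarrow> 'q) \<times> ('b \<Rightarrow> 'c) \<Rightarrow> ('o \<Rightarrow> 'p) \<times> ('a \<Rightarrow> 'b) \<Rightarrow> ('o \<Rightarrow> 'q) \<times> ('a \<Rightarrow> 'c)" where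
  "functor_comp G F = (fst G \<circ> fst F, snd G \<circ> snd F)"

definition iso_arrow :: "('o, 'a) cat \<Rightarrow> 'a \<Rightarrow> bool" where
  "iso_arrow C u \<longleftrightarrow> u \<in> Ar C \<and>
     (\<exists>v\<in>Ar C. Dom C v = Cod C u \<and> Cod C v = Dom C u \<and>
        Cmp C v u = Idn C (Dom C u) \<and> Cmp C u v = Idn C (Cod C u))"

definition terminal_object :: "('o, 'a) cat \<Rightarrow> 'o \<Rightarrow> bool" where
  "terminal_object C t \<longleftrightarrow>
     t \<in> Ob C \<and> (\<forall>c\<in>Ob C. \<exists>!u. u \<in> Ar C \<and> Dom C u = c \<and> Cod C u = t)"

record ('o, 'a, 's) psh =
  pob :: "'o \<Rightarrow> 's set"
  pmap :: "'a \<Rightarrow> 's \<Rightarrow> 's"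

definition presheaf :: "('o, 'a) cat \<Rightarrow> ('o, 'a, 's) psh \<Rightarrow> bool" where
  "presheaf C X \<longleftrightarrow>
     (\<forall>u\<in>Ar C. \<forall>x\<in>pob X (Cod C u). pmap X u x \<in> pob X (Dom C u)) \<and>
     (\<forall>a\<in>Ob C. \<forall>x\<in>pob X a. pmap X (Idn C a) x = x) \<and>
     (\<forall>u\<in>Ar C. \<forall>v\<in>Ar C. Cod C u = Dom C v \<longrightarrow>
        (\<forall>x\<in>pob X (Cod C v). pmap X (Cmp C v u) x = pmap X u (pmap X v x)))"

definition psh_hom ::
  "('o, 'a) cat \<Rightarrow> ('o, 'a, 's) psh \<Rightarrow> ('o, 'a, 't) psh \<Rightarrow> ('o \<Rightarrow> 's \<Rightarrow> 't) set" where
  "psh_hom C X Y =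
     {\<alpha> \<in> (\<Pi>\<^sub>E c\<in>Ob C. pob X c \<rightarrow>\<^sub>E pob Y c).
        \<forall>u\<in>Ar C. \<forall>x\<in>pob X (Cod C u).
          \<alpha> (Dom C u) (pmap X u x) = pmap Y u (\<alpha> (Cod C u) x)}"

definition psh_id :: "('o, 'a) cat \<Rightarrow> ('o, 'a, 's) psh \<Rightarrow> 'o \<Rightarrow> 's \<Rightarrow> 's" where
  "psh_id C X = (\<lambda>c\<in>Ob C. \<lambda>x\<in>pob X c. x)"

definition psh_comp ::
  "('o, 'a) cat \<Rightarrow> ('o, 'a, 's) psh \<Rightarrow> ('o \<Rightarrow> 't \<Rightarrow> 'r) \<Rightarrow> ('o \<Rightarrow> 's \<Rightarrow> 't) \<Rightarrow> 'o \<Rightarrow> 's \<Rightarrow> 'r" where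
  "psh_comp C X \<beta> \<alpha> = (\<lambda>c\<in>Ob C. compose (pob X c) (\<beta> c) (\<alpha> c))"

definition psh_cat ::
  "('o, 'a) cat \<Rightarrow>
    (('o, 'a, 's) psh, ('o, 'a, 's) psh \<times> ('o \<Rightarrow> 's \<Rightarrow> 's) \<times> ('o, 'a, 's) psh) cat" where
  "psh_cat C =
     hom_cat {X. presheaf C X} (psh_hom C) (psh_id C) (\<lambda>X Y Z \<beta> \<alpha>. psh_comp C X \<beta> \<alpha>)"

definition psh_prod :: "'i set \<Rightarrow> ('i \<Rightarrow> ('o, 'a, 's) psh) \<Rightarrow> ('o, 'a, 'i \<Rightarrow> 's) psh" where
  "psh_prod I X =
     \<lparr>pob = (\<lambda>c. \<Pi>\<^sub>E i\<in>I. pob (X i) c), pmap = (\<lambda>u x. \<lambda>i\<in>I. pmap (X i) u (x i))\<rparr>"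

definition yoneda :: "('o, 'a) cat \<Rightarrow> 'o \<Rightarrow> ('o, 'a, 'a) psh" where
  "yoneda C a =
     \<lparr>pob = (\<lambda>c. {u \<in> Ar C. Dom C u = c \<and> Cod C u = a}), pmap = (\<lambda>v u. Cmp C u v)\<rparr>"


section \<open>Regular Cartesian Reedy categories\<close>

definition wide_subcat :: "('o, 'a) cat \<Rightarrow> 'a set \<Rightarrow> bool" where
  "wide_subcat C S \<longleftrightarrow> S \<subseteq> Ar C \<and> (\<forall>a\<in>Ob C. Idn C a \<in> S) \<and>
     (\<forall>u\<in>S. \<forall>v\<in>S. Cod C u = Dom C v \<longrightarrow> Cmp C v u \<in> S)"

definition sections :: "('o, 'a) cat \<Rightarrow> 'a \<Rightarrow> 'a set" where
  "sections C p =
     {s \<in> Ar C. Dom C s = Cod C p \<and> Cod C s = Dom C p \<and> Cmp C p s = Idn C (Cod C p)}"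

definition factorizations :: "('o, 'a) cat \<Rightarrow> 'a set \<Rightarrow> 'a set \<Rightarrow> 'a \<Rightarrow> ('a \<times> 'a) set" where
  "factorizations C P M u =
     {(p, d). p \<in> M \<and> d \<in> P \<and> Cod C p = Dom C d \<and> Cmp C d p = u}"

definition skeletal ::
  "('o, 'a) cat \<Rightarrow> 'a set \<Rightarrow> 'a set \<Rightarrow> ('o \<Rightarrow> nat) \<Rightarrow> bool" where
  "skeletal C P M dim \<longleftrightarrow> category C \<and> wide_subcat C P \<and> wide_subcat C M \<and>
     (\<forall>u. iso_arrow C u \<longrightarrow> u \<in> P \<and> u \<in> M \<and> dim (Dom C u) = dim (Cod C u)) \<and>
     (\<forall>u\<in>P. \<not> iso_arrow C u \<longrightarrow> dim (Dom C u) < dim (Cod C u)) \<and>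
     (\<forall>u\<in>M. \<not> iso_arrow C u \<longrightarrow> dim (Dom C u) > dim (Cod C u)) \<and>
     (\<forall>u\<in>Ar C. factorizations C P M u \<noteq> {} \<and>
        (\<forall>(p, d)\<in>factorizations C P M u. \<forall>(p', d')\<in>factorizations C P M u.
           \<exists>!w. iso_arrow C w \<and> Dom C w = Cod C p \<and> Cod C w = Cod C p' \<and>
                Cmp C w p = p' \<and> Cmp C d' w = d)) \<and>
     (\<forall>p\<in>M. sections C p \<noteq> {}) \<and>
     (\<forall>p\<in>M. \<forall>q\<in>M. Dom C p = Dom C q \<longrightarrow> Cod C p = Cod C q \<longrightarrow>
        (p = q \<longleftrightarrow> sections C p = sections C q))"

definition normal_cat :: "('o, 'a) cat \<Rightarrow> bool" where
  "normal_cat C \<longleftrightarrow> (\<forall>u. iso_arrow C u \<longrightarrow> Dom C u = Cod C u \<longrightarrow> u = Idn C (Dom C u))"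

definition nondegenerate ::
  "('o, 'a) cat \<Rightarrow> ('o \<Rightarrow> nat) \<Rightarrow> ('o, 'a, 's) psh \<Rightarrow> 'o \<Rightarrow> ('o \<Rightarrow> 'a \<Rightarrow> 's) \<Rightarrow> bool" where
  "nondegenerate C dim X a \<sigma> \<longleftrightarrow> \<sigma> \<in> psh_hom C (yoneda C a) X \<and>
     \<not> (\<exists>b\<in>Ob C. \<exists>\<upsilon>\<in>psh_hom C (yoneda C a) (yoneda C b). \<exists>\<tau>\<in>psh_hom C (yoneda C b) X.
          dim b < dim a \<and> \<sigma> = psh_comp C (yoneda C a) \<tau> \<upsilon>)"

definition psh_monic ::
  "('o, 'a) cat \<Rightarrow> ('o, 'a, 's) psh \<Rightarrow> ('o \<Rightarrow> 's \<Rightarrow> 't) \<Rightarrow> bool" where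
  "psh_monic C X \<alpha> \<longleftrightarrow> (\<forall>c\<in>Ob C. inj_on (\<alpha> c) (pob X c))"

definition regular_psh ::
  "('o, 'a) cat \<Rightarrow> ('o \<Rightarrow> nat) \<Rightarrow> ('o, 'a, 's) psh \<Rightarrow> bool" where
  "regular_psh C dim X \<longleftrightarrow> presheaf C X \<and>
     (\<forall>a\<in>Ob C. \<forall>\<sigma>. nondegenerate C dim X a \<sigma> \<longrightarrow> psh_monic C (yoneda C a) \<sigma>)"

definition regular_skeletal ::
  "('o, 'a) cat \<Rightarrow> 'a set \<Rightarrow> 'a set \<Rightarrow> ('o \<Rightarrow> nat) \<Rightarrow> bool" where
  "regular_skeletal C P M dim \<longleftrightarrow> skeletal C P M dim \<and> normal_cat C \<and>
     (\<forall>a\<in>Ob C. regular_psh C dim (yoneda C a))"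

text \<open>
  A definition cannot quantify over value types, so the first closure condition below is
  stated for presheaves of sets of arrows. This is no restriction: the subpresheaf generated
  by a section is isomorphic to one of this kind, and
  lemma \<open>regular_psh_prod\<close> derives the condition for presheaves with values in any type.
\<close>

definition regular_cartesian_reedy ::
  "('o, 'a) cat \<Rightarrow> 'a set \<Rightarrow> 'a set \<Rightarrow> ('o \<Rightarrow> nat) \<Rightarrow> bool" where
  "regular_cartesian_reedy C P M dim \<longleftrightarrow> regular_skeletal C P M dim \<and>
     (\<forall>(I :: nat set) (X :: nat \<Rightarrow> ('o, 'a, 'a set) psh).
        finite I \<longrightarrow> (\<forall>i\<in>I. regular_psh C dim (X i)) \<longrightarrow> regular_psh C dim (psh_prod I X)) \<and>
     (\<forall>(I :: nat set) c a \<sigma>.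
        finite I \<longrightarrow> (\<forall>i\<in>I. c i \<in> Ob C) \<longrightarrow> a \<in> Ob C \<longrightarrow>
        nondegenerate C dim (psh_prod I (\<lambda>i. yoneda C (c i))) a \<sigma> \<longrightarrow>
        dim a \<le> (\<Sum>i\<in>I. dim (c i)))"


definition arrows :: "('o, 'a) cat \<Rightarrow> 'o \<Rightarrow> 'o \<Rightarrow> 'a set" where
  "arrows C a b = {u \<in> Ar C. Dom C u = a \<and> Cod C u = b}"

lemma categoryD:
  assumes "category C"
  shows "a \<in> Ob C \<Longrightarrow> Idn C a \<in> arrows C a a"
    and "u \<in> arrows C a b \<Longrightarrow> a \<in> Ob C \<and> b \<in> Ob C"
    and "u \<in> arrows C a b \<Longrightarrow> v \<in> arrows C b c \<Longrightarrow> Cmp C v u \<in> arrows C a c"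
    and "u \<in> arrows C a b \<Longrightarrow> Cmp C u (Idn C a) = u"
    and "u \<in> arrows C a b \<Longrightarrow> Cmp C (Idn C b) u = u"
    and "u \<in> arrows C a b \<Longrightarrow> v \<in> arrows C b c \<Longrightarrow> w \<in> arrows C c d \<Longrightarrow>
      Cmp C w (Cmp C v u) = Cmp C (Cmp C w v) u"
  using assms unfolding category_def arrows_def by auto

lemma presheaf_iff:
  assumes "category C"
  shows "presheaf C X \<longleftrightarrow>
    (\<forall>a b. \<forall>u\<in>arrows C a b. \<forall>x\<in>pob X b. pmap X u x \<in> pob X a) \<and>
    (\<forall>a\<in>Ob C. \<forall>x\<in>pob X a. pmap X (Idn C a) x = x) \<and>
    (\<forall>a b c. \<forall>u\<in>arrows C a b. \<forall>v\<in>arrows C b c. \<forall>x\<in>pob X c.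
       pmap X (Cmp C v u) x = pmap X u (pmap X v x))"
  unfolding presheaf_def arrows_def by auto

lemma presheaf_arrowsD:
  assumes "category C" "presheaf C X"
  shows "u \<in> arrows C a b \<Longrightarrow> x \<in> pob X b \<Longrightarrow> pmap X u x \<in> pob X a"
    and "a \<in> Ob C \<Longrightarrow> x \<in> pob X a \<Longrightarrow> pmap X (Idn C a) x = x"
    and "u \<in> arrows C a b \<Longrightarrow> v \<in> arrows C b c \<Longrightarrow> x \<in> pob X c \<Longrightarrow>
       pmap X (Cmp C v u) x = pmap X u (pmap X v x)"
  using assms(2) unfolding presheaf_iff[OF assms(1)] by blast+

lemma yoneda_simps: "pob (yoneda C a) c = arrows C c a" "pmap (yoneda C a) v u = Cmp C u v"
  by (simp_all add: yoneda_def arrows_def)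

lemma yoneda_presheaf: "category C \<Longrightarrow> presheaf C (yoneda C a)"
  using categoryD[of C] by (auto simp: presheaf_iff yoneda_simps)

definition element_map :: "('o, 'a) cat \<Rightarrow> ('o, 'a, 's) psh \<Rightarrow> 'o \<Rightarrow> 's \<Rightarrow> 'o \<Rightarrow> 'a \<Rightarrow> 's" where
  "element_map C X a x = (\<lambda>c\<in>Ob C. \<lambda>u\<in>arrows C c a. pmap X u x)"

lemma element_map_hom:
  assumes C: "category C" and X: "presheaf C X" and "x \<in> pob X a"
  shows "element_map C X a x \<in> psh_hom C (yoneda C a) X"
proof -
  have "element_map C X a x (Dom C u) (Cmp C v u) = pmap X u (element_map C X a x (Cod C u) v)"
    if "u \<in> Ar C" "v \<in> arrows C (Cod C u) a" for u v
  proof -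
    have u: "u \<in> arrows C (Dom C u) (Cod C u)" using that by (simp add: arrows_def)
    show ?thesis
      using that categoryD(2)[OF C u] categoryD(3)[OF C u that(2)] presheaf_arrowsD(3)[OF C X u that(2) assms(3)]
      by (simp add: element_map_def)
  qed
  then show ?thesis
    unfolding psh_hom_def yoneda_simps using presheaf_arrowsD(1)[OF C X _ assms(3)]
    by (auto simp: element_map_def)
qed

lemma psh_hom_element:
  assumes C: "category C" and X: "presheaf C X" and s: "\<sigma> \<in> psh_hom C (yoneda C a) X" and a: "a \<in> Ob C"
  shows "\<sigma> a (Idn C a) \<in> pob X a" "\<sigma> = element_map C X a (\<sigma> a (Idn C a))"
proof -
  have nat: "\<sigma> (Dom C u) (Cmp C v u) = pmap X u (\<sigma> (Cod C u) v)"
    if "u \<in> Ar C" "v \<in> arrows C (Cod C u) a" for u v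
    using s that by (simp add: psh_hom_def yoneda_simps)
  have ext: "\<sigma> \<in> extensional (Ob C)" "\<And>c. c \<in> Ob C \<Longrightarrow> \<sigma> c \<in> extensional (arrows C c a)"
    and mem: "\<And>c u. c \<in> Ob C \<Longrightarrow> u \<in> arrows C c a \<Longrightarrow> \<sigma> c u \<in> pob X c"
    using s by (auto simp: psh_hom_def yoneda_simps PiE_iff)
  show "\<sigma> a (Idn C a) \<in> pob X a" using mem[OF a categoryD(1)[OF C a]] .
  show "\<sigma> = element_map C X a (\<sigma> a (Idn C a))"
  proof (rule extensionalityI[OF ext(1)])
    fix c assume c: "c \<in> Ob C"
    show "\<sigma> c = element_map C X a (\<sigma> a (Idn C a)) c"
    proof (rule extensionalityI[OF ext(2)[OF c]])
      fix u assume u: "u \<in> arrows C c a"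
      then have "u \<in> Ar C" "Dom C u = c" "Cod C u = a" by (simp_all add: arrows_def)
      then show "\<sigma> c u = element_map C X a (\<sigma> a (Idn C a)) c u"
        using nat[of u "Idn C a"] categoryD(1)[OF C a] categoryD(5)[OF C u] u c by (simp add: element_map_def)
    qed (use c in \<open>simp add: element_map_def\<close>)
  qed (simp add: element_map_def)
qed

lemma element_map_comp:
  assumes C: "category C" and X: "presheaf C X" and u: "u \<in> arrows C a b" and y: "y \<in> pob X b"
  shows "psh_comp C (yoneda C a) (element_map C X b y) (element_map C (yoneda C b) a u)
    = element_map C X a (pmap X u y)"
proof -
  have "(\<lambda>v\<in>arrows C c a. element_map C X b y c (element_map C (yoneda C b) a u c v)) =
     (\<lambda>v\<in>arrows C c a. pmap X v (pmap X u y))" if c: "c \<in> Ob C" for c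
    using c categoryD(3)[OF C _ u] presheaf_arrowsD(3)[OF C X _ u y]
    by (auto simp: element_map_def yoneda_simps fun_eq_iff)
  then show ?thesis
    by (auto simp: psh_comp_def compose_def yoneda_simps element_map_def fun_eq_iff)
qed

lemma regular_psh_iff:
  assumes C: "category C"
  shows "regular_psh C dim X \<longleftrightarrow> presheaf C X \<and>
    (\<forall>a\<in>Ob C. \<forall>x\<in>pob X a.
       (\<exists>b. \<exists>u\<in>arrows C a b. \<exists>y\<in>pob X b. dim b < dim a \<and> x = pmap X u y) \<or>
       (\<forall>c\<in>Ob C. inj_on (\<lambda>u. pmap X u x) (arrows C c a)))" (is "_ \<longleftrightarrow> _ \<and> ?R")
proof (cases "presheaf C X")
  case X: True
  have deg: "nondegenerate C dim X a (element_map C X a x) \<longleftrightarrow>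
      \<not> (\<exists>b. \<exists>u\<in>arrows C a b. \<exists>y\<in>pob X b. dim b < dim a \<and> x = pmap X u y)"
    if a: "a \<in> Ob C" and x: "x \<in> pob X a" for a x
  proof -
    have inj: "x = y" if "y \<in> pob X a" "element_map C X a x = element_map C X a y" for y
    proof -
      have "element_map C X a x a (Idn C a) = element_map C X a y a (Idn C a)" using that(2) by simp
      then show ?thesis
        using a categoryD(1)[OF C a] presheaf_arrowsD(2)[OF C X a] x that(1) by (simp add: element_map_def)
    qed
    have "(\<exists>b\<in>Ob C. \<exists>\<upsilon>\<in>psh_hom C (yoneda C a) (yoneda C b). \<exists>\<tau>\<in>psh_hom C (yoneda C b) X.
          dim b < dim a \<and> element_map C X a x = psh_comp C (yoneda C a) \<tau> \<upsilon>) \<longleftrightarrow>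
       (\<exists>b. \<exists>u\<in>arrows C a b. \<exists>y\<in>pob X b. dim b < dim a \<and> x = pmap X u y)" (is "?A \<longleftrightarrow> ?B")
    proof
      assume ?A
      then obtain b \<upsilon> \<tau> where b: "b \<in> Ob C" and u: "\<upsilon> \<in> psh_hom C (yoneda C a) (yoneda C b)"
        and t: "\<tau> \<in> psh_hom C (yoneda C b) X" and d: "dim b < dim a"
        and e: "element_map C X a x = psh_comp C (yoneda C a) \<tau> \<upsilon>" by blast
      let ?u = "\<upsilon> a (Idn C a)" and ?y = "\<tau> b (Idn C b)"
      have u': "?u \<in> arrows C a b" using psh_hom_element(1)[OF C yoneda_presheaf[OF C] u a] by (simp add: yoneda_simps)
      have y: "?y \<in> pob X b" using psh_hom_element(1)[OF C X t b] .
      have "element_map C X a x = psh_comp C (yoneda C a) (element_map C X b ?y) (element_map C (yoneda C b) a ?u)"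
        using e psh_hom_element(2)[OF C X t b] psh_hom_element(2)[OF C yoneda_presheaf[OF C] u a] by simp
      then have "element_map C X a x = element_map C X a (pmap X ?u ?y)"
        using element_map_comp[OF C X u' y] by simp
      then have "x = pmap X ?u ?y" using inj presheaf_arrowsD(1)[OF C X u' y] by blast
      then show ?B using u' y d by blast
    next
      assume ?B
      then obtain b u y where u: "u \<in> arrows C a b" and y: "y \<in> pob X b" and d: "dim b < dim a" 
        and e: "x = pmap X u y" by blast
      have "b \<in> Ob C" using categoryD(2)[OF C u] by simp
      moreover have "element_map C (yoneda C b) a u \<in> psh_hom C (yoneda C a) (yoneda C b)"
        using element_map_hom[OF C yoneda_presheaf[OF C]] u by (simp add: yoneda_simps)
      ultimately show ?A
        using element_map_hom[OF C X y] element_map_comp[OF C X u y] d unfolding e by metis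
    qed
    then show ?thesis
      unfolding nondegenerate_def using element_map_hom[OF C X x] by blast
  qed
  have mono: "psh_monic C (yoneda C a) (element_map C X a x) \<longleftrightarrow>
     (\<forall>c\<in>Ob C. inj_on (\<lambda>u. pmap X u x) (arrows C c a))" for a x
    unfolding psh_monic_def by (intro ball_cong refl) (auto simp: yoneda_simps element_map_def inj_on_def)
  have "regular_psh C dim X \<longleftrightarrow> (\<forall>a\<in>Ob C. \<forall>x\<in>pob X a. 
      nondegenerate C dim X a (element_map C X a x) \<longrightarrow> psh_monic C (yoneda C a) (element_map C X a x))"
    (is "_ \<longleftrightarrow> ?M")
  proof
    assume ?M
    have "psh_monic C (yoneda C a) \<sigma>" if a: "a \<in> Ob C" and "nondegenerate C dim X a \<sigma>" for a \<sigma>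
    proof -
      have s: "\<sigma> \<in> psh_hom C (yoneda C a) X" using that(2) by (simp add: nondegenerate_def)
      show ?thesis
        using \<open>?M\<close> that psh_hom_element[OF C X s a] by metis
    qed
    then show "regular_psh C dim X" using X by (simp add: regular_psh_def)
  qed (simp add: regular_psh_def)
  also have "\<dots> \<longleftrightarrow> ?R"
    by (intro ball_cong refl) (simp only: deg mono imp_conv_disj not_not)
  finally show ?thesis using X by simp
qed (simp add: regular_psh_def)

lemma psh_prod_presheaf:
  assumes C: "category C" and X: "\<And>i. i \<in> I \<Longrightarrow> presheaf C (X i)"
  shows "presheaf C (psh_prod I X)"
  unfolding presheaf_iff[OF C]
proof (intro conjI allI ballI)
  fix a b u x assume "u \<in> arrows C a b" "x \<in> pob (psh_prod I X) b"
  then show "pmap (psh_prod I X) u x \<in> pob (psh_prod I X) a"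
    using presheaf_arrowsD(1)[OF C X] by (auto simp: psh_prod_def PiE_iff)
next
  fix a x assume a: "a \<in> Ob C" and x: "x \<in> pob (psh_prod I X) a"
  then have "x i = pmap (X i) (Idn C a) (x i)" if "i \<in> I" for i
    using presheaf_arrowsD(2)[OF C X[OF that] a] that by (auto simp: psh_prod_def PiE_iff)
  then show "pmap (psh_prod I X) (Idn C a) x = x" using x
    by (auto simp: psh_prod_def PiE_iff extensional_def fun_eq_iff)
next
  fix a b c u v x assume u: "u \<in> arrows C a b" and v: "v \<in> arrows C b c" and x: "x \<in> pob (psh_prod I X) c"
  then have "pmap (X i) (Cmp C v u) (x i) = pmap (X i) u (pmap (X i) v (x i))" if "i \<in> I" for i
    using presheaf_arrowsD(3)[OF C X[OF that] u v] that by (auto simp: psh_prod_def PiE_iff)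
  then show "pmap (psh_prod I X) (Cmp C v u) x = pmap (psh_prod I X) u (pmap (psh_prod I X) v x)"
    by (auto simp: psh_prod_def)
qed

text \<open>The subpresheaf generated by an element \<open>x\<close>; the element \<open>pmap X g x\<close> is encoded as the
  set of all arrows \<open>f\<close> with \<open>pmap X f x = pmap X g x\<close>.\<close>

definition fibre :: "('o, 'a) cat \<Rightarrow> ('o, 'a, 's) psh \<Rightarrow> 'o \<Rightarrow> 's \<Rightarrow> 'o \<Rightarrow> 'a \<Rightarrow> 'a set" where
  "fibre C X a x c g = {f \<in> arrows C c a. pmap X f x = pmap X g x}"

definition generated :: "('o, 'a) cat \<Rightarrow> ('o, 'a, 's) psh \<Rightarrow> 'o \<Rightarrow> 's \<Rightarrow> ('o, 'a, 'a set) psh" where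
  "generated C X a x =
     \<lparr>pob = (\<lambda>c. fibre C X a x c ` arrows C c a),
      pmap = (\<lambda>v S. \<Union>g\<in>S. fibre C X a x (Dom C v) (Cmp C g v))\<rparr>"

lemma fibre_eq_iff:
  "g \<in> arrows C c a \<Longrightarrow> g' \<in> arrows C c a \<Longrightarrow>
     fibre C X a x c g = fibre C X a x c g' \<longleftrightarrow> pmap X g x = pmap X g' x"
  unfolding fibre_def by auto

lemma generated_pmap:
  assumes C: "category C" and X: "presheaf C X" and x: "x \<in> pob X a"
    and v: "v \<in> arrows C b c" and g: "g \<in> arrows C c a"
  shows "pmap (generated C X a x) v (fibre C X a x c g) = fibre C X a x b (Cmp C g v)"
proof -
  have "Dom C v = b" using v by (simp add: arrows_def)
  have "fibre C X a x b (Cmp C g' v) = fibre C X a x b (Cmp C g v)" if "g' \<in> fibre C X a x c g" for g'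
    using that presheaf_arrowsD(3)[OF C X v _ x] g by (auto simp: fibre_def)
  moreover have "g \<in> fibre C X a x c g" using g by (simp add: fibre_def)
  ultimately have "(\<Union>g'\<in>fibre C X a x c g. fibre C X a x b (Cmp C g' v)) = fibre C X a x b (Cmp C g v)"
    by blast
  then show ?thesis using \<open>Dom C v = b\<close> by (simp add: generated_def)
qed

lemma generated_presheaf:
  assumes C: "category C" and X: "presheaf C X" and x: "x \<in> pob X a"
  shows "presheaf C (generated C X a x)"
proof -
  note p = generated_pmap[OF assms]
  have ob: "pob (generated C X a x) c = fibre C X a x c ` arrows C c a" for c
    by (simp add: generated_def)
  show ?thesis
    unfolding presheaf_iff[OF C] ob ball_simps
  proof (intro conjI allI ballI)
    fix b c v g assume v: "v \<in> arrows C b c" and g: "g \<in> arrows C c a"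
    then show "pmap (generated C X a x) v (fibre C X a x c g) \<in> fibre C X a x b ` arrows C b a"
      using categoryD(3)[OF C v g] by (simp add: p)
  next
    fix b g assume b: "b \<in> Ob C" and g: "g \<in> arrows C b a"
    then show "pmap (generated C X a x) (Idn C b) (fibre C X a x b g) = fibre C X a x b g"
      using categoryD(1)[OF C b] categoryD(4)[OF C g] by (simp add: p)
  next
    fix b c d u v g assume u: "u \<in> arrows C b c" and v: "v \<in> arrows C c d" and g: "g \<in> arrows C d a"
    then show "pmap (generated C X a x) (Cmp C v u) (fibre C X a x d g) =
      pmap (generated C X a x) u (pmap (generated C X a x) v (fibre C X a x d g))"
      using categoryD(3)[OF C u v] categoryD(3)[OF C v g] categoryD(6)[OF C u v g] by (simp add: p)
  qed
qed

lemma generated_regular: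
  assumes sk: "skeletal C P M dim" and X: "regular_psh C dim X" and x: "x \<in> pob X a"
  shows "regular_psh C dim (generated C X a x)"
proof -
  have C: "category C" using sk by (simp add: skeletal_def)
  have pX: "presheaf C X" using X by (simp add: regular_psh_def)
  note p = generated_pmap[OF C pX x]
  have ob: "pob (generated C X a x) c = fibre C X a x c ` arrows C c a" for c
    by (simp add: generated_def)
  show ?thesis
    unfolding regular_psh_iff[OF C] ob ball_simps
  proof (intro conjI ballI generated_presheaf[OF C pX x])
    fix b g assume b: "b \<in> Ob C" and g: "g \<in> arrows C b a"
    let ?S = "fibre C X a x b g" and ?y = "pmap X g x"
    have y: "?y \<in> pob X b" using presheaf_arrowsD(1)[OF C pX g x] .
    from X consider (deg) d u z where "u \<in> arrows C b d" "z \<in> pob X d" "dim d < dim b" "?y = pmap X u z"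
      | (inj) "\<forall>c\<in>Ob C. inj_on (\<lambda>u. pmap X u ?y) (arrows C c b)"
      using b y unfolding regular_psh_iff[OF C] by blast
    then show "(\<exists>e. \<exists>u\<in>arrows C b e. \<exists>T\<in>fibre C X a x e ` arrows C e a.
           dim e < dim b \<and> ?S = pmap (generated C X a x) u T) \<or>
         (\<forall>c\<in>Ob C. inj_on (\<lambda>u. pmap (generated C X a x) u ?S) (arrows C c b))"
    proof cases
      case inj
      have "u = u'" if c: "c \<in> Ob C" and u: "u \<in> arrows C c b" and u': "u' \<in> arrows C c b" 
        and e: "pmap (generated C X a x) u ?S = pmap (generated C X a x) u' ?S" for c u u'
      proof -
        have "pmap X (Cmp C g u) x = pmap X (Cmp C g u') x"
          using e unfolding p[OF u g] p[OF u' g] fibre_eq_iff[OF categoryD(3)[OF C u g] categoryD(3)[OF C u' g]] .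
        then show ?thesis
          using inj c u u' unfolding presheaf_arrowsD(3)[OF C pX u g x] presheaf_arrowsD(3)[OF C pX u' g x]
          by (meson inj_onD)
      qed
      then show ?thesis by (meson inj_onI)
    next
      case deg
      then have "factorizations C P M u \<noteq> {}" using sk unfolding skeletal_def arrows_def by auto
      then obtain q \<delta> where q: "q \<in> M" "\<delta> \<in> P" "Cod C q = Dom C \<delta>" "Cmp C \<delta> q = u"
        by (auto simp: factorizations_def)
      have Ar: "q \<in> Ar C" "\<delta> \<in> Ar C" using sk q(1,2) unfolding skeletal_def wide_subcat_def by auto
      define e where "e = Cod C q"
      have "Dom C q = b" "Cod C \<delta> = d"
        using C q(3,4) Ar deg(1) unfolding category_def arrows_def by auto
      then have qa: "q \<in> arrows C b e" and da: "\<delta> \<in> arrows C e d"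
        using Ar q(3) by (simp_all add: arrows_def e_def)
      have "dim e \<le> dim d"
        using sk q(2) da unfolding skeletal_def arrows_def by (cases "iso_arrow C \<delta>") force+
      then have de: "dim e < dim b" using deg(3) by simp
      obtain s where s: "s \<in> arrows C e b" "Cmp C q s = Idn C e"
        using sk q(1) qa unfolding skeletal_def sections_def arrows_def by force
      define w where "w = pmap X \<delta> z"
      have w: "w \<in> pob X e" using presheaf_arrowsD(1)[OF C pX da deg(2)] by (simp add: w_def)
      have yw: "?y = pmap X q w"
        using deg(4) presheaf_arrowsD(3)[OF C pX qa da deg(2)] q(4) by (simp add: w_def)
      have "pmap X s ?y = w"
        using presheaf_arrowsD(3)[OF C pX s(1) qa w] s(2) presheaf_arrowsD(2)[OF C pX _ w] 
          categoryD(2)[OF C s(1)] yw by simp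
      then have ws: "w = pmap X (Cmp C g s) x" using presheaf_arrowsD(3)[OF C pX s(1) g x] by simp
      have gs: "Cmp C g s \<in> arrows C e a" using categoryD(3)[OF C s(1) g] .
      have "pmap X (Cmp C (Cmp C g s) q) x = ?y"
        using presheaf_arrowsD(3)[OF C pX qa gs x] ws yw by simp
      then have "?S = pmap (generated C X a x) q (fibre C X a x e (Cmp C g s))"
        unfolding p[OF qa gs] by (simp add: fibre_eq_iff[OF g categoryD(3)[OF C qa gs]])
      then show ?thesis using qa gs de by blast
    qed
  qed
qed

lemma regular_psh_prod:
  fixes X :: "nat \<Rightarrow> ('o, 'a, 's) psh"
  assumes C: "regular_cartesian_reedy C P M dim" and I: "finite I"
    and X: "\<And>i. i \<in> I \<Longrightarrow> regular_psh C dim (X i)"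
  shows "regular_psh C dim (psh_prod I X)"
proof -
  have sk: "skeletal C P M dim"
    and prod: "\<And>Y :: nat \<Rightarrow> ('o, 'a, 'a set) psh. (\<forall>i\<in>I. regular_psh C dim (Y i)) \<Longrightarrow> regular_psh C dim (psh_prod I Y)"
    using C I unfolding regular_cartesian_reedy_def regular_skeletal_def by auto
  have cat: "category C" using sk by (simp add: skeletal_def)
  have pX: "presheaf C (X i)" if "i \<in> I" for i using X[OF that] by (simp add: regular_psh_def)
  show ?thesis
    unfolding regular_psh_iff[OF cat]
  proof (intro conjI ballI psh_prod_presheaf[OF cat pX])
    fix a x assume a: "a \<in> Ob C" and x: "x \<in> pob (psh_prod I X) a"
    have xi: "x i \<in> pob (X i) a" if "i \<in> I" for i using x that by (auto simp: psh_prod_def PiE_iff)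
    define Y where "Y = (\<lambda>i. generated C (X i) a (x i))"
    define \<eta> where "\<eta> = (\<lambda>i\<in>I. fibre C (X i) a (x i) a (Idn C a))"
    note ida = categoryD(1)[OF cat a]
    have Yob: "pob (Y i) c = fibre C (X i) a (x i) c ` arrows C c a" for i c
      by (simp add: generated_def Y_def)
    have Ymap: "pmap (Y i) v (fibre C (X i) a (x i) c g) = fibre C (X i) a (x i) b (Cmp C g v)"
      if "i \<in> I" "v \<in> arrows C b c" "g \<in> arrows C c a" for i v b c g
      unfolding Y_def using generated_pmap[OF cat pX[OF that(1)] xi[OF that(1)] that(2,3)] .
    have "regular_psh C dim (psh_prod I Y)"
      using generated_regular[OF sk X xi] by (intro prod) (simp add: Y_def)
    moreover have "\<eta> \<in> pob (psh_prod I Y) a"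
      using ida by (simp add: psh_prod_def Yob \<eta>_def)
    ultimately consider (deg) b u \<zeta> where "u \<in> arrows C a b" "\<zeta> \<in> pob (psh_prod I Y) b" "dim b < dim a"
        "\<eta> = pmap (psh_prod I Y) u \<zeta>"
      | (inj) "\<forall>c\<in>Ob C. inj_on (\<lambda>u. pmap (psh_prod I Y) u \<eta>) (arrows C c a)"
      using a unfolding regular_psh_iff[OF cat] by blast
    then show "(\<exists>b. \<exists>u\<in>arrows C a b. \<exists>y\<in>pob (psh_prod I X) b. dim b < dim a \<and> x = pmap (psh_prod I X) u y) \<or>
       (\<forall>c\<in>Ob C. inj_on (\<lambda>u. pmap (psh_prod I X) u x) (arrows C c a))"
    proof cases
      case deg
      have "\<exists>g. g \<in> arrows C b a \<and> \<zeta> i = fibre C (X i) a (x i) b g" if "i \<in> I" for i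
        using deg(2) that by (auto simp: psh_prod_def Yob PiE_iff)
      then obtain g where g: "\<And>i. i \<in> I \<Longrightarrow> g i \<in> arrows C b a"
        "\<And>i. i \<in> I \<Longrightarrow> \<zeta> i = fibre C (X i) a (x i) b (g i)" by metis
      let ?y = "\<lambda>i\<in>I. pmap (X i) (g i) (x i)"
      have "x i = pmap (X i) u (?y i)" if i: "i \<in> I" for i
      proof -
        have "\<eta> i = pmap (Y i) u (\<zeta> i)" using deg(4) i by (simp add: psh_prod_def)
        then have "fibre C (X i) a (x i) a (Idn C a) = fibre C (X i) a (x i) a (Cmp C (g i) u)"
          using i by (simp add: \<eta>_def g(2) Ymap[OF i deg(1) g(1)])
        then have "pmap (X i) (Idn C a) (x i) = pmap (X i) (Cmp C (g i) u) (x i)"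
          by (simp add: fibre_eq_iff[OF ida categoryD(3)[OF cat deg(1) g(1)[OF i]]])
        then show ?thesis
          using presheaf_arrowsD(2)[OF cat pX[OF i] a xi[OF i]] 
            presheaf_arrowsD(3)[OF cat pX[OF i] deg(1) g(1)[OF i] xi[OF i]] i by simp
      qed
      then have "x = pmap (psh_prod I X) u ?y"
        using x by (auto simp: psh_prod_def PiE_iff extensional_def fun_eq_iff)
      moreover have "?y \<in> pob (psh_prod I X) b"
        using presheaf_arrowsD(1)[OF cat pX g(1) xi] by (simp add: psh_prod_def)
      ultimately show ?thesis using deg(1,3) by blast
    next
      case inj
      have "u = u'" if c: "c \<in> Ob C" and u: "u \<in> arrows C c a" and u': "u' \<in> arrows C c a" 
        and e: "pmap (psh_prod I X) u x = pmap (psh_prod I X) u' x" for c u u'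
      proof -
        have "pmap (Y i) u (\<eta> i) = pmap (Y i) u' (\<eta> i)" if i: "i \<in> I" for i
        proof -
          have "pmap (X i) u (x i) = pmap (X i) u' (x i)"
            using fun_cong[OF e, of i] i by (simp add: psh_prod_def)
          then show ?thesis
            using i categoryD(5)[OF cat u] categoryD(5)[OF cat u']
            by (simp add: \<eta>_def Ymap[OF i u ida] Ymap[OF i u' ida] fibre_eq_iff[OF u u'])
        qed
        then have "pmap (psh_prod I Y) u \<eta> = pmap (psh_prod I Y) u' \<eta>"
          by (simp add: psh_prod_def cong: restrict_cong)
        then show ?thesis using inj c u u' by (meson inj_onD)
      qed
      then show ?thesis by (meson inj_onI)
    qed
  qed
qed


section \<open>Enriched categories\<close>

text \<open>
  Categories enriched in presheaves on \<open>B\<close> with the Cartesian product. For the simplex category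
  these are simplicially enriched categories, for its product with \<open>C\<close> they are the categories
  enriched in simplicial presheaves on \<open>C\<close>. \<^term>\<open>EComp E x y z b f g\<close> is the composite of
  \<open>f\<close> from \<open>x\<close> to \<open>y\<close> with \<open>g\<close> from \<open>y\<close> to \<open>z\<close> (diagrammatic order).
\<close>

record ('o, 'a, 'x, 'm) ecat =
  EOb :: "'x set"
  EHom :: "'x \<Rightarrow> 'x \<Rightarrow> ('o, 'a, 'm) psh"
  EId :: "'x \<Rightarrow> 'o \<Rightarrow> 'm"
  EComp :: "'x \<Rightarrow> 'x \<Rightarrow> 'x \<Rightarrow> 'o \<Rightarrow> 'm \<Rightarrow> 'm \<Rightarrow> 'm"

definition enriched_category :: "('o, 'a) cat \<Rightarrow> ('o, 'a, 'x, 'm) ecat \<Rightarrow> bool" where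
  "enriched_category B E \<longleftrightarrow>
     (\<forall>x\<in>EOb E. \<forall>y\<in>EOb E. presheaf B (EHom E x y)) \<and>
     (\<forall>x\<in>EOb E. \<forall>b\<in>Ob B. EId E x b \<in> pob (EHom E x x) b) \<and>
     (\<forall>x\<in>EOb E. \<forall>u\<in>Ar B. pmap (EHom E x x) u (EId E x (Cod B u)) = EId E x (Dom B u)) \<and>
     (\<forall>x\<in>EOb E. \<forall>y\<in>EOb E. \<forall>z\<in>EOb E. \<forall>b\<in>Ob B.
        \<forall>f\<in>pob (EHom E x y) b. \<forall>g\<in>pob (EHom E y z) b.
          EComp E x y z b f g \<in> pob (EHom E x z) b) \<and>
     (\<forall>x\<in>EOb E. \<forall>y\<in>EOb E. \<forall>z\<in>EOb E. \<forall>u\<in>Ar B.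
        \<forall>f\<in>pob (EHom E x y) (Cod B u). \<forall>g\<in>pob (EHom E y z) (Cod B u).
          pmap (EHom E x z) u (EComp E x y z (Cod B u) f g) =
          EComp E x y z (Dom B u) (pmap (EHom E x y) u f) (pmap (EHom E y z) u g)) \<and>
     (\<forall>x\<in>EOb E. \<forall>y\<in>EOb E. \<forall>b\<in>Ob B. \<forall>f\<in>pob (EHom E x y) b.
        EComp E x x y b (EId E x b) f = f \<and> EComp E x y y b f (EId E y b) = f) \<and>
     (\<forall>w\<in>EOb E. \<forall>x\<in>EOb E. \<forall>y\<in>EOb E. \<forall>z\<in>EOb E. \<forall>b\<in>Ob B.
        \<forall>f\<in>pob (EHom E w x) b. \<forall>g\<in>pob (EHom E x y) b. \<forall>h\<in>pob (EHom E y z) b.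
          EComp E w y z b (EComp E w x y b f g) h = EComp E w x z b f (EComp E x y z b g h))"

type_synonym ('o, 'x, 'm, 'y, 'n) efun = "('x \<Rightarrow> 'y) \<times> ('x \<Rightarrow> 'x \<Rightarrow> 'o \<Rightarrow> 'm \<Rightarrow> 'n)"

definition efunctors ::
  "('o, 'a) cat \<Rightarrow> ('o, 'a, 'x, 'm) ecat \<Rightarrow> ('o, 'a, 'y, 'n) ecat
    \<Rightarrow> ('o, 'x, 'm, 'y, 'n) efun set" where
  "efunctors B E E' =
     {(F, T). F \<in> EOb E \<rightarrow>\<^sub>E EOb E' \<and>
        T \<in> (\<Pi>\<^sub>E x\<in>EOb E. \<Pi>\<^sub>E y\<in>EOb E. psh_hom B (EHom E x y) (EHom E' (F x) (F y))) \<and>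
        (\<forall>x\<in>EOb E. \<forall>b\<in>Ob B. T x x b (EId E x b) = EId E' (F x) b) \<and>
        (\<forall>x\<in>EOb E. \<forall>y\<in>EOb E. \<forall>z\<in>EOb E. \<forall>b\<in>Ob B.
           \<forall>f\<in>pob (EHom E x y) b. \<forall>g\<in>pob (EHom E y z) b.
             T x z b (EComp E x y z b f g) =
             EComp E' (F x) (F y) (F z) b (T x y b f) (T y z b g))}"

definition efun_id ::
  "('o, 'a) cat \<Rightarrow> ('o, 'a, 'x, 'm) ecat \<Rightarrow> ('o, 'x, 'm, 'x, 'm) efun" where
  "efun_id B E = (\<lambda>x\<in>EOb E. x, \<lambda>x\<in>EOb E. \<lambda>y\<in>EOb E. psh_id B (EHom E x y))"

definition efun_comp ::
  "('o, 'a) cat \<Rightarrow> ('o, 'a, 'x, 'm) ecat \<Rightarrow>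
    ('o, 'y, 'n, 'z, 'k) efun \<Rightarrow> ('o, 'x, 'm, 'y, 'n) efun \<Rightarrow> ('o, 'x, 'm, 'z, 'k) efun" where
  "efun_comp B E = (\<lambda>(G, S) (F, T).
     (compose (EOb E) G F,
      \<lambda>x\<in>EOb E. \<lambda>y\<in>EOb E. psh_comp B (EHom E x y) (S (F x) (F y)) (T x y)))"

type_synonym ('o, 'a, 'x, 'm) ecat_ar =
  "('o, 'a, 'x, 'm) ecat \<times> ('o, 'x, 'm, 'x, 'm) efun \<times> ('o, 'a, 'x, 'm) ecat"

definition ecat_cat ::
  "('o, 'a) cat \<Rightarrow> (('o, 'a, 'x, 'm) ecat, ('o, 'a, 'x, 'm) ecat_ar) cat" where
  "ecat_cat B =
     hom_cat {E. enriched_category B E} (efunctors B) (efun_id B)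
       (\<lambda>E E' E'' G F. efun_comp B E G F)"

definition enriched_iso ::
  "('o, 'a) cat \<Rightarrow> ('o, 'a, 'x, 'm) ecat \<Rightarrow> ('o, 'a, 'y, 'n) ecat
    \<Rightarrow> ('o, 'x, 'm, 'y, 'n) efun \<Rightarrow> bool" where
  "enriched_iso B E E' F \<longleftrightarrow> F \<in> efunctors B E E' \<and>
     (\<exists>G\<in>efunctors B E' E. efun_comp B E G F = efun_id B E \<and> efun_comp B E' F G = efun_id B E')"

text \<open>
  Natural isomorphism of two functors to enriched categories. The two functors may use
  different types for objects and morphisms, hence they live in two instances of
  \<^const>\<open>ecat_cat\<close>.
\<close>

definition naturally_isomorphic ::
  "('o, 'a) cat \<Rightarrow> ('c, 'd) cat
    \<Rightarrow> ('c \<Rightarrow> ('o, 'a, 'x, 'm) ecat) \<times> ('d \<Rightarrow> ('o, 'a, 'x, 'm) ecat_ar)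
    \<Rightarrow> ('c \<Rightarrow> ('o, 'a, 'y, 'n) ecat) \<times> ('d \<Rightarrow> ('o, 'a, 'y, 'n) ecat_ar) \<Rightarrow> bool" where
  "naturally_isomorphic B A F G \<longleftrightarrow>
     is_functor A (ecat_cat B) F \<and> is_functor A (ecat_cat B) G \<and>
     (\<exists>\<Phi>. (\<forall>a\<in>Ob A. enriched_iso B (fst F a) (fst G a) (\<Phi> a)) \<and>
          (\<forall>u\<in>Ar A.
             efun_comp B (fst F (Dom A u)) (\<Phi> (Cod A u)) (fst (snd (snd F u))) =
             efun_comp B (fst F (Dom A u)) (fst (snd (snd G u))) (\<Phi> (Dom A u))))"


section \<open>Simplicial sets and the homotopy coherent nerve\<close>

definition delta_hom :: "nat \<Rightarrow> nat \<Rightarrow> (nat \<Rightarrow> nat) set" where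
  "delta_hom m n = {\<theta> \<in> {..m} \<rightarrow>\<^sub>E {..n}. mono_on {..m} \<theta>}"

type_synonym delta_ar = "nat \<times> (nat \<Rightarrow> nat) \<times> nat"

definition Delta :: "(nat, delta_ar) cat" where
  "Delta = hom_cat UNIV delta_hom (\<lambda>n. \<lambda>i\<in>{..n}. i) (\<lambda>l m n \<eta> \<theta>. compose {..l} \<eta> \<theta>)"

type_synonym 's sset = "(nat, delta_ar, 's) psh"
type_synonym ('x, 'm) scat = "(nat, delta_ar, 'x, 'm) ecat"

definition std_simplex :: "nat \<Rightarrow> (nat \<Rightarrow> nat) sset" where
  "std_simplex n = \<lparr>pob = (\<lambda>p. delta_hom p n), pmap = (\<lambda>(q, \<theta>, p) t. compose {..q} t \<theta>)\<rparr>"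

text \<open>
  The simplicial category usually written \<open>\<CC>[\<Delta>\<^sup>n]\<close>: the morphisms from \<open>i\<close> to \<open>j\<close> form
  the nerve of the poset of subsets of \<open>{i..j}\<close> that contain \<open>i\<close> and \<open>j\<close>
  (no such subset exists for \<open>i > j\<close>), and composition is union.
\<close>

type_synonym chain = "nat \<Rightarrow> nat set"

definition coherent_simplex :: "nat \<Rightarrow> (nat, chain) scat" where
  "coherent_simplex n =
     \<lparr>EOb = {..n},
      EHom = (\<lambda>i j.
        \<lparr>pob = (\<lambda>p. {S \<in> {..p} \<rightarrow>\<^sub>E {A. i \<in> A \<and> j \<in> A \<and> A \<subseteq> {i..j}}. mono_on {..p} S}),
         pmap = (\<lambda>(q, \<theta>, p) S. compose {..q} S \<theta>)\<rparr>),
      EId = (\<lambda>i p. \<lambda>r\<in>{..p}. {i}),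
      EComp = (\<lambda>i j k p S T. \<lambda>r\<in>{..p}. S r \<union> T r)\<rparr>"

definition coherent_simplex_map :: "delta_ar \<Rightarrow> (nat, nat, chain, nat, chain) efun" where
  "coherent_simplex_map = (\<lambda>(m, \<theta>, n).
     (\<theta>, \<lambda>i\<in>{..m}. \<lambda>j\<in>{..m}. \<lambda>p. \<lambda>S\<in>pob (EHom (coherent_simplex m) i j) p.
            \<lambda>r\<in>{..p}. \<theta> ` S r))"

definition coherent_nerve ::
  "('x, 'm) scat \<Rightarrow> (nat, nat, chain, 'x, 'm) efun sset" where
  "coherent_nerve D =
     \<lparr>pob = (\<lambda>n. efunctors Delta (coherent_simplex n) D),
      pmap = (\<lambda>(m, \<theta>, n) F.
        efun_comp Delta (coherent_simplex m) F (coherent_simplex_map (m, \<theta>, n)))\<rparr>"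

definition coherent_nerve_map ::
  "('x, 'm) scat \<Rightarrow> (nat, 'x, 'm, 'y, 'n) efun
    \<Rightarrow> nat \<Rightarrow> (nat, nat, chain, 'x, 'm) efun \<Rightarrow> (nat, nat, chain, 'y, 'n) efun" where
  "coherent_nerve_map D G =
     (\<lambda>n. \<lambda>F\<in>pob (coherent_nerve D) n. efun_comp Delta (coherent_simplex n) G F)"


section \<open>The left adjoint of the homotopy coherent nerve\<close>

text \<open>
  The simplicial category \<open>rigidify K\<close> is the colimit of the \<^const>\<open>coherent_simplex\<close>
  \<open>n\<close> over the simplices of \<open>K\<close>. Its objects are the vertices of \<open>K\<close>. In each degree \<open>p\<close>
  its morphisms are generated by the morphisms of degree \<open>p\<close> from \<open>i\<close> to \<open>j\<close> in
  the coherent simplex of each \<open>\<sigma>\<close>, encoded as \<open>(n, \<sigma>, i, j, S)\<close>,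
  subject to the relations making each coherent simplex a functor, naturally in \<open>\<sigma>\<close>.
  The universal property is lemma \<open>rigidify_universal\<close>; functoriality is determined by lemma
  \<open>rigidify_unit_natural\<close>.
\<close>

type_synonym 's gen = "nat \<times> 's \<times> nat \<times> nat \<times> chain"

definition vertex :: "'s sset \<Rightarrow> nat \<Rightarrow> 's \<Rightarrow> nat \<Rightarrow> 's" where
  "vertex K n \<sigma> i = pmap K (0, \<lambda>r\<in>{..0}. i, n) \<sigma>"

definition generators :: "'s sset \<Rightarrow> nat \<Rightarrow> 's gen set" where
  "generators K p =
     {(n, \<sigma>, i, j, S). \<sigma> \<in> pob K n \<and> i \<le> n \<and> j \<le> n \<and>
        S \<in> pob (EHom (coherent_simplex n) i j) p}"

primrec is_word :: "'s sset \<Rightarrow> nat \<Rightarrow> 's \<Rightarrow> 's \<Rightarrow> 's gen list \<Rightarrow> bool" where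
  "is_word K p x y [] \<longleftrightarrow> x = y \<and> x \<in> pob K 0"
| "is_word K p x y (g # w) \<longleftrightarrow> g \<in> generators K p \<and>
     (case g of (n, \<sigma>, i, j, S) \<Rightarrow> x = vertex K n \<sigma> i \<and> is_word K p (vertex K n \<sigma> j) y w)"

definition words :: "'s sset \<Rightarrow> nat \<Rightarrow> 's \<Rightarrow> 's \<Rightarrow> 's gen list set" where
  "words K p x y = {w. is_word K p x y w}"

inductive word_relation :: "'s sset \<Rightarrow> nat \<Rightarrow> 's gen list \<Rightarrow> 's gen list \<Rightarrow> bool"
  for K :: "'s sset" and p :: nat where
  unit: "\<lbrakk>\<sigma> \<in> pob K n; i \<le> n\<rbrakk> \<Longrightarrow> word_relation K p [(n, \<sigma>, i, i, EId (coherent_simplex n) i p)] []"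
| comp: "\<lbrakk>(n, \<sigma>, i, j, S) \<in> generators K p; (n, \<sigma>, j, k, T) \<in> generators K p\<rbrakk> \<Longrightarrow>
    word_relation K p [(n, \<sigma>, i, j, S), (n, \<sigma>, j, k, T)]
      [(n, \<sigma>, i, k, EComp (coherent_simplex n) i j k p S T)]"
| nat: "\<lbrakk>\<sigma> \<in> pob K n; \<theta> \<in> delta_hom m n; (m, pmap K (m, \<theta>, n) \<sigma>, i, j, S) \<in> generators K p\<rbrakk> \<Longrightarrow>
    word_relation K p [(m, pmap K (m, \<theta>, n) \<sigma>, i, j, S)]
      [(n, \<sigma>, \<theta> i, \<theta> j, snd (coherent_simplex_map (m, \<theta>, n)) i j p S)]"

definition word_rewrite :: "'s sset \<Rightarrow> nat \<Rightarrow> 's \<Rightarrow> 's \<Rightarrow> 's gen list rel" where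
  "word_rewrite K p x y = {(w, w'). w \<in> words K p x y \<and> w' \<in> words K p x y \<and>
     (\<exists>u a b v. word_relation K p a b \<and> w = u @ a @ v \<and> w' = u @ b @ v)}"

definition word_eq :: "'s sset \<Rightarrow> nat \<Rightarrow> 's \<Rightarrow> 's \<Rightarrow> 's gen list rel" where
  "word_eq K p x y = (word_rewrite K p x y \<union> (word_rewrite K p x y)\<inverse>)\<^sup>*"

definition rigidify :: "'s sset \<Rightarrow> ('s, 's gen list set) scat" where
  "rigidify K =
     \<lparr>EOb = pob K 0,
      EHom = (\<lambda>x y.
        \<lparr>pob = (\<lambda>p. words K p x y // word_eq K p x y),
         pmap = (\<lambda>(q, \<theta>, p) A. word_eq K q x y ``
           map (\<lambda>(n, \<sigma>, i, j, S).
             (n, \<sigma>, i, j, pmap (EHom (coherent_simplex n) i j) (q, \<theta>, p) S)) ` A)\<rparr>),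
      EId = (\<lambda>x p. word_eq K p x x `` {[]}),
      EComp = (\<lambda>x y z p A B. word_eq K p x z `` {a @ b | a b. a \<in> A \<and> b \<in> B})\<rparr>"

definition rigidify_map ::
  "'s sset \<Rightarrow> 't sset \<Rightarrow> (nat \<Rightarrow> 's \<Rightarrow> 't)
    \<Rightarrow> (nat, 's, 's gen list set, 't, 't gen list set) efun" where
  "rigidify_map K L h =
     (h 0, \<lambda>x\<in>pob K 0. \<lambda>y\<in>pob K 0. \<lambda>p. \<lambda>A\<in>pob (EHom (rigidify K) x y) p.
        word_eq L p (h 0 x) (h 0 y) `` map (\<lambda>(n, \<sigma>, i, j, S). (n, h n \<sigma>, i, j, S)) ` A)"

definition rigidify_unit ::
  "'s sset \<Rightarrow> nat \<Rightarrow> 's \<Rightarrow> (nat, nat, chain, 's, 's gen list set) efun" where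
  "rigidify_unit K = (\<lambda>n. \<lambda>\<sigma>\<in>pob K n.
     (\<lambda>i\<in>{..n}. vertex K n \<sigma> i,
      \<lambda>i\<in>{..n}. \<lambda>j\<in>{..n}. \<lambda>p. \<lambda>S\<in>pob (EHom (coherent_simplex n) i j) p.
        word_eq K p (vertex K n \<sigma> i) (vertex K n \<sigma> j) `` {[(n, \<sigma>, i, j, S)]}))"


lemma Delta_simps [simp]:
  "Ob Delta = UNIV"
  "(m, \<theta>, n) \<in> Ar Delta \<longleftrightarrow> \<theta> \<in> delta_hom m n"
  "Dom Delta (m, \<theta>, n) = m"
  "Cod Delta (m, \<theta>, n) = n"
  "Idn Delta n = (n, \<lambda>i\<in>{..n}. i, n)"
  "Cmp Delta (m', \<eta>, n) (l, \<theta>, m) = (l, compose {..l} \<eta> \<theta>, n)"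
  by (auto simp: Delta_def hom_cat_def)

lemma delta_homD:
  assumes "\<theta> \<in> delta_hom m n"
  shows "i \<le> m \<Longrightarrow> \<theta> i \<le> n" and "i \<le> j \<Longrightarrow> j \<le> m \<Longrightarrow> \<theta> i \<le> \<theta> j"
    and "\<not> i \<le> m \<Longrightarrow> \<theta> i = undefined" and "\<theta> \<in> extensional {..m}"
  using assms by (auto simp: delta_hom_def mono_on_def PiE_iff extensional_def)

lemma delta_homI:
  assumes "\<theta> \<in> extensional {..m}" "\<And>i. i \<le> m \<Longrightarrow> \<theta> i \<le> n"
    "\<And>i j. i \<le> j \<Longrightarrow> j \<le> m \<Longrightarrow> \<theta> i \<le> \<theta> j"
  shows "\<theta> \<in> delta_hom m n"
  using assms by (auto simp: delta_hom_def mono_on_def PiE_iff)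

lemma delta_hom_id: "(\<lambda>i\<in>{..n}. i) \<in> delta_hom n n"
  by (rule delta_homI) auto

lemma delta_hom_const: "i \<le> n \<Longrightarrow> (\<lambda>r\<in>{..0::nat}. i) \<in> delta_hom 0 n"
  by (rule delta_homI) auto

lemma delta_hom_compose:
  "\<theta> \<in> delta_hom l m \<Longrightarrow> \<eta> \<in> delta_hom m n \<Longrightarrow> compose {..l} \<eta> \<theta> \<in> delta_hom l n"
  by (rule delta_homI) (auto simp: compose_def delta_homD)

lemma Arr_Delta: "u \<in> Ar Delta \<longleftrightarrow> (\<exists>m \<theta> n. u = (m, \<theta>, n) \<and> \<theta> \<in> delta_hom m n)"
  by (cases u) auto

lemma category_Delta: "category Delta"
  unfolding category_def Ball_def
  by (auto simp: delta_hom_id delta_hom_compose Arr_Delta)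
    (auto simp: compose_def delta_homD fun_eq_iff)

lemma Ball_Ar_Delta:
  "(\<forall>u\<in>Ar Delta. P u) \<longleftrightarrow> (\<forall>m n \<theta>. \<theta> \<in> delta_hom m n \<longrightarrow> P (m, \<theta>, n))"
  by (auto simp: Arr_Delta)

lemma presheaf_Delta:
  "presheaf Delta K \<longleftrightarrow>
     (\<forall>m n \<theta> x. \<theta> \<in> delta_hom m n \<longrightarrow> x \<in> pob K n \<longrightarrow> pmap K (m, \<theta>, n) x \<in> pob K m) \<and>
     (\<forall>n x. x \<in> pob K n \<longrightarrow> pmap K (n, \<lambda>i\<in>{..n}. i, n) x = x) \<and>
     (\<forall>l m n \<theta> \<eta> x. \<theta> \<in> delta_hom l m \<longrightarrow> \<eta> \<in> delta_hom m n \<longrightarrow> x \<in> pob K n \<longrightarrow>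
        pmap K (l, compose {..l} \<eta> \<theta>, n) x = pmap K (l, \<theta>, m) (pmap K (m, \<eta>, n) x))"
  unfolding presheaf_def Ball_Ar_Delta by auto

lemma presheafD:
  assumes "presheaf Delta K"
  shows "\<theta> \<in> delta_hom m n \<Longrightarrow> x \<in> pob K n \<Longrightarrow> pmap K (m, \<theta>, n) x \<in> pob K m"
    and "x \<in> pob K n \<Longrightarrow> pmap K (n, \<lambda>i\<in>{..n}. i, n) x = x"
    and "\<theta> \<in> delta_hom l m \<Longrightarrow> \<eta> \<in> delta_hom m n \<Longrightarrow> x \<in> pob K n \<Longrightarrow>
        pmap K (l, \<theta>, m) (pmap K (m, \<eta>, n) x) = pmap K (l, compose {..l} \<eta> \<theta>, n) x"
  using assms unfolding presheaf_Delta by auto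

lemma psh_hom_Delta:
  "\<alpha> \<in> psh_hom Delta K L \<longleftrightarrow>
     (\<forall>n. \<alpha> n \<in> pob K n \<rightarrow>\<^sub>E pob L n) \<and>
     (\<forall>m n \<theta> x. \<theta> \<in> delta_hom m n \<longrightarrow> x \<in> pob K n \<longrightarrow>
        \<alpha> m (pmap K (m, \<theta>, n) x) = pmap L (m, \<theta>, n) (\<alpha> n x))"
  unfolding psh_hom_def Ball_Ar_Delta by (auto simp: PiE_iff)

lemma psh_homD:
  assumes "\<alpha> \<in> psh_hom Delta K L" 
  shows "x \<in> pob K n \<Longrightarrow> \<alpha> n x \<in> pob L n"
    "\<theta> \<in> delta_hom m n \<Longrightarrow> x \<in> pob K n \<Longrightarrow>
        \<alpha> m (pmap K (m, \<theta>, n) x) = pmap L (m, \<theta>, n) (\<alpha> n x)"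
    "\<alpha> n \<in> extensional (pob K n)"
  using assms by (auto simp: psh_hom_Delta PiE_iff)

lemma vertex_pmap:
  assumes "presheaf Delta K" "\<theta> \<in> delta_hom m n" "\<sigma> \<in> pob K n" "i \<le> m"
  shows "vertex K m (pmap K (m, \<theta>, n) \<sigma>) i = vertex K n \<sigma> (\<theta> i)"
proof -
  have "compose {..0::nat} \<theta> (\<lambda>r\<in>{..0}. i) = (\<lambda>r\<in>{..0}. \<theta> i)"
    by (auto simp: compose_def)
  then show ?thesis
    using presheafD(3)[OF assms(1) delta_hom_const[OF assms(4)] assms(2,3)] by (simp only: vertex_def)
qed

lemma vertex_in:
  "presheaf Delta K \<Longrightarrow> \<sigma> \<in> pob K n \<Longrightarrow> i \<le> n \<Longrightarrow> vertex K n \<sigma> i \<in> pob K 0"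
  using delta_hom_const[of i n] unfolding vertex_def presheaf_Delta by blast

lemma vertex_map:
  "h \<in> psh_hom Delta K L \<Longrightarrow> \<sigma> \<in> pob K n \<Longrightarrow> i \<le> n \<Longrightarrow>
     vertex L n (h n \<sigma>) i = h 0 (vertex K n \<sigma> i)"
  using delta_hom_const[of i n] by (simp add: vertex_def psh_homD)

lemma coh_hom:
  "S \<in> pob (EHom (coherent_simplex n) i j) p \<longleftrightarrow>
     S \<in> extensional {..p} \<and> (\<forall>r\<le>p. i \<in> S r \<and> j \<in> S r \<and> S r \<subseteq> {i..j}) \<and>
     (\<forall>r s. r \<le> s \<longrightarrow> s \<le> p \<longrightarrow> S r \<subseteq> S s)"
  by (simp add: coherent_simplex_def PiE_iff mono_on_def) (use order_trans in blast)

lemma coh_simps [simp]: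
  "EOb (coherent_simplex n) = {..n}"
  "EId (coherent_simplex n) i p = (\<lambda>r\<in>{..p}. {i})"
  "EComp (coherent_simplex n) i j k p S T = (\<lambda>r\<in>{..p}. S r \<union> T r)"
  "pmap (EHom (coherent_simplex n) i j) (q, \<theta>, p) S = compose {..q} S \<theta>"
  by (auto simp: coherent_simplex_def)

lemma coh_le: "S \<in> pob (EHom (coherent_simplex n) i j) p \<Longrightarrow> i \<le> j"
  unfolding coh_hom by (metis atLeastAtMost_iff le0 subsetD)

lemma coh_id: "(\<lambda>r\<in>{..p}. {i}) \<in> pob (EHom (coherent_simplex n) i i) p"
  by (auto simp: coh_hom)

lemma coh_comp:
  assumes S: "S \<in> pob (EHom (coherent_simplex n) i j) p"
    and T: "T \<in> pob (EHom (coherent_simplex n) j k) p"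
  shows "(\<lambda>r\<in>{..p}. S r \<union> T r) \<in> pob (EHom (coherent_simplex n) i k) p"
proof -
  have "S r \<union> T r \<subseteq> {i..k}" if "r \<le> p" for r
  proof -
    have "S r \<subseteq> {i..j}" "T r \<subseteq> {j..k}" using S T that unfolding coh_hom by blast+
    then show ?thesis using coh_le[OF S] coh_le[OF T] by fastforce
  qed
  then show ?thesis using S T unfolding coh_hom by (simp add: le_supI1 le_supI2)
qed

lemma coh_pmap:
  "S \<in> pob (EHom (coherent_simplex n) i j) p \<Longrightarrow> \<theta> \<in> delta_hom q p \<Longrightarrow>
   compose {..q} S \<theta> \<in> pob (EHom (coherent_simplex n) i j) q"
  unfolding coh_hom by (simp add: compose_def delta_homD)

lemma compose_id_ext: "S \<in> extensional {..n::nat} \<Longrightarrow> compose {..n} S (\<lambda>i\<in>{..n}. i) = S"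
  by (auto simp: compose_def extensional_def fun_eq_iff)

lemma compose_compose_delta: "\<theta> \<in> delta_hom l m \<Longrightarrow>
    compose {..l} (compose {..m} S \<eta>) \<theta> = compose {..l} S (compose {..l} \<eta> \<theta>)"
  by (auto simp: compose_def delta_homD fun_eq_iff)

lemma coh_presheaf: "presheaf Delta (EHom (coherent_simplex n) i j)"
  unfolding presheaf_Delta
proof (intro conjI allI impI)
  fix p S assume "S \<in> pob (EHom (coherent_simplex n) i j) p"
  then have "S \<in> extensional {..p}" by (simp add: coh_hom)
  then show "pmap (EHom (coherent_simplex n) i j) (p, \<lambda>i\<in>{..p}. i, p) S = S"
    by (auto simp: compose_def extensional_def fun_eq_iff)
next
  fix l m n' \<theta> \<eta> x assume "\<theta> \<in> delta_hom l m"
  then show "pmap (EHom (coherent_simplex n) i j) (l, compose {..l} \<eta> \<theta>, n') x =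
       pmap (EHom (coherent_simplex n) i j) (l, \<theta>, m) (pmap (EHom (coherent_simplex n) i j) (m, \<eta>, n') x)"
    by (auto simp: compose_def delta_homD fun_eq_iff)
qed (simp add: coh_pmap)

lemma coh_enriched: "enriched_category Delta (coherent_simplex n)"
  unfolding enriched_category_def Ball_Ar_Delta
proof (intro conjI ballI allI impI)
  fix x y b f assume "f \<in> pob (EHom (coherent_simplex n) x y) b"
  then have f: "f \<in> extensional {..b}" "\<And>r. r \<le> b \<Longrightarrow> x \<in> f r" "\<And>r. r \<le> b \<Longrightarrow> y \<in> f r"
    by (auto simp: coh_hom)
  show "EComp (coherent_simplex n) x x y b (EId (coherent_simplex n) x b) f = f"
    "EComp (coherent_simplex n) x y y b f (EId (coherent_simplex n) y b) = f"
    using f by (auto simp: extensional_def fun_eq_iff insert_absorb)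
qed (auto simp: coh_presheaf coh_id coh_comp Un_assoc compose_def delta_homD fun_eq_iff)

lemma coh_image:
  assumes S: "S \<in> pob (EHom (coherent_simplex m) i j) p" and t: "\<theta> \<in> delta_hom m n" and "j \<le> m"
  shows "(\<lambda>r\<in>{..p}. \<theta> ` S r) \<in> pob (EHom (coherent_simplex n) (\<theta> i) (\<theta> j)) p"
proof -
  have "\<theta> ` S r \<subseteq> {\<theta> i..\<theta> j}" if "r \<le> p" for r
  proof -
    have "i \<le> l \<and> l \<le> j" if "l \<in> S r" for l
      using S that \<open>r \<le> p\<close> unfolding coh_hom by (meson atLeastAtMost_iff subsetD)
    then have "\<theta> i \<le> \<theta> l \<and> \<theta> l \<le> \<theta> j" if "l \<in> S r" for l
      using delta_homD(2)[OF t] that assms(3) le_trans by blast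
    then show ?thesis by auto
  qed
  then show ?thesis using S unfolding coh_hom by (simp add: image_mono)
qed

lemma coh_map_efunctor:
  assumes t: "\<theta> \<in> delta_hom m n"
  shows "coherent_simplex_map (m, \<theta>, n) \<in> efunctors Delta (coherent_simplex m) (coherent_simplex n)"
proof -
  have "(\<lambda>p. \<lambda>S\<in>pob (EHom (coherent_simplex m) i j) p. \<lambda>r\<in>{..p}. \<theta> ` S r)
     \<in> psh_hom Delta (EHom (coherent_simplex m) i j) (EHom (coherent_simplex n) (\<theta> i) (\<theta> j))"
    if "i \<le> m" "j \<le> m" for i j
    unfolding psh_hom_Delta using that t
    by (simp add: coh_image coh_pmap) (auto simp: compose_def delta_homD fun_eq_iff)
  then show ?thesis
    using t unfolding efunctors_def coherent_simplex_map_def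
    by (auto simp: PiE_iff coh_id coh_comp delta_homD image_Un fun_eq_iff)
qed

lemma generators_iff:
  "(n, \<sigma>, i, j, S) \<in> generators K p \<longleftrightarrow> \<sigma> \<in> pob K n \<and> i \<le> n \<and> j \<le> n \<and>
        S \<in> pob (EHom (coherent_simplex n) i j) p"
  by (simp add: generators_def)

lemma is_word_ends: "presheaf Delta K \<Longrightarrow> is_word K p x y w \<Longrightarrow> x \<in> pob K 0 \<and> y \<in> pob K 0"
  by (induction w arbitrary: x) (auto simp: generators_iff vertex_in)

lemma is_word_append:
  assumes K: "presheaf Delta K"
  shows "is_word K p x z (u @ v) \<longleftrightarrow> (\<exists>y. is_word K p x y u \<and> is_word K p y z v)"
  by (induction u arbitrary: x) (use is_word_ends[OF K] in \<open>auto split: prod.splits\<close>)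

lemma coh_map_simp [simp]:
  "i \<le> m \<Longrightarrow> j \<le> m \<Longrightarrow> S \<in> pob (EHom (coherent_simplex m) i j) p \<Longrightarrow>
    snd (coherent_simplex_map (m, \<theta>, n)) i j p S = (\<lambda>r\<in>{..p}. \<theta> ` S r)"
  "fst (coherent_simplex_map (m, \<theta>, n)) = \<theta>"
  by (simp_all add: coherent_simplex_map_def)

definition word_class where "word_class K p x y w = word_eq K p x y `` {w}"

lemma word_eq_sym: "(a, b) \<in> word_eq K p x y \<Longrightarrow> (b, a) \<in> word_eq K p x y"
  unfolding word_eq_def by (metis converse_Un converse_converse converse_iff rtrancl_converseI sup_commute)

lemma word_eq_trans: "(a, b) \<in> word_eq K p x y \<Longrightarrow> (b, c) \<in> word_eq K p x y \<Longrightarrow> (a, c) \<in> word_eq K p x y"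
  unfolding word_eq_def by simp

lemma word_eq_refl: "(a, a) \<in> word_eq K p x y"
  unfolding word_eq_def by simp

lemma word_eq_word: "(a, b) \<in> word_eq K p x y \<Longrightarrow> is_word K p x y a \<Longrightarrow> is_word K p x y b"
  unfolding word_eq_def by (induction rule: rtrancl_induct) (auto simp: word_rewrite_def words_def)

lemma word_class_eq_iff: "word_class K p x y a = word_class K p x y b \<longleftrightarrow> (a, b) \<in> word_eq K p x y"
proof
  assume "word_class K p x y a = word_class K p x y b"
  moreover have "b \<in> word_class K p x y b" by (simp add: word_class_def word_eq_refl)
  ultimately have "b \<in> word_class K p x y a" by simp
  then show "(a, b) \<in> word_eq K p x y" by (simp add: word_class_def)
next
  assume ab: "(a, b) \<in> word_eq K p x y"
  show "word_class K p x y a = word_class K p x y b"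
    using word_eq_trans[OF ab] word_eq_trans[OF word_eq_sym[OF ab]] by (auto simp: word_class_def)
qed

lemma word_eq_map:
  assumes "\<And>a b. (a, b) \<in> word_rewrite K p x y \<Longrightarrow> (\<Phi> a, \<Phi> b) \<in> word_eq L q x' y'"
    and "(a, b) \<in> word_eq K p x y"
  shows "(\<Phi> a, \<Phi> b) \<in> word_eq L q x' y'"
  using assms(2) unfolding word_eq_def[of K]
proof (induction rule: rtrancl_induct)
  case base
  then show ?case by (rule word_eq_refl)
next
  case (step b c)
  have "(\<Phi> b, \<Phi> c) \<in> word_eq L q x' y'"
    using step.hyps(2) assms(1)[of b c] word_eq_sym[OF assms(1)[of c b]] by blast
  then show ?case by (rule word_eq_trans[OF step.IH])
qed

lemma word_class_image:
  assumes "\<And>a b. (a, b) \<in> word_rewrite K p x y \<Longrightarrow> (\<Phi> a, \<Phi> b) \<in> word_eq L q x' y'"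
  shows "word_eq L q x' y' `` \<Phi> ` word_class K p x y w = word_class L q x' y' (\<Phi> w)"
proof -
  have "(\<Phi> w, \<Phi> a) \<in> word_eq L q x' y'" if "a \<in> word_class K p x y w" for a
    using that word_eq_map[of K p x y \<Phi> L q x' y' w a, OF assms] by (simp add: word_class_def)
  moreover have "w \<in> word_class K p x y w" by (simp add: word_class_def word_eq_refl)
  ultimately show ?thesis unfolding word_class_def[of L] by (auto intro: word_eq_trans)
qed


lemma rewrite_cong:
  assumes K: "presheaf Delta K" and "is_word K p x' x u" "is_word K p y y' v"
    "(a, b) \<in> word_rewrite K p x y"
  shows "(u @ a @ v, u @ b @ v) \<in> word_rewrite K p x' y'"
proof -
  obtain u' a' b' v' where *: "word_relation K p a' b'" "a = u' @ a' @ v'" "b = u' @ b' @ v'"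
    "is_word K p x y a" "is_word K p x y b"
    using assms(4) by (auto simp: word_rewrite_def words_def)
  then have "u @ a @ v = (u @ u') @ a' @ (v' @ v)" "u @ b @ v = (u @ u') @ b' @ (v' @ v)" by auto
  moreover have "is_word K p x' y' (u @ a @ v)" "is_word K p x' y' (u @ b @ v)"
    using * assms(2,3) is_word_append[OF K] by metis+
  ultimately show ?thesis using *(1) unfolding word_rewrite_def words_def by blast
qed

lemma word_eq_cong1:
  assumes K: "presheaf Delta K" and "is_word K p x' x u" "is_word K p y y' v"
    "(a, b) \<in> word_eq K p x y"
  shows "(u @ a @ v, u @ b @ v) \<in> word_eq K p x' y'"
proof (rule word_eq_map[where \<Phi> = "\<lambda>a. u @ a @ v", OF _ assms(4)])
  fix a b assume "(a, b) \<in> word_rewrite K p x y"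
  then show "(u @ a @ v, u @ b @ v) \<in> word_eq K p x' y'"
    using rewrite_cong[OF assms(1-3)] by (auto simp: word_eq_def)
qed

lemma word_eq_append:
  assumes K: "presheaf Delta K" and "is_word K p x y a" "is_word K p y z b"
    "(a, a') \<in> word_eq K p x y" "(b, b') \<in> word_eq K p y z"
  shows "(a @ b, a' @ b') \<in> word_eq K p x z"
proof -
  have "x \<in> pob K 0" "z \<in> pob K 0" using is_word_ends[OF K] assms(2,3) by auto
  then have "(a @ b, a' @ b) \<in> word_eq K p x z" "(a' @ b, a' @ b') \<in> word_eq K p x z"
    using word_eq_cong1[OF K, of p x x "[]" y z b a a'] assms(3,4)
      word_eq_cong1[OF K, of p x y a' z z "[]" b b'] assms(5) word_eq_word[OF assms(4,2)] by auto
  then show ?thesis by (rule word_eq_trans)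
qed

lemma rigidify_EOb [simp]: "EOb (rigidify K) = pob K 0"
  by (simp add: rigidify_def)

lemma rigidify_hom: "A \<in> pob (EHom (rigidify K) x y) p \<longleftrightarrow> (\<exists>w. is_word K p x y w \<and> A = word_class K p x y w)"
  by (auto simp: rigidify_def quotient_def words_def word_class_def)

lemma rigidify_EId: "EId (rigidify K) x p = word_class K p x x []"
  by (simp add: rigidify_def word_class_def)

lemma rigidify_EComp:
  assumes K: "presheaf Delta K" and "is_word K p x y a" "is_word K p y z b"
  shows "EComp (rigidify K) x y z p (word_class K p x y a) (word_class K p y z b) = word_class K p x z (a @ b)"
proof -
  have 1: "(a @ b, a' @ b') \<in> word_eq K p x z" if "a' \<in> word_class K p x y a" "b' \<in> word_class K p y z b" for a' b'
    using that word_eq_append[OF assms] by (auto simp: word_class_def)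
  have 2: "a \<in> word_class K p x y a" "b \<in> word_class K p y z b" by (simp_all add: word_class_def word_eq_refl)
  have "word_eq K p x z `` {a' @ b' | a' b'. a' \<in> word_class K p x y a \<and> b' \<in> word_class K p y z b} 
     = word_class K p x z (a @ b)" (is "?L = ?R")
  proof
    show "?L \<subseteq> ?R"
      using word_eq_trans[OF 1] by (auto simp: word_class_def[of K p x z])
    show "?R \<subseteq> ?L"
      using 2 unfolding word_class_def[of K p x z] by blast
  qed
  then show ?thesis by (simp add: rigidify_def)
qed

definition gen_map where
  "gen_map h q \<theta> = (\<lambda>(n, \<sigma>, i, j, S). (n, h n \<sigma>, i, j, compose {..q::nat} S \<theta>))"

lemma gen_map_generator:
  assumes "h \<in> psh_hom Delta K L" "\<theta> \<in> delta_hom q p" "g \<in> generators K p"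
  shows "gen_map h q \<theta> g \<in> generators L q"
  using assms by (cases g) (auto simp: gen_map_def generators_iff psh_homD coh_pmap)

lemma gen_map_word:
  assumes "h \<in> psh_hom Delta K L" "\<theta> \<in> delta_hom q p"
  shows "is_word K p x y w \<Longrightarrow> is_word L q (h 0 x) (h 0 y) (map (gen_map h q \<theta>) w)"
proof (induction w arbitrary: x)
  case Nil
  then show ?case using assms by (auto simp: psh_homD)
next
  case (Cons g w)
  obtain n \<sigma> i j S where g: "g = (n, \<sigma>, i, j, S)" by (cases g)
  have "gen_map h q \<theta> g \<in> generators L q" using gen_map_generator[OF assms] Cons.prems by auto
  moreover have "vertex L n (h n \<sigma>) i = h 0 (vertex K n \<sigma> i)" "vertex L n (h n \<sigma>) j = h 0 (vertex K n \<sigma> j)"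
    using Cons.prems g vertex_map[OF assms(1)] by (auto simp: generators_iff)
  ultimately show ?case using Cons g by (auto simp: gen_map_def)
qed

lemma gen_map_relation:
  assumes h: "h \<in> psh_hom Delta K L" and t: "\<theta> \<in> delta_hom q p" and "word_relation K p a b"
  shows "word_relation L q (map (gen_map h q \<theta>) a) (map (gen_map h q \<theta>) b)"
  using assms(3)
proof cases
  case (unit \<sigma> n i)
  have "gen_map h q \<theta> (n, \<sigma>, i, i, EId (coherent_simplex n) i p) = (n, h n \<sigma>, i, i, EId (coherent_simplex n) i q)"
    using t by (auto simp: gen_map_def compose_def delta_homD fun_eq_iff)
  then show ?thesis using unit word_relation.unit[of "h n \<sigma>" L n i q] psh_homD[OF h] by simp
next
  case (comp n \<sigma> i j S k T)
  have "gen_map h q \<theta> (n, \<sigma>, i, k, EComp (coherent_simplex n) i j k p S T)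
     = (n, h n \<sigma>, i, k, EComp (coherent_simplex n) i j k q (compose {..q} S \<theta>) (compose {..q} T \<theta>))"
    using t by (auto simp: gen_map_def compose_def delta_homD fun_eq_iff)
  moreover have "(n, h n \<sigma>, i, j, compose {..q} S \<theta>) \<in> generators L q"
    "(n, h n \<sigma>, j, k, compose {..q} T \<theta>) \<in> generators L q"
    using comp gen_map_generator[OF h t] by (force simp: gen_map_def)+
  ultimately show ?thesis using comp word_relation.comp[of n "h n \<sigma>" i j _ L q]
    by (simp add: gen_map_def)
next
  case (nat \<sigma> n \<eta> m i j S)
  then have S: "i \<le> m" "j \<le> m" "S \<in> pob (EHom (coherent_simplex m) i j) p" by (auto simp: generators_iff)
  have 1: "h m (pmap K (m, \<eta>, n) \<sigma>) = pmap L (m, \<eta>, n) (h n \<sigma>)" using nat psh_homD[OF h] by auto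
  have "(m, h m (pmap K (m, \<eta>, n) \<sigma>), i, j, compose {..q} S \<theta>) \<in> generators L q"
    using nat gen_map_generator[OF h t] by (force simp: gen_map_def)
  then have "word_relation L q [(m, pmap L (m, \<eta>, n) (h n \<sigma>), i, j, compose {..q} S \<theta>)]
      [(n, h n \<sigma>, \<eta> i, \<eta> j, snd (coherent_simplex_map (m, \<eta>, n)) i j q (compose {..q} S \<theta>))]"
    using word_relation.nat[of "h n \<sigma>" L n \<eta> m] nat psh_homD[OF h] 1 by simp
  moreover have "snd (coherent_simplex_map (m, \<eta>, n)) i j q (compose {..q} S \<theta>)
    = compose {..q} (snd (coherent_simplex_map (m, \<eta>, n)) i j p S) \<theta>"
    using S t coh_pmap[OF S(3) t] by (auto simp: compose_def delta_homD fun_eq_iff)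
  ultimately show ?thesis using nat by (simp add: gen_map_def 1)
qed

lemma gen_map_word_eq:
  assumes h: "h \<in> psh_hom Delta K L" and t: "\<theta> \<in> delta_hom q p" and "(a, b) \<in> word_rewrite K p x y"
  shows "(map (gen_map h q \<theta>) a, map (gen_map h q \<theta>) b) \<in> word_eq L q (h 0 x) (h 0 y)"
proof -
  have "(map (gen_map h q \<theta>) a, map (gen_map h q \<theta>) b) \<in> word_rewrite L q (h 0 x) (h 0 y)"
    using assms(3) gen_map_word[OF h t] gen_map_relation[OF h t] unfolding word_rewrite_def words_def
    by (fastforce)
  then show ?thesis by (auto simp: word_eq_def)
qed

lemma psh_id_hom: "presheaf Delta K \<Longrightarrow> psh_id Delta K \<in> psh_hom Delta K K"
  by (auto simp: psh_hom_Delta psh_id_def presheaf_Delta)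

lemma psh_id_apply: "c \<in> Ob C \<Longrightarrow> x \<in> pob X c \<Longrightarrow> psh_id C X c x = x"
  by (simp add: psh_id_def)

lemma word_class_word: "is_word K p x y w \<Longrightarrow> a \<in> word_class K p x y w \<Longrightarrow> is_word K p x y a"
  by (auto simp: word_class_def word_eq_word)

lemma is_word_gens: "is_word K p x y w \<Longrightarrow> set w \<subseteq> generators K p"
  by (induction w arbitrary: x) auto

lemma rigidify_pmap:
  assumes K: "presheaf Delta K" and w: "is_word K p x y w" and t: "\<theta> \<in> delta_hom q p"
  shows "pmap (EHom (rigidify K) x y) (q, \<theta>, p) (word_class K p x y w)
     = word_class K q x y (map (gen_map (psh_id Delta K) q \<theta>) w)"
proof -
  let ?f = "\<lambda>(n, \<sigma>, i, j, S). (n, \<sigma>, i, j, pmap (EHom (coherent_simplex n) i j) (q, \<theta>, p) S)"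
  have xy: "x \<in> pob K 0" "y \<in> pob K 0" using is_word_ends[OF K w] by auto
  have eq: "map ?f a = map (gen_map (psh_id Delta K) q \<theta>) a" if "is_word K p x' y a" for a x'
  proof -
    have "?f g = gen_map (psh_id Delta K) q \<theta> g" if "g \<in> generators K p" for g
      using that by (cases g) (simp add: gen_map_def psh_id_def generators_iff)
    then show ?thesis using is_word_gens[OF that] by (meson map_cong subsetD)
  qed
  have img: "map ?f ` word_class K p x y w = map (gen_map (psh_id Delta K) q \<theta>) ` word_class K p x y w"
    by (rule image_cong[OF refl eq[OF word_class_word[OF w]]])
  have "pmap (EHom (rigidify K) x y) (q, \<theta>, p) (word_class K p x y w)
    = word_eq K q x y `` map ?f ` word_class K p x y w"
    by (simp add: rigidify_def)
  also have "\<dots> = word_eq K q x y `` map (gen_map (psh_id Delta K) q \<theta>) ` word_class K p x y w"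
    by (simp only: img)
  also have "\<dots> = word_class K q x y (map (gen_map (psh_id Delta K) q \<theta>) w)"
    using gen_map_word_eq[OF psh_id_hom[OF K] t, of _ _ x y] xy
    by (intro word_class_image) (simp add: psh_id_apply)
  finally show ?thesis .
qed

lemma op_word:
  assumes K: "presheaf Delta K" and w: "is_word K p x y w" and t: "\<theta> \<in> delta_hom q p"
  shows "is_word K q x y (map (gen_map (psh_id Delta K) q \<theta>) w)"
  using gen_map_word[OF psh_id_hom[OF K] t w] is_word_ends[OF K w] by (simp add: psh_id_def)

lemma rigidify_presheaf:
  assumes K: "presheaf Delta K"
  shows "presheaf Delta (EHom (rigidify K) x y)"
  unfolding presheaf_Delta
proof (intro conjI allI impI)
  fix m n \<theta> A assume t: "\<theta> \<in> delta_hom m n" and "A \<in> pob (EHom (rigidify K) x y) n"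
  then show "pmap (EHom (rigidify K) x y) (m, \<theta>, n) A \<in> pob (EHom (rigidify K) x y) m"
    using rigidify_pmap[OF K _ t] op_word[OF K _ t] unfolding rigidify_hom by metis
next
  fix n A assume "A \<in> pob (EHom (rigidify K) x y) n"
  then obtain w where w: "is_word K n x y w" "A = word_class K n x y w" by (auto simp: rigidify_hom)
  have "gen_map (psh_id Delta K) n (\<lambda>i\<in>{..n}. i) g = g" if "g \<in> generators K n" for g
    using that by (cases g) (auto simp: gen_map_def psh_id_def generators_iff coh_hom compose_id_ext)
  then have "map (gen_map (psh_id Delta K) n (\<lambda>i\<in>{..n}. i)) w = w"
    using is_word_gens[OF w(1)] by (intro map_idI) blast
  then show "pmap (EHom (rigidify K) x y) (n, \<lambda>i\<in>{..n}. i, n) A = A"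
    using rigidify_pmap[OF K w(1) delta_hom_id] w(2) by simp
next
  fix l m n \<theta> \<eta> A assume t: "\<theta> \<in> delta_hom l m" "\<eta> \<in> delta_hom m n"
    and "A \<in> pob (EHom (rigidify K) x y) n"
  then obtain w where w: "is_word K n x y w" "A = word_class K n x y w" by (auto simp: rigidify_hom)
  have "gen_map (psh_id Delta K) l \<theta> (gen_map (psh_id Delta K) m \<eta> g) = gen_map (psh_id Delta K) l (compose {..l} \<eta> \<theta>) g"
    if "g \<in> generators K n" for g
    using that t
    by (cases g) (auto simp: gen_map_def psh_id_apply generators_iff compose_compose_delta)
  then have "map (gen_map (psh_id Delta K) l \<theta>) (map (gen_map (psh_id Delta K) m \<eta>) w)
     = map (gen_map (psh_id Delta K) l (compose {..l} \<eta> \<theta>)) w"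
    using is_word_gens[OF w(1)] by (simp only: map_map comp_def) (intro map_cong refl, blast)
  then show "pmap (EHom (rigidify K) x y) (l, compose {..l} \<eta> \<theta>, n) A =
       pmap (EHom (rigidify K) x y) (l, \<theta>, m) (pmap (EHom (rigidify K) x y) (m, \<eta>, n) A)"
    using w rigidify_pmap[OF K _ delta_hom_compose[OF t]] rigidify_pmap[OF K _ t(1)] rigidify_pmap[OF K _ t(2)]
      op_word[OF K _ t(2)] by metis
qed

lemma rigidify_enriched:
  assumes K: "presheaf Delta K"
  shows "enriched_category Delta (rigidify K)"
  unfolding enriched_category_def
proof (intro conjI ballI)
  fix x y z u f g assume u: "u \<in> Ar Delta" and 
    "f \<in> pob (EHom (rigidify K) x y) (Cod Delta u)" "g \<in> pob (EHom (rigidify K) y z) (Cod Delta u)"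
  then obtain q \<theta> p a b where *: "u = (q, \<theta>, p)" "\<theta> \<in> delta_hom q p" 
    "is_word K p x y a" "f = word_class K p x y a" "is_word K p y z b" "g = word_class K p y z b"
    by (auto simp: rigidify_hom Arr_Delta)
  have "is_word K p x z (a @ b)" using * is_word_append[OF K] by blast
  then show "pmap (EHom (rigidify K) x z) u (EComp (rigidify K) x y z (Cod Delta u) f g) =
       EComp (rigidify K) x y z (Dom Delta u) (pmap (EHom (rigidify K) x y) u f) (pmap (EHom (rigidify K) y z) u g)"
    using * by (simp add: rigidify_EComp[OF K] rigidify_pmap[OF K] op_word[OF K])
next
  fix x u assume "x \<in> EOb (rigidify K)" "u \<in> Ar Delta"
  then show "pmap (EHom (rigidify K) x x) u (EId (rigidify K) x (Cod Delta u)) = EId (rigidify K) x (Dom Delta u)"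
    using rigidify_pmap[OF K, of _ x x "[]"] by (auto simp: rigidify_EId Arr_Delta)
next
  fix x y z b f g assume "f \<in> pob (EHom (rigidify K) x y) b" "g \<in> pob (EHom (rigidify K) y z) b"
  then show "EComp (rigidify K) x y z b f g \<in> pob (EHom (rigidify K) x z) b"
    unfolding rigidify_hom using rigidify_EComp[OF K] is_word_append[OF K] by metis
next
  fix x y b f assume xy: "x \<in> EOb (rigidify K)" "y \<in> EOb (rigidify K)" and 
    "f \<in> pob (EHom (rigidify K) x y) b"
  then obtain w where w: "is_word K b x y w" "f = word_class K b x y w" by (auto simp: rigidify_hom)
  then show "EComp (rigidify K) x x y b (EId (rigidify K) x b) f = f"
    "EComp (rigidify K) x y y b f (EId (rigidify K) y b) = f"
    using xy rigidify_EComp[OF K, of b x x "[]" y w] rigidify_EComp[OF K, of b x y w y "[]"] by (auto simp: rigidify_EId)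
next
  fix w x y z b f g h assume "f \<in> pob (EHom (rigidify K) w x) b"
    "g \<in> pob (EHom (rigidify K) x y) b" "h \<in> pob (EHom (rigidify K) y z) b"
  then obtain u v t where *: "is_word K b w x u" "f = word_class K b w x u" "is_word K b x y v" "g = word_class K b x y v"
     "is_word K b y z t" "h = word_class K b y z t" by (auto simp: rigidify_hom)
  then have "is_word K b w y (u @ v)" "is_word K b x z (v @ t)" using is_word_append[OF K] by blast+
  then show "EComp (rigidify K) w y z b (EComp (rigidify K) w x y b f g) h =
       EComp (rigidify K) w x z b f (EComp (rigidify K) x y z b g h)"
    using * by (simp add: rigidify_EComp[OF K])
qed (auto simp: rigidify_presheaf[OF K] rigidify_EId rigidify_hom intro!: exI[of _ "[]"])

lemma coherent_nerve_simps [simp]: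
  "pob (coherent_nerve D) n = efunctors Delta (coherent_simplex n) D"
  "pmap (coherent_nerve D) (m, \<theta>, n) F =
    efun_comp Delta (coherent_simplex m) F (coherent_simplex_map (m, \<theta>, n))"
  by (simp_all add: coherent_nerve_def)

lemma efunctors_iff:
  "F \<in> efunctors B E E' \<longleftrightarrow>
     fst F \<in> EOb E \<rightarrow>\<^sub>E EOb E' \<and>
     snd F \<in> (\<Pi>\<^sub>E x\<in>EOb E. \<Pi>\<^sub>E y\<in>EOb E. psh_hom B (EHom E x y) (EHom E' (fst F x) (fst F y))) \<and>
     (\<forall>x\<in>EOb E. \<forall>b\<in>Ob B. snd F x x b (EId E x b) = EId E' (fst F x) b) \<and>
     (\<forall>x\<in>EOb E. \<forall>y\<in>EOb E. \<forall>z\<in>EOb E. \<forall>b\<in>Ob B.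
        \<forall>f\<in>pob (EHom E x y) b. \<forall>g\<in>pob (EHom E y z) b.
          snd F x z b (EComp E x y z b f g) =
          EComp E' (fst F x) (fst F y) (fst F z) b (snd F x y b f) (snd F y z b g))"
  by (cases F) (simp add: efunctors_def)

lemma efunctorsD:
  assumes "F \<in> efunctors B E E'"
  shows "x \<in> EOb E \<Longrightarrow> fst F x \<in> EOb E'"
    and "x \<in> EOb E \<Longrightarrow> y \<in> EOb E \<Longrightarrow> snd F x y \<in> psh_hom B (EHom E x y) (EHom E' (fst F x) (fst F y))"
    and "x \<in> EOb E \<Longrightarrow> b \<in> Ob B \<Longrightarrow> snd F x x b (EId E x b) = EId E' (fst F x) b"
    and "x \<in> EOb E \<Longrightarrow> y \<in> EOb E \<Longrightarrow> z \<in> EOb E \<Longrightarrow> b \<in> Ob B \<Longrightarrow>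
        f \<in> pob (EHom E x y) b \<Longrightarrow> g \<in> pob (EHom E y z) b \<Longrightarrow>
          snd F x z b (EComp E x y z b f g) =
          EComp E' (fst F x) (fst F y) (fst F z) b (snd F x y b f) (snd F y z b g)"
    and "fst F \<in> extensional (EOb E)" "snd F \<in> extensional (EOb E)"
    and "x \<in> EOb E \<Longrightarrow> snd F x \<in> extensional (EOb E)"
  using assms unfolding efunctors_iff by (auto simp: PiE_iff)

lemma psh_hom_ext:
  assumes "\<alpha> \<in> psh_hom Delta X Y" "\<beta> \<in> psh_hom Delta X Z"
    "\<And>p x. x \<in> pob X p \<Longrightarrow> \<alpha> p x = \<beta> p x"
  shows "\<alpha> = \<beta>"
proof
  fix p show "\<alpha> p = \<beta> p"
    using psh_homD(3)[OF assms(1), of p] psh_homD(3)[OF assms(2), of p] assms(3)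
    by (intro extensionalityI[of _ "pob X p"]) auto
qed

lemma efunctors_ext:
  assumes F: "F \<in> efunctors Delta E E'" and G: "G \<in> efunctors Delta E E'"
    and 1: "\<And>x. x \<in> EOb E \<Longrightarrow> fst F x = fst G x"
    and 2: "\<And>x y p f. x \<in> EOb E \<Longrightarrow> y \<in> EOb E \<Longrightarrow> f \<in> pob (EHom E x y) p \<Longrightarrow>
        snd F x y p f = snd G x y p f"
  shows "F = G"
proof (rule prod_eqI)
  show "fst F = fst G"
    using efunctorsD(5)[OF F] efunctorsD(5)[OF G] 1 by (rule extensionalityI)
  show "snd F = snd G"
  proof (rule extensionalityI[OF efunctorsD(6)[OF F] efunctorsD(6)[OF G]])
    fix x assume x: "x \<in> EOb E"
    show "snd F x = snd G x"
    proof (rule extensionalityI[OF efunctorsD(7)[OF F x] efunctorsD(7)[OF G x]])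
      fix y assume y: "y \<in> EOb E"
      show "snd F x y = snd G x y"
        using efunctorsD(2)[OF F x y] efunctorsD(2)[OF G x y] 2[OF x y] by (rule psh_hom_ext)
    qed
  qed
qed

lemma efun_comp_simps:
  "x \<in> EOb E \<Longrightarrow> fst (efun_comp B E G F) x = fst G (fst F x)"
  "x \<in> EOb E \<Longrightarrow> y \<in> EOb E \<Longrightarrow> b \<in> Ob B \<Longrightarrow> f \<in> pob (EHom E x y) b \<Longrightarrow>
     snd (efun_comp B E G F) x y b f = snd G (fst F x) (fst F y) b (snd F x y b f)"
  by (simp_all add: efun_comp_def psh_comp_def compose_def split: prod.splits)


lemma efunctors_comp:
  assumes F: "F \<in> efunctors Delta E E'" and G: "G \<in> efunctors Delta E' E''"
    and P: "\<And>x y. x \<in> EOb E \<Longrightarrow> y \<in> EOb E \<Longrightarrow> presheaf Delta (EHom E x y)"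
    and C: "enriched_category Delta E"
  shows "efun_comp Delta E G F \<in> efunctors Delta E E''"
proof -
  note f = efunctorsD[OF F] and g = efunctorsD[OF G]
  note f2 = psh_homD[OF f(2)] and g2 = psh_homD[OF g(2)]
  have E: "EId E x b \<in> pob (EHom E x x) b" if "x \<in> EOb E" for x b
    using C that by (simp add: enriched_category_def)
  have E': "EComp E x y z b u v \<in> pob (EHom E x z) b" if "x \<in> EOb E" "y \<in> EOb E" "z \<in> EOb E"
    "u \<in> pob (EHom E x y) b" "v \<in> pob (EHom E y z) b" for x y z b u v
    using C that by (simp add: enriched_category_def)
  have H: "psh_comp Delta (EHom E x y) (snd G (fst F x) (fst F y)) (snd F x y)
      \<in> psh_hom Delta (EHom E x y) (EHom E'' (fst G (fst F x)) (fst G (fst F y)))"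
    if "x \<in> EOb E" "y \<in> EOb E" for x y
    unfolding psh_hom_Delta 
    using that by (auto simp: psh_comp_def compose_def f f2 g2 presheafD(1)[OF P] PiE_iff)
  have 2: "snd (efun_comp Delta E G F) = (\<lambda>x\<in>EOb E. \<lambda>y\<in>EOb E. psh_comp Delta (EHom E x y) (snd G (fst F x) (fst F y)) (snd F x y))"
    by (simp add: efun_comp_def split: prod.splits)
  have 1: "fst (efun_comp Delta E G F) = compose (EOb E) (fst G) (fst F)"
    by (simp add: efun_comp_def split: prod.splits)
  show ?thesis
    unfolding efunctors_iff
  proof (intro conjI ballI)
    show "fst (efun_comp Delta E G F) \<in> EOb E \<rightarrow>\<^sub>E EOb E''"
      by (auto simp: 1 compose_def f g)
    show "snd (efun_comp Delta E G F) \<in> (\<Pi>\<^sub>E x\<in>EOb E. \<Pi>\<^sub>E y\<in>EOb E.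
       psh_hom Delta (EHom E x y) (EHom E'' (fst (efun_comp Delta E G F) x) (fst (efun_comp Delta E G F) y)))"
      using H by (auto simp: 1 2 compose_def)
  next
    fix x b assume "x \<in> EOb E" 
    then show "snd (efun_comp Delta E G F) x x b (EId E x b) = EId E'' (fst (efun_comp Delta E G F) x) b"
      by (simp add: efun_comp_simps E f g)
  next
    fix x y z b u v assume "x \<in> EOb E" "y \<in> EOb E" "z \<in> EOb E"
      "u \<in> pob (EHom E x y) b" "v \<in> pob (EHom E y z) b"
    then show "snd (efun_comp Delta E G F) x z b (EComp E x y z b u v) =
      EComp E'' (fst (efun_comp Delta E G F) x) (fst (efun_comp Delta E G F) y) (fst (efun_comp Delta E G F) z) b
       (snd (efun_comp Delta E G F) x y b u) (snd (efun_comp Delta E G F) y z b v)"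
      by (simp add: efun_comp_simps E' f f2 g)
  qed
qed

lemma relation_class:
  assumes "word_relation K p a b" "is_word K p x y a" "is_word K p x y b"
  shows "word_class K p x y a = word_class K p x y b"
proof -
  have "\<exists>u a' b' v. word_relation K p a' b' \<and> a = u @ a' @ v \<and> b = u @ b' @ v"
    using assms(1) by (metis append_Nil append_Nil2)
  then have "(a, b) \<in> word_rewrite K p x y"
    using assms by (simp add: word_rewrite_def words_def)
  then show ?thesis by (auto simp: word_class_eq_iff word_eq_def)
qed

lemma unit_simps:
  assumes "\<sigma> \<in> pob K n"
  shows "i \<le> n \<Longrightarrow> fst (rigidify_unit K n \<sigma>) i = vertex K n \<sigma> i"
    "i \<le> n \<Longrightarrow> j \<le> n \<Longrightarrow> S \<in> pob (EHom (coherent_simplex n) i j) p \<Longrightarrow>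
     snd (rigidify_unit K n \<sigma>) i j p S = word_class K p (vertex K n \<sigma> i) (vertex K n \<sigma> j) [(n, \<sigma>, i, j, S)]"
  using assms by (simp_all add: rigidify_unit_def word_class_def)

lemma rigidify_unit_efunctor:
  assumes K: "presheaf Delta K" and s: "\<sigma> \<in> pob K n"
  shows "rigidify_unit K n \<sigma> \<in> efunctors Delta (coherent_simplex n) (rigidify K)"
proof -
  let ?v = "vertex K n \<sigma>" and ?F = "rigidify_unit K n \<sigma>"
  have v: "?v i \<in> pob K 0" if "i \<le> n" for i using vertex_in[OF K s that] .
  have w: "is_word K p (?v i) (?v j) [(n, \<sigma>, i, j, S)]"
    if "i \<le> n" "j \<le> n" "S \<in> pob (EHom (coherent_simplex n) i j) p" for i j p S
    using that s v by (simp add: generators_iff)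
  note u = unit_simps[OF s]
  have H: "snd ?F i j \<in> psh_hom Delta (EHom (coherent_simplex n) i j) (EHom (rigidify K) (?v i) (?v j))"
    if ij: "i \<le> n" "j \<le> n" for i j
    unfolding psh_hom_Delta
  proof (intro conjI allI impI)
    fix p
    have "snd ?F i j p \<in> extensional (pob (EHom (coherent_simplex n) i j) p)"
      using s ij by (simp add: rigidify_unit_def)
    moreover have "snd ?F i j p S \<in> pob (EHom (rigidify K) (?v i) (?v j)) p" 
      if "S \<in> pob (EHom (coherent_simplex n) i j) p" for S
      unfolding u(2)[OF ij that] rigidify_hom using w[OF ij that] by blast
    ultimately show "snd ?F i j p \<in> pob (EHom (coherent_simplex n) i j) p \<rightarrow>\<^sub>E pob (EHom (rigidify K) (?v i) (?v j)) p"
      by (simp add: PiE_iff)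
  next
    fix q p \<theta> S assume t: "\<theta> \<in> delta_hom q p" and S: "S \<in> pob (EHom (coherent_simplex n) i j) p"
    show "snd ?F i j q (pmap (EHom (coherent_simplex n) i j) (q, \<theta>, p) S) =
      pmap (EHom (rigidify K) (?v i) (?v j)) (q, \<theta>, p) (snd ?F i j p S)"
      using ij S coh_pmap[OF S t]
      by (simp add: u rigidify_pmap[OF K w t] gen_map_def psh_id_apply s)
  qed
  show ?thesis
    unfolding efunctors_iff
  proof (intro conjI ballI)
    show "fst ?F \<in> EOb (coherent_simplex n) \<rightarrow>\<^sub>E EOb (rigidify K)"
      using s v by (auto simp: rigidify_unit_def)
    show "snd ?F \<in> (\<Pi>\<^sub>E x\<in>EOb (coherent_simplex n). \<Pi>\<^sub>E y\<in>EOb (coherent_simplex n).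
        psh_hom Delta (EHom (coherent_simplex n) x y) (EHom (rigidify K) (fst ?F x) (fst ?F y)))"
    proof (intro PiE_I)
      fix x y assume "x \<in> EOb (coherent_simplex n)" "y \<in> EOb (coherent_simplex n)"
      then show "snd ?F x y \<in> psh_hom Delta (EHom (coherent_simplex n) x y) (EHom (rigidify K) (fst ?F x) (fst ?F y))"
        using H by (simp add: u)
    qed (use s in \<open>simp_all add: rigidify_unit_def\<close>)
  next
    fix x p assume "x \<in> EOb (coherent_simplex n)"
    then have x: "x \<le> n" by simp
    have r: "word_relation K p [(n, \<sigma>, x, x, EId (coherent_simplex n) x p)] []"
      using word_relation.unit[OF s x] .
    show "snd ?F x x p (EId (coherent_simplex n) x p) = EId (rigidify K) (fst ?F x) p"
      using x relation_class[OF r, of "?v x" "?v x"] w[OF x x coh_id] v[OF x]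
      by (simp add: u coh_id rigidify_EId)
  next
    fix x y z p S T assume "x \<in> EOb (coherent_simplex n)" "y \<in> EOb (coherent_simplex n)" "z \<in> EOb (coherent_simplex n)"
      and S: "S \<in> pob (EHom (coherent_simplex n) x y) p" and T: "T \<in> pob (EHom (coherent_simplex n) y z) p"
    then have x: "x \<le> n" "y \<le> n" "z \<le> n" by simp_all
    have r: "word_relation K p [(n, \<sigma>, x, y, S), (n, \<sigma>, y, z, T)] [(n, \<sigma>, x, z, EComp (coherent_simplex n) x y z p S T)]"
      using x S T s by (intro word_relation.comp) (simp_all add: generators_iff)
    have 1: "is_word K p (?v x) (?v z) [(n, \<sigma>, x, y, S), (n, \<sigma>, y, z, T)]"
      using x S T s v by (simp add: generators_iff)
    show "snd ?F x z p (EComp (coherent_simplex n) x y z p S T) =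
       EComp (rigidify K) (fst ?F x) (fst ?F y) (fst ?F z) p (snd ?F x y p S) (snd ?F y z p T)"
      using x S T coh_comp[OF S T] relation_class[OF r 1] w[OF x(1,3) coh_comp[OF S T]]
      by (simp add: u rigidify_EComp[OF K w w])
  qed
qed

lemma rigidify_unit_hom:
  assumes K: "presheaf Delta K"
  shows "rigidify_unit K \<in> psh_hom Delta K (coherent_nerve (rigidify K))"
  unfolding psh_hom_Delta
proof (intro conjI allI impI)
  fix n
  have "rigidify_unit K n \<in> extensional (pob K n)" by (simp add: rigidify_unit_def)
  then show "rigidify_unit K n \<in> pob K n \<rightarrow>\<^sub>E pob (coherent_nerve (rigidify K)) n"
    using rigidify_unit_efunctor[OF K] by (simp add: PiE_iff)
next
  fix m n \<theta> \<sigma> assume t: "\<theta> \<in> delta_hom m n" and s: "\<sigma> \<in> pob K n"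
  have s': "pmap K (m, \<theta>, n) \<sigma> \<in> pob K m" using presheafD(1)[OF K t s] .
  note c = coh_map_efunctor[OF t]
  have "rigidify_unit K m (pmap K (m, \<theta>, n) \<sigma>) =
    efun_comp Delta (coherent_simplex m) (rigidify_unit K n \<sigma>) (coherent_simplex_map (m, \<theta>, n))"
  proof (rule efunctors_ext[OF rigidify_unit_efunctor[OF K s'] efunctors_comp[OF c rigidify_unit_efunctor[OF K s]]])
    fix i assume "i \<in> EOb (coherent_simplex m)"
    then show "fst (rigidify_unit K m (pmap K (m, \<theta>, n) \<sigma>)) i =
      fst (efun_comp Delta (coherent_simplex m) (rigidify_unit K n \<sigma>) (coherent_simplex_map (m, \<theta>, n))) i"
      by (simp add: efun_comp_simps unit_simps s s' vertex_pmap[OF K t s] delta_homD[OF t])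
  next
    fix i j p S assume "i \<in> EOb (coherent_simplex m)" "j \<in> EOb (coherent_simplex m)"
      and S: "S \<in> pob (EHom (coherent_simplex m) i j) p"
    then have ij: "i \<le> m" "j \<le> m" by simp_all
    have S': "(\<lambda>r\<in>{..p}. \<theta> ` S r) \<in> pob (EHom (coherent_simplex n) (\<theta> i) (\<theta> j)) p"
      using coh_image[OF S t ij(2)] .
    have g: "(m, pmap K (m, \<theta>, n) \<sigma>, i, j, S) \<in> generators K p"
      using ij s' S by (simp add: generators_iff)
    have tij: "\<theta> i \<le> n" "\<theta> j \<le> n" using delta_homD(1)[OF t] ij by auto
    have "word_class K p (vertex K n \<sigma> (\<theta> i)) (vertex K n \<sigma> (\<theta> j)) [(m, pmap K (m, \<theta>, n) \<sigma>, i, j, S)]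
      = word_class K p (vertex K n \<sigma> (\<theta> i)) (vertex K n \<sigma> (\<theta> j)) [(n, \<sigma>, \<theta> i, \<theta> j, snd (coherent_simplex_map (m, \<theta>, n)) i j p S)]"
      using g ij tij S s S' vertex_in[OF K s]
      by (intro relation_class[OF word_relation.nat[OF s t g]])
        (simp_all add: vertex_pmap[OF K t s] generators_iff)
    then show "snd (rigidify_unit K m (pmap K (m, \<theta>, n) \<sigma>)) i j p S =
      snd (efun_comp Delta (coherent_simplex m) (rigidify_unit K n \<sigma>) (coherent_simplex_map (m, \<theta>, n))) i j p S"
      using ij tij S S' by (simp add: efun_comp_simps unit_simps s s' vertex_pmap[OF K t s])
  qed (simp_all add: coh_presheaf coh_enriched)
  then show "rigidify_unit K m (pmap K (m, \<theta>, n) \<sigma>) =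
       pmap (coherent_nerve (rigidify K)) (m, \<theta>, n) (rigidify_unit K n \<sigma>)"
    by simp
qed

lemma rigidify_map_simps:
  assumes h: "h \<in> psh_hom Delta K L" and K: "presheaf Delta K"
  shows "fst (rigidify_map K L h) = h 0"
    and "is_word K p x y w \<Longrightarrow> snd (rigidify_map K L h) x y p (word_class K p x y w)
      = word_class L p (h 0 x) (h 0 y) (map (gen_map h p (\<lambda>i\<in>{..p}. i)) w)"
proof -
  show "fst (rigidify_map K L h) = h 0" by (simp add: rigidify_map_def)
  assume w: "is_word K p x y w"
  let ?f = "\<lambda>(n, \<sigma>, i, j, S). (n, h n \<sigma>, i, j, S)" and ?g = "gen_map h p (\<lambda>i\<in>{..p}. i)"
  have eq: "map ?f a = map ?g a" if "is_word K p x y a" for a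
  proof -
    have "?f g = ?g g" if "g \<in> generators K p" for g
      using that by (cases g) (simp add: gen_map_def generators_iff coh_hom compose_id_ext)
    then show ?thesis using is_word_gens[OF that] by (meson map_cong subsetD)
  qed
  have img: "map ?f ` word_class K p x y w = map ?g ` word_class K p x y w"
    by (rule image_cong[OF refl eq[OF word_class_word[OF w]]])
  have A: "word_class K p x y w \<in> pob (EHom (rigidify K) x y) p" unfolding rigidify_hom using w by blast
  have "snd (rigidify_map K L h) x y p (word_class K p x y w) = word_eq L p (h 0 x) (h 0 y) `` map ?f ` word_class K p x y w"
    using is_word_ends[OF K w] A by (simp add: rigidify_map_def)
  also have "\<dots> = word_eq L p (h 0 x) (h 0 y) `` map ?g ` word_class K p x y w"
    by (simp only: img)
  also have "\<dots> = word_class L p (h 0 x) (h 0 y) (map ?g w)"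
    using gen_map_word_eq[OF h delta_hom_id, of _ _ p x y] by (intro word_class_image) simp
  finally show "snd (rigidify_map K L h) x y p (word_class K p x y w) = word_class L p (h 0 x) (h 0 y) (map ?g w)" .
qed

lemma rigidify_map_efunctor:
  assumes K: "presheaf Delta K" and L: "presheaf Delta L" and h: "h \<in> psh_hom Delta K L"
  shows "rigidify_map K L h \<in> efunctors Delta (rigidify K) (rigidify L)"
proof -
  let ?F = "rigidify_map K L h" and ?g = "\<lambda>p. map (gen_map h p (\<lambda>i\<in>{..p}. i))"
  note s = rigidify_map_simps[OF h K]
  have w: "is_word L p (h 0 x) (h 0 y) (?g p a)" if "is_word K p x y a" for p x y a
    using gen_map_word[OF h delta_hom_id that] .
  have H: "snd ?F x y \<in> psh_hom Delta (EHom (rigidify K) x y) (EHom (rigidify L) (h 0 x) (h 0 y))"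
    if xy: "x \<in> pob K 0" "y \<in> pob K 0" for x y
    unfolding psh_hom_Delta
  proof (intro conjI allI impI)
    fix p
    have "snd ?F x y p \<in> extensional (pob (EHom (rigidify K) x y) p)"
      using xy by (simp add: rigidify_map_def)
    moreover have "snd ?F x y p A \<in> pob (EHom (rigidify L) (h 0 x) (h 0 y)) p" 
      if A: "A \<in> pob (EHom (rigidify K) x y) p" for A
    proof -
      obtain a where a: "is_word K p x y a" "A = word_class K p x y a" using A unfolding rigidify_hom by blast
      show ?thesis unfolding rigidify_hom a(2) s(2)[OF a(1)] using w[OF a(1)] by blast
    qed
    ultimately show "snd ?F x y p \<in> pob (EHom (rigidify K) x y) p \<rightarrow>\<^sub>E pob (EHom (rigidify L) (h 0 x) (h 0 y)) p"
      by (simp add: PiE_iff)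
  next
    fix q p \<theta> A assume t: "\<theta> \<in> delta_hom q p" and A: "A \<in> pob (EHom (rigidify K) x y) p"
    then obtain a where a: "is_word K p x y a" "A = word_class K p x y a" unfolding rigidify_hom by blast
    have "gen_map h q (\<lambda>i\<in>{..q}. i) (gen_map (psh_id Delta K) q \<theta> g) = gen_map (psh_id Delta L) q \<theta> (gen_map h p (\<lambda>i\<in>{..p}. i) g)"
      if "g \<in> generators K p" for g
      using that t coh_pmap[OF _ t]
      by (cases g) (simp add: gen_map_def psh_id_apply psh_homD[OF h] generators_iff coh_hom compose_id_ext)
    then have "?g q (map (gen_map (psh_id Delta K) q \<theta>) a) = map (gen_map (psh_id Delta L) q \<theta>) (?g p a)"
      using is_word_gens[OF a(1)] by (simp only: map_map comp_def) (intro map_cong refl, blast)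
    then show "snd ?F x y q (pmap (EHom (rigidify K) x y) (q, \<theta>, p) A) =
       pmap (EHom (rigidify L) (h 0 x) (h 0 y)) (q, \<theta>, p) (snd ?F x y p A)"
      by (simp only: a(2) s(2)[OF a(1)] rigidify_pmap[OF K a(1) t] s(2)[OF op_word[OF K a(1) t]] rigidify_pmap[OF L w[OF a(1)] t])
  qed
  show ?thesis
    unfolding efunctors_iff s(1)
  proof (intro conjI ballI)
    show "h 0 \<in> EOb (rigidify K) \<rightarrow>\<^sub>E EOb (rigidify L)"
      using h by (simp add: psh_hom_Delta)
    show "snd ?F \<in> (\<Pi>\<^sub>E x\<in>EOb (rigidify K). \<Pi>\<^sub>E y\<in>EOb (rigidify K).
        psh_hom Delta (EHom (rigidify K) x y) (EHom (rigidify L) (h 0 x) (h 0 y)))"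
      using H by (intro PiE_I) (simp_all add: rigidify_map_def)
  next
    fix x p assume "x \<in> EOb (rigidify K)"
    then show "snd ?F x x p (EId (rigidify K) x p) = EId (rigidify L) (h 0 x) p"
      using s(2)[of p x x "[]"] by (simp add: rigidify_EId)
  next
    fix x y z p A B assume "A \<in> pob (EHom (rigidify K) x y) p" "B \<in> pob (EHom (rigidify K) y z) p"
    then obtain a b where a: "is_word K p x y a" "A = word_class K p x y a" and b: "is_word K p y z b" "B = word_class K p y z b"
      unfolding rigidify_hom by blast
    have ab: "is_word K p x z (a @ b)" using a b is_word_append[OF K] by blast
    show "snd ?F x z p (EComp (rigidify K) x y z p A B) =
       EComp (rigidify L) (h 0 x) (h 0 y) (h 0 z) p (snd ?F x y p A) (snd ?F y z p B)"
      by (simp only: a(2) b(2) rigidify_EComp[OF K a(1) b(1)] s(2)[OF ab] s(2)[OF a(1)] s(2)[OF b(1)]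
          rigidify_EComp[OF L w[OF a(1)] w[OF b(1)]] map_append)
  qed
qed

lemma rigidify_unit_natural:
  assumes K: "presheaf Delta K" and L: "presheaf Delta L" and h: "h \<in> psh_hom Delta K L"
  shows "psh_comp Delta K (coherent_nerve_map (rigidify K) (rigidify_map K L h)) (rigidify_unit K) =
         psh_comp Delta K (rigidify_unit L) h"
proof -
  have "efun_comp Delta (coherent_simplex n) (rigidify_map K L h) (rigidify_unit K n \<sigma>) = rigidify_unit L n (h n \<sigma>)"
    if s: "\<sigma> \<in> pob K n" for n \<sigma>
  proof -
    have s': "h n \<sigma> \<in> pob L n" using psh_homD(1)[OF h s] .
    note F = rigidify_map_efunctor[OF K L h]
    show ?thesis
    proof (rule efunctors_ext[OF efunctors_comp[OF rigidify_unit_efunctor[OF K s] F] rigidify_unit_efunctor[OF L s']])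
      fix i assume "i \<in> EOb (coherent_simplex n)"
      then show "fst (efun_comp Delta (coherent_simplex n) (rigidify_map K L h) (rigidify_unit K n \<sigma>)) i =
         fst (rigidify_unit L n (h n \<sigma>)) i"
        by (simp add: efun_comp_simps rigidify_map_simps[OF h K] unit_simps s s' vertex_map[OF h])
    next
      fix i j p S assume "i \<in> EOb (coherent_simplex n)" "j \<in> EOb (coherent_simplex n)"
        and S: "S \<in> pob (EHom (coherent_simplex n) i j) p"
      then have ij: "i \<le> n" "j \<le> n" by simp_all
      have w: "is_word K p (vertex K n \<sigma> i) (vertex K n \<sigma> j) [(n, \<sigma>, i, j, S)]"
        using ij s S vertex_in[OF K s] by (simp add: generators_iff)
      show "snd (efun_comp Delta (coherent_simplex n) (rigidify_map K L h) (rigidify_unit K n \<sigma>)) i j p S =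
         snd (rigidify_unit L n (h n \<sigma>)) i j p S"
        using S ij compose_id_ext[of S p]
        by (simp add: efun_comp_simps rigidify_map_simps(2)[OF h K w] unit_simps s s' vertex_map[OF h] gen_map_def coh_hom)
    qed (simp_all add: coh_presheaf coh_enriched)
  qed
  then show ?thesis
    using rigidify_unit_efunctor[OF K]
    by (auto simp: psh_comp_def coherent_nerve_map_def compose_def fun_eq_iff)
qed

lemma coherent_nerve_presheaf: "presheaf Delta (coherent_nerve D)"
  unfolding presheaf_Delta coherent_nerve_simps
proof (intro conjI allI impI)
  fix m n \<theta> F assume t: "\<theta> \<in> delta_hom m n" and F: "F \<in> efunctors Delta (coherent_simplex n) D"
  show "efun_comp Delta (coherent_simplex m) F (coherent_simplex_map (m, \<theta>, n)) \<in> efunctors Delta (coherent_simplex m) D"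
    using efunctors_comp[OF coh_map_efunctor[OF t] F coh_presheaf coh_enriched] .
next
  fix n F assume F: "F \<in> efunctors Delta (coherent_simplex n) D"
  let ?t = "\<lambda>i\<in>{..n}. i"
  show "efun_comp Delta (coherent_simplex n) F (coherent_simplex_map (n, ?t, n)) = F"
  proof (rule efunctors_ext[OF efunctors_comp[OF coh_map_efunctor[OF delta_hom_id] F coh_presheaf coh_enriched] F])
    fix i j p S assume ij: "i \<in> EOb (coherent_simplex n)" "j \<in> EOb (coherent_simplex n)"
      and S: "S \<in> pob (EHom (coherent_simplex n) i j) p"
    have "?t ` S r = S r" if "r \<le> p" for r
    proof -
      have "S r \<subseteq> {i..j}" using S that unfolding coh_hom by blast
      then have "S r \<subseteq> {..n}" using ij by auto
      then show ?thesis by force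
    qed
    moreover have "S r = undefined" if "\<not> r \<le> p" for r
      using S that by (simp add: coh_hom extensional_def)
    ultimately have "(\<lambda>r\<in>{..p}. ?t ` S r) = S" by (auto simp: restrict_def fun_eq_iff)
    then show "snd (efun_comp Delta (coherent_simplex n) F (coherent_simplex_map (n, ?t, n))) i j p S = snd F i j p S"
      using ij S by (simp add: efun_comp_simps)
  qed (simp add: efun_comp_simps)
next
  fix l m n \<theta> \<eta> F assume t: "\<theta> \<in> delta_hom l m" and e: "\<eta> \<in> delta_hom m n"
    and F: "F \<in> efunctors Delta (coherent_simplex n) D"
  note c = efunctors_comp[OF coh_map_efunctor _ coh_presheaf coh_enriched]
  show "efun_comp Delta (coherent_simplex l) F (coherent_simplex_map (l, compose {..l} \<eta> \<theta>, n)) =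
     efun_comp Delta (coherent_simplex l) (efun_comp Delta (coherent_simplex m) F (coherent_simplex_map (m, \<eta>, n)))
       (coherent_simplex_map (l, \<theta>, m))"
  proof (rule efunctors_ext[OF c[OF delta_hom_compose[OF t e] F] c[OF t c[OF e F]]])
    fix i assume "i \<in> EOb (coherent_simplex l)"
    then show "fst (efun_comp Delta (coherent_simplex l) F (coherent_simplex_map (l, compose {..l} \<eta> \<theta>, n))) i =
     fst (efun_comp Delta (coherent_simplex l) (efun_comp Delta (coherent_simplex m) F (coherent_simplex_map (m, \<eta>, n)))
       (coherent_simplex_map (l, \<theta>, m))) i"
      using delta_homD[OF t] by (simp add: efun_comp_simps compose_def)
  next
    fix i j p S assume ij: "i \<in> EOb (coherent_simplex l)" "j \<in> EOb (coherent_simplex l)"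
      and S: "S \<in> pob (EHom (coherent_simplex l) i j) p"
    have "compose {..l} \<eta> \<theta> ` S r = \<eta> ` \<theta> ` S r" if "r \<le> p" for r
    proof -
      have "S r \<subseteq> {i..j}" using S that unfolding coh_hom by blast
      then have "S r \<subseteq> {..l}" using ij by auto
      then show ?thesis by (force simp: compose_def image_image)
    qed
    then have "(\<lambda>r\<in>{..p}. compose {..l} \<eta> \<theta> ` S r) = (\<lambda>r\<in>{..p}. \<eta> ` (\<lambda>r\<in>{..p}. \<theta> ` S r) r)"
      by (auto simp: restrict_def fun_eq_iff)
    then show "snd (efun_comp Delta (coherent_simplex l) F (coherent_simplex_map (l, compose {..l} \<eta> \<theta>, n))) i j p S =
     snd (efun_comp Delta (coherent_simplex l) (efun_comp Delta (coherent_simplex m) F (coherent_simplex_map (m, \<eta>, n)))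
       (coherent_simplex_map (l, \<theta>, m))) i j p S"
      using ij S coh_image[OF S t] delta_homD(1)[OF t]
      by (simp add: efun_comp_simps compose_def)
  qed
qed

context
  fixes K :: "'s sset" and D :: "('x, 'm) scat" and h :: "nat \<Rightarrow> 's \<Rightarrow> (nat, nat, chain, 'x, 'm) efun"
  assumes K: "presheaf Delta K" and D: "enriched_category Delta D"
    and h: "h \<in> psh_hom Delta K (coherent_nerve D)"
begin

definition "value_ob x = fst (h 0 x) 0"

primrec word_value :: "nat \<Rightarrow> 's \<Rightarrow> 's \<Rightarrow> 's gen list \<Rightarrow> 'm" where
  "word_value p x y [] = EId D (value_ob x) p"
| "word_value p x y (g # w) = (case g of (n, \<sigma>, i, j, S) \<Rightarrow>
     EComp D (value_ob x) (value_ob (vertex K n \<sigma> j)) (value_ob y) p (snd (h n \<sigma>) i j p S)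
       (word_value p (vertex K n \<sigma> j) y w))"

lemma h_efunctor: "\<sigma> \<in> pob K n \<Longrightarrow> h n \<sigma> \<in> efunctors Delta (coherent_simplex n) D"
  using psh_homD(1)[OF h] by simp

lemma h_pmap: "\<theta> \<in> delta_hom m n \<Longrightarrow> \<sigma> \<in> pob K n \<Longrightarrow>
    h m (pmap K (m, \<theta>, n) \<sigma>) = efun_comp Delta (coherent_simplex m) (h n \<sigma>) (coherent_simplex_map (m, \<theta>, n))"
  using psh_homD(2)[OF h] by simp

lemma value_vertex: 
  assumes "\<sigma> \<in> pob K n" "i \<le> n" shows "value_ob (vertex K n \<sigma> i) = fst (h n \<sigma>) i"
  unfolding value_ob_def vertex_def h_pmap[OF delta_hom_const[OF assms(2)] assms(1)]
  by (simp add: efun_comp_simps)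

lemma value_ob_in: "x \<in> pob K 0 \<Longrightarrow> value_ob x \<in> EOb D"
  unfolding value_ob_def using efunctorsD(1)[OF h_efunctor] by simp

lemma gen_in:
  assumes "(n, \<sigma>, i, j, S) \<in> generators K p"
  shows "snd (h n \<sigma>) i j p S \<in> pob (EHom D (value_ob (vertex K n \<sigma> i)) (value_ob (vertex K n \<sigma> j))) p"
proof -
  have s: "\<sigma> \<in> pob K n" "i \<le> n" "j \<le> n" "S \<in> pob (EHom (coherent_simplex n) i j) p"
    using assms by (simp_all add: generators_iff)
  show ?thesis
    unfolding value_vertex[OF s(1,2)] value_vertex[OF s(1,3)]
    using psh_homD(1)[OF efunctorsD(2)[OF h_efunctor[OF s(1)]] s(4)] s by simp
qed

lemma D_comp: "x \<in> EOb D \<Longrightarrow> y \<in> EOb D \<Longrightarrow> z \<in> EOb D \<Longrightarrow> f \<in> pob (EHom D x y) p \<Longrightarrow>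
    g \<in> pob (EHom D y z) p \<Longrightarrow> EComp D x y z p f g \<in> pob (EHom D x z) p"
  and D_id: "x \<in> EOb D \<Longrightarrow> EId D x p \<in> pob (EHom D x x) p"
  and D_unit: "x \<in> EOb D \<Longrightarrow> y \<in> EOb D \<Longrightarrow> f \<in> pob (EHom D x y) p \<Longrightarrow> EComp D x x y p (EId D x p) f = f"
    "x \<in> EOb D \<Longrightarrow> y \<in> EOb D \<Longrightarrow> f \<in> pob (EHom D x y) p \<Longrightarrow> EComp D x y y p f (EId D y p) = f"
  and D_assoc: "w \<in> EOb D \<Longrightarrow> x \<in> EOb D \<Longrightarrow> y \<in> EOb D \<Longrightarrow> z \<in> EOb D \<Longrightarrow>
    f \<in> pob (EHom D w x) p \<Longrightarrow> g \<in> pob (EHom D x y) p \<Longrightarrow> k \<in> pob (EHom D y z) p \<Longrightarrow>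
    EComp D w x z p f (EComp D x y z p g k) = EComp D w y z p (EComp D w x y p f g) k"
  and D_pmap: "x \<in> EOb D \<Longrightarrow> y \<in> EOb D \<Longrightarrow> z \<in> EOb D \<Longrightarrow> \<theta> \<in> delta_hom q p \<Longrightarrow>
    f \<in> pob (EHom D x y) p \<Longrightarrow> g \<in> pob (EHom D y z) p \<Longrightarrow>
    pmap (EHom D x z) (q, \<theta>, p) (EComp D x y z p f g) =
    EComp D x y z q (pmap (EHom D x y) (q, \<theta>, p) f) (pmap (EHom D y z) (q, \<theta>, p) g)"
  and D_pmap_id: "x \<in> EOb D \<Longrightarrow> \<theta> \<in> delta_hom q p \<Longrightarrow> pmap (EHom D x x) (q, \<theta>, p) (EId D x p) = EId D x q"
  using D unfolding enriched_category_def Ball_Ar_Delta by simp_all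

lemma value_in: "is_word K p x y w \<Longrightarrow> word_value p x y w \<in> pob (EHom D (value_ob x) (value_ob y)) p"
proof (induction w arbitrary: x)
  case Nil
  then show ?case by (auto simp: D_id value_ob_in)
next
  case (Cons g w)
  obtain n \<sigma> i j S where g: "g = (n, \<sigma>, i, j, S)" by (cases g)
  have w: "is_word K p (vertex K n \<sigma> j) y w" "x = vertex K n \<sigma> i" and G: "(n, \<sigma>, i, j, S) \<in> generators K p"
    using Cons.prems g by simp_all
  have "x \<in> pob K 0" "vertex K n \<sigma> j \<in> pob K 0" "y \<in> pob K 0"
    using is_word_ends[OF K w(1)] is_word_ends[OF K Cons.prems(1)] by simp_all
  then show ?case using gen_in[OF G] Cons.IH[OF w(1)] by (simp add: g w(2) D_comp value_ob_in)
qed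

lemma value_append: "is_word K p x y u \<Longrightarrow> is_word K p y z v \<Longrightarrow>
   word_value p x z (u @ v) = EComp D (value_ob x) (value_ob y) (value_ob z) p (word_value p x y u) (word_value p y z v)"
proof (induction u arbitrary: x)
  case Nil
  then show ?case using is_word_ends[OF K Nil(2)] by (simp add: D_unit value_ob_in value_in)
next
  case (Cons g u)
  obtain n \<sigma> i j S where g: "g = (n, \<sigma>, i, j, S)" by (cases g)
  have w: "is_word K p (vertex K n \<sigma> j) y u" "x = vertex K n \<sigma> i" and G: "(n, \<sigma>, i, j, S) \<in> generators K p"
    using Cons.prems g by simp_all
  have "x \<in> pob K 0" "vertex K n \<sigma> j \<in> pob K 0" "y \<in> pob K 0" "z \<in> pob K 0"
    using is_word_ends[OF K w(1)] is_word_ends[OF K Cons.prems(1)] is_word_ends[OF K Cons.prems(2)] by simp_all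
  then show ?case
    using gen_in[OF G] Cons.IH[OF w(1) Cons.prems(2)] value_in[OF w(1)] value_in[OF Cons.prems(2)]
    by (simp add: g w(2) D_assoc value_ob_in)
qed

lemma value_gen:
  assumes "(n, \<sigma>, i, j, S) \<in> generators K p" 
  shows "word_value p (vertex K n \<sigma> i) (vertex K n \<sigma> j) [(n, \<sigma>, i, j, S)] = snd (h n \<sigma>) i j p S"
  using assms gen_in[OF assms] by (simp add: D_unit value_ob_in generators_iff vertex_in[OF K])

lemma value_relation:
  assumes "word_relation K p a b" "is_word K p x y a" "is_word K p x y b"
  shows "word_value p x y a = word_value p x y b"
  using assms(1)
proof cases
  case (unit \<sigma> n i)
  have g: "(n, \<sigma>, i, i, EId (coherent_simplex n) i p) \<in> generators K p"
    and xy: "x = vertex K n \<sigma> i" "y = x"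
    using assms unit by (simp_all add: generators_iff coh_id)
  have "snd (h n \<sigma>) i i p (EId (coherent_simplex n) i p) = EId D (fst (h n \<sigma>) i) p"
    using efunctorsD(3)[OF h_efunctor] unit by simp
  then show ?thesis using value_gen[OF g] unit xy value_vertex by simp
next
  case (comp n \<sigma> i j S k T)
  then have s: "\<sigma> \<in> pob K n" "i \<le> n" "j \<le> n" "k \<le> n"
    and S: "S \<in> pob (EHom (coherent_simplex n) i j) p" and T: "T \<in> pob (EHom (coherent_simplex n) j k) p"
    by (simp_all add: generators_iff)
  have g: "(n, \<sigma>, i, k, EComp (coherent_simplex n) i j k p S T) \<in> generators K p"
    using s coh_comp[OF S T] by (simp add: generators_iff)
  have xy: "x = vertex K n \<sigma> i" "y = vertex K n \<sigma> k"
    using assms(3) comp by simp_all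
  have "word_value p x y a = EComp D (value_ob x) (value_ob (vertex K n \<sigma> j)) (value_ob y) p (snd (h n \<sigma>) i j p S) (snd (h n \<sigma>) j k p T)"
    using value_gen[OF comp(4)] unfolding comp(1) xy by simp
  also have "\<dots> = snd (h n \<sigma>) i k p (EComp (coherent_simplex n) i j k p S T)"
    using efunctorsD(4)[OF h_efunctor[OF s(1)] _ _ _ _ S T] s by (simp add: xy value_vertex)
  also have "\<dots> = word_value p x y b" using value_gen[OF g] comp xy by simp
  finally show ?thesis .
next
  case (nat \<sigma> n \<theta> m i j S)
  let ?S = "snd (coherent_simplex_map (m, \<theta>, n)) i j p S" and ?s = "pmap K (m, \<theta>, n) \<sigma>"
  have s: "i \<le> m" "j \<le> m" "S \<in> pob (EHom (coherent_simplex m) i j) p"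
    using nat by (simp_all add: generators_iff)
  have g: "(n, \<sigma>, \<theta> i, \<theta> j, ?S) \<in> generators K p"
    using assms(3) nat by simp
  have xy: "x = vertex K n \<sigma> (\<theta> i)" "y = vertex K n \<sigma> (\<theta> j)"
    using assms(3) nat by simp_all
  have xy': "x = vertex K m ?s i" "y = vertex K m ?s j"
    using assms(2) nat by simp_all
  have "word_value p x y a = snd (h m ?s) i j p S"
    using value_gen[OF nat(5)] nat(1) xy' by simp
  also have "\<dots> = snd (h n \<sigma>) (\<theta> i) (\<theta> j) p ?S"
    unfolding h_pmap[OF nat(4,3)] using s by (simp add: efun_comp_simps)
  also have "\<dots> = word_value p x y b" using value_gen[OF g] nat(2) xy by simp
  finally show ?thesis .
qed

lemma is_word_target: "is_word K p x y w \<Longrightarrow> is_word K p x y' w \<Longrightarrow> y = y'"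
  by (induction w arbitrary: x) auto

lemma is_word_source: "is_word K p x y w \<Longrightarrow> is_word K p x' y w \<Longrightarrow> x = x'"
  by (cases w) auto

lemma value_word_rewrite:
  assumes "(a, b) \<in> word_rewrite K p x y"
  shows "word_value p x y a = word_value p x y b"
proof -
  obtain u a' b' v where r: "word_relation K p a' b'" "a = u @ a' @ v" "b = u @ b' @ v"
    and w: "is_word K p x y a" "is_word K p x y b"
    using assms by (auto simp: word_rewrite_def words_def)
  obtain x1 y1 where 1: "is_word K p x x1 u" "is_word K p x1 y1 a'" "is_word K p y1 y v"
    using w(1) unfolding r(2) is_word_append[OF K] by blast
  obtain x2 y2 where 2: "is_word K p x x2 u" "is_word K p x2 y2 b'" "is_word K p y2 y v"
    using w(2) unfolding r(3) is_word_append[OF K] by blast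
  have "x2 = x1" "y2 = y1"
    using is_word_target[OF 2(1) 1(1)] is_word_source[OF 2(3) 1(3)] by simp_all
  then have b': "is_word K p x1 y1 b'" using 2 by simp
  have av: "is_word K p x1 y (a' @ v)" "is_word K p x1 y (b' @ v)" unfolding is_word_append[OF K] using 1 b' by blast+
  show ?thesis
    unfolding r(2,3) value_append[OF 1(1) av(1)] value_append[OF 1(1) av(2)] value_append[OF 1(2,3)] 
      value_append[OF b' 1(3)] value_relation[OF r(1) 1(2) b'] ..
qed

lemma value_word_eq: "(a, b) \<in> word_eq K p x y \<Longrightarrow> word_value p x y a = word_value p x y b"
  unfolding word_eq_def
proof (induction rule: rtrancl_induct)
  case (step b c)
  have "word_value p x y b = word_value p x y c"
    using step.hyps(2) value_word_rewrite[of b c] value_word_rewrite[of c b] by auto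
  then show ?case using step.IH by simp
qed simp

lemma value_pmap:
  "is_word K p x y w \<Longrightarrow> \<theta> \<in> delta_hom q p \<Longrightarrow> 
    pmap (EHom D (value_ob x) (value_ob y)) (q, \<theta>, p) (word_value p x y w) = word_value q x y (map (gen_map (psh_id Delta K) q \<theta>) w)"
proof (induction w arbitrary: x)
  case Nil
  then show ?case by (auto simp: D_pmap_id value_ob_in)
next
  case (Cons g w)
  obtain n \<sigma> i j S where g: "g = (n, \<sigma>, i, j, S)" by (cases g)
  have w: "is_word K p (vertex K n \<sigma> j) y w" "x = vertex K n \<sigma> i" and G: "(n, \<sigma>, i, j, S) \<in> generators K p"
    using Cons.prems g by simp_all
  have s: "\<sigma> \<in> pob K n" "i \<le> n" "j \<le> n" "S \<in> pob (EHom (coherent_simplex n) i j) p"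
    using G by (simp_all add: generators_iff)
  have "x \<in> pob K 0" "vertex K n \<sigma> j \<in> pob K 0" "y \<in> pob K 0"
    using is_word_ends[OF K w(1)] is_word_ends[OF K Cons.prems(1)] by simp_all
  moreover have "pmap (EHom D (value_ob x) (value_ob (vertex K n \<sigma> j))) (q, \<theta>, p) (snd (h n \<sigma>) i j p S)
    = snd (h n \<sigma>) i j q (compose {..q} S \<theta>)"
    using psh_homD(2)[OF efunctorsD(2)[OF h_efunctor[OF s(1)]] Cons.prems(2) s(4)] s
    by (simp add: w(2) value_vertex)
  ultimately show ?case
    using gen_in[OF G] Cons.IH[OF w(1) Cons.prems(2)] value_in[OF w(1)] Cons.prems(2)
    by (simp add: g w(2) D_pmap value_ob_in gen_map_def psh_id_apply s(1))
qed

definition rigidify_lift :: "(nat, 's, 's gen list set, 'x, 'm) efun" where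
  "rigidify_lift = (\<lambda>x\<in>pob K 0. value_ob x, \<lambda>x\<in>pob K 0. \<lambda>y\<in>pob K 0. \<lambda>p.
     \<lambda>A\<in>pob (EHom (rigidify K) x y) p. word_value p x y (SOME w. w \<in> A))"

lemma rigidify_lift_simps:
  "x \<in> pob K 0 \<Longrightarrow> fst rigidify_lift x = value_ob x"
  "is_word K p x y w \<Longrightarrow> snd rigidify_lift x y p (word_class K p x y w) = word_value p x y w"
proof -
  assume w: "is_word K p x y w"
  let ?A = "word_class K p x y w"
  have A: "?A \<in> pob (EHom (rigidify K) x y) p" unfolding rigidify_hom using w by blast
  have "w \<in> ?A" by (simp add: word_class_def word_eq_refl)
  then have "(SOME w. w \<in> ?A) \<in> ?A" by (rule someI)
  then have "word_value p x y w = word_value p x y (SOME w. w \<in> ?A)"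
    by (intro value_word_eq) (simp add: word_class_def)
  then show "snd rigidify_lift x y p ?A = word_value p x y w"
    using A is_word_ends[OF K w] by (simp add: rigidify_lift_def)
qed (simp add: rigidify_lift_def)

lemma rigidify_lift_efunctor: "rigidify_lift \<in> efunctors Delta (rigidify K) D"
proof -
  note s = rigidify_lift_simps
  have H: "snd rigidify_lift x y \<in> psh_hom Delta (EHom (rigidify K) x y) (EHom D (value_ob x) (value_ob y))"
    if xy: "x \<in> pob K 0" "y \<in> pob K 0" for x y
    unfolding psh_hom_Delta
  proof (intro conjI allI impI)
    fix p
    have "snd rigidify_lift x y p \<in> extensional (pob (EHom (rigidify K) x y) p)"
      using xy by (simp add: rigidify_lift_def)
    moreover have "snd rigidify_lift x y p A \<in> pob (EHom D (value_ob x) (value_ob y)) p" 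
      if A: "A \<in> pob (EHom (rigidify K) x y) p" for A
    proof -
      obtain a where a: "is_word K p x y a" "A = word_class K p x y a" using A unfolding rigidify_hom by blast
      show ?thesis unfolding a(2) s(2)[OF a(1)] using value_in[OF a(1)] .
    qed
    ultimately show "snd rigidify_lift x y p \<in> pob (EHom (rigidify K) x y) p \<rightarrow>\<^sub>E pob (EHom D (value_ob x) (value_ob y)) p"
      by (simp add: PiE_iff)
  next
    fix q p \<theta> A assume t: "\<theta> \<in> delta_hom q p" and A: "A \<in> pob (EHom (rigidify K) x y) p"
    then obtain a where a: "is_word K p x y a" "A = word_class K p x y a" unfolding rigidify_hom by blast
    show "snd rigidify_lift x y q (pmap (EHom (rigidify K) x y) (q, \<theta>, p) A) =
       pmap (EHom D (value_ob x) (value_ob y)) (q, \<theta>, p) (snd rigidify_lift x y p A)"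
      by (simp only: a(2) s(2)[OF a(1)] rigidify_pmap[OF K a(1) t] s(2)[OF op_word[OF K a(1) t]] value_pmap[OF a(1) t])
  qed
  show ?thesis
    unfolding efunctors_iff
  proof (intro conjI ballI)
    show "fst rigidify_lift \<in> EOb (rigidify K) \<rightarrow>\<^sub>E EOb D"
      using value_ob_in by (simp add: rigidify_lift_def)
    show "snd rigidify_lift \<in> (\<Pi>\<^sub>E x\<in>EOb (rigidify K). \<Pi>\<^sub>E y\<in>EOb (rigidify K).
        psh_hom Delta (EHom (rigidify K) x y) (EHom D (fst rigidify_lift x) (fst rigidify_lift y)))"
    proof (intro PiE_I)
      fix x y assume "x \<in> EOb (rigidify K)" "y \<in> EOb (rigidify K)"
      then show "snd rigidify_lift x y \<in> psh_hom Delta (EHom (rigidify K) x y) (EHom D (fst rigidify_lift x) (fst rigidify_lift y))"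
        using H by (simp add: s)
    qed (simp_all add: rigidify_lift_def)
  next
    fix x p assume "x \<in> EOb (rigidify K)"
    then show "snd rigidify_lift x x p (EId (rigidify K) x p) = EId D (fst rigidify_lift x) p"
      using s(2)[of p x x "[]"] by (simp add: rigidify_EId s)
  next
    fix x y z p A B assume xyz: "x \<in> EOb (rigidify K)" "y \<in> EOb (rigidify K)" "z \<in> EOb (rigidify K)"
      and "A \<in> pob (EHom (rigidify K) x y) p" "B \<in> pob (EHom (rigidify K) y z) p"
    then obtain a b where a: "is_word K p x y a" "A = word_class K p x y a" and b: "is_word K p y z b" "B = word_class K p y z b"
      unfolding rigidify_hom by blast
    have ab: "is_word K p x z (a @ b)" using a b is_word_append[OF K] by blast
    show "snd rigidify_lift x z p (EComp (rigidify K) x y z p A B) =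
       EComp D (fst rigidify_lift x) (fst rigidify_lift y) (fst rigidify_lift z) p (snd rigidify_lift x y p A) (snd rigidify_lift y z p B)"
      using xyz by (simp add: a(2) b(2) rigidify_EComp[OF K a(1) b(1)] s(1) s(2)[OF ab] s(2)[OF a(1)] s(2)[OF b(1)]
          value_append[OF a(1) b(1)])
  qed
qed

lemma rigidify_lift_unit:
  assumes s: "\<sigma> \<in> pob K n"
  shows "efun_comp Delta (coherent_simplex n) rigidify_lift (rigidify_unit K n \<sigma>) = h n \<sigma>"
proof (rule efunctors_ext[OF efunctors_comp[OF rigidify_unit_efunctor[OF K s] rigidify_lift_efunctor] h_efunctor[OF s]])
  fix i assume "i \<in> EOb (coherent_simplex n)"
  then show "fst (efun_comp Delta (coherent_simplex n) rigidify_lift (rigidify_unit K n \<sigma>)) i = fst (h n \<sigma>) i"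
    by (simp add: efun_comp_simps unit_simps s rigidify_lift_simps(1) vertex_in[OF K s] value_vertex)
next
  fix i j p S assume ij: "i \<in> EOb (coherent_simplex n)" "j \<in> EOb (coherent_simplex n)"
    and S: "S \<in> pob (EHom (coherent_simplex n) i j) p"
  then have g: "(n, \<sigma>, i, j, S) \<in> generators K p" using s by (simp add: generators_iff)
  have w: "is_word K p (vertex K n \<sigma> i) (vertex K n \<sigma> j) [(n, \<sigma>, i, j, S)]"
    using ij g vertex_in[OF K s] by simp
  show "snd (efun_comp Delta (coherent_simplex n) rigidify_lift (rigidify_unit K n \<sigma>)) i j p S = snd (h n \<sigma>) i j p S"
    using S ij value_gen[OF g] by (simp add: efun_comp_simps unit_simps s rigidify_lift_simps(2)[OF w] del: word_value.simps)
qed (simp_all add: coh_presheaf coh_enriched)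

lemma rigidify_lift_unique:
  assumes F: "F \<in> efunctors Delta (rigidify K) D"
    and u: "\<And>n \<sigma>. \<sigma> \<in> pob K n \<Longrightarrow> efun_comp Delta (coherent_simplex n) F (rigidify_unit K n \<sigma>) = h n \<sigma>"
  shows "F = rigidify_lift"
proof (rule efunctors_ext[OF F rigidify_lift_efunctor])
  have v0: "vertex K 0 x 0 = x" if "x \<in> pob K 0" for x
  proof -
    have "(\<lambda>r\<in>{..0}. 0) = (\<lambda>i\<in>{..0}. i::nat)" by auto
    then show ?thesis using presheafD(2)[OF K that] by (simp only: vertex_def)
  qed
  have ob: "fst F x = value_ob x" if x: "x \<in> pob K 0" for x
    unfolding value_ob_def u[OF x, symmetric] using x by (simp add: efun_comp_simps unit_simps v0)
  then show "fst F x = fst rigidify_lift x" if "x \<in> EOb (rigidify K)" for x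
    using that by (simp add: rigidify_lift_simps)
  have gen: "snd F (vertex K n \<sigma> i) (vertex K n \<sigma> j) p (word_class K p (vertex K n \<sigma> i) (vertex K n \<sigma> j) [(n, \<sigma>, i, j, S)])
     = snd (h n \<sigma>) i j p S" if g: "(n, \<sigma>, i, j, S) \<in> generators K p" for n \<sigma> i j S p
    using g unfolding generators_iff
    by (subst u[symmetric]) (simp_all add: efun_comp_simps unit_simps)
  have mor: "snd F x y p (word_class K p x y w) = word_value p x y w" if "is_word K p x y w" for x y p w
    using that
  proof (induction w arbitrary: x)
    case Nil
    then show ?case using efunctorsD(3)[OF F, of x p] by (auto simp: rigidify_EId ob)
  next
    case (Cons g w)
    obtain n \<sigma> i j S where g: "g = (n, \<sigma>, i, j, S)" by (cases g)
    let ?x = "vertex K n \<sigma> i" and ?z = "vertex K n \<sigma> j"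
    have w: "is_word K p ?z y w" "x = ?x" and G: "(n, \<sigma>, i, j, S) \<in> generators K p"
      using Cons.prems g by simp_all
    have xyz: "?x \<in> pob K 0" "?z \<in> pob K 0" "y \<in> pob K 0"
      using is_word_ends[OF K w(1)] is_word_ends[OF K Cons.prems] w(2) by simp_all
    have 1: "is_word K p ?x ?z [(n, \<sigma>, i, j, S)]" using G xyz by simp
    have "word_class K p x y (g # w) = EComp (rigidify K) ?x ?z y p (word_class K p ?x ?z [(n, \<sigma>, i, j, S)]) (word_class K p ?z y w)"
      using rigidify_EComp[OF K 1 w(1)] by (simp add: g w(2))
    moreover have "word_class K p ?x ?z [(n, \<sigma>, i, j, S)] \<in> pob (EHom (rigidify K) ?x ?z) p"
      "word_class K p ?z y w \<in> pob (EHom (rigidify K) ?z y) p"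
      unfolding rigidify_hom using 1 w(1) by blast+
    ultimately have "snd F x y p (word_class K p x y (g # w)) = 
      EComp D (fst F ?x) (fst F ?z) (fst F y) p (snd F ?x ?z p (word_class K p ?x ?z [(n, \<sigma>, i, j, S)])) (snd F ?z y p (word_class K p ?z y w))"
      using efunctorsD(4)[OF F, of ?x ?z y p] xyz by (simp add: w(2))
    then show ?case by (simp add: gen[OF G] Cons.IH[OF w(1)] ob xyz g w(2))
  qed
  show "snd F x y p f = snd rigidify_lift x y p f" if "f \<in> pob (EHom (rigidify K) x y) p" for x y p f
    using that mor rigidify_lift_simps(2) unfolding rigidify_hom by metis
qed

lemma rigidify_universal_aux:
  assumes F: "F \<in> efunctors Delta (rigidify K) D"
  shows "psh_comp Delta K (coherent_nerve_map (rigidify K) F) (rigidify_unit K) = h \<longleftrightarrow>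
    (\<forall>n. \<forall>\<sigma>\<in>pob K n. efun_comp Delta (coherent_simplex n) F (rigidify_unit K n \<sigma>) = h n \<sigma>)"
    (is "?L = h \<longleftrightarrow> _")
proof
  have L: "?L n \<sigma> = efun_comp Delta (coherent_simplex n) F (rigidify_unit K n \<sigma>)" if "\<sigma> \<in> pob K n" for n \<sigma>
    using that rigidify_unit_efunctor[OF K that] by (simp add: psh_comp_def coherent_nerve_map_def compose_def)
  show "\<forall>n. \<forall>\<sigma>\<in>pob K n. efun_comp Delta (coherent_simplex n) F (rigidify_unit K n \<sigma>) = h n \<sigma>" if "?L = h"
    using that L by metis
  assume R: "\<forall>n. \<forall>\<sigma>\<in>pob K n. efun_comp Delta (coherent_simplex n) F (rigidify_unit K n \<sigma>) = h n \<sigma>"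
  show "?L = h"
  proof
    fix n
    show "?L n = h n"
    proof (rule extensionalityI)
      show "?L n \<in> extensional (pob K n)" by (simp add: psh_comp_def)
      show "h n \<in> extensional (pob K n)" using psh_homD(3)[OF h] .
    qed (use L R in simp)
  qed
qed

end

lemma rigidify_universal:
  assumes "presheaf Delta K" "enriched_category Delta D" "h \<in> psh_hom Delta K (coherent_nerve D)"
  shows "\<exists>!F. F \<in> efunctors Delta (rigidify K) D \<and>
    psh_comp Delta K (coherent_nerve_map (rigidify K) F) (rigidify_unit K) = h"
proof (rule ex1I[of _ "rigidify_lift K D h"])
  show "rigidify_lift K D h \<in> efunctors Delta (rigidify K) D \<and>
      psh_comp Delta K (coherent_nerve_map (rigidify K) (rigidify_lift K D h)) (rigidify_unit K) = h"
    using rigidify_lift_efunctor[OF assms] rigidify_lift_unit[OF assms]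
      rigidify_universal_aux[OF assms rigidify_lift_efunctor[OF assms]] by blast
next
  fix F
  assume F: "F \<in> efunctors Delta (rigidify K) D \<and>
      psh_comp Delta K (coherent_nerve_map (rigidify K) F) (rigidify_unit K) = h"
  then have "\<forall>n. \<forall>\<sigma>\<in>pob K n. efun_comp Delta (coherent_simplex n) F (rigidify_unit K n \<sigma>) = h n \<sigma>"
    using rigidify_universal_aux[OF assms, of F] by blast
  then show "F = rigidify_lift K D h" using F by (intro rigidify_lift_unique[OF assms]) simp_all
qed


section \<open>The wreath product, cellular sets and the functor V\<close>

type_synonym ('o, 'a, 's) wob = "nat \<times> (nat \<Rightarrow> ('o, 'a, 's) psh)"
type_synonym ('o, 's, 't) wmor = "(nat \<Rightarrow> nat) \<times> (nat \<Rightarrow> 'o \<Rightarrow> 's \<Rightarrow> nat \<Rightarrow> 't)"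
type_synonym ('o, 'a, 's) war = "('o, 'a, 's) wob \<times> ('o, 's, 's) wmor \<times> ('o, 'a, 's) wob"

definition wreath_hom ::
  "('o, 'a) cat \<Rightarrow> ('o, 'a, 's) wob \<Rightarrow> ('o, 'a, 't) wob \<Rightarrow> ('o, 's, 't) wmor set" where
  "wreath_hom C = (\<lambda>(n, X) (m, Y).
     {(\<gamma>, f). \<gamma> \<in> delta_hom n m \<and>
        f \<in> (\<Pi>\<^sub>E i\<in>{1..n}. psh_hom C (X i) (psh_prod {\<gamma> (i - 1)<..\<gamma> i} Y))})"

definition block :: "nat \<Rightarrow> (nat \<Rightarrow> nat) \<Rightarrow> nat \<Rightarrow> nat" where
  "block n \<gamma> l = (THE i. i \<in> {1..n} \<and> \<gamma> (i - 1) < l \<and> l \<le> \<gamma> i)"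

definition wreath_id :: "('o, 'a) cat \<Rightarrow> ('o, 'a, 's) wob \<Rightarrow> ('o, 's, 's) wmor" where
  "wreath_id C = (\<lambda>(n, X).
     (\<lambda>i\<in>{..n}. i, \<lambda>i\<in>{1..n}. \<lambda>c\<in>Ob C. \<lambda>x\<in>pob (X i) c. \<lambda>j\<in>{i}. x))"

definition wreath_comp ::
  "('o, 'a) cat \<Rightarrow> ('o, 'a, 's) wob \<Rightarrow> ('o, 'a, 't) wob
    \<Rightarrow> ('o, 't, 'r) wmor \<Rightarrow> ('o, 's, 't) wmor \<Rightarrow> ('o, 's, 'r) wmor" where
  "wreath_comp C = (\<lambda>(n, X) (m, Y) (\<delta>, g) (\<gamma>, f).
     (compose {..n} \<delta> \<gamma>,
      \<lambda>i\<in>{1..n}. \<lambda>c\<in>Ob C. \<lambda>x\<in>pob (X i) c. \<lambda>l\<in>{\<delta> (\<gamma> (i - 1))<..\<delta> (\<gamma> i)}.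
        g (block m \<delta> l) c (f i c x (block m \<delta> l)) l))"

definition wreath :: "('o, 'a) cat \<Rightarrow> (('o, 'a, 's) wob, ('o, 'a, 's) war) cat" where
  "wreath C =
     hom_cat {(n, X). X \<in> extensional {1..n} \<and> (\<forall>i\<in>{1..n}. presheaf C (X i))}
       (wreath_hom C) (wreath_id C) (\<lambda>X Y Z g f. wreath_comp C X Y g f)"

definition cell :: "('o, 'a) cat \<Rightarrow> nat \<Rightarrow> (nat \<Rightarrow> 'o) \<Rightarrow> ('o, 'a, 'a) wob" where
  "cell C n c = (n, \<lambda>i\<in>{1..n}. yoneda C (c i))"

definition Theta :: "('o, 'a) cat \<Rightarrow> (('o, 'a, 'a) wob, ('o, 'a, 'a) war) cat" where
  "Theta C = full_subcat (wreath C) {cell C n c | n c. \<forall>i\<in>{1..n}. c i \<in> Ob C}"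

type_synonym ('o, 'a, 's) cellular_set = "(('o, 'a, 'a) wob, ('o, 'a, 'a) war, 's) psh"

definition V_ob ::
  "('o, 'a) cat \<Rightarrow> ('o, 'a, 's) wob \<Rightarrow> ('o, 'a, ('o, 'a, 's) wmor) cellular_set" where
  "V_ob C X =
     \<lparr>pob = (\<lambda>T. wreath_hom C T X), pmap = (\<lambda>(T', u, T) v. wreath_comp C T' T v u)\<rparr>"

definition V_ar ::
  "('o, 'a) cat \<Rightarrow> ('o, 'a, 's) war \<Rightarrow>
    ('o, 'a, ('o, 'a, 's) wmor) cellular_set \<times>
    (('o, 'a, 'a) wob \<Rightarrow> ('o, 'a, 's) wmor \<Rightarrow> ('o, 'a, 's) wmor) \<times>
    ('o, 'a, ('o, 'a, 's) wmor) cellular_set" where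
  "V_ar C = (\<lambda>(X, w, Y).
     (V_ob C X,
      \<lambda>T\<in>Ob (Theta C). \<lambda>v\<in>wreath_hom C T X. wreath_comp C T X w v,
      V_ob C Y))"

definition "V_functor C = (V_ob C, V_ar C)"


section \<open>The coherent realization\<close>

definition k_ob :: "('o, 'a) cat \<Rightarrow> nat \<times> 'o \<Rightarrow> ('o, 'a, 'a) wob" where
  "k_ob C = (\<lambda>(n, c). cell C n (\<lambda>i. c))"

definition k_ar :: "('o, 'a) cat \<Rightarrow> delta_ar \<times> 'a \<Rightarrow> ('o, 'a, 'a) war" where
  "k_ar C = (\<lambda>((n, \<theta>, m), u).
     (k_ob C (n, Dom C u),
      (\<theta>, \<lambda>i\<in>{1..n}. \<lambda>b\<in>Ob C. \<lambda>v\<in>pob (yoneda C (Dom C u)) b.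
            \<lambda>j\<in>{\<theta> (i - 1)<..\<theta> i}. Cmp C u v),
      k_ob C (m, Cod C u)))"

text \<open>\<open>slice C X c\<close> is the simplicial set obtained from \<open>k\<^sup>* X\<close> by evaluation at \<open>c\<close>.\<close>

definition slice :: "('o, 'a) cat \<Rightarrow> ('o, 'a, 's) cellular_set \<Rightarrow> 'o \<Rightarrow> 's sset" where
  "slice C X c =
     \<lparr>pob = (\<lambda>n. pob X (k_ob C (n, c))), pmap = (\<lambda>\<theta>. pmap X (k_ar C (\<theta>, Idn C c)))\<rparr>"

definition slice_restrict ::
  "('o, 'a) cat \<Rightarrow> ('o, 'a, 's) cellular_set \<Rightarrow> 'a \<Rightarrow> nat \<Rightarrow> 's \<Rightarrow> 's" where
  "slice_restrict C X u = (\<lambda>n. \<lambda>\<sigma>\<in>pob (slice C X (Cod C u)) n. pmap X (k_ar C (Idn Delta n, u)) \<sigma>)"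

definition slice_map ::
  "('o, 'a) cat \<Rightarrow> (('o, 'a, 'a) wob \<Rightarrow> 's \<Rightarrow> 't) \<Rightarrow> 'o \<Rightarrow> nat \<Rightarrow> 's \<Rightarrow> 't" where
  "slice_map C \<alpha> c = (\<lambda>n. \<alpha> (k_ob C (n, c)))"

text \<open>The object set is the set of vertices of every slice, since \<^term>\<open>k_ob C (0, c)\<close> does not
  depend on \<open>c\<close>.\<close>

definition realization_ob ::
  "('o, 'a) cat \<Rightarrow> ('o, 'a, 's) cellular_set
    \<Rightarrow> (nat \<times> 'o, delta_ar \<times> 'a, 's, 's gen list set) ecat" where
  "realization_ob C X =
     \<lparr>EOb = pob X (cell C 0 undefined),
      EHom = (\<lambda>x y.
        \<lparr>pob = (\<lambda>(p, c). pob (EHom (rigidify (slice C X c)) x y) p),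
         pmap = (\<lambda>(\<theta>, u) A.
           pmap (EHom (rigidify (slice C X (Dom C u))) x y) \<theta>
             (snd (rigidify_map (slice C X (Cod C u)) (slice C X (Dom C u)) (slice_restrict C X u))
                x y (Cod Delta \<theta>) A))\<rparr>),
      EId = (\<lambda>x (p, c). EId (rigidify (slice C X c)) x p),
      EComp = (\<lambda>x y z (p, c). EComp (rigidify (slice C X c)) x y z p)\<rparr>"

definition realization_ar ::
  "('o, 'a) cat \<Rightarrow>
    ('o, 'a, 's) cellular_set \<times> (('o, 'a, 'a) wob \<Rightarrow> 's \<Rightarrow> 's) \<times> ('o, 'a, 's) cellular_set
    \<Rightarrow> (nat \<times> 'o, delta_ar \<times> 'a, 's, 's gen list set) ecat_ar" where
  "realization_ar C = (\<lambda>(X, \<alpha>, Y).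
     (realization_ob C X,
      (\<alpha> (cell C 0 undefined),
       \<lambda>x\<in>EOb (realization_ob C X). \<lambda>y\<in>EOb (realization_ob C X). \<lambda>(p, c)\<in>Ob (prod_cat Delta C).
         snd (rigidify_map (slice C X c) (slice C Y c) (slice_map C \<alpha> c)) x y p),
      realization_ob C Y))"

definition "realization C = (realization_ob C, realization_ar C)"


section \<open>The functor Q\<close>

text \<open>
  A morphism of degree \<open>(p, c)\<close> from \<open>i\<close> to \<open>j\<close> is a pair \<open>(x, t)\<close> with \<open>x k\<close> in \<open>X\<^sub>k(c)\<close> for
  \<open>i < k \<le> j\<close> and \<open>t k\<close> a \<open>p\<close>-simplex of the interval for \<open>i < k < j\<close>; for \<open>i = j\<close> both
  index sets are empty and this is the terminal simplicial presheaf.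
\<close>

type_synonym 's qmor = "(nat \<Rightarrow> 's) \<times> (nat \<Rightarrow> nat \<Rightarrow> nat)"

definition Q_hom ::
  "('o, 'a, 's) wob \<Rightarrow> nat \<Rightarrow> nat \<Rightarrow> (nat \<times> 'o, delta_ar \<times> 'a, 's qmor) psh" where
  "Q_hom = (\<lambda>(n, X) i j.
     \<lparr>pob = (\<lambda>(p, c).
        if i \<le> j
        then pob (psh_prod {i<..j} X) c \<times> pob (psh_prod {i<..<j} (\<lambda>k. std_simplex 1)) p
        else {}),
      pmap = (\<lambda>(\<theta>, u) (x, t).
        (pmap (psh_prod {i<..j} X) u x, pmap (psh_prod {i<..<j} (\<lambda>k. std_simplex 1)) \<theta> t))\<rparr>)"

definition Q_ob ::
  "('o, 'a, 's) wob \<Rightarrow> (nat \<times> 'o, delta_ar \<times> 'a, nat, 's qmor) ecat" where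
  "Q_ob X =
     \<lparr>EOb = {..fst X}, EHom = Q_hom X,
      EId = (\<lambda>i (p, c). (\<lambda>k. undefined, \<lambda>k. undefined)),
      EComp = (\<lambda>i j k (p, c) (x, t) (y, s).
        (\<lambda>l\<in>{i<..k}. if l \<le> j then x l else y l,
         \<lambda>l\<in>{i<..<k}. if l < j then t l else if l = j then (\<lambda>r\<in>{..p}. 1) else s l))\<rparr>"

definition Q_ar ::
  "('o, 'a) cat \<Rightarrow> ('o, 'a, 's) war
    \<Rightarrow> (nat \<times> 'o, delta_ar \<times> 'a, nat, 's qmor) ecat_ar" where
  "Q_ar C = (\<lambda>((n, X), (\<gamma>, f), Y).
     (Q_ob (n, X),
      (\<gamma>, \<lambda>i\<in>{..n}. \<lambda>j\<in>{..n}. \<lambda>(p, c)\<in>Ob (prod_cat Delta C). \<lambda>(x, t)\<in>pob (Q_hom (n, X) i j) (p, c).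
         (\<lambda>l\<in>{\<gamma> i<..\<gamma> j}. f (block n \<gamma> l) c (x (block n \<gamma> l)) l,
          \<lambda>l\<in>{\<gamma> i<..<\<gamma> j}. \<lambda>r\<in>{..p}. Max (insert 0 {t k r | k. i < k \<and> k < j \<and> \<gamma> k = l}))),
      Q_ob Y))"

definition "Q_functor C = (Q_ob, Q_ar C)"

end

theory Submission
  imports Defs
begin

text \<open>Fix an object \<open>c\<close> of \<open>C\<close> and evaluate everything at \<open>c\<close>. By the Yoneda lemma an \<open>m\<close>-simplex of the
  slice at \<open>c\<close> of \<open>V[n](X\<^sub>1, \<dots>, X\<^sub>n)\<close> is a monotone map \<open>\<gamma>\<close> from \<open>[m]\<close> to \<open>[n]\<close> with an element of \<open>X\<^sub>l(c)\<close> for every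
  \<open>l\<close> with \<open>\<gamma> 0 < l \<le> \<gamma> m\<close>. This is the nerve of the free category on the linear quiver with
  vertices \<open>0, \<dots>, n\<close> and the elements of \<open>X\<^sub>l(c)\<close> as edges from \<open>l - 1\<close> to \<open>l\<close>. So the claim is that
  the rigidification of such a nerve is the slice of \<open>Q\<close>: its morphisms from \<open>i\<close> to \<open>j\<close> are pairs of a
  path and a simplex of the cube on the vertices strictly between \<open>i\<close> and \<open>j\<close>.

  To see this, send the generator given by a simplex \<open>\<sigma>\<close> and a chain of vertex sets to the path
  traversed by \<open>\<sigma>\<close> together with the indicator, for each intermediate vertex of the quiver, of the
  images of the chain under \<open>\<gamma>\<close>. Two observations show that this is bijective on morphisms. A path from \<open>i\<close> to \<open>j\<close>
  is itself a simplex \<open>\<kappa>\<close> of dimension \<open>j - i\<close> that visits every vertex of the interval once, and a generator is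
  carried by the simplicial identities to the unique generator over \<open>\<kappa>\<close> with the same value
  (\<open>gen_determined\<close>). And two composable generators both live over the simplex of the concatenated
  path, where they can be composed, so every word reduces to a single generator
  (\<open>morphism_gen\<close>).

  These comparisons are natural in \<open>c\<close>, so they assemble to isomorphisms of categories enriched in simplicial
  presheaves (\<open>Psi_iso\<close>), and natural in \<open>[n](X\<^sub>1, \<dots>, X\<^sub>n)\<close> (\<open>Psi_square\<close>); both
  are checked on single generators, which by the above exhaust all morphisms. The functoriality of \<open>Q\<close> itself follows by
  transport along these isomorphisms from that of the composite \<open>V\<close> followed by the
  realization (\<open>naturally_isomorphic_transport\<close>).\<close>

section \<open>Categories of presheaves and of enriched categories\<close>

lemma hom_cat_simps [simp]:
  "Ob (hom_cat S H i k) = S"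
  "(x, f, y) \<in> Ar (hom_cat S H i k) \<longleftrightarrow> x \<in> S \<and> y \<in> S \<and> f \<in> H x y"
  "Dom (hom_cat S H i k) (x, f, y) = x" "Cod (hom_cat S H i k) (x, f, y) = y"
  "Idn (hom_cat S H i k) x = (x, i x, x)"
  "Cmp (hom_cat S H i k) (y, g, z) (x, f, y') = (x, k x y z g f, z)"
  by (simp_all add: hom_cat_def)

lemma hom_cat_category:
  assumes "\<And>x. x \<in> S \<Longrightarrow> i x \<in> H x x"
    and "\<And>x y z f g. \<lbrakk>x \<in> S; y \<in> S; z \<in> S; f \<in> H x y; g \<in> H y z\<rbrakk> \<Longrightarrow> k x y z g f \<in> H x z"
    and "\<And>x y f. \<lbrakk>x \<in> S; y \<in> S; f \<in> H x y\<rbrakk> \<Longrightarrow> k x x y f (i x) = f \<and> k x y y (i y) f = f"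
    and "\<And>w x y z f g h. \<lbrakk>w \<in> S; x \<in> S; y \<in> S; z \<in> S; f \<in> H w x; g \<in> H x y; h \<in> H y z\<rbrakk> \<Longrightarrow>
      k w y z h (k w x y g f) = k w x z (k x y z h g) f"
  shows "category (hom_cat S H i k)"
  unfolding category_def using assms by (auto simp: hom_cat_def)

lemma functor_comp_is_functor:
  assumes "is_functor A B F" "is_functor B C G"
  shows "is_functor A C (functor_comp G F)"
  using assms unfolding is_functor_def functor_comp_def by (simp add: category_def)

lemma categoryE:
  assumes "category C"
  shows "u \<in> Ar C \<Longrightarrow> Dom C u \<in> Ob C" "u \<in> Ar C \<Longrightarrow> Cod C u \<in> Ob C"
    and "a \<in> Ob C \<Longrightarrow> Idn C a \<in> Ar C" "a \<in> Ob C \<Longrightarrow> Dom C (Idn C a) = a" "a \<in> Ob C \<Longrightarrow> Cod C (Idn C a) = a"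
    and "u \<in> Ar C \<Longrightarrow> v \<in> Ar C \<Longrightarrow> Cod C u = Dom C v \<Longrightarrow> Cmp C v u \<in> Ar C"
    and "u \<in> Ar C \<Longrightarrow> v \<in> Ar C \<Longrightarrow> Cod C u = Dom C v \<Longrightarrow> Dom C (Cmp C v u) = Dom C u"
    and "u \<in> Ar C \<Longrightarrow> v \<in> Ar C \<Longrightarrow> Cod C u = Dom C v \<Longrightarrow> Cod C (Cmp C v u) = Cod C v"
    and "u \<in> Ar C \<Longrightarrow> Cmp C u (Idn C (Dom C u)) = u" "u \<in> Ar C \<Longrightarrow> Cmp C (Idn C (Cod C u)) u = u"
    and "u \<in> Ar C \<Longrightarrow> v \<in> Ar C \<Longrightarrow> w \<in> Ar C \<Longrightarrow> Cod C u = Dom C v \<Longrightarrow> Cod C v = Dom C w \<Longrightarrow>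
        Cmp C w (Cmp C v u) = Cmp C (Cmp C w v) u"
  using assms unfolding category_def by auto

lemma presheafE:
  assumes "presheaf C X"
  shows "u \<in> Ar C \<Longrightarrow> x \<in> pob X (Cod C u) \<Longrightarrow> pmap X u x \<in> pob X (Dom C u)"
    and "a \<in> Ob C \<Longrightarrow> x \<in> pob X a \<Longrightarrow> pmap X (Idn C a) x = x"
    and "u \<in> Ar C \<Longrightarrow> v \<in> Ar C \<Longrightarrow> Cod C u = Dom C v \<Longrightarrow> x \<in> pob X (Cod C v) \<Longrightarrow>
        pmap X (Cmp C v u) x = pmap X u (pmap X v x)"
  using assms unfolding presheaf_def by auto

lemma psh_homE:
  assumes "\<alpha> \<in> psh_hom C X Y"
  shows "c \<in> Ob C \<Longrightarrow> x \<in> pob X c \<Longrightarrow> \<alpha> c x \<in> pob Y c"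
    and "u \<in> Ar C \<Longrightarrow> x \<in> pob X (Cod C u) \<Longrightarrow> \<alpha> (Dom C u) (pmap X u x) = pmap Y u (\<alpha> (Cod C u) x)"
    and "\<alpha> \<in> extensional (Ob C)" "c \<in> Ob C \<Longrightarrow> \<alpha> c \<in> extensional (pob X c)"
  using assms unfolding psh_hom_def by (auto simp: PiE_iff)

lemma psh_homI:
  assumes "\<alpha> \<in> extensional (Ob C)" "\<And>c. c \<in> Ob C \<Longrightarrow> \<alpha> c \<in> extensional (pob X c)"
    and "\<And>c x. c \<in> Ob C \<Longrightarrow> x \<in> pob X c \<Longrightarrow> \<alpha> c x \<in> pob Y c"
    and "\<And>u x. u \<in> Ar C \<Longrightarrow> x \<in> pob X (Cod C u) \<Longrightarrow> \<alpha> (Dom C u) (pmap X u x) = pmap Y u (\<alpha> (Cod C u) x)"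
  shows "\<alpha> \<in> psh_hom C X Y"
  using assms unfolding psh_hom_def by (auto simp: PiE_iff)

lemma family_eqI:
  assumes "\<alpha> \<in> extensional A" "\<beta> \<in> extensional A"
    and "\<And>c. c \<in> A \<Longrightarrow> \<alpha> c \<in> extensional (X c)" "\<And>c. c \<in> A \<Longrightarrow> \<beta> c \<in> extensional (X c)"
    and "\<And>c x. c \<in> A \<Longrightarrow> x \<in> X c \<Longrightarrow> \<alpha> c x = \<beta> c x"
  shows "\<alpha> = \<beta>"
  using assms(1,2) by (rule extensionalityI) (rule extensionalityI[OF assms(3,4)], simp_all add: assms(5))

lemma psh_comp_simps:
  "psh_comp C X \<beta> \<alpha> \<in> extensional (Ob C)"
  "c \<in> Ob C \<Longrightarrow> psh_comp C X \<beta> \<alpha> c \<in> extensional (pob X c)"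
  "c \<in> Ob C \<Longrightarrow> x \<in> pob X c \<Longrightarrow> psh_comp C X \<beta> \<alpha> c x = \<beta> c (\<alpha> c x)"
  by (simp_all add: psh_comp_def compose_def)

lemma psh_id_simps:
  "psh_id C X \<in> extensional (Ob C)"
  "c \<in> Ob C \<Longrightarrow> psh_id C X c \<in> extensional (pob X c)"
  by (simp_all add: psh_id_def)

lemma psh_id_in:
  assumes "category C" "presheaf C X"
  shows "psh_id C X \<in> psh_hom C X X"
  by (rule psh_homI) (simp_all add: psh_id_simps psh_id_apply categoryE[OF assms(1)] presheafE[OF assms(2)])

lemma psh_comp_in:
  assumes "category C" "presheaf C X" "\<alpha> \<in> psh_hom C X Y" "\<beta> \<in> psh_hom C Y Z"
  shows "psh_comp C X \<beta> \<alpha> \<in> psh_hom C X Z"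
  by (rule psh_homI)
    (simp_all add: psh_comp_simps categoryE[OF assms(1)] presheafE[OF assms(2)] psh_homE(1,2)[OF assms(3)] psh_homE(1,2)[OF assms(4)])

lemma psh_comp_id:
  assumes "\<alpha> \<in> psh_hom C X Y"
  shows "psh_comp C X \<alpha> (psh_id C X) = \<alpha>" "psh_comp C X (psh_id C Y) \<alpha> = \<alpha>"
  by (rule family_eqI[where A = "Ob C" and X = "pob X"];
      simp add: psh_comp_simps psh_id_apply psh_homE[OF assms])+

lemma psh_comp_assoc:
  assumes "\<alpha> \<in> psh_hom C X Y"
  shows "psh_comp C X \<gamma> (psh_comp C X \<beta> \<alpha>) = psh_comp C X (psh_comp C Y \<gamma> \<beta>) \<alpha>"
  by (rule family_eqI[where A = "Ob C" and X = "pob X"])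
    (simp_all add: psh_comp_simps psh_homE(1)[OF assms])

lemma psh_cat_category: "category C \<Longrightarrow> category (psh_cat C)"
  unfolding psh_cat_def
  by (rule hom_cat_category) (simp_all add: psh_id_in psh_comp_in psh_comp_id psh_comp_assoc)

lemma prod_cat_simps [simp]:
  "Ob (prod_cat A B) = Ob A \<times> Ob B" "(u, v) \<in> Ar (prod_cat A B) \<longleftrightarrow> u \<in> Ar A \<and> v \<in> Ar B"
  "Dom (prod_cat A B) (u, v) = (Dom A u, Dom B v)" "Cod (prod_cat A B) (u, v) = (Cod A u, Cod B v)"
  "Idn (prod_cat A B) (a, b) = (Idn A a, Idn B b)"
  "Cmp (prod_cat A B) (u, v) (u', v') = (Cmp A u u', Cmp B v v')"
  by (simp_all add: prod_cat_def)

lemma prod_cat_category: "category A \<Longrightarrow> category B \<Longrightarrow> category (prod_cat A B)"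
  unfolding category_def by (auto simp: prod_cat_def)

lemma full_subcat_simps [simp]:
  "Ob (full_subcat A S) = S"
  "u \<in> Ar (full_subcat A S) \<longleftrightarrow> u \<in> Ar A \<and> Dom A u \<in> S \<and> Cod A u \<in> S"
  "Dom (full_subcat A S) = Dom A" "Cod (full_subcat A S) = Cod A"
  "Idn (full_subcat A S) = Idn A" "Cmp (full_subcat A S) = Cmp A"
  by (simp_all add: full_subcat_def)

lemma full_subcat_category: "category A \<Longrightarrow> S \<subseteq> Ob A \<Longrightarrow> category (full_subcat A S)"
  unfolding category_def by auto

lemma enriched_categoryE:
  assumes "enriched_category B E"
  shows "x \<in> EOb E \<Longrightarrow> y \<in> EOb E \<Longrightarrow> presheaf B (EHom E x y)"
    and "x \<in> EOb E \<Longrightarrow> b \<in> Ob B \<Longrightarrow> EId E x b \<in> pob (EHom E x x) b"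
    and "x \<in> EOb E \<Longrightarrow> y \<in> EOb E \<Longrightarrow> z \<in> EOb E \<Longrightarrow> b \<in> Ob B \<Longrightarrow>
        f \<in> pob (EHom E x y) b \<Longrightarrow> g \<in> pob (EHom E y z) b \<Longrightarrow> EComp E x y z b f g \<in> pob (EHom E x z) b"
    and "x \<in> EOb E \<Longrightarrow> u \<in> Ar B \<Longrightarrow> pmap (EHom E x x) u (EId E x (Cod B u)) = EId E x (Dom B u)"
    and "x \<in> EOb E \<Longrightarrow> y \<in> EOb E \<Longrightarrow> z \<in> EOb E \<Longrightarrow> u \<in> Ar B \<Longrightarrow>
        f \<in> pob (EHom E x y) (Cod B u) \<Longrightarrow> g \<in> pob (EHom E y z) (Cod B u) \<Longrightarrow>
          pmap (EHom E x z) u (EComp E x y z (Cod B u) f g) =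
          EComp E x y z (Dom B u) (pmap (EHom E x y) u f) (pmap (EHom E y z) u g)"
    and "x \<in> EOb E \<Longrightarrow> y \<in> EOb E \<Longrightarrow> b \<in> Ob B \<Longrightarrow> f \<in> pob (EHom E x y) b \<Longrightarrow> EComp E x x y b (EId E x b) f = f"
    and "x \<in> EOb E \<Longrightarrow> y \<in> EOb E \<Longrightarrow> b \<in> Ob B \<Longrightarrow> f \<in> pob (EHom E x y) b \<Longrightarrow> EComp E x y y b f (EId E y b) = f"
    and "w \<in> EOb E \<Longrightarrow> x \<in> EOb E \<Longrightarrow> y \<in> EOb E \<Longrightarrow> z \<in> EOb E \<Longrightarrow> b \<in> Ob B \<Longrightarrow>
        f \<in> pob (EHom E w x) b \<Longrightarrow> g \<in> pob (EHom E x y) b \<Longrightarrow> h \<in> pob (EHom E y z) b \<Longrightarrow>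
          EComp E w y z b (EComp E w x y b f g) h = EComp E w x z b f (EComp E x y z b g h)"
  using assms unfolding enriched_category_def by simp_all

lemma efunctorsE:
  assumes "F \<in> efunctors B E E'" "x \<in> EOb E" "y \<in> EOb E"
  shows "b \<in> Ob B \<Longrightarrow> f \<in> pob (EHom E x y) b \<Longrightarrow> snd F x y b f \<in> pob (EHom E' (fst F x) (fst F y)) b"
    and "u \<in> Ar B \<Longrightarrow> f \<in> pob (EHom E x y) (Cod B u) \<Longrightarrow>
      snd F x y (Dom B u) (pmap (EHom E x y) u f) = pmap (EHom E' (fst F x) (fst F y)) u (snd F x y (Cod B u) f)"
    and "snd F x y \<in> extensional (Ob B)" "b \<in> Ob B \<Longrightarrow> snd F x y b \<in> extensional (pob (EHom E x y) b)"
  by (fact psh_homE[OF efunctorsD(2)[OF assms]])+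

lemma efunctorsI:
  assumes "fst F \<in> extensional (EOb E)" "snd F \<in> extensional (EOb E)"
    and "\<And>x. x \<in> EOb E \<Longrightarrow> snd F x \<in> extensional (EOb E)"
    and "\<And>x. x \<in> EOb E \<Longrightarrow> fst F x \<in> EOb E'"
    and "\<And>x y. x \<in> EOb E \<Longrightarrow> y \<in> EOb E \<Longrightarrow> snd F x y \<in> psh_hom B (EHom E x y) (EHom E' (fst F x) (fst F y))"
    and "\<And>x b. x \<in> EOb E \<Longrightarrow> b \<in> Ob B \<Longrightarrow> snd F x x b (EId E x b) = EId E' (fst F x) b"
    and "\<And>x y z b f g. \<lbrakk>x \<in> EOb E; y \<in> EOb E; z \<in> EOb E; b \<in> Ob B; f \<in> pob (EHom E x y) b; g \<in> pob (EHom E y z) b\<rbrakk> \<Longrightarrow>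
      snd F x z b (EComp E x y z b f g) = EComp E' (fst F x) (fst F y) (fst F z) b (snd F x y b f) (snd F y z b g)"
  shows "F \<in> efunctors B E E'"
  using assms unfolding efunctors_iff by (auto simp: PiE_iff)

lemma efun_eqI:
  assumes "fst F \<in> extensional (EOb E)" "fst G \<in> extensional (EOb E)"
    and "snd F \<in> extensional (EOb E)" "snd G \<in> extensional (EOb E)"
    and "\<And>x. x \<in> EOb E \<Longrightarrow> snd F x \<in> extensional (EOb E)" "\<And>x. x \<in> EOb E \<Longrightarrow> snd G x \<in> extensional (EOb E)"
    and "\<And>x y. x \<in> EOb E \<Longrightarrow> y \<in> EOb E \<Longrightarrow> snd F x y \<in> extensional (Ob B)"
    and "\<And>x y. x \<in> EOb E \<Longrightarrow> y \<in> EOb E \<Longrightarrow> snd G x y \<in> extensional (Ob B)"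
    and "\<And>x y b. x \<in> EOb E \<Longrightarrow> y \<in> EOb E \<Longrightarrow> b \<in> Ob B \<Longrightarrow> snd F x y b \<in> extensional (pob (EHom E x y) b)"
    and "\<And>x y b. x \<in> EOb E \<Longrightarrow> y \<in> EOb E \<Longrightarrow> b \<in> Ob B \<Longrightarrow> snd G x y b \<in> extensional (pob (EHom E x y) b)"
    and "\<And>x. x \<in> EOb E \<Longrightarrow> fst F x = fst G x"
    and "\<And>x y b f. x \<in> EOb E \<Longrightarrow> y \<in> EOb E \<Longrightarrow> b \<in> Ob B \<Longrightarrow> f \<in> pob (EHom E x y) b \<Longrightarrow>
      snd F x y b f = snd G x y b f"
  shows "F = G"
proof (rule prod_eqI)
  show "fst F = fst G" using assms(1,2,11) by (rule extensionalityI)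
  have "snd F x = snd G x" if x: "x \<in> EOb E" for x
  proof (rule extensionalityI[OF assms(5,6)[OF x]])
    fix y assume y: "y \<in> EOb E"
    show "snd F x y = snd G x y"
      by (rule family_eqI[OF assms(7,8)[OF x y] assms(9,10)[OF x y] assms(12)[OF x y]])
  qed
  then show "snd F = snd G" by (rule extensionalityI[OF assms(3,4)])
qed

lemma efunctors_eqI:
  assumes "F \<in> efunctors B E E'" "G \<in> efunctors B E E''"
    and "\<And>x. x \<in> EOb E \<Longrightarrow> fst F x = fst G x"
    and "\<And>x y b f. x \<in> EOb E \<Longrightarrow> y \<in> EOb E \<Longrightarrow> b \<in> Ob B \<Longrightarrow> f \<in> pob (EHom E x y) b \<Longrightarrow>
      snd F x y b f = snd G x y b f"
  shows "F = G"
  by (rule efun_eqI[where E = E and B = B])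
    (simp_all add: efunctorsD[OF assms(1)] efunctorsD[OF assms(2)] efunctorsE[OF assms(1)] efunctorsE[OF assms(2)] assms(3,4))

lemma efun_comp_ext:
  "fst (efun_comp B E G F) \<in> extensional (EOb E)" "snd (efun_comp B E G F) \<in> extensional (EOb E)"
  "x \<in> EOb E \<Longrightarrow> snd (efun_comp B E G F) x \<in> extensional (EOb E)"
  "x \<in> EOb E \<Longrightarrow> y \<in> EOb E \<Longrightarrow> snd (efun_comp B E G F) x y \<in> extensional (Ob B)"
  "x \<in> EOb E \<Longrightarrow> y \<in> EOb E \<Longrightarrow> b \<in> Ob B \<Longrightarrow> snd (efun_comp B E G F) x y b \<in> extensional (pob (EHom E x y) b)"
  by (simp_all add: efun_comp_def psh_comp_simps split: prod.splits)

lemma efun_id_simps: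
  "fst (efun_id B E) \<in> extensional (EOb E)" "snd (efun_id B E) \<in> extensional (EOb E)"
  "x \<in> EOb E \<Longrightarrow> snd (efun_id B E) x \<in> extensional (EOb E)"
  "x \<in> EOb E \<Longrightarrow> fst (efun_id B E) x = x"
  "x \<in> EOb E \<Longrightarrow> y \<in> EOb E \<Longrightarrow> snd (efun_id B E) x y = psh_id B (EHom E x y)"
  by (simp_all add: efun_id_def)

lemma efun_id_in:
  assumes B: "category B" and E: "enriched_category B E"
  shows "efun_id B E \<in> efunctors B E E"
  by (rule efunctorsI)
    (simp_all add: efun_id_simps psh_id_in[OF B] psh_id_apply enriched_categoryE[OF E])

lemma efun_comp_in:
  assumes B: "category B" and E: "enriched_category B E"
    and F: "F \<in> efunctors B E E'" and G: "G \<in> efunctors B E' E''"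
  shows "efun_comp B E G F \<in> efunctors B E E''"
proof (rule efunctorsI)
  fix x y assume xy: "x \<in> EOb E" "y \<in> EOb E"
  have "snd (efun_comp B E G F) x y = psh_comp B (EHom E x y) (snd G (fst F x) (fst F y)) (snd F x y)"
    using xy by (simp add: efun_comp_def split: prod.splits)
  then show "snd (efun_comp B E G F) x y \<in>
      psh_hom B (EHom E x y) (EHom E'' (fst (efun_comp B E G F) x) (fst (efun_comp B E G F) y))"
    using xy psh_comp_in[OF B enriched_categoryE(1)[OF E xy] efunctorsD(2)[OF F xy]
        efunctorsD(2)[OF G efunctorsD(1)[OF F xy(1)] efunctorsD(1)[OF F xy(2)]]]
    by (simp add: efun_comp_simps)
qed (simp_all add: efun_comp_ext efun_comp_simps efunctorsD[OF F] efunctorsD[OF G] efunctorsE[OF F] enriched_categoryE[OF E])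

lemma efun_comp_assoc:
  assumes F: "F \<in> efunctors B E E'"
  shows "efun_comp B E H (efun_comp B E G F) = efun_comp B E (efun_comp B E' H G) F"
  by (rule efun_eqI[where E = E and B = B])
    (simp_all add: efun_comp_ext efun_comp_simps efunctorsD[OF F] efunctorsE[OF F])

lemma efun_comp_id:
  assumes E: "enriched_category B E" and F: "F \<in> efunctors B E E'"
  shows "efun_comp B E F (efun_id B E) = F" "efun_comp B E (efun_id B E') F = F"
  by (rule efun_eqI[where E = E and B = B];
    simp add: efun_comp_ext efun_comp_simps efun_id_simps psh_id_apply efunctorsD[OF F] efunctorsE[OF F])+

lemma ecat_cat_category: "category B \<Longrightarrow> category (ecat_cat B)"
  unfolding ecat_cat_def
  by (rule hom_cat_category) (simp_all add: efun_id_in efun_comp_in efun_comp_id efun_comp_assoc)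

text \<open>A fully faithful functor that is bijective on objects is invertible: the inverse bijections
  inherit compatibility with restriction, identities and composition.\<close>

lemma enriched_iso_bij:
  assumes E: "enriched_category B E" and B: "category B" and F: "F \<in> efunctors B E E'"
    and ob: "bij_betw (fst F) (EOb E) (EOb E')"
    and hom: "\<And>x y b. x \<in> EOb E \<Longrightarrow> y \<in> EOb E \<Longrightarrow> b \<in> Ob B \<Longrightarrow>
      bij_betw (snd F x y b) (pob (EHom E x y) b) (pob (EHom E' (fst F x) (fst F y)) b)"
  shows "enriched_iso B E E' F"
proof -
  define i where "i = inv_into (EOb E) (fst F)"
  define H where "H = (\<lambda>x y b. inv_into (pob (EHom E x y) b) (snd F x y b))"
  define G where "G = (restrict i (EOb E'), \<lambda>x\<in>EOb E'. \<lambda>y\<in>EOb E'. \<lambda>b\<in>Ob B.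
     restrict (H (i x) (i y) b) (pob (EHom E' x y) b))"
  have i: "i x \<in> EOb E" "fst F (i x) = x" if "x \<in> EOb E'" for x
    using that ob unfolding i_def by (simp_all add: bij_betw_def inv_into_into f_inv_into_f)
  have iF: "i (fst F x) = x" if "x \<in> EOb E" for x
    using that ob unfolding i_def by (simp add: bij_betw_def)
  have HF: "H x y b (snd F x y b f) = f" if "x \<in> EOb E" "y \<in> EOb E" "b \<in> Ob B" "f \<in> pob (EHom E x y) b" for x y b f
    using that hom[of x y b] unfolding H_def by (simp add: bij_betw_def)
  have G: "fst G x = i x" if "x \<in> EOb E'" for x using that by (simp add: G_def)
  have H: "\<exists>g. g \<in> pob (EHom E (i x) (i y)) b \<and> f = snd F (i x) (i y) b g \<and> snd G x y b f = g"
    if "x \<in> EOb E'" "y \<in> EOb E'" "b \<in> Ob B" "f \<in> pob (EHom E' x y) b" for x y b f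
  proof -
    have "f \<in> snd F (i x) (i y) b ` pob (EHom E (i x) (i y)) b"
      using hom[of "i x" "i y" b] that by (simp add: i bij_betw_def)
    then obtain g where "g \<in> pob (EHom E (i x) (i y)) b" "f = snd F (i x) (i y) b g" by blast
    then show ?thesis using that HF[of "i x" "i y" b g] by (auto simp: G_def i)
  qed
  have Gin: "G \<in> efunctors B E' E"
  proof (rule efunctorsI)
    fix x y assume xy: "x \<in> EOb E'" "y \<in> EOb E'"
    show "snd G x y \<in> psh_hom B (EHom E' x y) (EHom E (fst G x) (fst G y))"
    proof (rule psh_homI)
      show "snd G x y b f \<in> pob (EHom E (fst G x) (fst G y)) b" if "b \<in> Ob B" "f \<in> pob (EHom E' x y) b" for b f
        using H[OF xy that] xy by (auto simp: G)
    next
      fix u f assume u: "u \<in> Ar B" "f \<in> pob (EHom E' x y) (Cod B u)"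
      obtain g where g: "g \<in> pob (EHom E (i x) (i y)) (Cod B u)" "f = snd F (i x) (i y) (Cod B u) g" "snd G x y (Cod B u) f = g"
        using H[OF xy categoryE(2)[OF B u(1)] u(2)] by blast
      have p: "pmap (EHom E (i x) (i y)) u g \<in> pob (EHom E (i x) (i y)) (Dom B u)"
        using presheafE(1)[OF enriched_categoryE(1)[OF E i(1)[OF xy(1)] i(1)[OF xy(2)]] u(1) g(1)] .
      have e: "pmap (EHom E' x y) u f = snd F (i x) (i y) (Dom B u) (pmap (EHom E (i x) (i y)) u g)"
        using efunctorsE(2)[OF F i(1)[OF xy(1)] i(1)[OF xy(2)] u(1) g(1)] xy by (simp add: g(2) i)
      have "snd F (i x) (i y) (Dom B u) (pmap (EHom E (i x) (i y)) u g) \<in> pob (EHom E' x y) (Dom B u)"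
        using efunctorsE(1)[OF F i(1)[OF xy(1)] i(1)[OF xy(2)] _ p] xy categoryE(1)[OF B u(1)] by (simp add: i)
      then have "snd G x y (Dom B u) (pmap (EHom E' x y) u f) = pmap (EHom E (i x) (i y)) u g"
        unfolding e using HF[OF i(1)[OF xy(1)] i(1)[OF xy(2)] categoryE(1)[OF B u(1)] p] xy categoryE(1)[OF B u(1)]
        by (simp add: G_def)
      then show "snd G x y (Dom B u) (pmap (EHom E' x y) u f) = pmap (EHom E (fst G x) (fst G y)) u (snd G x y (Cod B u) f)"
        using xy g(3) by (simp add: G)
    qed (use xy in \<open>simp_all add: G_def\<close>)
  next
    fix x b assume xb: "x \<in> EOb E'" "b \<in> Ob B"
    have I: "EId E (i x) b \<in> pob (EHom E (i x) (i x)) b" using enriched_categoryE(2)[OF E] xb i by simp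
    have "EId E' x b = snd F (i x) (i x) b (EId E (i x) b)" using efunctorsD(3)[OF F] xb i by simp
    moreover have "EId E' x b \<in> pob (EHom E' x x) b"
      using efunctorsE(1)[OF F i(1)[OF xb(1)] i(1)[OF xb(1)] xb(2) I] xb i calculation by simp
    ultimately show "snd G x x b (EId E' x b) = EId E (fst G x) b"
      using HF[OF i(1)[OF xb(1)] i(1)[OF xb(1)] xb(2) I] xb by (simp add: G_def)
  next
    fix x y z b f g assume xyz: "x \<in> EOb E'" "y \<in> EOb E'" "z \<in> EOb E'" and b: "b \<in> Ob B"
      and f: "f \<in> pob (EHom E' x y) b" and g: "g \<in> pob (EHom E' y z) b"
    obtain f' where f': "f' \<in> pob (EHom E (i x) (i y)) b" "f = snd F (i x) (i y) b f'" "snd G x y b f = f'"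
      using H[OF xyz(1,2) b f] by blast
    obtain g' where g': "g' \<in> pob (EHom E (i y) (i z)) b" "g = snd F (i y) (i z) b g'" "snd G y z b g = g'"
      using H[OF xyz(2,3) b g] by blast
    have c: "EComp E (i x) (i y) (i z) b f' g' \<in> pob (EHom E (i x) (i z)) b"
      using enriched_categoryE(3)[OF E _ _ _ b f'(1) g'(1)] xyz i by simp
    have "EComp E' x y z b f g = snd F (i x) (i z) b (EComp E (i x) (i y) (i z) b f' g')"
      using efunctorsD(4)[OF F _ _ _ b f'(1) g'(1)] xyz i f' g' by simp
    moreover have "snd F (i x) (i z) b (EComp E (i x) (i y) (i z) b f' g') \<in> pob (EHom E' x z) b"
      using efunctorsE(1)[OF F _ _ b c] xyz i by simp
    ultimately show "snd G x z b (EComp E' x y z b f g) = EComp E (fst G x) (fst G y) (fst G z) b (snd G x y b f) (snd G y z b g)"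
      using HF[OF _ _ b c] xyz b i f'(3) g'(3) by (simp add: G_def)
  qed (simp_all add: G_def i)
  have "efun_comp B E G F = efun_id B E"
  proof (rule efunctors_eqI[OF efun_comp_in[OF B E F Gin] efun_id_in[OF B E]])
    fix x y b f assume "x \<in> EOb E" "y \<in> EOb E" "b \<in> Ob B" "f \<in> pob (EHom E x y) b"
    then show "snd (efun_comp B E G F) x y b f = snd (efun_id B E) x y b f"
      using HF[of x y b f] by (simp add: efun_comp_simps efun_id_simps psh_id_apply G_def iF efunctorsD(1)[OF F] efunctorsE(1)[OF F])
  qed (simp add: efun_comp_simps efun_id_simps G iF efunctorsD(1)[OF F])
  moreover have "efun_comp B E' F G = efun_id B E'"
  proof (rule efun_eqI[where E = E' and B = B])
    fix x y b f assume *: "x \<in> EOb E'" "y \<in> EOb E'" "b \<in> Ob B" "f \<in> pob (EHom E' x y) b"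
    then show "snd (efun_comp B E' F G) x y b f = snd (efun_id B E') x y b f"
      using H[OF *] by (auto simp: efun_comp_simps efun_id_simps psh_id_apply G)
  qed (simp_all add: efun_comp_simps efun_comp_ext efun_id_simps psh_id_simps G i)
  ultimately show ?thesis unfolding enriched_iso_def using F Gin by blast
qed

text \<open>Transport of structure: arrow assignments that are conjugate to a functor by isomorphisms
  at every object automatically respect sources, targets, identities and composition.\<close>

lemma naturally_isomorphic_transport:
  assumes B: "category B" and G: "is_functor A (ecat_cat B) G"
    and E: "\<And>a. a \<in> Ob A \<Longrightarrow> enriched_category B (Fo a)"
    and iso: "\<And>a. a \<in> Ob A \<Longrightarrow> enriched_iso B (fst G a) (Fo a) (P a)"
    and Fa: "\<And>u. u \<in> Ar A \<Longrightarrow> Fa u = (Fo (Dom A u), f u, Fo (Cod A u))"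
    and ext: "\<And>u. u \<in> Ar A \<Longrightarrow> efun_comp B (Fo (Dom A u)) (f u) (efun_id B (Fo (Dom A u))) = f u"
    and square: "\<And>u. u \<in> Ar A \<Longrightarrow> efun_comp B (fst G (Dom A u)) (f u) (P (Dom A u)) =
      efun_comp B (fst G (Dom A u)) (P (Cod A u)) (fst (snd (snd G u)))"
  shows "naturally_isomorphic B A (Fo, Fa) G"
proof -
  define g where "g u = fst (snd (snd G u))" for u
  have A: "category A" using G by (simp add: is_functor_def)
  note c = categoryE[OF A]
  have P: "P a \<in> efunctors B (fst G a) (Fo a)" if "a \<in> Ob A" for a
    using iso[OF that] by (simp add: enriched_iso_def)
  have "\<forall>a\<in>Ob A. \<exists>Q. Q \<in> efunctors B (Fo a) (fst G a) \<and>
     efun_comp B (fst G a) Q (P a) = efun_id B (fst G a) \<and> efun_comp B (Fo a) (P a) Q = efun_id B (Fo a)"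
    using iso unfolding enriched_iso_def by blast
  then obtain Q where Q: "Q a \<in> efunctors B (Fo a) (fst G a)"
    and QP: "efun_comp B (fst G a) (Q a) (P a) = efun_id B (fst G a)"
    and PQ: "efun_comp B (Fo a) (P a) (Q a) = efun_id B (Fo a)" if "a \<in> Ob A" for a
    by metis
  have GE: "enriched_category B (fst G a)" if "a \<in> Ob A" for a
    using G that by (simp add: is_functor_def ecat_cat_def)
  have Gu: "snd G u = (fst G (Dom A u), g u, fst G (Cod A u)) \<and> g u \<in> efunctors B (fst G (Dom A u)) (fst G (Cod A u))"
    if "u \<in> Ar A" for u
    using G that by (cases "snd G u") (force simp: is_functor_def ecat_cat_def g_def)
  have g: "g u \<in> efunctors B (fst G (Dom A u)) (fst G (Cod A u))" if "u \<in> Ar A" for u using Gu[OF that] by simp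
  have gid: "g (Idn A a) = efun_id B (fst G a)" if "a \<in> Ob A" for a
    using G that by (simp add: is_functor_def ecat_cat_def g_def)
  have gcomp: "g (Cmp A v u) = efun_comp B (fst G (Dom A u)) (g v) (g u)"
    if "u \<in> Ar A" "v \<in> Ar A" "Cod A u = Dom A v" for u v
  proof -
    have "snd G (Cmp A v u) = Cmp (ecat_cat B) (snd G v) (snd G u)" using G that by (simp add: is_functor_def)
    then show ?thesis using Gu[OF that(1)] Gu[OF that(2)] Gu[OF c(6)[OF that]] by (simp add: ecat_cat_def)
  qed
  note assoc = efun_comp_assoc and into = efun_comp_in[OF B]
  \<comment> \<open>Conjugation by the isomorphisms recovers \<open>f\<close> from the functor, so its laws follow from those of \<open>g\<close>.\<close>
  have f: "f u = efun_comp B (Fo (Dom A u)) (P (Cod A u)) (efun_comp B (Fo (Dom A u)) (g u) (Q (Dom A u)))"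
    if u: "u \<in> Ar A" for u
  proof -
    note a = c(1)[OF u]
    have "f u = efun_comp B (Fo (Dom A u)) (f u) (efun_comp B (Fo (Dom A u)) (P (Dom A u)) (Q (Dom A u)))"
      using ext[OF u] PQ[OF a] by simp
    also have "\<dots> = efun_comp B (Fo (Dom A u)) (efun_comp B (fst G (Dom A u)) (P (Cod A u)) (g u)) (Q (Dom A u))"
      by (simp only: assoc[OF Q[OF a]] square[OF u] g_def)
    finally show ?thesis by (simp only: assoc[OF Q[OF a]])
  qed
  have fin: "f u \<in> efunctors B (Fo (Dom A u)) (Fo (Cod A u))" if u: "u \<in> Ar A" for u
    unfolding f[OF u]
    by (rule into[OF E[OF c(1)[OF u]] into[OF E[OF c(1)[OF u]] Q[OF c(1)[OF u]] g[OF u]] P[OF c(2)[OF u]]])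
  have fid: "f (Idn A a) = efun_id B (Fo a)" if a: "a \<in> Ob A" for a
    using f[OF c(3)[OF a]] efun_comp_id(2)[OF E[OF a] Q[OF a]] a by (simp add: c gid PQ)
  have fcomp: "f (Cmp A v u) = efun_comp B (Fo (Dom A u)) (f v) (f u)"
    if u: "u \<in> Ar A" and v: "v \<in> Ar A" and uv: "Cod A u = Dom A v" for u v
  proof -
    let ?a = "Dom A u" and ?b = "Dom A v" and ?c = "Cod A v"
    have a: "?a \<in> Ob A" "?b \<in> Ob A" "?c \<in> Ob A" using c u v by simp_all
    define w where "w = efun_comp B (Fo ?a) (g u) (Q ?a)"
    have w: "w \<in> efunctors B (Fo ?a) (fst G ?b)"
      unfolding w_def using into[OF E[OF a(1)] Q[OF a(1)] g[OF u]] uv by simp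
    have Pw: "efun_comp B (Fo ?a) (P ?b) w \<in> efunctors B (Fo ?a) (Fo ?b)"
      using into[OF E[OF a(1)] w P[OF a(2)]] .
    have "efun_comp B (Fo ?a) (f v) (f u) =
       efun_comp B (Fo ?a) (P ?c) (efun_comp B (Fo ?a) (efun_comp B (Fo ?b) (g v) (Q ?b)) (efun_comp B (Fo ?a) (P ?b) w))"
      unfolding f[OF v] f[OF u] uv w_def[symmetric] by (rule assoc[OF Pw, symmetric])
    also have "efun_comp B (Fo ?a) (efun_comp B (Fo ?b) (g v) (Q ?b)) (efun_comp B (Fo ?a) (P ?b) w)
      = efun_comp B (Fo ?a) (g v) (efun_comp B (Fo ?a) (efun_comp B (fst G ?b) (Q ?b) (P ?b)) w)"
      by (simp only: assoc[OF Pw, symmetric] assoc[OF w] assoc[OF P[OF a(2)]])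
    also have "\<dots> = efun_comp B (Fo ?a) (g (Cmp A v u)) (Q ?a)"
      unfolding QP[OF a(2)] efun_comp_id(2)[OF E[OF a(1)] w] gcomp[OF u v uv]
      by (simp only: w_def assoc[OF Q[OF a(1)]])
    finally show ?thesis
      using f[OF c(6)[OF u v uv]] by (simp add: c(7,8)[OF u v uv])
  qed
  have "is_functor A (ecat_cat B) (Fo, Fa)"
    unfolding is_functor_def
    using A ecat_cat_category[OF B] E fin fid fcomp by (simp add: Fa c ecat_cat_def)
  moreover have "\<exists>\<Phi>. (\<forall>a\<in>Ob A. enriched_iso B (Fo a) (fst G a) (\<Phi> a)) \<and>
     (\<forall>u\<in>Ar A. efun_comp B (Fo (Dom A u)) (\<Phi> (Cod A u)) (fst (snd (Fa u))) =
             efun_comp B (Fo (Dom A u)) (fst (snd (snd G u))) (\<Phi> (Dom A u)))"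
  proof (intro exI[of _ Q] conjI ballI)
    fix a assume a: "a \<in> Ob A"
    show "enriched_iso B (Fo a) (fst G a) (Q a)"
      unfolding enriched_iso_def using Q[OF a] P[OF a] PQ[OF a] QP[OF a] by blast
  next
    fix u assume u: "u \<in> Ar A"
    define w where "w = efun_comp B (Fo (Dom A u)) (g u) (Q (Dom A u))"
    have w: "w \<in> efunctors B (Fo (Dom A u)) (fst G (Cod A u))"
      unfolding w_def by (rule into[OF E[OF c(1)[OF u]] Q[OF c(1)[OF u]] g[OF u]])
    show "efun_comp B (Fo (Dom A u)) (Q (Cod A u)) (fst (snd (Fa u))) =
             efun_comp B (Fo (Dom A u)) (fst (snd (snd G u))) (Q (Dom A u))"
      using efun_comp_id(2)[OF E[OF c(1)[OF u]] w]
      by (simp add: Fa[OF u] f[OF u] g_def[symmetric] w_def[symmetric] assoc[OF w] QP[OF c(2)[OF u]])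
  qed
  ultimately show ?thesis unfolding naturally_isomorphic_def using G by simp
qed

section \<open>The wreath product\<close>

lemma pred_le [simp]: "(i::nat) \<le> n \<Longrightarrow> i - Suc 0 \<le> n"
  by simp

text \<open>The half-open intervals between consecutive values of a monotone map partition its range
  of values; \<^const>\<open>block\<close> locates the part that contains a given point.\<close>

lemma block_eqI:
  assumes g: "\<gamma> \<in> delta_hom n m" and i: "1 \<le> i" "i \<le> n" and l: "\<gamma> (i - 1) < l" "l \<le> \<gamma> i"
  shows "block n \<gamma> l = i"
  unfolding block_def
proof (rule the_equality)
  show "i \<in> {1..n} \<and> \<gamma> (i - 1) < l \<and> l \<le> \<gamma> i" using assms by simp
next
  fix i' assume i': "i' \<in> {1..n} \<and> \<gamma> (i' - 1) < l \<and> l \<le> \<gamma> i'"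
  have "\<not> i' \<le> i - 1" using delta_homD(2)[OF g, of i' "i - 1"] i i' l by force
  moreover have "\<not> i \<le> i' - 1" using delta_homD(2)[OF g, of i "i' - 1"] i i' l by force
  ultimately show "i' = i" by simp
qed

lemma block:
  assumes g: "\<gamma> \<in> delta_hom n m" and l: "\<gamma> a < l" "l \<le> \<gamma> b" and a: "a \<le> n" and b: "b \<le> n"
  shows "a < block n \<gamma> l" "block n \<gamma> l \<le> b" "1 \<le> block n \<gamma> l" "block n \<gamma> l \<le> n"
    "\<gamma> (block n \<gamma> l - 1) < l" "l \<le> \<gamma> (block n \<gamma> l)"
proof -
  define i where "i = (LEAST i. l \<le> \<gamma> i)"
  have i: "l \<le> \<gamma> i" "i \<le> b" unfolding i_def using l(2) by (rule LeastI, rule Least_le)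
  have ai: "a < i" using delta_homD(2)[OF g, of i a] i l a by (metis leD leI le_trans)
  have "\<not> l \<le> \<gamma> (i - 1)" unfolding i_def using ai i_def not_less_Least[of "i - 1" "\<lambda>i. l \<le> \<gamma> i"] by auto
  then have *: "\<gamma> (i - 1) < l" by simp
  have "block n \<gamma> l = i" using block_eqI[OF g _ _ * i(1)] ai i(2) b by simp
  then show "a < block n \<gamma> l" "block n \<gamma> l \<le> b" "1 \<le> block n \<gamma> l" "block n \<gamma> l \<le> n"
    "\<gamma> (block n \<gamma> l - 1) < l" "l \<le> \<gamma> (block n \<gamma> l)"
    using ai i b * by simp_all
qed

lemma block_id:
  assumes "1 \<le> i" "i \<le> n" shows "block n (\<lambda>i\<in>{..n}. i) i = i"
  by (rule block_eqI[OF delta_hom_id]) (use assms in simp_all)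

lemma block_compose:
  assumes g: "\<gamma> \<in> delta_hom n m" and d: "\<delta> \<in> delta_hom m k"
    and l: "\<delta> (\<gamma> a) < l" "l \<le> \<delta> (\<gamma> b)" and a: "a \<le> n" "b \<le> n"
  shows "block n (compose {..n} \<delta> \<gamma>) l = block n \<gamma> (block m \<delta> l)"
proof -
  note b = block[OF d l delta_homD(1)[OF g a(1)] delta_homD(1)[OF g a(2)]]
  note b' = block[OF g b(1,2) a]
  have "\<delta> (\<gamma> (block n \<gamma> (block m \<delta> l) - 1)) \<le> \<delta> (block m \<delta> l - 1)"
    using b'(3,4,5) b(3,4) by (intro delta_homD(2)[OF d]) auto
  moreover have "\<delta> (block m \<delta> l) \<le> \<delta> (\<gamma> (block n \<gamma> (block m \<delta> l)))"
    using b'(6) delta_homD(1)[OF g b'(4)] by (intro delta_homD(2)[OF d])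
  ultimately show ?thesis
    using b(5,6) b'(3,4) by (intro block_eqI[OF delta_hom_compose[OF g d]]) (auto simp: compose_def)
qed

text \<open>Maps into a finite product are given by their coordinates. The rules below describe morphisms
  of the wreath product by the coordinate \<open>l\<close> of the component \<open>i\<close>, where \<open>l\<close> lies in the part of
  index \<open>i\<close>; the composition formula is then evaluated one coordinate at a time.\<close>

lemma wreath_homD:
  assumes "\<phi> \<in> wreath_hom C (n, X) (m, Y)"
  shows "fst \<phi> \<in> delta_hom n m" "snd \<phi> \<in> extensional {1..n}"
    and "1 \<le> i \<Longrightarrow> i \<le> n \<Longrightarrow> snd \<phi> i \<in> psh_hom C (X i) (psh_prod {fst \<phi> (i - 1)<..fst \<phi> i} Y)"
  using assms by (auto simp: wreath_hom_def PiE_iff)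

lemma wreath_homE:
  assumes "\<phi> \<in> wreath_hom C (n, X) (m, Y)" and i: "1 \<le> i" "i \<le> n"
  shows "snd \<phi> i \<in> extensional (Ob C)" 
    and "c \<in> Ob C \<Longrightarrow> snd \<phi> i c \<in> extensional (pob (X i) c)"
    and "c \<in> Ob C \<Longrightarrow> x \<in> pob (X i) c \<Longrightarrow> snd \<phi> i c x \<in> extensional {fst \<phi> (i - 1)<..fst \<phi> i}"
    and "c \<in> Ob C \<Longrightarrow> x \<in> pob (X i) c \<Longrightarrow> fst \<phi> (i - 1) < l \<Longrightarrow> l \<le> fst \<phi> i \<Longrightarrow> snd \<phi> i c x l \<in> pob (Y l) c"
    and "u \<in> Ar C \<Longrightarrow> x \<in> pob (X i) (Cod C u) \<Longrightarrow> fst \<phi> (i - 1) < l \<Longrightarrow> l \<le> fst \<phi> i \<Longrightarrow>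
      snd \<phi> i (Dom C u) (pmap (X i) u x) l = pmap (Y l) u (snd \<phi> i (Cod C u) x l)"
proof -
  note h = wreath_homD(3)[OF assms]
  show "snd \<phi> i \<in> extensional (Ob C)" "c \<in> Ob C \<Longrightarrow> snd \<phi> i c \<in> extensional (pob (X i) c)"
    using psh_homE(3,4)[OF h] .
  show "c \<in> Ob C \<Longrightarrow> x \<in> pob (X i) c \<Longrightarrow> snd \<phi> i c x \<in> extensional {fst \<phi> (i - 1)<..fst \<phi> i}"
    "c \<in> Ob C \<Longrightarrow> x \<in> pob (X i) c \<Longrightarrow> fst \<phi> (i - 1) < l \<Longrightarrow> l \<le> fst \<phi> i \<Longrightarrow> snd \<phi> i c x l \<in> pob (Y l) c"
    using psh_homE(1)[OF h, of c x] by (auto simp: psh_prod_def PiE_iff)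
  show "u \<in> Ar C \<Longrightarrow> x \<in> pob (X i) (Cod C u) \<Longrightarrow> fst \<phi> (i - 1) < l \<Longrightarrow> l \<le> fst \<phi> i \<Longrightarrow>
      snd \<phi> i (Dom C u) (pmap (X i) u x) l = pmap (Y l) u (snd \<phi> i (Cod C u) x l)"
    using psh_homE(2)[OF h, of u x] by (simp add: psh_prod_def)
qed

lemma wreath_homI:
  assumes C: "category C" and X: "\<And>i. 1 \<le> i \<Longrightarrow> i \<le> n \<Longrightarrow> presheaf C (X i)"
    and "fst \<phi> \<in> delta_hom n m" "snd \<phi> \<in> extensional {1..n}"
    and "\<And>i. 1 \<le> i \<Longrightarrow> i \<le> n \<Longrightarrow> snd \<phi> i \<in> extensional (Ob C)"
    and "\<And>i c. 1 \<le> i \<Longrightarrow> i \<le> n \<Longrightarrow> c \<in> Ob C \<Longrightarrow> snd \<phi> i c \<in> extensional (pob (X i) c)"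
    and e: "\<And>i c x. 1 \<le> i \<Longrightarrow> i \<le> n \<Longrightarrow> c \<in> Ob C \<Longrightarrow> x \<in> pob (X i) c \<Longrightarrow>
      snd \<phi> i c x \<in> extensional {fst \<phi> (i - 1)<..fst \<phi> i}"
    and v: "\<And>i c x l. 1 \<le> i \<Longrightarrow> i \<le> n \<Longrightarrow> c \<in> Ob C \<Longrightarrow> x \<in> pob (X i) c \<Longrightarrow> fst \<phi> (i - 1) < l \<Longrightarrow> l \<le> fst \<phi> i \<Longrightarrow>
      snd \<phi> i c x l \<in> pob (Y l) c"
    and nat: "\<And>i u x l. 1 \<le> i \<Longrightarrow> i \<le> n \<Longrightarrow> u \<in> Ar C \<Longrightarrow> x \<in> pob (X i) (Cod C u) \<Longrightarrow> fst \<phi> (i - 1) < l \<Longrightarrow> l \<le> fst \<phi> i \<Longrightarrow>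
      snd \<phi> i (Dom C u) (pmap (X i) u x) l = pmap (Y l) u (snd \<phi> i (Cod C u) x l)"
  shows "\<phi> \<in> wreath_hom C (n, X) (m, Y)"
proof -
  have "snd \<phi> i \<in> psh_hom C (X i) (psh_prod {fst \<phi> (i - 1)<..fst \<phi> i} Y)" if i: "1 \<le> i" "i \<le> n" for i
  proof (rule psh_homI)
    fix u x assume u: "u \<in> Ar C" and x: "x \<in> pob (X i) (Cod C u)"
    show "snd \<phi> i (Dom C u) (pmap (X i) u x) = pmap (psh_prod {fst \<phi> (i - 1)<..fst \<phi> i} Y) u (snd \<phi> i (Cod C u) x)"
      by (rule extensionalityI[OF e[OF i categoryE(1)[OF C u] presheafE(1)[OF X[OF i] u x]]])
        (simp_all add: psh_prod_def nat[OF i u x, simplified])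
  qed (use assms i in \<open>simp_all add: psh_prod_def PiE_iff\<close>)
  then show ?thesis using assms(3,4) by (cases \<phi>) (simp add: wreath_hom_def PiE_iff)
qed

lemma wreath_hom_eqI:
  assumes p: "\<phi> \<in> wreath_hom C (n, X) (m, Y)" and q: "\<psi> \<in> wreath_hom C (n, X) (m, Y)"
    and 1: "\<And>i. i \<le> n \<Longrightarrow> fst \<phi> i = fst \<psi> i"
    and 2: "\<And>i c x l. 1 \<le> i \<Longrightarrow> i \<le> n \<Longrightarrow> c \<in> Ob C \<Longrightarrow> x \<in> pob (X i) c \<Longrightarrow>
      fst \<phi> (i - 1) < l \<Longrightarrow> l \<le> fst \<phi> i \<Longrightarrow> snd \<phi> i c x l = snd \<psi> i c x l"
  shows "\<phi> = \<psi>"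
proof (rule prod_eqI)
  show e: "fst \<phi> = fst \<psi>"
    using delta_homD(4)[OF wreath_homD(1)[OF p]] delta_homD(4)[OF wreath_homD(1)[OF q]] 1 
    by (rule extensionalityI) simp
  show "snd \<phi> = snd \<psi>"
  proof (rule extensionalityI[OF wreath_homD(2)[OF p] wreath_homD(2)[OF q]])
    fix i assume "i \<in> {1..n}"
    then have i: "1 \<le> i" "i \<le> n" by simp_all
    show "snd \<phi> i = snd \<psi> i"
    proof (rule family_eqI[where A = "Ob C" and X = "pob (X i)"])
      fix c x assume cx: "c \<in> Ob C" "x \<in> pob (X i) c"
      show "snd \<phi> i c x = snd \<psi> i c x"
        by (rule extensionalityI[OF wreath_homE(3)[OF p i cx] wreath_homE(3)[OF q i cx, folded e]])
          (use 2[OF i cx] in simp)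
    qed (simp_all add: wreath_homE[OF p i] wreath_homE[OF q i])
  qed
qed

lemma wreath_comp_simps:
  "fst (wreath_comp C (n, X) (m, Y) \<psi> \<phi>) = compose {..n} (fst \<psi>) (fst \<phi>)"
  "snd (wreath_comp C (n, X) (m, Y) \<psi> \<phi>) = (\<lambda>i\<in>{1..n}. \<lambda>c\<in>Ob C. \<lambda>x\<in>pob (X i) c.
     \<lambda>l\<in>{fst \<psi> (fst \<phi> (i - 1))<..fst \<psi> (fst \<phi> i)}.
        snd \<psi> (block m (fst \<psi>) l) c (snd \<phi> i c x (block m (fst \<psi>) l)) l)"
  by (simp_all add: wreath_comp_def split: prod.splits)

lemma wreath_comp_eval:
  assumes "1 \<le> i" "i \<le> n" "c \<in> Ob C" "x \<in> pob (X i) c"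
    "fst \<psi> (fst \<phi> (i - 1)) < l" "l \<le> fst \<psi> (fst \<phi> i)"
  shows "snd (wreath_comp C (n, X) (m, Y) \<psi> \<phi>) i c x l =
    snd \<psi> (block m (fst \<psi>) l) c (snd \<phi> i c x (block m (fst \<psi>) l)) l"
  using assms by (simp add: wreath_comp_simps)

text \<open>The objects involved may take values in different types. This is what makes the laws of
  the wreath product applicable to the action of cells, whose values are arrows, on arbitrary objects.\<close>

lemma wreath_comp_in:
  assumes C: "category C" and X: "\<And>i. 1 \<le> i \<Longrightarrow> i \<le> n \<Longrightarrow> presheaf C (X i)"
    and p: "\<phi> \<in> wreath_hom C (n, X) (m, Y)" and q: "\<psi> \<in> wreath_hom C (m, Y) (k, Z)"
  shows "wreath_comp C (n, X) (m, Y) \<psi> \<phi> \<in> wreath_hom C (n, X) (k, Z)"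
proof -
  let ?W = "wreath_comp C (n, X) (m, Y) \<psi> \<phi>"
  let ?b = "block m (fst \<psi>)"
  have b: "1 \<le> ?b l" "?b l \<le> m" "fst \<psi> (?b l - 1) < l" "l \<le> fst \<psi> (?b l)"
    "fst \<phi> (i - 1) < ?b l" "?b l \<le> fst \<phi> i"
    if "1 \<le> i" "i \<le> n" "fst \<psi> (fst \<phi> (i - 1)) < l" "l \<le> fst \<psi> (fst \<phi> i)" for i l
    using block[OF wreath_homD(1)[OF q] that(3,4)] delta_homD(1)[OF wreath_homD(1)[OF p]] that by auto
  note D = wreath_homD(1)[OF p] wreath_homD(1)[OF q]
  show ?thesis
  proof (rule wreath_homI[OF C X])
    show "fst ?W \<in> delta_hom n k"
      using delta_hom_compose[OF D] by (simp add: wreath_comp_simps)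
  next
    fix i c x l assume i: "1 \<le> i" "i \<le> n" and c: "c \<in> Ob C" "x \<in> pob (X i) c"
      "fst ?W (i - 1) < l" "l \<le> fst ?W i"
    then have l: "fst \<psi> (fst \<phi> (i - 1)) < l" "l \<le> fst \<psi> (fst \<phi> i)" by (simp_all add: wreath_comp_simps compose_def)
    show "snd ?W i c x l \<in> pob (Z l) c"
      unfolding wreath_comp_eval[where X = X and \<phi> = \<phi> and \<psi> = \<psi>, OF i c(1,2) l]
      by (rule wreath_homE(4)[OF q b(1,2)[OF i l] c(1) wreath_homE(4)[OF p i c(1,2) b(5,6)[OF i l]] b(3,4)[OF i l]])
  next
    fix i u x l assume i: "1 \<le> i" "i \<le> n" and u: "u \<in> Ar C" and x: "x \<in> pob (X i) (Cod C u)" and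
      "fst ?W (i - 1) < l" "l \<le> fst ?W i"
    then have l: "fst \<psi> (fst \<phi> (i - 1)) < l" "l \<le> fst \<psi> (fst \<phi> i)" by (simp_all add: wreath_comp_simps compose_def)
    note c = categoryE(1,2)[OF C u] and p' = wreath_homE(5)[OF p i u x b(5,6)[OF i l]]
    note v = wreath_homE(4)[OF p i c(2) x b(5,6)[OF i l]]
    show "snd ?W i (Dom C u) (pmap (X i) u x) l =
       pmap (Z l) u (snd ?W i (Cod C u) x l)"
      unfolding wreath_comp_eval[where X = X and \<phi> = \<phi> and \<psi> = \<psi>, OF i c(1) presheafE(1)[OF X[OF i] u x] l]
        wreath_comp_eval[where X = X and \<phi> = \<phi> and \<psi> = \<psi>, OF i c(2) x l] p'
      by (rule wreath_homE(5)[OF q b(1,2)[OF i l] u v b(3,4)[OF i l]])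
  qed (simp_all add: wreath_comp_simps compose_def)
qed

lemma wreath_comp_assoc:
  assumes C: "category C" and X: "\<And>i. 1 \<le> i \<Longrightarrow> i \<le> n \<Longrightarrow> presheaf C (X i)"
    and Y: "\<And>i. 1 \<le> i \<Longrightarrow> i \<le> m \<Longrightarrow> presheaf C (Y i)"
    and p: "\<phi> \<in> wreath_hom C (n, X) (m, Y)" and q: "\<psi> \<in> wreath_hom C (m, Y) (k, Z)"
    and r: "\<chi> \<in> wreath_hom C (k, Z) (j, W)"
  shows "wreath_comp C (n, X) (k, Z) \<chi> (wreath_comp C (n, X) (m, Y) \<psi> \<phi>) =
    wreath_comp C (n, X) (m, Y) (wreath_comp C (m, Y) (k, Z) \<chi> \<psi>) \<phi>" (is "?L = ?R")
proof -
  note pq = wreath_comp_in[OF C X p q] and qr = wreath_comp_in[OF C Y q r]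
  note D = wreath_homD(1)[OF p] wreath_homD(1)[OF q] wreath_homD(1)[OF r]
  show ?thesis
  proof (rule wreath_hom_eqI[OF wreath_comp_in[OF C X pq r] wreath_comp_in[OF C X p qr]])
    show "fst ?L i = fst ?R i" if "i \<le> n" for i
      using that delta_homD(1)[OF D(1) that] by (simp add: wreath_comp_simps compose_def)
  next
    fix i c x l assume i: "1 \<le> i" "i \<le> n" and cx: "c \<in> Ob C" "x \<in> pob (X i) c"
      and "fst ?L (i - 1) < l" "l \<le> fst ?L i"
    then have l: "fst \<chi> (fst \<psi> (fst \<phi> (i - 1))) < l" "l \<le> fst \<chi> (fst \<psi> (fst \<phi> i))"
      by (simp_all add: wreath_comp_simps compose_def)
    have i': "i - 1 \<le> n" using i by simp
    note fi = delta_homD(1)[OF D(1) i'] delta_homD(1)[OF D(1) i(2)]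
    note b = block[OF D(3) l delta_homD(1)[OF D(2) fi(1)] delta_homD(1)[OF D(2) fi(2)]]
    let ?b = "block k (fst \<chi>) l"
    note b2 = block[OF D(2) b(1,2) fi]
    let ?b2 = "block m (fst \<psi>) ?b"
    note v = wreath_homE(4)[OF p i cx b2(1,2)]
    have bb: "block m (compose {..m} (fst \<chi>) (fst \<psi>)) l = ?b2"
      using block_compose[OF D(2,3) l fi] .
    have "snd ?L i c x l = snd \<chi> ?b c (snd (wreath_comp C (n, X) (m, Y) \<psi> \<phi>) i c x ?b) l"
      using l i' i by (intro wreath_comp_eval[where X = X, OF i cx]) (simp_all add: wreath_comp_simps compose_def)
    also have "\<dots> = snd \<chi> ?b c (snd \<psi> ?b2 c (snd \<phi> i c x ?b2) ?b) l"
      by (simp only: wreath_comp_eval[where X = X and \<phi> = \<phi> and \<psi> = \<psi>, OF i cx b(1,2)])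
    also have "\<dots> = snd (wreath_comp C (m, Y) (k, Z) \<chi> \<psi>) ?b2 c (snd \<phi> i c x ?b2) l"
    proof -
      have "fst \<chi> (fst \<psi> (?b2 - 1)) \<le> fst \<chi> (?b - 1)" using b2(5) b(3,4) by (intro delta_homD(2)[OF D(3)]) auto
      moreover have "fst \<chi> ?b \<le> fst \<chi> (fst \<psi> ?b2)" using b2(6) delta_homD(1)[OF D(2) b2(4)] by (intro delta_homD(2)[OF D(3)])
      ultimately show ?thesis
        using b(5,6) by (intro wreath_comp_eval[where X = Y, OF b2(3,4) cx(1) v, symmetric]) auto
    qed
    also have "\<dots> = snd ?R i c x l"
      using l fi by (subst wreath_comp_eval[where X = X, OF i cx]) (simp_all add: wreath_comp_simps(1) bb compose_def[of _ _ "fst \<psi>"] bb[unfolded compose_def])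
    finally show "snd ?L i c x l = snd ?R i c x l" .
  qed
qed

lemma wreath_id_simps:
  "fst (wreath_id C (n, X)) = (\<lambda>i\<in>{..n}. i)"
  "snd (wreath_id C (n, X)) = (\<lambda>i\<in>{1..n}. \<lambda>c\<in>Ob C. \<lambda>x\<in>pob (X i) c. \<lambda>j\<in>{i}. x)"
  by (simp_all add: wreath_id_def)

lemma wreath_id_in:
  assumes C: "category C" and X: "\<And>i. 1 \<le> i \<Longrightarrow> i \<le> n \<Longrightarrow> presheaf C (X i)"
  shows "wreath_id C (n, X) \<in> wreath_hom C (n, X) (n, X)" (is "?I \<in> _")
proof (rule wreath_homI[OF C X])
  fix i c x assume "1 \<le> i" "i \<le> n" "c \<in> Ob C" "x \<in> pob (X i) c"
  moreover have "{i - 1<..i} = {i}" if "1 \<le> i" using that by auto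
  ultimately show "snd ?I i c x \<in> extensional {fst ?I (i - 1)<..fst ?I i}"
    by (auto simp: wreath_id_simps)
next
  fix i c x l assume *: "1 \<le> i" "i \<le> n" "c \<in> Ob C" "x \<in> pob (X i) c"
     "fst ?I (i - 1) < l" "l \<le> fst ?I i"
  then have "l = i" by (simp add: wreath_id_simps)
  then show "snd ?I i c x l \<in> pob (X l) c" using * by (simp add: wreath_id_simps)
next
  fix i u x l assume *: "1 \<le> i" "i \<le> n" "u \<in> Ar C" "x \<in> pob (X i) (Cod C u)"
     "fst ?I (i - 1) < l" "l \<le> fst ?I i"
  then have "l = i" by (simp add: wreath_id_simps)
  then show "snd ?I i (Dom C u) (pmap (X i) u x) l = pmap (X l) u (snd ?I i (Cod C u) x l)" 
    using * categoryE(1,2)[OF C *(3)] presheafE(1)[OF X[OF *(1,2)] *(3,4)] by (simp add: wreath_id_simps)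
qed (simp_all add: wreath_id_simps delta_hom_id[simplified])

lemma wreath_comp_id_left:
  assumes C: "category C" and X: "\<And>i. 1 \<le> i \<Longrightarrow> i \<le> n \<Longrightarrow> presheaf C (X i)"
    and Y: "\<And>i. 1 \<le> i \<Longrightarrow> i \<le> m \<Longrightarrow> presheaf C (Y i)"
    and p: "\<phi> \<in> wreath_hom C (n, X) (m, Y)"
  shows "wreath_comp C (n, X) (m, Y) (wreath_id C (m, Y)) \<phi> = \<phi>" (is "?L = _")
proof (rule wreath_hom_eqI[OF wreath_comp_in[OF C X p wreath_id_in[OF C Y]] p])
  note d = delta_homD(1)[OF wreath_homD(1)[OF p]]
  show "fst ?L i = fst \<phi> i" if "i \<le> n" for i
    using that d[OF that] by (simp add: wreath_comp_simps wreath_id_simps compose_def)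
  fix i c x l assume i: "1 \<le> i" "i \<le> n" and cx: "c \<in> Ob C" "x \<in> pob (X i) c" and "fst ?L (i - 1) < l" "l \<le> fst ?L i"
  then have l: "fst \<phi> (i - 1) < l" "l \<le> fst \<phi> i" using d[of i] d[of "i - 1"]
    by (simp_all add: wreath_comp_simps wreath_id_simps compose_def)
  then have lm: "1 \<le> l" "l \<le> m" using d[of i] i by auto
  have "block m (fst (wreath_id C (m, Y))) l = l" using block_id[OF lm] by (simp add: wreath_id_simps)
  then show "snd ?L i c x l = snd \<phi> i c x l"
    using l lm wreath_homE(4)[OF p i cx l] i d[of i] d[of "i - 1"] cx
    by (subst wreath_comp_eval[where X = X, OF i cx]) (simp_all add: wreath_id_simps)
qed

lemma wreath_comp_id_right:
  assumes C: "category C" and X: "\<And>i. 1 \<le> i \<Longrightarrow> i \<le> n \<Longrightarrow> presheaf C (X i)"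
    and p: "\<phi> \<in> wreath_hom C (n, X) (m, Y)"
  shows "wreath_comp C (n, X) (n, X) \<phi> (wreath_id C (n, X)) = \<phi>" (is "?L = _")
proof (rule wreath_hom_eqI[OF wreath_comp_in[OF C X wreath_id_in[OF C X] p] p])
  show "fst ?L i = fst \<phi> i" if "i \<le> n" for i
    using that by (simp add: wreath_comp_simps wreath_id_simps compose_def)
  fix i c x l assume i: "1 \<le> i" "i \<le> n" and cx: "c \<in> Ob C" "x \<in> pob (X i) c" and "fst ?L (i - 1) < l" "l \<le> fst ?L i"
  then have l: "fst \<phi> (i - 1) < l" "l \<le> fst \<phi> i"
    by (simp_all add: wreath_comp_simps wreath_id_simps compose_def)
  have "block n (fst \<phi>) l = i" using block_eqI[OF wreath_homD(1)[OF p] i l] .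
  then show "snd ?L i c x l = snd \<phi> i c x l"
    using l i cx by (subst wreath_comp_eval[where X = X, OF i cx]) (simp_all add: wreath_id_simps)
qed

definition wreath_object :: "('o, 'a) cat \<Rightarrow> ('o, 'a, 's) wob \<Rightarrow> bool" where
  "wreath_object C T \<longleftrightarrow> (\<forall>i. 1 \<le> i \<longrightarrow> i \<le> fst T \<longrightarrow> presheaf C (snd T i))"

lemma wreath_laws:
  assumes C: "category C" and T: "wreath_object C T"
  shows "wreath_id C T \<in> wreath_hom C T T"
    and "\<phi> \<in> wreath_hom C T U \<Longrightarrow> \<psi> \<in> wreath_hom C U W \<Longrightarrow> wreath_comp C T U \<psi> \<phi> \<in> wreath_hom C T W"
    and "\<phi> \<in> wreath_hom C T U \<Longrightarrow> \<psi> \<in> wreath_hom C U W \<Longrightarrow> \<chi> \<in> wreath_hom C W Z \<Longrightarrow> wreath_object C U \<Longrightarrow>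
      wreath_comp C T W \<chi> (wreath_comp C T U \<psi> \<phi>) = wreath_comp C T U (wreath_comp C U W \<chi> \<psi>) \<phi>"
    and "\<phi> \<in> wreath_hom C T U \<Longrightarrow> wreath_comp C T T \<phi> (wreath_id C T) = \<phi>"
    and "\<phi> \<in> wreath_hom C T U \<Longrightarrow> wreath_object C U \<Longrightarrow> wreath_comp C T U (wreath_id C U) \<phi> = \<phi>"
proof -
  obtain n X where T': "T = (n, X)" "\<And>i. 1 \<le> i \<Longrightarrow> i \<le> n \<Longrightarrow> presheaf C (X i)"
    using T by (cases T) (simp add: wreath_object_def)
  show "wreath_id C T \<in> wreath_hom C T T" unfolding T'(1) by (rule wreath_id_in[OF C T'(2)])
  show "\<phi> \<in> wreath_hom C T U \<Longrightarrow> \<psi> \<in> wreath_hom C U W \<Longrightarrow> wreath_comp C T U \<psi> \<phi> \<in> wreath_hom C T W"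
    unfolding T'(1) by (cases U, cases W) (simp add: wreath_comp_in[OF C] T'(2))
  show "\<phi> \<in> wreath_hom C T U \<Longrightarrow> wreath_comp C T T \<phi> (wreath_id C T) = \<phi>"
    unfolding T'(1) by (cases U) (simp add: wreath_comp_id_right[OF C] T'(2))
  show "\<phi> \<in> wreath_hom C T U \<Longrightarrow> wreath_object C U \<Longrightarrow> wreath_comp C T U (wreath_id C U) \<phi> = \<phi>"
    unfolding T'(1) by (cases U) (simp add: wreath_comp_id_left[OF C] T'(2) wreath_object_def)
  show "\<phi> \<in> wreath_hom C T U \<Longrightarrow> \<psi> \<in> wreath_hom C U W \<Longrightarrow> \<chi> \<in> wreath_hom C W Z \<Longrightarrow> wreath_object C U \<Longrightarrow>
      wreath_comp C T W \<chi> (wreath_comp C T U \<psi> \<phi>) = wreath_comp C T U (wreath_comp C U W \<chi> \<psi>) \<phi>"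
    unfolding T'(1) by (cases U, cases W, cases Z) (simp add: wreath_comp_assoc[OF C] T'(2) wreath_object_def)
qed

lemma wreath_object_set:
  "{(n, X). X \<in> extensional {1..n} \<and> (\<forall>i\<in>{1..n}. presheaf C (X i))} =
     {T. snd T \<in> extensional {1..fst T} \<and> wreath_object C T}"
  by (auto simp: wreath_object_def)

lemma wreath_category:
  assumes C: "category C" shows "category (wreath C)"
  unfolding wreath_def wreath_object_set by (rule hom_cat_category; simp add: wreath_laws[OF C])

lemma wreath_simps [simp]:
  "T \<in> Ob (wreath C) \<longleftrightarrow> snd T \<in> extensional {1..fst T} \<and> wreath_object C T"
  "(T, \<phi>, U) \<in> Ar (wreath C) \<longleftrightarrow> T \<in> Ob (wreath C) \<and> U \<in> Ob (wreath C) \<and> \<phi> \<in> wreath_hom C T U"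
  "Dom (wreath C) (T, \<phi>, U) = T" "Cod (wreath C) (T, \<phi>, U) = U"
  "Idn (wreath C) T = (T, wreath_id C T, T)"
  "Cmp (wreath C) (U, \<psi>, W) (T, \<phi>, U') = (T, wreath_comp C T U \<psi> \<phi>, W)"
  by (auto simp: wreath_def wreath_object_def)

lemma cell_object:
  assumes "category C" shows "cell C n c \<in> Ob (wreath C)"
  using assms by (simp add: cell_def wreath_object_def yoneda_presheaf)

lemma Theta_category:
  assumes "category C" shows "category (Theta C)"
  unfolding Theta_def by (rule full_subcat_category[OF wreath_category[OF assms]]) (use cell_object[OF assms] in blast)

lemma Theta_object:
  "category C \<Longrightarrow> T \<in> Ob (Theta C) \<Longrightarrow> T \<in> Ob (wreath C) \<and> wreath_object C T"
  using cell_object by (fastforce simp: Theta_def)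

lemma Theta_simps [simp]:
  "Dom (Theta C) (T, \<phi>, U) = T" "Cod (Theta C) (T, \<phi>, U) = U"
  "Idn (Theta C) T = (T, wreath_id C T, T)"
  "Cmp (Theta C) (U, \<psi>, W) (T, \<phi>, U') = (T, wreath_comp C T U \<psi> \<phi>, W)"
  by (simp_all add: Theta_def)

lemma Theta_arrow:
  "category C \<Longrightarrow> (T, \<phi>, U) \<in> Ar (Theta C) \<longleftrightarrow> T \<in> Ob (Theta C) \<and> U \<in> Ob (Theta C) \<and> \<phi> \<in> wreath_hom C T U"
  using Theta_object[of C T] Theta_object[of C U] by (auto simp: Theta_def)

section \<open>The functor V\<close>

lemma V_ob_simps [simp]:
  "pob (V_ob C X) T = wreath_hom C T X" "pmap (V_ob C X) (T', u, T) v = wreath_comp C T' T v u"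
  by (simp_all add: V_ob_def)

lemma Theta_arrowE:
  assumes "category C" "u \<in> Ar (Theta C)"
  obtains T \<phi> U where "u = (T, \<phi>, U)" "T \<in> Ob (Theta C)" "U \<in> Ob (Theta C)" "\<phi> \<in> wreath_hom C T U"
    "wreath_object C T" "wreath_object C U"
proof -
  obtain T \<phi> U where u: "u = (T, \<phi>, U)" by (cases u)
  show ?thesis
    using that[OF u] assms(2) Theta_object[OF assms(1), of T] Theta_object[OF assms(1), of U]
    unfolding u Theta_arrow[OF assms(1)] by blast
qed

lemma V_ob_presheaf:
  assumes C: "category C" shows "presheaf (Theta C) (V_ob C X)"
  unfolding presheaf_def
proof (intro conjI ballI impI)
  fix u x assume "u \<in> Ar (Theta C)" and x: "x \<in> pob (V_ob C X) (Cod (Theta C) u)"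
  then obtain T \<phi> U where u: "u = (T, \<phi>, U)" "\<phi> \<in> wreath_hom C T U" "wreath_object C T"
    using Theta_arrowE[OF C] by metis
  then show "pmap (V_ob C X) u x \<in> pob (V_ob C X) (Dom (Theta C) u)"
    using x wreath_laws(2)[OF C u(3,2)] by simp
next
  fix T x assume "T \<in> Ob (Theta C)" "x \<in> pob (V_ob C X) T"
  then show "pmap (V_ob C X) (Idn (Theta C) T) x = x"
    using wreath_laws(4)[OF C conjunct2[OF Theta_object[OF C]]] by simp
next
  fix u v x assume "u \<in> Ar (Theta C)" "v \<in> Ar (Theta C)" and *: "Cod (Theta C) u = Dom (Theta C) v"
    "x \<in> pob (V_ob C X) (Cod (Theta C) v)"
  then obtain T \<phi> U \<psi> W where u: "u = (T, \<phi>, U)" "\<phi> \<in> wreath_hom C T U" "wreath_object C T" 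
    and v: "v = (U, \<psi>, W)" "\<psi> \<in> wreath_hom C U W" "wreath_object C U"
    using Theta_arrowE[OF C, of u] Theta_arrowE[OF C, of v] by (metis Theta_simps(1,2))
  then show "pmap (V_ob C X) (Cmp (Theta C) v u) x = pmap (V_ob C X) u (pmap (V_ob C X) v x)"
    using * wreath_laws(3)[OF C u(3,2) v(2) _ v(3)] by simp
qed

definition V_map where
  "V_map C X Y w = (\<lambda>T\<in>Ob (Theta C). \<lambda>v\<in>wreath_hom C T X. wreath_comp C T X w v)"

lemma V_ar_eq: "V_ar C (X, w, Y) = (V_ob C X, V_map C X Y w, V_ob C Y)"
  by (simp add: V_ar_def V_map_def)

lemma V_map_in:
  assumes C: "category C" and X: "wreath_object C X" and w: "w \<in> wreath_hom C X Y"
  shows "V_map C X Y w \<in> psh_hom (Theta C) (V_ob C X) (V_ob C Y)"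
proof (rule psh_homI)
  fix T x assume T: "T \<in> Ob (Theta C)" and "x \<in> pob (V_ob C X) T"
  then show "V_map C X Y w T x \<in> pob (V_ob C Y) T"
    using wreath_laws(2)[OF C conjunct2[OF Theta_object[OF C T]] _ w] by (simp add: V_map_def)
next
  fix u x assume "u \<in> Ar (Theta C)" and x: "x \<in> pob (V_ob C X) (Cod (Theta C) u)"
  then obtain T \<phi> U where u: "u = (T, \<phi>, U)" "T \<in> Ob (Theta C)" "U \<in> Ob (Theta C)" "\<phi> \<in> wreath_hom C T U"
    "wreath_object C T" "wreath_object C U"
    using Theta_arrowE[OF C] by metis
  then show "V_map C X Y w (Dom (Theta C) u) (pmap (V_ob C X) u x) = pmap (V_ob C Y) u (V_map C X Y w (Cod (Theta C) u) x)"
    using x wreath_laws(2)[OF C u(5,4), of x X] wreath_laws(3)[OF C u(5,4) _ w u(6), of x] by (simp add: V_map_def)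
qed (simp_all add: V_map_def)

lemma V_is_functor:
  assumes C: "category C"
  shows "is_functor (wreath C) (psh_cat (Theta C)) (V_functor C)" (is "is_functor _ ?P _")
  unfolding is_functor_def
proof (intro conjI ballI impI wreath_category[OF C] psh_cat_category[OF Theta_category[OF C]])
  fix X :: "('a, 'b, 'c) wob" assume X: "X \<in> Ob (wreath C)"
  show "fst (V_functor C) X \<in> Ob ?P"
    by (simp add: V_functor_def psh_cat_def V_ob_presheaf[OF C])
  have "V_map C X X (wreath_id C X) = psh_id (Theta C) (V_ob C X)"
  proof (rule family_eqI[where A = "Ob (Theta C)" and X = "pob (V_ob C X)"])
    fix T v assume "T \<in> Ob (Theta C)" "v \<in> pob (V_ob C X) T"
    then show "V_map C X X (wreath_id C X) T v = psh_id (Theta C) (V_ob C X) T v"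
      using wreath_laws(5)[OF C conjunct2[OF Theta_object[OF C]], of T v X] X by (simp add: V_map_def psh_id_apply)
  qed (simp_all add: V_map_def psh_id_def)
  then show "snd (V_functor C) (Idn (wreath C) X) = Idn ?P (fst (V_functor C) X)"
    by (simp add: V_functor_def V_ar_eq psh_cat_def)
next
  fix u :: "('a, 'b, 'c) war" assume *: "u \<in> Ar (wreath C)"
  obtain X f Y where u: "u = (X, f, Y)" by (cases u)
  have "wreath_object C X" "f \<in> wreath_hom C X Y" using * by (simp_all add: u)
  then show "snd (V_functor C) u \<in> Ar ?P"
    "Dom ?P (snd (V_functor C) u) = fst (V_functor C) (Dom (wreath C) u)"
    "Cod ?P (snd (V_functor C) u) = fst (V_functor C) (Cod (wreath C) u)"
    using V_map_in[OF C] by (simp_all add: u V_functor_def psh_cat_def V_ar_eq V_ob_presheaf[OF C])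
next
  fix u v :: "('a, 'b, 'c) war" assume *: "u \<in> Ar (wreath C)" "v \<in> Ar (wreath C)" "Cod (wreath C) u = Dom (wreath C) v"
  obtain X f Y where u: "u = (X, f, Y)" by (cases u)
  obtain g Z where v: "v = (Y, g, Z)" using * u by (cases v) simp
  have f: "f \<in> wreath_hom C X Y" and g: "g \<in> wreath_hom C Y Z" and X: "wreath_object C X" using * by (simp_all add: u v)
  have "V_map C X Z (wreath_comp C X Y g f) = psh_comp (Theta C) (V_ob C X) (V_map C Y Z g) (V_map C X Y f)"
  proof (rule family_eqI[where A = "Ob (Theta C)" and X = "pob (V_ob C X)"])
    fix T x assume T: "T \<in> Ob (Theta C)" and x: "x \<in> pob (V_ob C X) T"
    then show "V_map C X Z (wreath_comp C X Y g f) T x = psh_comp (Theta C) (V_ob C X) (V_map C Y Z g) (V_map C X Y f) T x"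
      using wreath_laws(3)[OF C conjunct2[OF Theta_object[OF C T]] _ f g X, of x]
        wreath_laws(2)[OF C conjunct2[OF Theta_object[OF C T]] _ f, of x]
      by (simp add: V_map_def psh_comp_simps)
  qed (use psh_comp_simps(2)[where X = "V_ob C X" and C = "Theta C"] in \<open>simp_all add: V_map_def psh_comp_simps(1)\<close>)
  then show "snd (V_functor C) (Cmp (wreath C) v u) = Cmp ?P (snd (V_functor C) v) (snd (V_functor C) u)"
    by (simp add: u v V_functor_def V_ar_eq psh_cat_def)
qed

section \<open>The diagonal functor\<close>

definition k_hom where
  "k_hom C n \<theta> u = (\<theta>, \<lambda>i\<in>{1..n}. \<lambda>b\<in>Ob C. \<lambda>v\<in>arrows C b (Dom C u). \<lambda>j\<in>{\<theta> (i - 1)<..\<theta> i}. Cmp C u v)"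

lemma k_ar_eq: "k_ar C ((n, \<theta>, m), u) = (k_ob C (n, Dom C u), k_hom C n \<theta> u, k_ob C (m, Cod C u))"
  by (simp add: k_ar_def k_hom_def yoneda_simps)

lemma k_ob_eq: "k_ob C (n, c) = (n, \<lambda>i\<in>{1..n}. yoneda C c)"
  by (simp add: k_ob_def cell_def)

lemma k_ob_in: "c \<in> Ob C \<Longrightarrow> k_ob C (n, c) \<in> Ob (Theta C)"
  by (auto simp: k_ob_def Theta_def)

lemma k_hom_in:
  assumes C: "category C" and t: "\<theta> \<in> delta_hom n m" and u: "u \<in> Ar C"
  shows "k_hom C n \<theta> u \<in> wreath_hom C (k_ob C (n, Dom C u)) (k_ob C (m, Cod C u))"
  unfolding k_ob_eq
proof (rule wreath_homI[OF C])
  have u': "u \<in> arrows C (Dom C u) (Cod C u)" using u by (simp add: arrows_def)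
  show "fst (k_hom C n \<theta> u) \<in> delta_hom n m" using t by (simp add: k_hom_def)
  fix i l assume i: "1 \<le> i" "i \<le> n" and l: "fst (k_hom C n \<theta> u) (i - 1) < l" "l \<le> fst (k_hom C n \<theta> u) i"
  then have l': "1 \<le> l" "l \<le> m" using delta_homD(1)[OF t i(2)] by (auto simp: k_hom_def)
  show "snd (k_hom C n \<theta> u) i c x l \<in> pob ((\<lambda>i\<in>{1..m}. yoneda C (Cod C u)) l) c"
    if "c \<in> Ob C" "x \<in> pob ((\<lambda>i\<in>{1..n}. yoneda C (Dom C u)) i) c" for c x
    using that i l l' categoryD(3)[OF C _ u'] by (simp add: k_hom_def yoneda_simps)
  show "snd (k_hom C n \<theta> u) i (Dom C w) (pmap ((\<lambda>i\<in>{1..n}. yoneda C (Dom C u)) i) w x) l =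
      pmap ((\<lambda>i\<in>{1..m}. yoneda C (Cod C u)) l) w (snd (k_hom C n \<theta> u) i (Cod C w) x l)"
    if w: "w \<in> Ar C" and x: "x \<in> pob ((\<lambda>i\<in>{1..n}. yoneda C (Dom C u)) i) (Cod C w)" for w x
  proof -
    have w': "w \<in> arrows C (Dom C w) (Cod C w)" using w by (simp add: arrows_def)
    have x': "x \<in> arrows C (Cod C w) (Dom C u)" using x i by (simp add: yoneda_simps)
    show ?thesis
      using i l l' x' categoryD(3)[OF C w' x'] categoryE(1,2)[OF C w] categoryD(6)[OF C w' x' u']
      by (simp add: k_hom_def yoneda_simps)
  qed
qed (simp_all add: k_hom_def yoneda_presheaf[OF C] yoneda_simps)

lemma k_arrow:
  assumes C: "category C" and t: "\<theta> \<in> delta_hom n m" and u: "u \<in> Ar C"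
  shows "k_ar C ((n, \<theta>, m), u) \<in> Ar (Theta C)"
  unfolding k_ar_eq Theta_arrow[OF C] using k_hom_in[OF assms] k_ob_in categoryE(1,2)[OF C u] by metis

lemma k_hom_eval:
  assumes "1 \<le> i" "i \<le> n" "b \<in> Ob C" "v \<in> arrows C b (Dom C u)" "\<theta> (i - 1) < l" "l \<le> \<theta> i"
  shows "snd (k_hom C n \<theta> u) i b v l = Cmp C u v"
  using assms by (simp add: k_hom_def)

lemma k_comp:
  assumes C: "category C" and t: "\<theta> \<in> delta_hom n m" and e: "\<eta> \<in> delta_hom m k"
    and u: "u \<in> Ar C" and v: "v \<in> Ar C" and uv: "Cod C u = Dom C v"
  shows "k_ar C ((n, compose {..n} \<eta> \<theta>, k), Cmp C v u) = Cmp (Theta C) (k_ar C ((m, \<eta>, k), v)) (k_ar C ((n, \<theta>, m), u))"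
proof -
  note c = categoryE(6-8)[OF C u v uv]
  note fg = k_hom_in[OF C t u] k_hom_in[OF C e v]
  have obj: "wreath_object C (k_ob C (n, Dom C u))"
    using Theta_object[OF C k_ob_in[OF categoryE(1)[OF C u]]] by blast
  have "k_hom C n (compose {..n} \<eta> \<theta>) (Cmp C v u) = wreath_comp C (k_ob C (n, Dom C u)) (k_ob C (m, Dom C v)) (k_hom C m \<eta> v) (k_hom C n \<theta> u)"
    (is "?L = ?R")
  proof (rule wreath_hom_eqI)
    show "?L \<in> wreath_hom C (n, \<lambda>i\<in>{1..n}. yoneda C (Dom C u)) (k, \<lambda>i\<in>{1..k}. yoneda C (Cod C v))"
      using k_hom_in[OF C delta_hom_compose[OF t e] c(1)] c by (simp add: k_ob_eq)
    show "?R \<in> wreath_hom C (n, \<lambda>i\<in>{1..n}. yoneda C (Dom C u)) (k, \<lambda>i\<in>{1..k}. yoneda C (Cod C v))"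
      using wreath_laws(2)[OF C obj fg(1)[unfolded uv] fg(2)] by (simp add: k_ob_eq)
    show "fst ?L i = fst ?R i" if "i \<le> n" for i
      by (simp add: k_ob_eq wreath_comp_simps k_hom_def)
    fix i b x l assume i: "1 \<le> i" "i \<le> n" and b: "b \<in> Ob C" and "x \<in> pob ((\<lambda>i\<in>{1..n}. yoneda C (Dom C u)) i) b"
      and "fst ?L (i - 1) < l" "l \<le> fst ?L i"
    then have x: "x \<in> arrows C b (Dom C u)" and l: "\<eta> (\<theta> (i - 1)) < l" "l \<le> \<eta> (\<theta> i)"
      by (simp_all add: yoneda_simps k_hom_def compose_def)
    have i': "i - 1 \<le> n" using i by simp
    have u': "u \<in> arrows C (Dom C u) (Dom C v)" and v': "v \<in> arrows C (Dom C v) (Cod C v)" using u v uv by (simp_all add: arrows_def)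
    note bl = block[OF e l delta_homD(1)[OF t i'] delta_homD(1)[OF t i(2)]]
    have "snd ?R i b x l = snd (k_hom C m \<eta> v) (block m \<eta> l) b (snd (k_hom C n \<theta> u) i b x (block m \<eta> l)) l"
      using i b x l by (simp add: k_ob_eq wreath_comp_simps k_hom_def yoneda_simps)
    also have "\<dots> = Cmp C v (Cmp C u x)"
      using k_hom_eval[OF i b x, of \<theta>, OF bl(1,2)] k_hom_eval[OF bl(3,4) b, of "Cmp C u x" v \<eta> l] bl(5,6)
        categoryD(3)[OF C x u'] by simp
    also have "\<dots> = snd ?L i b x l"
      using k_hom_eval[OF i b, of x "Cmp C v u" "compose {..n} \<eta> \<theta>" l] x l i i' c categoryD(6)[OF C x u' v']
      by (simp add: compose_def)
    finally show "snd ?L i b x l = snd ?R i b x l" by simp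
  qed
  then show ?thesis using c by (simp add: k_ar_eq uv)
qed

lemma k_id:
  assumes C: "category C" and c: "c \<in> Ob C"
  shows "k_ar C ((n, \<lambda>i\<in>{..n}. i, n), Idn C c) = Idn (Theta C) (k_ob C (n, c))"
proof -
  have "k_hom C n (\<lambda>i\<in>{..n}. i) (Idn C c) = wreath_id C (k_ob C (n, c))"
    using categoryD(5)[OF C, of _ _ c] categoryE(3-5)[OF C c]
    by (auto simp: k_hom_def k_ob_eq wreath_id_def yoneda_simps fun_eq_iff)
  then show ?thesis by (simp add: k_ar_eq categoryE(3-5)[OF C c])
qed

text \<open>Vertices carry no label in \<open>C\<close>: restriction along any arrow of \<open>C\<close> fixes them.\<close>

lemma k_zero:
  assumes "category C" "u \<in> Ar C"
  shows "k_ar C ((0, \<lambda>i\<in>{..0}. i, 0), u) = Idn (Theta C) (cell C 0 c)"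
  by (auto simp: k_ar_eq k_hom_def k_ob_def cell_def wreath_id_def restrict_def)

section \<open>The coherent realization is a functor\<close>

lemma compose_id_left: "\<theta> \<in> delta_hom m n \<Longrightarrow> compose {..m} (\<lambda>i\<in>{..n}. i) \<theta> = \<theta>"
  by (rule extensionalityI[of _ "{..m}"]) (simp_all add: compose_def delta_homD)

lemma compose_id_right: "\<theta> \<in> delta_hom m n \<Longrightarrow> compose {..m} \<theta> (\<lambda>i\<in>{..m}. i) = \<theta>"
  by (rule compose_id_ext[OF delta_homD(4)])

lemma cell_zero_in: "cell C 0 c \<in> Ob (Theta C)"
  by (auto simp: Theta_def intro!: exI[of _ 0])

lemma k_pmap:
  assumes C: "category C" and X: "presheaf (Theta C) X"
  shows "\<theta> \<in> delta_hom n m \<Longrightarrow> u \<in> Ar C \<Longrightarrow> x \<in> pob X (k_ob C (m, Cod C u)) \<Longrightarrow>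
      pmap X (k_ar C ((n, \<theta>, m), u)) x \<in> pob X (k_ob C (n, Dom C u))"
    and "\<theta> \<in> delta_hom n m \<Longrightarrow> \<eta> \<in> delta_hom m k \<Longrightarrow> u \<in> Ar C \<Longrightarrow> v \<in> Ar C \<Longrightarrow> Cod C u = Dom C v \<Longrightarrow>
      x \<in> pob X (k_ob C (k, Cod C v)) \<Longrightarrow>
      pmap X (k_ar C ((n, \<theta>, m), u)) (pmap X (k_ar C ((m, \<eta>, k), v)) x) =
      pmap X (k_ar C ((n, compose {..n} \<eta> \<theta>, k), Cmp C v u)) x"
    and "c \<in> Ob C \<Longrightarrow> x \<in> pob X (k_ob C (n, c)) \<Longrightarrow> pmap X (k_ar C ((n, \<lambda>i\<in>{..n}. i, n), Idn C c)) x = x"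
    and "u \<in> Ar C \<Longrightarrow> x \<in> pob X (cell C 0 undefined) \<Longrightarrow> pmap X (k_ar C ((0, \<lambda>i\<in>{..0}. i, 0), u)) x = x"
proof -
  note p = presheafE[OF X]
  have k: "Dom (Theta C) (k_ar C ((n, \<theta>, m), u)) = k_ob C (n, Dom C u)"
    "Cod (Theta C) (k_ar C ((n, \<theta>, m), u)) = k_ob C (m, Cod C u)" for n \<theta> m u
    by (simp_all add: k_ar_eq)
  show "\<theta> \<in> delta_hom n m \<Longrightarrow> u \<in> Ar C \<Longrightarrow> x \<in> pob X (k_ob C (m, Cod C u)) \<Longrightarrow>
      pmap X (k_ar C ((n, \<theta>, m), u)) x \<in> pob X (k_ob C (n, Dom C u))"
    using p(1)[OF k_arrow[OF C], of \<theta> n m u] by (simp add: k)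
  show "\<theta> \<in> delta_hom n m \<Longrightarrow> \<eta> \<in> delta_hom m k \<Longrightarrow> u \<in> Ar C \<Longrightarrow> v \<in> Ar C \<Longrightarrow> Cod C u = Dom C v \<Longrightarrow>
      x \<in> pob X (k_ob C (k, Cod C v)) \<Longrightarrow>
      pmap X (k_ar C ((n, \<theta>, m), u)) (pmap X (k_ar C ((m, \<eta>, k), v)) x) =
      pmap X (k_ar C ((n, compose {..n} \<eta> \<theta>, k), Cmp C v u)) x"
    using p(3)[OF k_arrow[OF C] k_arrow[OF C], of \<theta> n m u \<eta> m k v x] by (simp add: k k_comp[OF C])
  show "c \<in> Ob C \<Longrightarrow> x \<in> pob X (k_ob C (n, c)) \<Longrightarrow> pmap X (k_ar C ((n, \<lambda>i\<in>{..n}. i, n), Idn C c)) x = x"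
    unfolding k_id[OF C] using p(2)[OF k_ob_in] by blast
  have "cell C 0 undefined \<in> Ob (Theta C)" by (rule cell_zero_in)
  then show "u \<in> Ar C \<Longrightarrow> x \<in> pob X (cell C 0 undefined) \<Longrightarrow> pmap X (k_ar C ((0, \<lambda>i\<in>{..0}. i, 0), u)) x = x"
    unfolding k_zero[OF C, where c = undefined] using p(2) by blast
qed

lemma k_ob_zero: "k_ob C (0, c) = cell C 0 undefined"
  by (auto simp: k_ob_def cell_def restrict_def)

lemma slice_map_zero: "slice_map C \<alpha> c 0 = \<alpha> (cell C 0 undefined)"
  by (simp add: slice_map_def k_ob_zero)

lemma slice_simps:
  "pob (slice C X c) n = pob X (k_ob C (n, c))"
  "pmap (slice C X c) \<theta> = pmap X (k_ar C (\<theta>, Idn C c))"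
  by (simp_all add: slice_def)

lemma slice_presheaf:
  assumes C: "category C" and X: "presheaf (Theta C) X" and c: "c \<in> Ob C"
  shows "presheaf Delta (slice C X c)"
  unfolding presheaf_Delta slice_simps
  using k_pmap[OF C X] categoryE(3-5)[OF C c] categoryE(9)[OF C, of "Idn C c"] c
  by (metis (no_types, lifting))

lemma slice_restrict_simps:
  assumes "\<sigma> \<in> pob X (k_ob C (n, Cod C u))"
  shows "slice_restrict C X u n \<sigma> = pmap X (k_ar C ((n, \<lambda>i\<in>{..n}. i, n), u)) \<sigma>"
  using assms by (simp add: slice_restrict_def slice_simps)

lemma slice_restrict_hom:
  assumes C: "category C" and X: "presheaf (Theta C) X" and u: "u \<in> Ar C"
  shows "slice_restrict C X u \<in> psh_hom Delta (slice C X (Cod C u)) (slice C X (Dom C u))"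
  unfolding psh_hom_Delta
proof (intro conjI allI impI)
  note c = categoryE(1,2)[OF C u]
  note k = k_pmap[OF C X]
  fix n show "slice_restrict C X u n \<in> pob (slice C X (Cod C u)) n \<rightarrow>\<^sub>E pob (slice C X (Dom C u)) n"
    using k(1)[OF delta_hom_id u] by (auto simp: slice_restrict_def slice_simps)
  fix m \<theta> x assume t: "\<theta> \<in> delta_hom m n" and "x \<in> pob (slice C X (Cod C u)) n"
  then have x: "x \<in> pob X (k_ob C (n, Cod C u))" by (simp add: slice_simps)
  have "pmap X (k_ar C ((m, \<theta>, n), Idn C (Cod C u))) x \<in> pob X (k_ob C (m, Cod C u))"
    using k(1)[OF t, of "Idn C (Cod C u)" x] x c categoryE[OF C] by simp
  then show "slice_restrict C X u m (pmap (slice C X (Cod C u)) (m, \<theta>, n) x) =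
       pmap (slice C X (Dom C u)) (m, \<theta>, n) (slice_restrict C X u n x)"
    using k(2)[OF delta_hom_id t u, of "Idn C (Cod C u)" x] k(2)[OF t delta_hom_id _ u, of "Idn C (Dom C u)" x] x c u
    by (simp add: slice_simps slice_restrict_simps categoryE[OF C] compose_id_left[OF t] compose_id_right[OF t])
qed

lemma slice_map_hom:
  assumes C: "category C" and a: "\<alpha> \<in> psh_hom (Theta C) X Y" and c: "c \<in> Ob C"
  shows "slice_map C \<alpha> c \<in> psh_hom Delta (slice C X c) (slice C Y c)"
  unfolding psh_hom_Delta
proof (intro conjI allI impI)
  note p = psh_homE[OF a]
  fix n show "slice_map C \<alpha> c n \<in> pob (slice C X c) n \<rightarrow>\<^sub>E pob (slice C Y c) n"
    using p(1,4)[OF k_ob_in[OF c]] by (auto simp: slice_map_def slice_simps PiE_iff)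
  fix m \<theta> x assume t: "\<theta> \<in> delta_hom m n" and "x \<in> pob (slice C X c) n"
  then show "slice_map C \<alpha> c m (pmap (slice C X c) (m, \<theta>, n) x) = pmap (slice C Y c) (m, \<theta>, n) (slice_map C \<alpha> c n x)"
    using p(2)[OF k_arrow[OF C t, of "Idn C c"], of x] c by (simp add: slice_map_def slice_simps k_ar_eq categoryE[OF C])
qed

lemma slice_map_restrict:
  assumes C: "category C" and X: "presheaf (Theta C) X" and a: "\<alpha> \<in> psh_hom (Theta C) X Y" and u: "u \<in> Ar C"
  shows "psh_comp Delta (slice C X (Cod C u)) (slice_map C \<alpha> (Dom C u)) (slice_restrict C X u) =
    psh_comp Delta (slice C X (Cod C u)) (slice_restrict C Y u) (slice_map C \<alpha> (Cod C u))"
proof -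
  have "slice_map C \<alpha> (Dom C u) n (slice_restrict C X u n x) = slice_restrict C Y u n (slice_map C \<alpha> (Cod C u) n x)"
    if "x \<in> pob (slice C X (Cod C u)) n" for n x
    using psh_homE(2)[OF a k_arrow[OF C delta_hom_id u], of x n] that
      psh_homE(1)[OF a k_ob_in[OF categoryE(2)[OF C u]], of x n]
    by (simp add: slice_simps slice_restrict_simps slice_map_def k_ar_eq)
  then show ?thesis by (auto simp: psh_comp_def compose_def fun_eq_iff)
qed

text \<open>Rigidification is functorial because a simplicial map renames the simplices in a word
  letter by letter.\<close>

lemma rigidify_map_comp:
  assumes K: "presheaf Delta K" and L: "presheaf Delta L"
    and h: "h \<in> psh_hom Delta K L" and h': "h' \<in> psh_hom Delta L M" and A: "A \<in> pob (EHom (rigidify K) x y) p"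
  shows "snd (rigidify_map L M h') (h 0 x) (h 0 y) p (snd (rigidify_map K L h) x y p A) =
    snd (rigidify_map K M (psh_comp Delta K h' h)) x y p A"
proof -
  obtain w where w: "is_word K p x y w" "A = word_class K p x y w" using A unfolding rigidify_hom by blast
  have xy: "x \<in> pob K 0" "y \<in> pob K 0" using is_word_ends[OF K w(1)] by simp_all
  have hh: "psh_comp Delta K h' h \<in> psh_hom Delta K M"
    using psh_comp_in[OF category_Delta K h h'] .
  have "gen_map h' p (\<lambda>i\<in>{..p}. i) (gen_map h p (\<lambda>i\<in>{..p}. i) g) = gen_map (psh_comp Delta K h' h) p (\<lambda>i\<in>{..p}. i) g"
    if "g \<in> generators K p" for g
    using that by (cases g) (simp add: gen_map_def generators_iff coh_hom compose_id_ext psh_comp_simps)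
  then have "map (gen_map h' p (\<lambda>i\<in>{..p}. i)) (map (gen_map h p (\<lambda>i\<in>{..p}. i)) w) = map (gen_map (psh_comp Delta K h' h) p (\<lambda>i\<in>{..p}. i)) w"
    using is_word_gens[OF w(1)] by (simp only: map_map comp_def) (intro map_cong refl, blast)
  then show ?thesis
    by (simp only: w(2) rigidify_map_simps(2)[OF h K w(1)] rigidify_map_simps(2)[OF hh K w(1)]
        rigidify_map_simps(2)[OF h' L gen_map_word[OF h delta_hom_id w(1)]])
      (simp add: psh_comp_simps xy)
qed

lemma rigidify_map_id:
  assumes K: "presheaf Delta K" and h: "h \<in> psh_hom Delta K K" and id: "\<And>n \<sigma>. \<sigma> \<in> pob K n \<Longrightarrow> h n \<sigma> = \<sigma>"
    and A: "A \<in> pob (EHom (rigidify K) x y) p"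
  shows "snd (rigidify_map K K h) x y p A = A"
proof -
  obtain w where w: "is_word K p x y w" "A = word_class K p x y w" using A unfolding rigidify_hom by blast
  have "gen_map h p (\<lambda>i\<in>{..p}. i) g = g" if "g \<in> generators K p" for g
    using that by (cases g) (simp add: gen_map_def generators_iff coh_hom compose_id_ext id)
  then have "map (gen_map h p (\<lambda>i\<in>{..p}. i)) w = w"
    using is_word_gens[OF w(1)] by (intro map_idI) blast
  then show ?thesis using is_word_ends[OF K w(1)] by (simp add: w(2) rigidify_map_simps(2)[OF h K w(1)] id)
qed

text \<open>A category enriched in simplicial presheaves on \<open>C\<close> amounts to simplicial categories \<open>D c\<close>
  with a common set of objects and, for every arrow of \<open>C\<close>, a transition functor that fixes objects.\<close>

locale levelwise =
  fixes C :: "('o, 'a) cat" and E :: "(nat \<times> 'o, delta_ar \<times> 'a, 'x, 'm) ecat"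
    and D :: "'o \<Rightarrow> ('x, 'm) scat" and R :: "'a \<Rightarrow> (nat, 'x, 'm, 'x, 'm) efun"
  assumes base: "category C"
    and level: "c \<in> Ob C \<Longrightarrow> enriched_category Delta (D c)"
    and level_ob: "c \<in> Ob C \<Longrightarrow> EOb (D c) = EOb E"
    and trans: "u \<in> Ar C \<Longrightarrow> R u \<in> efunctors Delta (D (Cod C u)) (D (Dom C u))"
    and trans_ob: "u \<in> Ar C \<Longrightarrow> x \<in> EOb E \<Longrightarrow> fst (R u) x = x"
    and trans_id: "c \<in> Ob C \<Longrightarrow> x \<in> EOb E \<Longrightarrow> y \<in> EOb E \<Longrightarrow> f \<in> pob (EHom (D c) x y) p \<Longrightarrow>
      snd (R (Idn C c)) x y p f = f"
    and trans_comp: "u \<in> Ar C \<Longrightarrow> v \<in> Ar C \<Longrightarrow> Cod C u = Dom C v \<Longrightarrow> x \<in> EOb E \<Longrightarrow> y \<in> EOb E \<Longrightarrow>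
      f \<in> pob (EHom (D (Cod C v)) x y) p \<Longrightarrow>
      snd (R (Cmp C v u)) x y p f = snd (R u) x y p (snd (R v) x y p f)"
    and hom: "c \<in> Ob C \<Longrightarrow> x \<in> EOb E \<Longrightarrow> y \<in> EOb E \<Longrightarrow> pob (EHom E x y) (p, c) = pob (EHom (D c) x y) p"
    and restr: "u \<in> Ar C \<Longrightarrow> \<theta> \<in> delta_hom q p \<Longrightarrow> x \<in> EOb E \<Longrightarrow> y \<in> EOb E \<Longrightarrow>
      f \<in> pob (EHom (D (Cod C u)) x y) p \<Longrightarrow>
      pmap (EHom E x y) ((q, \<theta>, p), u) f = pmap (EHom (D (Dom C u)) x y) (q, \<theta>, p) (snd (R u) x y p f)"
    and unit: "c \<in> Ob C \<Longrightarrow> x \<in> EOb E \<Longrightarrow> EId E x (p, c) = EId (D c) x p"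
    and comp: "c \<in> Ob C \<Longrightarrow> x \<in> EOb E \<Longrightarrow> y \<in> EOb E \<Longrightarrow> z \<in> EOb E \<Longrightarrow>
      f \<in> pob (EHom (D c) x y) p \<Longrightarrow> g \<in> pob (EHom (D c) y z) p \<Longrightarrow>
      EComp E x y z (p, c) f g = EComp (D c) x y z p f g"
begin

lemma trans_in:
  "u \<in> Ar C \<Longrightarrow> x \<in> EOb E \<Longrightarrow> y \<in> EOb E \<Longrightarrow> f \<in> pob (EHom (D (Cod C u)) x y) p \<Longrightarrow>
    snd (R u) x y p f \<in> pob (EHom (D (Dom C u)) x y) p"
  using efunctorsE(1)[OF trans, of u x y p f] by (simp add: level_ob categoryE[OF base] trans_ob)

lemma trans_natural:
  assumes "u \<in> Ar C" "x \<in> EOb E" "y \<in> EOb E" "\<theta> \<in> delta_hom q p" "f \<in> pob (EHom (D (Cod C u)) x y) p"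
  shows "snd (R u) x y q (pmap (EHom (D (Cod C u)) x y) (q, \<theta>, p) f) =
    pmap (EHom (D (Dom C u)) x y) (q, \<theta>, p) (snd (R u) x y p f)"
  using efunctorsE(2)[OF trans[OF assms(1)], of x y "(q, \<theta>, p)" f] assms
  by (simp add: level_ob categoryE[OF base] trans_ob)

lemma arrow_cases:
  assumes "w \<in> Ar (prod_cat Delta C)"
  obtains q \<theta> p u where "w = ((q, \<theta>, p), u)" "\<theta> \<in> delta_hom q p" "u \<in> Ar C"
  using assms by (cases w) (auto simp: Arr_Delta)

lemma level_presheaf:
  assumes "c \<in> Ob C" "x \<in> EOb E" "y \<in> EOb E" shows "presheaf Delta (EHom (D c) x y)"
  using enriched_categoryE(1)[OF level[OF assms(1)]] assms by (simp add: level_ob)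

lemma hom_presheaf:
  assumes x: "x \<in> EOb E" and y: "y \<in> EOb E"
  shows "presheaf (prod_cat Delta C) (EHom E x y)" (is "presheaf ?B _")
  unfolding presheaf_def
proof (intro conjI ballI impI)
  fix w f assume "w \<in> Ar ?B" and f: "f \<in> pob (EHom E x y) (Cod ?B w)"
  then obtain q \<theta> p u where w: "w = ((q, \<theta>, p), u)" "\<theta> \<in> delta_hom q p" "u \<in> Ar C" by (elim arrow_cases)
  note c = categoryE(1,2)[OF base w(3)]
  have f': "f \<in> pob (EHom (D (Cod C u)) x y) p" using f c x y by (simp add: w(1) hom)
  show "pmap (EHom E x y) w f \<in> pob (EHom E x y) (Dom ?B w)"
    using presheafD(1)[OF level_presheaf[OF c(1) x y] w(2) trans_in[OF w(3) x y f']] c x y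
    by (simp add: w(1) restr[OF w(3,2) x y f'] hom)
next
  fix a f assume "a \<in> Ob ?B" and f: "f \<in> pob (EHom E x y) a"
  then obtain p c where a: "a = (p, c)" "c \<in> Ob C" by auto
  have f': "f \<in> pob (EHom (D c) x y) p" using f a x y by (simp add: hom)
  note i = categoryE(3-5)[OF base a(2)]
  show "pmap (EHom E x y) (Idn ?B a) f = f"
    using restr[OF i(1) delta_hom_id x y, of f p] f' presheafD(2)[OF level_presheaf[OF a(2) x y] f']
    by (simp add: a(1) i trans_id[OF a(2) x y f'])
next
  fix w w' f assume ww: "w \<in> Ar ?B" "w' \<in> Ar ?B" 
    and e: "Cod ?B w = Dom ?B w'"
    and f: "f \<in> pob (EHom E x y) (Cod ?B w')"
  obtain q \<theta> p u where w: "w = ((q, \<theta>, p), u)" "\<theta> \<in> delta_hom q p" "u \<in> Ar C" using ww(1) by (elim arrow_cases)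
  obtain \<eta> r v where w': "w' = ((p, \<eta>, r), v)" "\<eta> \<in> delta_hom p r" "v \<in> Ar C" and uv: "Cod C u = Dom C v"
    using ww(2) by (elim arrow_cases) (use e w(1) in auto)
  note c = categoryE(1,2)[OF base w(3)] categoryE(1,2)[OF base w'(3)]
  note vu = categoryE(6-8)[OF base w(3) w'(3) uv]
  have f': "f \<in> pob (EHom (D (Cod C v)) x y) r" using f c x y by (simp add: w' hom)
  let ?g = "snd (R v) x y r f"
  have g: "?g \<in> pob (EHom (D (Dom C v)) x y) r" using trans_in[OF w'(3) x y f'] .
  have pg: "pmap (EHom (D (Dom C v)) x y) (p, \<eta>, r) ?g \<in> pob (EHom (D (Cod C u)) x y) p"
    using presheafD(1)[OF level_presheaf[OF c(3) x y] w'(2) g] uv by simp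
  have "pmap (EHom E x y) w (pmap (EHom E x y) w' f) =
     pmap (EHom (D (Dom C u)) x y) (q, \<theta>, p) (snd (R u) x y p (pmap (EHom (D (Dom C v)) x y) (p, \<eta>, r) ?g))"
    by (simp add: w(1) w'(1) restr[OF w'(3,2) x y f'] restr[OF w(3,2) x y pg])
  also have "\<dots> = pmap (EHom (D (Dom C u)) x y) (q, \<theta>, p) (pmap (EHom (D (Dom C u)) x y) (p, \<eta>, r) (snd (R u) x y r ?g))"
    using trans_natural[OF w(3) x y w'(2), of ?g] g by (simp add: uv)
  also have "\<dots> = pmap (EHom (D (Dom C u)) x y) (q, compose {..q} \<eta> \<theta>, r) (snd (R u) x y r ?g)"
    using presheafD(3)[OF level_presheaf[OF c(1) x y] w(2) w'(2)] trans_in[OF w(3) x y, of ?g r] g by (simp add: uv)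
  also have "\<dots> = pmap (EHom E x y) (Cmp ?B w' w) f"
    using restr[OF vu(1) delta_hom_compose[OF w(2) w'(2)] x y, of f] f' trans_comp[OF w(3) w'(3) uv x y f']
    by (simp add: w(1) w'(1) vu)
  finally show "pmap (EHom E x y) (Cmp ?B w' w) f = pmap (EHom E x y) w (pmap (EHom E x y) w' f)" ..
qed

lemma enriched: "enriched_category (prod_cat Delta C) E" (is "enriched_category ?B _")
  unfolding enriched_category_def
proof (intro conjI ballI)
  fix x a assume "x \<in> EOb E" "a \<in> Ob ?B"
  then show "EId E x a \<in> pob (EHom E x x) a"
    using enriched_categoryE(2)[OF level] by (auto simp: unit hom level_ob)
next
  fix x w assume x: "x \<in> EOb E" and "w \<in> Ar ?B"
  then obtain q \<theta> p u where w: "w = ((q, \<theta>, p), u)" "\<theta> \<in> delta_hom q p" "u \<in> Ar C" by (elim arrow_cases)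
  note c = categoryE(1,2)[OF base w(3)]
  have i: "EId (D (Cod C u)) x p \<in> pob (EHom (D (Cod C u)) x x) p"
    using enriched_categoryE(2)[OF level[OF c(2)]] x c by (simp add: level_ob)
  show "pmap (EHom E x x) w (EId E x (Cod ?B w)) = EId E x (Dom ?B w)"
    using efunctorsD(3)[OF trans[OF w(3)], of x p] enriched_categoryE(4)[OF level[OF c(1)], of x "(q, \<theta>, p)"] w c x
    by (simp add: unit restr[OF w(3,2) x x i] level_ob trans_ob)
next
  fix x y z a f g assume x: "x \<in> EOb E" "y \<in> EOb E" "z \<in> EOb E" and "a \<in> Ob ?B"
     "f \<in> pob (EHom E x y) a" "g \<in> pob (EHom E y z) a"
  then show "EComp E x y z a f g \<in> pob (EHom E x z) a"
    using enriched_categoryE(3)[OF level] by (auto simp: comp hom level_ob)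
next
  fix x y z w f g assume x: "x \<in> EOb E" "y \<in> EOb E" "z \<in> EOb E" and "w \<in> Ar ?B" and
     fg: "f \<in> pob (EHom E x y) (Cod ?B w)" "g \<in> pob (EHom E y z) (Cod ?B w)"
  then obtain q \<theta> p u where w: "w = ((q, \<theta>, p), u)" "\<theta> \<in> delta_hom q p" "u \<in> Ar C" by (elim arrow_cases)
  note c = categoryE(1,2)[OF base w(3)]
  have f: "f \<in> pob (EHom (D (Cod C u)) x y) p" and g: "g \<in> pob (EHom (D (Cod C u)) y z) p"
    using fg x c by (simp_all add: w(1) hom)
  note f' = trans_in[OF w(3) x(1,2) f] and g' = trans_in[OF w(3) x(2,3) g]
  have fg': "EComp (D (Cod C u)) x y z p f g \<in> pob (EHom (D (Cod C u)) x z) p"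
    using enriched_categoryE(3)[OF level[OF c(2)], of x y z p f g] f g x c by (simp add: level_ob)
  note pf = presheafD(1)[OF level_presheaf[OF c(1) x(1,2)] w(2) f'] presheafD(1)[OF level_presheaf[OF c(1) x(2,3)] w(2) g']
  have "pmap (EHom E x z) w (EComp E x y z (Cod ?B w) f g) =
     pmap (EHom (D (Dom C u)) x z) (q, \<theta>, p) (EComp (D (Dom C u)) x y z p (snd (R u) x y p f) (snd (R u) y z p g))"
    using efunctorsD(4)[OF trans[OF w(3)], of x y z p f g] x c f g
    by (simp add: w(1) comp restr[OF w(3,2) x(1,3) fg'] level_ob trans_ob[OF w(3)])
  also have "\<dots> = EComp (D (Dom C u)) x y z q (pmap (EHom (D (Dom C u)) x y) (q, \<theta>, p) (snd (R u) x y p f)) 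
      (pmap (EHom (D (Dom C u)) y z) (q, \<theta>, p) (snd (R u) y z p g))"
    using enriched_categoryE(5)[OF level[OF c(1)], of x y z "(q, \<theta>, p)"] x c f' g' w(2) by (simp add: level_ob)
  also have "\<dots> = EComp E x y z (Dom ?B w) (pmap (EHom E x y) w f) (pmap (EHom E y z) w g)"
    using x c pf by (simp add: w(1) comp restr[OF w(3,2) x(1,2) f] restr[OF w(3,2) x(2,3) g])
  finally show "pmap (EHom E x z) w (EComp E x y z (Cod ?B w) f g) =
     EComp E x y z (Dom ?B w) (pmap (EHom E x y) w f) (pmap (EHom E y z) w g)" .
next
  fix x y a f assume x: "x \<in> EOb E" "y \<in> EOb E" and "a \<in> Ob ?B" and
     f: "f \<in> pob (EHom E x y) a"
  then obtain p c where a: "a = (p, c)" "c \<in> Ob C" by auto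
  note l = level[OF a(2)]
  show "EComp E x x y a (EId E x a) f = f" "EComp E x y y a f (EId E y a) = f"
    using enriched_categoryE(2,6,7)[OF l] x a f by (simp_all add: comp unit hom level_ob)
next
  fix w x y z a f g h assume *: "w \<in> EOb E" "x \<in> EOb E" "y \<in> EOb E" "z \<in> EOb E" and "a \<in> Ob ?B" and
     f: "f \<in> pob (EHom E w x) a" "g \<in> pob (EHom E x y) a" "h \<in> pob (EHom E y z) a"
  then obtain p c where a: "a = (p, c)" "c \<in> Ob C" by auto
  note l = level[OF a(2)]
  show "EComp E w y z a (EComp E w x y a f g) h = EComp E w x z a f (EComp E x y z a g h)"
    using enriched_categoryE(3,8)[OF l] * a f by (simp add: comp hom level_ob)
qed (rule hom_presheaf)

end

text \<open>The enriched functor given by simplicial functors \<open>F c\<close> with a common action \<open>\<phi>\<close> on objects.\<close>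

definition assemble where
  "assemble C E \<phi> F = (restrict \<phi> (EOb E), \<lambda>x\<in>EOb E. \<lambda>y\<in>EOb E. \<lambda>(p, c)\<in>Ob (prod_cat Delta C). snd (F c) x y p)"

lemma assemble_simps:
  "x \<in> EOb E \<Longrightarrow> fst (assemble C E \<phi> F) x = \<phi> x"
  "x \<in> EOb E \<Longrightarrow> y \<in> EOb E \<Longrightarrow> c \<in> Ob C \<Longrightarrow> snd (assemble C E \<phi> F) x y (p, c) = snd (F c) x y p"
  by (simp_all add: assemble_def)

lemma assemble_efunctor:
  assumes "levelwise C E D R" "levelwise C E' D' R'"
    and F: "\<And>c. c \<in> Ob C \<Longrightarrow> F c \<in> efunctors Delta (D c) (D' c)"
    and \<phi>: "\<And>c x. c \<in> Ob C \<Longrightarrow> x \<in> EOb E \<Longrightarrow> fst (F c) x = \<phi> x"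
    and \<phi>E: "\<And>x. x \<in> EOb E \<Longrightarrow> \<phi> x \<in> EOb E'"
    and square: "\<And>u x y p f. u \<in> Ar C \<Longrightarrow> x \<in> EOb E \<Longrightarrow> y \<in> EOb E \<Longrightarrow> f \<in> pob (EHom (D (Cod C u)) x y) p \<Longrightarrow>
      snd (F (Dom C u)) x y p (snd (R u) x y p f) = snd (R' u) (\<phi> x) (\<phi> y) p (snd (F (Cod C u)) x y p f)"
  shows "assemble C E \<phi> F \<in> efunctors (prod_cat Delta C) E E'"
proof -
  let ?B = "prod_cat Delta C"
  interpret E: levelwise C E D R by fact
  interpret E': levelwise C E' D' R' by fact
  let ?T = "assemble C E \<phi> F"
  note s = assemble_simps
  have in': "snd (F c) x y p f \<in> pob (EHom (D' c) (\<phi> x) (\<phi> y)) p"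
    if "c \<in> Ob C" "x \<in> EOb E" "y \<in> EOb E" "f \<in> pob (EHom (D c) x y) p" for c x y p f
    using efunctorsE(1)[OF F[OF that(1)], of x y p f] that \<phi> by (simp add: E.level_ob)
  show ?thesis
  proof (rule efunctorsI)
    fix x y assume xy: "x \<in> EOb E" "y \<in> EOb E"
    show "snd ?T x y \<in> psh_hom ?B (EHom E x y) (EHom E' (fst ?T x) (fst ?T y))"
    proof (rule psh_homI)
      show "snd ?T x y \<in> extensional (Ob ?B)" using xy by (simp add: assemble_def)
    next
      fix a assume a: "a \<in> Ob ?B"
      obtain p c where p: "a = (p, c)" "c \<in> Ob C" using a by auto
      show "snd ?T x y a \<in> extensional (pob (EHom E x y) a)"
        using efunctorsE(4)[OF F[OF p(2)], of x y p] xy p by (simp add: s E.hom E.level_ob)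
      fix f assume "f \<in> pob (EHom E x y) a"
      then show "snd ?T x y a f \<in> pob (EHom E' (fst ?T x) (fst ?T y)) a"
        using in'[OF p(2) xy] xy p by (simp add: s E.hom E'.hom \<phi>E)
    next
      fix w f assume w: "w \<in> Ar ?B" and f: "f \<in> pob (EHom E x y) (Cod ?B w)"
      from w obtain q \<theta> p u where w: "w = ((q, \<theta>, p), u)" "\<theta> \<in> delta_hom q p" "u \<in> Ar C" by (elim E.arrow_cases)
      note c = categoryE(1,2)[OF E.base w(3)]
      have f': "f \<in> pob (EHom (D (Cod C u)) x y) p" using f xy c by (simp add: w(1) E.hom)
      have "snd ?T x y (Dom ?B w) (pmap (EHom E x y) w f) =
        snd (F (Dom C u)) x y q (pmap (EHom (D (Dom C u)) x y) (q, \<theta>, p) (snd (R u) x y p f))"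
        using xy c by (simp add: w(1) s E.restr[OF w(3,2) xy f'])
      also have "\<dots> = pmap (EHom (D' (Dom C u)) (\<phi> x) (\<phi> y)) (q, \<theta>, p) (snd (F (Dom C u)) x y p (snd (R u) x y p f))"
        using efunctorsE(2)[OF F[OF c(1)], of x y "(q, \<theta>, p)"] E.trans_in[OF w(3) xy f'] xy c w(2)
        by (simp add: E.level_ob \<phi>)
      also have "\<dots> = pmap (EHom E' (fst ?T x) (fst ?T y)) w (snd ?T x y (Cod ?B w) f)"
        using xy c by (simp add: w(1) s square[OF w(3) xy f'] E'.restr[OF w(3,2) \<phi>E \<phi>E in'[OF c(2) xy f']])
      finally show "snd ?T x y (Dom ?B w) (pmap (EHom E x y) w f) =
        pmap (EHom E' (fst ?T x) (fst ?T y)) w (snd ?T x y (Cod ?B w) f)" .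
    qed
  next
    fix x a assume x: "x \<in> EOb E" and "a \<in> Ob ?B"
    then obtain p c where p: "a = (p, c)" "c \<in> Ob C" by auto
    show "snd ?T x x a (EId E x a) = EId E' (fst ?T x) a"
      using efunctorsD(3)[OF F[OF p(2)], of x p] x p by (simp add: s E.unit E'.unit E.level_ob \<phi> \<phi>E)
  next
    fix x y z a f g assume xyz: "x \<in> EOb E" "y \<in> EOb E" "z \<in> EOb E" and "a \<in> Ob ?B"
      and f: "f \<in> pob (EHom E x y) a" and g: "g \<in> pob (EHom E y z) a"
    then obtain p c where p: "a = (p, c)" "c \<in> Ob C" by auto
    show "snd ?T x z a (EComp E x y z a f g) = EComp E' (fst ?T x) (fst ?T y) (fst ?T z) a (snd ?T x y a f) (snd ?T y z a g)"
      using efunctorsD(4)[OF F[OF p(2)], of x y z p f g] xyz p f g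
      by (simp add: s E.comp E'.comp E.hom E.level_ob \<phi> \<phi>E in')
  qed (simp_all add: assemble_def \<phi>E)
qed

definition transition where
  "transition C X = (\<lambda>u. rigidify_map (slice C X (Cod C u)) (slice C X (Dom C u)) (slice_restrict C X u))"

text \<open>The transition functors fix objects because vertices carry no label in \<open>C\<close>.\<close>

lemma realization_levelwise:
  assumes C: "category C" and X: "presheaf (Theta C) X"
  shows "levelwise C (realization_ob C X) (\<lambda>c. rigidify (slice C X c))
    (transition C X)"
proof -
  note sp = slice_presheaf[OF C X] and sr = slice_restrict_hom[OF C X]
  have ob: "EOb (realization_ob C X) = pob X (cell C 0 undefined)" by (simp add: realization_ob_def)
  have z: "slice_restrict C X u 0 x = x" if "u \<in> Ar C" "x \<in> pob X (cell C 0 undefined)" for u x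
    using that k_pmap(4)[OF C X that] by (simp add: slice_restrict_simps k_ob_zero)
  have comp: "slice_restrict C X (Cmp C v u) = psh_comp Delta (slice C X (Cod C v)) (slice_restrict C X u) (slice_restrict C X v)"
    if u: "u \<in> Ar C" "v \<in> Ar C" "Cod C u = Dom C v" for u v
  proof (rule family_eqI[where A = UNIV and X = "pob (slice C X (Cod C v))"])
    fix n x assume "x \<in> pob (slice C X (Cod C v)) n"
    then have x: "x \<in> pob X (k_ob C (n, Cod C v))" by (simp add: slice_simps)
    show "slice_restrict C X (Cmp C v u) n x = psh_comp Delta (slice C X (Cod C v)) (slice_restrict C X u) (slice_restrict C X v) n x"
      using k_pmap(1)[OF C X delta_hom_id u(2) x] k_pmap(2)[OF C X delta_hom_id delta_hom_id u x] x u
      by (simp add: psh_comp_simps slice_simps slice_restrict_simps categoryE[OF C] compose_id_left[OF delta_hom_id])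
  qed (use u categoryE(8)[OF C] in \<open>simp_all add: slice_restrict_def psh_comp_simps\<close>)
  show ?thesis
    unfolding transition_def
  proof (unfold_locales)
    fix c assume "c \<in> Ob C"
    then show "enriched_category Delta (rigidify (slice C X c))" by (rule rigidify_enriched[OF sp])
  next
    fix u assume "u \<in> Ar C"
    then show "rigidify_map (slice C X (Cod C u)) (slice C X (Dom C u)) (slice_restrict C X u)
        \<in> efunctors Delta (rigidify (slice C X (Cod C u))) (rigidify (slice C X (Dom C u)))"
      using rigidify_map_efunctor[OF sp sp sr] categoryE[OF C] by simp
  next
    fix c x y f p assume c: "c \<in> Ob C" and f: "f \<in> pob (EHom (rigidify (slice C X c)) x y) p"
    show "snd (rigidify_map (slice C X (Cod C (Idn C c))) (slice C X (Dom C (Idn C c))) (slice_restrict C X (Idn C c))) x y p f = f"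
      using rigidify_map_id[OF sp[OF c] _ _ f, of "slice_restrict C X (Idn C c)"] sr[of "Idn C c"] k_pmap(3)[OF C X c]
        categoryE(3-5)[OF C c] by (simp add: slice_simps slice_restrict_simps)
  next
    fix u v x y f p assume u: "u \<in> Ar C" "v \<in> Ar C" "Cod C u = Dom C v"
      and x: "x \<in> EOb (realization_ob C X)" "y \<in> EOb (realization_ob C X)"
      and f: "f \<in> pob (EHom (rigidify (slice C X (Cod C v))) x y) p"
    show "snd (rigidify_map (slice C X (Cod C (Cmp C v u))) (slice C X (Dom C (Cmp C v u))) (slice_restrict C X (Cmp C v u))) x y p f =
       snd (rigidify_map (slice C X (Cod C u)) (slice C X (Dom C u)) (slice_restrict C X u)) x y p
        (snd (rigidify_map (slice C X (Cod C v)) (slice C X (Dom C v)) (slice_restrict C X v)) x y p f)"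
      using rigidify_map_comp[OF sp[OF categoryE(2)[OF C u(2)]] sp[OF categoryE(1)[OF C u(2)]] sr[OF u(2)] sr[OF u(1), unfolded u(3)] f]
        u x comp[OF u] z[OF u(2)] categoryE[OF C] by (simp add: ob)
  next
    fix u \<theta> q p x y f assume "\<theta> \<in> delta_hom q p"
    show "pmap (EHom (realization_ob C X) x y) ((q, \<theta>, p), u) f =
       pmap (EHom (rigidify (slice C X (Dom C u))) x y) (q, \<theta>, p)
        (snd (rigidify_map (slice C X (Cod C u)) (slice C X (Dom C u)) (slice_restrict C X u)) x y p f)"
      by (simp add: realization_ob_def)
  qed (simp_all add: C realization_ob_def slice_simps k_ob_zero rigidify_map_def z)
qed

definition realization_map where
  "realization_map C X Y \<alpha> = assemble C (realization_ob C X) (\<alpha> (cell C 0 undefined))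
     (\<lambda>c. rigidify_map (slice C X c) (slice C Y c) (slice_map C \<alpha> c))"

lemma realization_ar_eq:
  assumes "\<alpha> \<in> psh_hom (Theta C) X Y"
  shows "realization_ar C (X, \<alpha>, Y) = (realization_ob C X, realization_map C X Y \<alpha>, realization_ob C Y)"
proof -
  have "cell C 0 undefined \<in> Ob (Theta C)" by (rule cell_zero_in)
  then have "restrict (\<alpha> (cell C 0 undefined)) (EOb (realization_ob C X)) = \<alpha> (cell C 0 undefined)"
    using psh_homE(4)[OF assms] by (simp add: realization_ob_def extensional_restrict)
  then show ?thesis by (simp add: realization_ar_def realization_map_def assemble_def)
qed

lemma realization_map_in:
  assumes C: "category C" and X: "presheaf (Theta C) X" and Y: "presheaf (Theta C) Y"
    and a: "\<alpha> \<in> psh_hom (Theta C) X Y"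
  shows "realization_map C X Y \<alpha> \<in> efunctors (prod_cat Delta C) (realization_ob C X) (realization_ob C Y)"
  unfolding realization_map_def
proof (rule assemble_efunctor[OF realization_levelwise[OF C X, unfolded transition_def]
      realization_levelwise[OF C Y, unfolded transition_def]])
  have ob: "EOb (realization_ob C X) = pob X (cell C 0 undefined)" for X by (simp add: realization_ob_def)
  have cell: "cell C 0 undefined \<in> Ob (Theta C)" by (rule cell_zero_in)
  note sp = slice_presheaf[OF C] and sr = slice_restrict_hom[OF C] and sm = slice_map_hom[OF C a]
  show "rigidify_map (slice C X c) (slice C Y c) (slice_map C \<alpha> c) \<in> efunctors Delta (rigidify (slice C X c)) (rigidify (slice C Y c))"
    if "c \<in> Ob C" for c using rigidify_map_efunctor[OF sp[OF X that] sp[OF Y that] sm[OF that]] .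
  show "fst (rigidify_map (slice C X c) (slice C Y c) (slice_map C \<alpha> c)) x = \<alpha> (cell C 0 undefined) x" for c x
    by (simp add: rigidify_map_def slice_map_def k_ob_zero)
  show "\<alpha> (cell C 0 undefined) x \<in> EOb (realization_ob C Y)" if "x \<in> EOb (realization_ob C X)" for x
    using psh_homE(1)[OF a cell] that by (simp add: ob)
  fix u x y p f assume u: "u \<in> Ar C" and x: "x \<in> EOb (realization_ob C X)" "y \<in> EOb (realization_ob C X)"
    and f: "f \<in> pob (EHom (rigidify (slice C X (Cod C u))) x y) p"
  note c = categoryE(1,2)[OF C u]
  have z: "slice_restrict C X u 0 x = x" if "x \<in> pob X (cell C 0 undefined)" for x
    using that k_pmap(4)[OF C X u that] by (simp add: slice_restrict_simps k_ob_zero)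
  show "snd (rigidify_map (slice C X (Dom C u)) (slice C Y (Dom C u)) (slice_map C \<alpha> (Dom C u))) x y p
        (snd (rigidify_map (slice C X (Cod C u)) (slice C X (Dom C u)) (slice_restrict C X u)) x y p f) =
       snd (rigidify_map (slice C Y (Cod C u)) (slice C Y (Dom C u)) (slice_restrict C Y u)) (\<alpha> (cell C 0 undefined) x) (\<alpha> (cell C 0 undefined) y) p
        (snd (rigidify_map (slice C X (Cod C u)) (slice C Y (Cod C u)) (slice_map C \<alpha> (Cod C u))) x y p f)"
    using rigidify_map_comp[OF sp[OF X c(2)] sp[OF X c(1)] sr[OF X u] sm[OF c(1)] f]
      rigidify_map_comp[OF sp[OF X c(2)] sp[OF Y c(2)] sm[OF c(2)] sr[OF Y u] f] x z
    by (simp add: ob slice_map_restrict[OF C X a u] slice_map_zero)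
qed

lemma realization_is_functor:
  assumes C: "category C"
  shows "is_functor (psh_cat (Theta C)) (ecat_cat (prod_cat Delta C)) (realization C)"
  unfolding is_functor_def
proof (intro conjI ballI impI psh_cat_category[OF Theta_category[OF C]] ecat_cat_category prod_cat_category category_Delta C)
  let ?B = "prod_cat Delta C"
  let ?P = "psh_cat (Theta C)"
  note T = Theta_category[OF C]
  have cell: "cell C 0 undefined \<in> Ob (Theta C)" by (rule cell_zero_in)
  have ob: "EOb (realization_ob C X) = pob X (cell C 0 undefined)" for X :: "('a, 'b, 'c) cellular_set" by (simp add: realization_ob_def)
  have B: "category ?B" by (rule prod_cat_category[OF category_Delta C])
  note sp = slice_presheaf[OF C] and sm = slice_map_hom[OF C]
  {
    fix X :: "('a, 'b, 'c) cellular_set" assume "X \<in> Ob ?P"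
    then have X: "presheaf (Theta C) X" by (simp add: psh_cat_def)
    note L = realization_levelwise[OF C X]
    interpret levelwise C "realization_ob C X" "\<lambda>c. rigidify (slice C X c)"
      "transition C X" by (rule L)
    show "fst (realization C) X \<in> Ob (ecat_cat ?B)"
      using enriched by (simp add: realization_def ecat_cat_def)
    note i = psh_id_in[OF T X]
    have "realization_map C X X (psh_id (Theta C) X) = efun_id ?B (realization_ob C X)"
    proof (rule efunctors_eqI[OF realization_map_in[OF C X X i] efun_id_in[OF B enriched]])
      fix x y a f assume xy: "x \<in> EOb (realization_ob C X)" "y \<in> EOb (realization_ob C X)"
        and "a \<in> Ob ?B" "f \<in> pob (EHom (realization_ob C X) x y) a"
      moreover from this obtain p c where "a = (p, c)" "c \<in> Ob C" by auto
      ultimately show "snd (realization_map C X X (psh_id (Theta C) X)) x y a f = snd (efun_id ?B (realization_ob C X)) x y a f"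
        using rigidify_map_id[OF sp[OF X], of c "slice_map C (psh_id (Theta C) X) c" f x y p] sm[OF i, of c] k_ob_in[of c C]
        by (simp add: realization_map_def assemble_simps efun_id_simps psh_id_apply hom slice_map_def slice_simps)
    qed (simp add: realization_map_def assemble_simps ob psh_id_apply[OF cell] efun_id_simps)
    then show "snd (realization C) (Idn ?P X) = Idn (ecat_cat ?B) (fst (realization C) X)"
      by (simp add: realization_def psh_cat_def ecat_cat_def realization_ar_eq[OF i])
  next
    fix u assume u: "u \<in> Ar (?P :: (('a, 'b, 'c) cellular_set, _) cat)"
    obtain X \<alpha> Y where u': "u = (X, \<alpha>, Y)" by (cases u)
    have X: "presheaf (Theta C) X" and Y: "presheaf (Theta C) Y" and a: "\<alpha> \<in> psh_hom (Theta C) X Y"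
      using u by (simp_all add: u' psh_cat_def)
    show "snd (realization C) u \<in> Ar (ecat_cat ?B)"
      using realization_map_in[OF C X Y a] levelwise.enriched[OF realization_levelwise[OF C X]]
        levelwise.enriched[OF realization_levelwise[OF C Y]]
      by (simp add: u' realization_def ecat_cat_def realization_ar_eq[OF a])
    show "Dom (ecat_cat ?B) (snd (realization C) u) = fst (realization C) (Dom ?P u)"
      "Cod (ecat_cat ?B) (snd (realization C) u) = fst (realization C) (Cod ?P u)"
      by (simp_all add: u' realization_def ecat_cat_def psh_cat_def realization_ar_eq[OF a])
  next
    fix u v assume u: "u \<in> Ar (?P :: (('a, 'b, 'c) cellular_set, _) cat)"
      and v: "v \<in> Ar (?P :: (('a, 'b, 'c) cellular_set, _) cat)" and uv: "Cod ?P u = Dom ?P v"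
    obtain X \<alpha> Y where u': "u = (X, \<alpha>, Y)" by (cases u)
    obtain \<beta> Z where v': "v = (Y, \<beta>, Z)" using uv by (cases v) (simp add: u' psh_cat_def)
    have X: "presheaf (Theta C) X" and Y: "presheaf (Theta C) Y" and Z: "presheaf (Theta C) Z"
      and a: "\<alpha> \<in> psh_hom (Theta C) X Y" and b: "\<beta> \<in> psh_hom (Theta C) Y Z"
      using u v by (simp_all add: u' v' psh_cat_def)
    interpret X: levelwise C "realization_ob C X" "\<lambda>c. rigidify (slice C X c)"
      "transition C X" by (rule realization_levelwise[OF C X])
    note ba = psh_comp_in[OF T X a b]
    note RX = realization_map_in[OF C X Y a] and RY = realization_map_in[OF C Y Z b]
    have "realization_map C X Z (psh_comp (Theta C) X \<beta> \<alpha>) =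
      efun_comp ?B (realization_ob C X) (realization_map C Y Z \<beta>) (realization_map C X Y \<alpha>)"
    proof (rule efunctors_eqI[OF realization_map_in[OF C X Z ba] efun_comp_in[OF B X.enriched RX RY]])
      fix x y e f assume xy: "x \<in> EOb (realization_ob C X)" "y \<in> EOb (realization_ob C X)"
        and e: "e \<in> Ob ?B" and f: "f \<in> pob (EHom (realization_ob C X) x y) e"
      obtain p c where p: "e = (p, c)" "c \<in> Ob C" using e by auto
      have f': "f \<in> pob (EHom (rigidify (slice C X c)) x y) p" using f xy p by (simp add: X.hom)
      have "psh_comp Delta (slice C X c) (slice_map C \<beta> c) (slice_map C \<alpha> c) = slice_map C (psh_comp (Theta C) X \<beta> \<alpha>) c"
        using k_ob_in[OF p(2)] by (simp add: psh_comp_def slice_map_def slice_simps restrict_UNIV)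
      then show "snd (realization_map C X Z (psh_comp (Theta C) X \<beta> \<alpha>)) x y e f =
        snd (efun_comp ?B (realization_ob C X) (realization_map C Y Z \<beta>) (realization_map C X Y \<alpha>)) x y e f"
        using rigidify_map_comp[OF sp[OF X p(2)] sp[OF Y p(2)] sm[OF a p(2)] sm[OF b p(2)] f'] xy p f e
          efunctorsD(1)[OF RX xy(1)] efunctorsD(1)[OF RX xy(2)]
        by (simp add: efun_comp_simps realization_map_def assemble_simps slice_map_zero)
    next
      fix x assume x: "x \<in> EOb (realization_ob C X)"
      then show "fst (realization_map C X Z (psh_comp (Theta C) X \<beta> \<alpha>)) x =
        fst (efun_comp ?B (realization_ob C X) (realization_map C Y Z \<beta>) (realization_map C X Y \<alpha>)) x"
        using efunctorsD(1)[OF RX x] cell by (simp add: efun_comp_simps realization_map_def assemble_simps ob psh_comp_simps)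
    qed
    then show "snd (realization C) (Cmp ?P v u) =
       Cmp (ecat_cat ?B) (snd (realization C) v) (snd (realization C) u)"
      by (simp add: u' v' realization_def psh_cat_def ecat_cat_def realization_ar_eq[OF a] realization_ar_eq[OF b] realization_ar_eq[OF ba])
  }
qed

section \<open>The nerve of a free category on a linear quiver\<close>

text \<open>The quiver has vertices \<open>0, \<dots>, n\<close> and edges \<open>S k\<close> from \<open>k - 1\<close> to \<open>k\<close>. A simplex of the nerve of
  its free category is a monotone sequence of vertices together with one edge for each step
  between the first and the last of them.\<close>

definition path_nerve :: "nat \<Rightarrow> (nat \<Rightarrow> 's set) \<Rightarrow> ((nat \<Rightarrow> nat) \<times> (nat \<Rightarrow> 's)) sset" where
  "path_nerve n S =
     \<lparr>pob = (\<lambda>m. {(\<gamma>, x). \<gamma> \<in> delta_hom m n \<and> x \<in> (\<Pi>\<^sub>E l\<in>{\<gamma> 0<..\<gamma> m}. S l)}),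
      pmap = (\<lambda>(k, \<theta>, m) (\<gamma>, x). (compose {..k} \<gamma> \<theta>, restrict x {\<gamma> (\<theta> 0)<..\<gamma> (\<theta> k)}))\<rparr>"

text \<open>The slices of \<open>Q\<close>: a morphism is a path in the quiver together with a simplex of the cube that has
  one coordinate for each intermediate vertex.\<close>

definition linear_scat :: "nat \<Rightarrow> (nat \<Rightarrow> 's set) \<Rightarrow> (nat, 's qmor) scat" where
  "linear_scat n S =
     \<lparr>EOb = {..n},
      EHom = (\<lambda>i j.
        \<lparr>pob = (\<lambda>p. if i \<le> j then (\<Pi>\<^sub>E l\<in>{i<..j}. S l) \<times> pob (psh_prod {i<..<j} (\<lambda>k. std_simplex 1)) p else {}),
         pmap = (\<lambda>\<theta> (x, t). (x, pmap (psh_prod {i<..<j} (\<lambda>k. std_simplex 1)) \<theta> t))\<rparr>),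
      EId = (\<lambda>i p. (\<lambda>k. undefined, \<lambda>k. undefined)),
      EComp = (\<lambda>i j k p (x, t) (y, s).
        (\<lambda>l\<in>{i<..k}. if l \<le> j then x l else y l,
         \<lambda>l\<in>{i<..<k}. if l < j then t l else if l = j then (\<lambda>r\<in>{..p}. 1) else s l))\<rparr>"

lemma path_nerve_simps:
  "\<sigma> \<in> pob (path_nerve n S) m \<longleftrightarrow> fst \<sigma> \<in> delta_hom m n \<and> snd \<sigma> \<in> (\<Pi>\<^sub>E l\<in>{fst \<sigma> 0<..fst \<sigma> m}. S l)"
  "pmap (path_nerve n S) (k, \<theta>, m) \<sigma> = (compose {..k} (fst \<sigma>) \<theta>, restrict (snd \<sigma>) {fst \<sigma> (\<theta> 0)<..fst \<sigma> (\<theta> k)})"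
  by (auto simp: path_nerve_def split: prod.splits)

lemma linear_ob [simp]: "EOb (linear_scat n S) = {..n}"
  by (simp add: linear_scat_def)

lemma linear_hom:
  "f \<in> pob (EHom (linear_scat n S) i j) p \<longleftrightarrow> i \<le> j \<and>
     fst f \<in> extensional {i<..j} \<and> (\<forall>l. i < l \<longrightarrow> l \<le> j \<longrightarrow> fst f l \<in> S l) \<and>
     snd f \<in> extensional {i<..<j} \<and> (\<forall>l. i < l \<longrightarrow> l < j \<longrightarrow> snd f l \<in> delta_hom p 1)"
  by (cases f) (auto simp: linear_scat_def psh_prod_def std_simplex_def PiE_iff)

lemma linear_pmap:
  "pmap (EHom (linear_scat n S) i j) (q, \<theta>, p) f = (fst f, \<lambda>l\<in>{i<..<j}. compose {..q} (snd f l) \<theta>)"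
  by (simp add: linear_scat_def psh_prod_def std_simplex_def split: prod.splits)

lemma linear_id: "EId (linear_scat n S) i p = (\<lambda>k. undefined, \<lambda>k. undefined)"
  by (simp add: linear_scat_def)

lemma linear_comp:
  "EComp (linear_scat n S) i j k p f g =
     (\<lambda>l\<in>{i<..k}. if l \<le> j then fst f l else fst g l,
      \<lambda>l\<in>{i<..<k}. if l < j then snd f l else if l = j then (\<lambda>r\<in>{..p}. 1) else snd g l)"
  by (cases f, cases g) (auto simp: linear_scat_def)

lemma linear_eqI:
  assumes "f \<in> pob (EHom (linear_scat n S) i j) p" "g \<in> pob (EHom (linear_scat n S) i j) p"
    and "\<And>l. i < l \<Longrightarrow> l \<le> j \<Longrightarrow> fst f l = fst g l"
    and "\<And>l r. i < l \<Longrightarrow> l < j \<Longrightarrow> r \<le> p \<Longrightarrow> snd f l r = snd g l r"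
  shows "f = g"
proof (rule prod_eqI)
  show "fst f = fst g"
    by (rule extensionalityI[where A = "{i<..j}"]) (use assms(1-3) in \<open>simp_all add: linear_hom\<close>)
  show "snd f = snd g"
  proof (rule extensionalityI[where A = "{i<..<j}"])
    fix l assume l: "l \<in> {i<..<j}"
    then have "snd f l \<in> delta_hom p 1" "snd g l \<in> delta_hom p 1" using assms(1,2) by (simp_all add: linear_hom)
    then show "snd f l = snd g l"
      using assms(4)[of l] l by (intro extensionalityI[OF delta_homD(4) delta_homD(4)]) auto
  qed (use assms(1,2) in \<open>simp_all add: linear_hom\<close>)
qed

lemma delta_const: "(\<lambda>r\<in>{..p}. Suc 0) \<in> delta_hom p (Suc 0)"
  by (rule delta_homI) auto

lemma linear_comp_in:
  assumes "f \<in> pob (EHom (linear_scat n S) i j) p" "g \<in> pob (EHom (linear_scat n S) j k) p"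
  shows "EComp (linear_scat n S) i j k p f g \<in> pob (EHom (linear_scat n S) i k) p"
  using assms unfolding linear_hom linear_comp by (auto simp: delta_const)

lemma linear_pmap_in:
  assumes "f \<in> pob (EHom (linear_scat n S) i j) p" "\<theta> \<in> delta_hom q p"
  shows "pmap (EHom (linear_scat n S) i j) (q, \<theta>, p) f \<in> pob (EHom (linear_scat n S) i j) q"
  using assms delta_hom_compose[OF assms(2)] unfolding linear_hom linear_pmap by simp

lemma linear_id_in: "EId (linear_scat n S) i p \<in> pob (EHom (linear_scat n S) i i) p"
  by (simp add: linear_hom linear_id extensional_def)

lemma linear_presheaf: "presheaf Delta (EHom (linear_scat n S) i j)" (is "presheaf _ ?H")
  unfolding presheaf_Delta
proof (intro conjI allI impI)
  fix p f assume f: "f \<in> pob ?H p"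
  show "pmap ?H (p, \<lambda>i\<in>{..p}. i, p) f = f"
    by (rule linear_eqI[OF linear_pmap_in[OF f delta_hom_id] f]) (simp_all add: linear_pmap compose_def)
next
  fix l m k \<theta> \<eta> f assume t: "\<theta> \<in> delta_hom l m" and e: "\<eta> \<in> delta_hom m k" and f: "f \<in> pob ?H k"
  show "pmap ?H (l, compose {..l} \<eta> \<theta>, k) f =
    pmap ?H (l, \<theta>, m) (pmap ?H (m, \<eta>, k) f)"
    by (rule linear_eqI[OF linear_pmap_in[OF f delta_hom_compose[OF t e]] linear_pmap_in[OF linear_pmap_in[OF f e] t]])
      (simp_all add: linear_pmap compose_def delta_homD[OF t])
qed (rule linear_pmap_in)

lemma linear_enriched: "enriched_category Delta (linear_scat n S)" (is "enriched_category _ ?L")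
  unfolding enriched_category_def Ball_Ar_Delta
proof (intro conjI ballI allI impI)
  fix x assume "x \<in> EOb ?L"
  fix q p \<theta> assume t: "\<theta> \<in> delta_hom q p"
  have "pmap (EHom ?L x x) (q, \<theta>, p) (EId ?L x p) = EId ?L x q"
    by (rule linear_eqI[OF linear_pmap_in[OF linear_id_in t] linear_id_in]) simp_all
  then show "pmap (EHom ?L x x) (q, \<theta>, p) (EId ?L x (Cod Delta (q, \<theta>, p))) =
     EId ?L x (Dom Delta (q, \<theta>, p))" by simp
next
  fix x y z q p \<theta> f g assume t: "\<theta> \<in> delta_hom q p" 
    and "f \<in> pob (EHom ?L x y) (Cod Delta (q, \<theta>, p))" "g \<in> pob (EHom ?L y z) (Cod Delta (q, \<theta>, p))"
  then have f: "f \<in> pob (EHom ?L x y) p" and g: "g \<in> pob (EHom ?L y z) p" by simp_all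
  have "pmap (EHom ?L x z) (q, \<theta>, p) (EComp ?L x y z p f g) =
    EComp ?L x y z q (pmap (EHom ?L x y) (q, \<theta>, p) f) (pmap (EHom ?L y z) (q, \<theta>, p) g)"
    by (rule linear_eqI[OF linear_pmap_in[OF linear_comp_in[OF f g] t] linear_comp_in[OF linear_pmap_in[OF f t] linear_pmap_in[OF g t]]])
      (auto simp: linear_pmap linear_comp compose_def delta_homD[OF t])
  then show "pmap (EHom ?L x z) (q, \<theta>, p) (EComp ?L x y z (Cod Delta (q, \<theta>, p)) f g) =
     EComp ?L x y z (Dom Delta (q, \<theta>, p)) (pmap (EHom ?L x y) (q, \<theta>, p) f)
           (pmap (EHom ?L y z) (q, \<theta>, p) g)" by simp
next
  fix x y p f assume f: "f \<in> pob (EHom ?L x y) p"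
  show "EComp ?L x x y p (EId ?L x p) f = f"
    by (rule linear_eqI[OF linear_comp_in[OF linear_id_in f] f]) (simp_all add: linear_comp)
  show "EComp ?L x y y p f (EId ?L y p) = f"
    by (rule linear_eqI[OF linear_comp_in[OF f linear_id_in] f]) (simp_all add: linear_comp)
next
  fix w x y z p f g h assume f: "f \<in> pob (EHom ?L w x) p" and g: "g \<in> pob (EHom ?L x y) p"
    and h: "h \<in> pob (EHom ?L y z) p"
  have "w \<le> x" "x \<le> y" "y \<le> z" using f g h by (simp_all add: linear_hom)
  then show "EComp ?L w y z p (EComp ?L w x y p f g) h =
      EComp ?L w x z p f (EComp ?L x y z p g h)"
    by (intro linear_eqI[OF linear_comp_in[OF linear_comp_in[OF f g] h] linear_comp_in[OF f linear_comp_in[OF g h]]])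
      (auto simp: linear_comp)
qed (simp_all add: linear_presheaf linear_id_in linear_comp_in)

text \<open>A simplex of the nerve sends a chain of subsets to the edges along the way and, for each
  intermediate vertex of the quiver, the indicator of its membership in the image of the chain.\<close>

definition path_value :: "nat \<Rightarrow> (nat \<Rightarrow> nat) \<Rightarrow> (nat \<Rightarrow> 's) \<Rightarrow> nat \<Rightarrow> nat \<Rightarrow> chain \<Rightarrow> 's qmor" where
  "path_value p \<gamma> x i j A =
     (restrict x {\<gamma> i<..\<gamma> j}, \<lambda>l\<in>{\<gamma> i<..<\<gamma> j}. \<lambda>r\<in>{..p}. if l \<in> \<gamma> ` A r then 1 else 0)"

definition path_functor where
  "path_functor m \<gamma> x =
     (\<gamma>, \<lambda>i\<in>{..m}. \<lambda>j\<in>{..m}. \<lambda>p. \<lambda>A\<in>pob (EHom (coherent_simplex m) i j) p. path_value p \<gamma> x i j A)"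

lemma coh_image_bounds:
  assumes A: "A \<in> pob (EHom (coherent_simplex m) i j) p" and g: "\<gamma> \<in> delta_hom m n" and j: "j \<le> m" and r: "r \<le> p"
  shows "\<gamma> i \<in> \<gamma> ` A r" "\<gamma> j \<in> \<gamma> ` A r" "l \<in> \<gamma> ` A r \<Longrightarrow> \<gamma> i \<le> l \<and> l \<le> \<gamma> j"
proof -
  have "(\<lambda>r\<in>{..p}. \<gamma> ` A r) \<in> pob (EHom (coherent_simplex n) (\<gamma> i) (\<gamma> j)) p" by (rule coh_image[OF A g j])
  then have *: "\<gamma> i \<in> \<gamma> ` A r \<and> \<gamma> j \<in> \<gamma> ` A r \<and> \<gamma> ` A r \<subseteq> {\<gamma> i..\<gamma> j}" using r unfolding coh_hom by simp
  then show "\<gamma> i \<in> \<gamma> ` A r" "\<gamma> j \<in> \<gamma> ` A r" by blast+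
  show "\<gamma> i \<le> l \<and> l \<le> \<gamma> j" if "l \<in> \<gamma> ` A r" using * that by (meson atLeastAtMost_iff subsetD)
qed

lemma path_value_in:
  assumes s: "(\<gamma>, x) \<in> pob (path_nerve n S) m" and A: "A \<in> pob (EHom (coherent_simplex m) i j) p" and j: "j \<le> m"
  shows "path_value p \<gamma> x i j A \<in> pob (EHom (linear_scat n S) (\<gamma> i) (\<gamma> j)) p"
proof -
  have g: "\<gamma> \<in> delta_hom m n" and x: "x \<in> (\<Pi>\<^sub>E l\<in>{\<gamma> 0<..\<gamma> m}. S l)" using s by (simp_all add: path_nerve_simps)
  have b: "\<gamma> 0 \<le> \<gamma> i" "\<gamma> i \<le> \<gamma> j" "\<gamma> j \<le> \<gamma> m"
    using coh_le[OF A] j delta_homD(2)[OF g] by simp_all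
  have "x l \<in> S l" if "\<gamma> i < l" "l \<le> \<gamma> j" for l using x that b by (auto simp: PiE_iff)
  moreover have "(\<lambda>r\<in>{..p}. if l \<in> \<gamma> ` A r then 1 else 0) \<in> delta_hom p 1" for l
  proof (rule delta_homI)
    fix r s assume "r \<le> s" "s \<le> p"
    moreover from this have "A r \<subseteq> A s" using A unfolding coh_hom by blast
    ultimately show "(\<lambda>r\<in>{..p}. if l \<in> \<gamma> ` A r then 1 else 0::nat) r \<le> (\<lambda>r\<in>{..p}. if l \<in> \<gamma> ` A r then 1 else 0) s"
      by auto
  qed auto
  ultimately show ?thesis using b by (simp add: linear_hom path_value_def)
qed

text \<open>Compatibility with composition is where the coordinate \<open>1\<close> in the composition of the linear
  category comes from: two composable chains both contain the vertex at which they meet.\<close>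

lemma path_functor_in:
  assumes s: "(\<gamma>, x) \<in> pob (path_nerve n S) m"
  shows "path_functor m \<gamma> x \<in> efunctors Delta (coherent_simplex m) (linear_scat n S)"
proof -
  let ?L = "linear_scat n S"
  let ?P = "path_functor m \<gamma> x"
  let ?C = "coherent_simplex m"
  have g: "\<gamma> \<in> delta_hom m n" using s by (simp add: path_nerve_simps)
  note v = path_value_in[OF s]
  note S = linear_eqI[where S = S and n = n]
  show ?thesis
  proof (rule efunctorsI)
    fix i j assume "i \<in> EOb ?C" "j \<in> EOb ?C"
    then have ij: "i \<le> m" "j \<le> m" by simp_all
    show "snd ?P i j \<in> psh_hom Delta (EHom ?C i j)
      (EHom ?L (fst ?P i) (fst ?P j))"
      unfolding psh_hom_Delta
    proof (intro conjI allI impI)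
      fix p show "snd ?P i j p \<in> pob (EHom ?C i j) p \<rightarrow>\<^sub>E
          pob (EHom ?L (fst ?P i) (fst ?P j)) p"
        using v ij by (simp add: path_functor_def PiE_iff)
    next
      fix q p \<theta> A assume t: "\<theta> \<in> delta_hom q p" and A: "A \<in> pob (EHom ?C i j) p"
      have "path_value q \<gamma> x i j (compose {..q} A \<theta>) = pmap (EHom ?L (\<gamma> i) (\<gamma> j)) (q, \<theta>, p) (path_value p \<gamma> x i j A)"
        by (rule S[OF v[OF coh_pmap[OF A t] ij(2)] linear_pmap_in[OF v[OF A ij(2)] t]])
          (simp_all add: path_value_def linear_pmap compose_def delta_homD[OF t])
      then show "snd ?P i j q (pmap (EHom ?C i j) (q, \<theta>, p) A) =
        pmap (EHom ?L (fst ?P i) (fst ?P j)) (q, \<theta>, p) (snd ?P i j p A)"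
        using ij A coh_pmap[OF A t] by (simp add: path_functor_def)
    qed
  next
    fix i p assume "i \<in> EOb ?C"
    then have i: "i \<le> m" by simp
    have "path_value p \<gamma> x i i (\<lambda>r\<in>{..p}. {i}) = EId ?L (\<gamma> i) p"
      by (rule S[OF v[OF coh_id i] linear_id_in]) simp_all
    then show "snd ?P i i p (EId ?C i p) = EId ?L (fst ?P i) p"
      using i by (simp add: path_functor_def coh_id)
  next
    fix i j k p A B assume "i \<in> EOb ?C" "j \<in> EOb ?C" "k \<in> EOb ?C"
      and A: "A \<in> pob (EHom ?C i j) p" and B: "B \<in> pob (EHom ?C j k) p"
    then have ijk: "i \<le> m" "j \<le> m" "k \<le> m" by simp_all
    note AB = coh_comp[OF A B]
    have "path_value p \<gamma> x i k (\<lambda>r\<in>{..p}. A r \<union> B r) =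
      EComp ?L (\<gamma> i) (\<gamma> j) (\<gamma> k) p (path_value p \<gamma> x i j A) (path_value p \<gamma> x j k B)"
    proof (rule S[OF v[OF AB ijk(3)] linear_comp_in[OF v[OF A ijk(2)] v[OF B ijk(3)]]])
      fix l r assume l: "\<gamma> i < l" "l < \<gamma> k" and r: "r \<le> p"
      note bA = coh_image_bounds[OF A g ijk(2) r] and bB = coh_image_bounds[OF B g ijk(3) r]
      have "l \<in> \<gamma> ` (A r \<union> B r) \<longleftrightarrow> (if l < \<gamma> j then l \<in> \<gamma> ` A r else if l = \<gamma> j then True else l \<in> \<gamma> ` B r)"
        using bA bB by (force simp: image_Un)
      then show "snd (path_value p \<gamma> x i k (\<lambda>r\<in>{..p}. A r \<union> B r)) l r =
        snd (EComp ?L (\<gamma> i) (\<gamma> j) (\<gamma> k) p (path_value p \<gamma> x i j A) (path_value p \<gamma> x j k B)) l r"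
        using l r by (simp add: path_value_def linear_comp)
    qed (simp add: path_value_def linear_comp)
    then show "snd ?P i k p (EComp ?C i j k p A B) =
      EComp ?L (fst ?P i) (fst ?P j) (fst ?P k) p 
       (snd ?P i j p A) (snd ?P j k p B)"
      using ijk A B AB by (simp add: path_functor_def)
  qed (use g in \<open>simp_all add: path_functor_def delta_homD\<close>)
qed

lemma path_functor_natural:
  assumes s: "(\<gamma>, x) \<in> pob (path_nerve n S) m" and t: "\<theta> \<in> delta_hom k m"
  shows "path_functor k (compose {..k} \<gamma> \<theta>) (restrict x {\<gamma> (\<theta> 0)<..\<gamma> (\<theta> k)}) =
    efun_comp Delta (coherent_simplex k) (path_functor m \<gamma> x) (coherent_simplex_map (k, \<theta>, m))"
proof (rule efunctors_eqI)
  let ?L = "linear_scat n S"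
  let ?P = "path_functor k (compose {..k} \<gamma> \<theta>) (restrict x {\<gamma> (\<theta> 0)<..\<gamma> (\<theta> k)})"
  let ?Q = "efun_comp Delta (coherent_simplex k) (path_functor m \<gamma> x) (coherent_simplex_map (k, \<theta>, m))"
  let ?C = "coherent_simplex k"
  have g: "\<gamma> \<in> delta_hom m n" and x: "x \<in> (\<Pi>\<^sub>E l\<in>{\<gamma> 0<..\<gamma> m}. S l)" using s by (simp_all add: path_nerve_simps)
  have b: "\<gamma> 0 \<le> \<gamma> (\<theta> 0)" "\<gamma> (\<theta> 0) \<le> \<gamma> (\<theta> k)" "\<gamma> (\<theta> k) \<le> \<gamma> m"
    using delta_homD(1,2)[OF t] delta_homD(2)[OF g] by simp_all
  have s': "(compose {..k} \<gamma> \<theta>, restrict x {\<gamma> (\<theta> 0)<..\<gamma> (\<theta> k)}) \<in> pob (path_nerve n S) k"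
    using delta_hom_compose[OF t g] x b by (auto simp: path_nerve_simps compose_def PiE_iff)
  show "?P \<in> efunctors Delta ?C ?L"
    by (rule path_functor_in[OF s'])
  show "?Q \<in> efunctors Delta ?C ?L"
    by (rule efun_comp_in[OF category_Delta coh_enriched coh_map_efunctor[OF t] path_functor_in[OF s]])
  show "fst ?P i =
      fst ?Q i"
    if "i \<in> EOb ?C" for i using that by (simp add: efun_comp_simps path_functor_def compose_def)
  fix i j p A assume "i \<in> EOb ?C" "j \<in> EOb ?C" and A: "A \<in> pob (EHom ?C i j) p"
  then have ij: "i \<le> k" "j \<le> k" by simp_all
  note A' = coh_image[OF A t ij(2)]
  have sub: "A r \<subseteq> {..k}" if "r \<le> p" for r using A that ij unfolding coh_hom by (meson atLeastAtMost_iff atMost_iff le_trans subsetD subsetI)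
  have img: "compose {..k} \<gamma> \<theta> ` A r = \<gamma> ` \<theta> ` A r" if "r \<le> p" for r
    using sub[OF that] by (force simp: compose_def image_image)
  have c: "compose {..k} \<gamma> \<theta> i = \<gamma> (\<theta> i)" "compose {..k} \<gamma> \<theta> j = \<gamma> (\<theta> j)" using ij by (simp_all add: compose_def)
  have "\<gamma> (\<theta> 0) \<le> \<gamma> (\<theta> i)" "\<gamma> (\<theta> j) \<le> \<gamma> (\<theta> k)" using ij delta_homD[OF t] delta_homD(2)[OF g] by simp_all
  then have "restrict (restrict x {\<gamma> (\<theta> 0)<..\<gamma> (\<theta> k)}) {\<gamma> (\<theta> i)<..\<gamma> (\<theta> j)} = restrict x {\<gamma> (\<theta> i)<..\<gamma> (\<theta> j)}"
    by (auto simp: fun_eq_iff)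
  then have "path_value p (compose {..k} \<gamma> \<theta>) (restrict x {\<gamma> (\<theta> 0)<..\<gamma> (\<theta> k)}) i j A = path_value p \<gamma> x (\<theta> i) (\<theta> j) (\<lambda>r\<in>{..p}. \<theta> ` A r)"
    by (simp add: path_value_def c img del: restrict_apply cong: restrict_cong) (simp add: img cong: restrict_cong)
  then show "snd ?P i j p A =
      snd ?Q i j p A"
    using ij A A' delta_homD(1)[OF t] by (simp add: efun_comp_simps path_functor_def)
qed

section \<open>Rigidification of the nerve\<close>

text \<open>Any simplicial set isomorphic to the nerve has the linear simplicial category as its
  rigidification. The universal functor to the latter is determined by the values of simplices.\<close>

locale linear_nerve =
  fixes K :: "'v sset" and n :: nat and S :: "nat \<Rightarrow> 's set" and e :: "nat \<Rightarrow> 'v \<Rightarrow> (nat \<Rightarrow> nat) \<times> (nat \<Rightarrow> 's)"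
  assumes K: "presheaf Delta K" and e: "e \<in> psh_hom Delta K (path_nerve n S)"
    and bij: "bij_betw (e m) (pob K m) (pob (path_nerve n S) m)"
begin

abbreviation "ver m \<sigma> \<equiv> fst (e m \<sigma>)"
abbreviation "lab m \<sigma> \<equiv> snd (e m \<sigma>)"
abbreviation "gval p m \<sigma> i j A \<equiv> path_value p (ver m \<sigma>) (lab m \<sigma>) i j A"
abbreviation "gen m \<sigma> i j p A \<equiv> snd (rigidify_unit K m \<sigma>) i j p A"

definition comparison :: "nat \<Rightarrow> 'v \<Rightarrow> (nat, nat, chain, nat, 's qmor) efun" where
  "comparison m = (\<lambda>\<sigma>\<in>pob K m. path_functor m (ver m \<sigma>) (lab m \<sigma>))"

definition "lift = rigidify_lift K (linear_scat n S) comparison"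

lemma e_in: "\<sigma> \<in> pob K m \<Longrightarrow> (ver m \<sigma>, lab m \<sigma>) \<in> pob (path_nerve n S) m"
  using psh_homD(1)[OF e] by simp

lemma ver: "\<sigma> \<in> pob K m \<Longrightarrow> ver m \<sigma> \<in> delta_hom m n"
  using e_in path_nerve_simps(1) by fastforce

lemma e_pmap:
  "\<theta> \<in> delta_hom k m \<Longrightarrow> \<sigma> \<in> pob K m \<Longrightarrow> e k (pmap K (k, \<theta>, m) \<sigma>) =
     (compose {..k} (ver m \<sigma>) \<theta>, restrict (lab m \<sigma>) {ver m \<sigma> (\<theta> 0)<..ver m \<sigma> (\<theta> k)})"
  using psh_homD(2)[OF e] by (simp add: path_nerve_simps)

lemma e_inj: "\<sigma> \<in> pob K m \<Longrightarrow> \<tau> \<in> pob K m \<Longrightarrow> e m \<sigma> = e m \<tau> \<Longrightarrow> \<sigma> = \<tau>"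
  using bij[of m] unfolding bij_betw_def by (meson inj_onD)

lemma comparison_hom: "comparison \<in> psh_hom Delta K (coherent_nerve (linear_scat n S))"
  unfolding psh_hom_Delta
proof (intro conjI allI impI)
  fix m show "comparison m \<in> pob K m \<rightarrow>\<^sub>E pob (coherent_nerve (linear_scat n S)) m"
    using path_functor_in[OF e_in] by (simp add: comparison_def PiE_iff)
next
  fix k m \<theta> \<sigma> assume t: "\<theta> \<in> delta_hom k m" and s: "\<sigma> \<in> pob K m"
  show "comparison k (pmap K (k, \<theta>, m) \<sigma>) = pmap (coherent_nerve (linear_scat n S)) (k, \<theta>, m) (comparison m \<sigma>)"
    using presheafD(1)[OF K t s] s path_functor_natural[OF e_in[OF s] t] by (simp add: comparison_def e_pmap[OF t s])
qed

lemma lift_efunctor: "lift \<in> efunctors Delta (rigidify K) (linear_scat n S)"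
  unfolding lift_def by (rule rigidify_lift_efunctor[OF K linear_enriched comparison_hom])

lemma lift_gen:
  assumes s: "\<sigma> \<in> pob K m" and ij: "i \<le> m" "j \<le> m" and A: "A \<in> pob (EHom (coherent_simplex m) i j) p"
  shows "snd lift (vertex K m \<sigma> i) (vertex K m \<sigma> j) p (gen m \<sigma> i j p A) = gval p m \<sigma> i j A"
proof -
  have "efun_comp Delta (coherent_simplex m) lift (rigidify_unit K m \<sigma>) = path_functor m (ver m \<sigma>) (lab m \<sigma>)"
    unfolding lift_def rigidify_lift_unit[OF K linear_enriched comparison_hom s] using s by (simp add: comparison_def)
  then have "snd (efun_comp Delta (coherent_simplex m) lift (rigidify_unit K m \<sigma>)) i j p A = gval p m \<sigma> i j A"
    using ij A by (simp add: path_functor_def)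
  then show ?thesis using ij A by (simp add: efun_comp_simps unit_simps(1)[OF s])
qed

lemma lift_ob: "v \<in> pob K 0 \<Longrightarrow> fst lift v = ver 0 v 0"
  unfolding lift_def
  by (simp add: rigidify_lift_simps(1)[OF K linear_enriched comparison_hom] value_ob_def[OF K linear_enriched comparison_hom]
      comparison_def path_functor_def)

lemma gen_natural:
  assumes t: "\<theta> \<in> delta_hom k m" and s: "\<sigma> \<in> pob K m" and ij: "i \<le> k" "j \<le> k" and A: "A \<in> pob (EHom (coherent_simplex k) i j) p"
  shows "gen k (pmap K (k, \<theta>, m) \<sigma>) i j p A = gen m \<sigma> (\<theta> i) (\<theta> j) p (\<lambda>r\<in>{..p}. \<theta> ` A r)"
  using psh_homD(2)[OF rigidify_unit_hom[OF K] t s] ij A by (simp add: efun_comp_simps)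

lemma ver_vertex: "\<sigma> \<in> pob K m \<Longrightarrow> i \<le> m \<Longrightarrow> ver 0 (vertex K m \<sigma> i) 0 = ver m \<sigma> i"
  unfolding vertex_def by (subst e_pmap[OF delta_hom_const]) (simp_all add: compose_def)

lemma vertex_inj:
  assumes "v \<in> pob K 0" "w \<in> pob K 0" "ver 0 v 0 = ver 0 w 0"
  shows "v = w"
proof -
  have "ver 0 v = ver 0 w"
    by (rule extensionalityI[OF delta_homD(4)[OF ver[OF assms(1)]] delta_homD(4)[OF ver[OF assms(2)]]]) (use assms(3) in simp)
  moreover have "lab 0 v = lab 0 w"
    using e_in[OF assms(1)] e_in[OF assms(2)] by (auto simp: path_nerve_simps)
  ultimately show ?thesis by (intro e_inj[OF assms(1,2)] prod_eqI)
qed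

lemma interval_simplex:
  assumes "a \<le> b" "b \<le> n" "x \<in> (\<Pi>\<^sub>E l\<in>{a<..b}. S l)"
  obtains \<kappa> where "\<kappa> \<in> pob K (b - a)" "e (b - a) \<kappa> = (\<lambda>l\<in>{..b - a}. a + l, x)"
proof -
  have "(\<lambda>l\<in>{..b - a}. a + l, x) \<in> pob (path_nerve n S) (b - a)"
    using assms by (auto simp: path_nerve_simps intro!: delta_homI)
  then show ?thesis using bij[of "b - a"] that unfolding bij_betw_def by (metis imageE)
qed

text \<open>A simplicial operator produces every simplex from the simplex on the interval that it spans,
  and likewise the simplex on any subinterval. This reduces any generator to one on an interval.\<close>

lemma gen_interval:
  assumes s: "\<sigma> \<in> pob K m" and ij: "i \<le> m" "j \<le> m" and A: "A \<in> pob (EHom (coherent_simplex m) i j) p"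
    and ab: "a = ver m \<sigma> i" "b = ver m \<sigma> j" and k: "\<kappa> \<in> pob K (b - a)"
    and ek: "e (b - a) \<kappa> = (\<lambda>l\<in>{..b - a}. a + l, restrict (lab m \<sigma>) {a<..b})"
    and T: "T \<in> pob (EHom (coherent_simplex (b - a)) 0 (b - a)) p"
    and AT: "\<And>r. r \<le> p \<Longrightarrow> (+) a ` T r = ver m \<sigma> ` A r"
  shows "gen m \<sigma> i j p A = gen (b - a) \<kappa> 0 (b - a) p T"
proof -
  let ?g = "ver m \<sigma>"
  note g = ver[OF s]
  define a0 b0 where "a0 = ?g 0" and "b0 = ?g m"
  have ord: "a0 \<le> ?g l" "?g l \<le> b0" if "l \<le> m" for l using delta_homD(2)[OF g] that by (simp_all add: a0_def b0_def)
  have le: "a0 \<le> a" "a \<le> b" "b \<le> b0"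
    using ord ij delta_homD(2)[OF g coh_le[OF A] ij(2)] by (simp_all add: ab)
  have b0n: "b0 \<le> n" using delta_homD(1)[OF g, of m] by (simp add: b0_def)
  have x: "lab m \<sigma> \<in> (\<Pi>\<^sub>E l\<in>{a0<..b0}. S l)" using e_in[OF s] by (simp add: path_nerve_simps a0_def b0_def)
  \<comment> \<open>The simplex \<open>\<tau>\<close> on the whole path of \<open>\<sigma>\<close> has both \<open>\<sigma>\<close> (along \<open>\<theta>\<close>) and \<open>\<kappa>\<close> (along \<open>\<iota>\<close>) as restrictions.\<close>
  obtain \<tau> where t: "\<tau> \<in> pob K (b0 - a0)" "e (b0 - a0) \<tau> = (\<lambda>l\<in>{..b0 - a0}. a0 + l, lab m \<sigma>)"
    using interval_simplex[OF _ b0n x] le by force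
  define \<theta> where "\<theta> = (\<lambda>l\<in>{..m}. ?g l - a0)"
  define \<iota> where "\<iota> = (\<lambda>l\<in>{..b - a}. l + (a - a0))"
  have th: "\<theta> \<in> delta_hom m (b0 - a0)"
    unfolding \<theta>_def using ord delta_homD(2)[OF g] by (intro delta_homI) (auto intro: diff_le_mono)
  have io: "\<iota> \<in> delta_hom (b - a) (b0 - a0)"
    unfolding \<iota>_def using le by (intro delta_homI) auto
  have th_app: "\<theta> l = ?g l - a0" if "l \<le> m" for l using that by (simp add: \<theta>_def)
  have io_app: "\<iota> l = l + (a - a0)" if "l \<le> b - a" for l using that by (simp add: \<iota>_def)
  have sig: "pmap K (m, \<theta>, b0 - a0) \<tau> = \<sigma>"
  proof (rule e_inj[OF presheafD(1)[OF K th t(1)] s], rule prod_eqI)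
    have "compose {..m} (\<lambda>l\<in>{..b0 - a0}. a0 + l) \<theta> = ver m \<sigma>"
      using ord by (intro extensionalityI[OF _ delta_homD(4)[OF g]]) (simp_all add: compose_def th_app diff_le_mono)
    then show "ver m (pmap K (m, \<theta>, b0 - a0) \<tau>) = ver m \<sigma>" by (simp add: e_pmap[OF th t(1)] t(2))
    have "lab m \<sigma> \<in> extensional {a0<..b0}" using x by (simp add: PiE_iff)
    then show "lab m (pmap K (m, \<theta>, b0 - a0) \<tau>) = lab m \<sigma>"
      using le by (simp add: e_pmap[OF th t(1)] t(2) th_app a0_def[symmetric] b0_def[symmetric] extensional_restrict)
  qed
  have kap: "pmap K (b - a, \<iota>, b0 - a0) \<tau> = \<kappa>"
  proof (rule e_inj[OF presheafD(1)[OF K io t(1)] k], rule prod_eqI)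
    have "compose {..b - a} (\<lambda>l\<in>{..b0 - a0}. a0 + l) \<iota> = (\<lambda>l\<in>{..b - a}. a + l)"
      using le by (intro extensionalityI[where A = "{..b - a}"]) (auto simp: compose_def io_app)
    then show "ver (b - a) (pmap K (b - a, \<iota>, b0 - a0) \<tau>) = ver (b - a) \<kappa>"
      by (simp add: ek e_pmap[OF io t(1)] t(2))
    show "lab (b - a) (pmap K (b - a, \<iota>, b0 - a0) \<tau>) = lab (b - a) \<kappa>"
      using le by (simp add: ek e_pmap[OF io t(1)] t(2) io_app)
  qed
  have img: "\<theta> ` A r = \<iota> ` T r" if r: "r \<le> p" for r
  proof -
    have Am: "A r \<subseteq> {..m}" and Tm: "T r \<subseteq> {..b - a}"
      using A T r ij unfolding coh_hom by (meson atLeastAtMost_iff atMost_iff le_trans subsetD subsetI)+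
    have "\<theta> ` A r = (\<lambda>l. l - a0) ` ?g ` A r" using Am by (force simp: \<theta>_def image_image)
    also have "\<dots> = (\<lambda>l. l - a0) ` (+) a ` T r" by (simp only: AT[OF r])
    also have "\<dots> = \<iota> ` T r" using Tm le by (force simp: \<iota>_def image_image)
    finally show ?thesis .
  qed
  have "gen m \<sigma> i j p A = gen (b0 - a0) \<tau> (\<theta> i) (\<theta> j) p (\<lambda>r\<in>{..p}. \<theta> ` A r)"
    using gen_natural[OF th t(1) ij A] by (simp add: sig)
  also have "\<dots> = gen (b0 - a0) \<tau> (\<iota> 0) (\<iota> (b - a)) p (\<lambda>r\<in>{..p}. \<iota> ` T r)"
    using ij le by (simp add: th_app io_app ab[symmetric] img cong: restrict_cong)
  also have "\<dots> = gen (b - a) \<kappa> 0 (b - a) p T"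
    using gen_natural[OF io t(1) _ _ T] by (simp add: kap)
  finally show ?thesis .
qed

text \<open>Two generators with the same value are equal: both equal the generator on the interval that
  their common value describes.\<close>

lemma gen_determined:
  assumes s: "\<sigma> \<in> pob K m" and ij: "i \<le> m" "j \<le> m" and A: "A \<in> pob (EHom (coherent_simplex m) i j) p"
    and s': "\<sigma>' \<in> pob K m'" and ij': "i' \<le> m'" "j' \<le> m'" and A': "A' \<in> pob (EHom (coherent_simplex m') i' j') p"
    and ends: "ver m \<sigma> i = ver m' \<sigma>' i'" "ver m \<sigma> j = ver m' \<sigma>' j'"
    and eq: "gval p m \<sigma> i j A = gval p m' \<sigma>' i' j' A'"
  shows "gen m \<sigma> i j p A = gen m' \<sigma>' i' j' p A'"
proof -
  let ?L = "linear_scat n S"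
  define a b where "a = ver m \<sigma> i" and "b = ver m \<sigma> j"
  note bA = coh_image_bounds[OF A ver[OF s] ij(2)] and bA' = coh_image_bounds[OF A' ver[OF s'] ij'(2)]
  have f: "gval p m \<sigma> i j A \<in> pob (EHom ?L a b) p"
    unfolding a_def b_def by (rule path_value_in[OF e_in[OF s] A ij(2)])
  have ab: "a \<le> b" "b \<le> n" using f delta_homD(1)[OF ver[OF s] ij(2)] by (simp_all add: linear_hom b_def)
  have x: "restrict (lab m \<sigma>) {a<..b} \<in> (\<Pi>\<^sub>E l\<in>{a<..b}. S l)"
    using f by (simp add: linear_hom path_value_def a_def b_def PiE_iff)
  have x': "restrict (lab m' \<sigma>') {a<..b} = restrict (lab m \<sigma>) {a<..b}"
    using eq ends by (simp add: path_value_def a_def b_def)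
  \<comment> \<open>Cube coordinates record the intermediate vertices; the end points belong to both images.\<close>
  have img: "ver m' \<sigma>' ` A' r = ver m \<sigma> ` A r" if r: "r \<le> p" for r
  proof -
    have "l \<in> ver m' \<sigma>' ` A' r \<longleftrightarrow> l \<in> ver m \<sigma> ` A r" for l
    proof (cases "a < l \<and> l < b")
      case True
      then have "snd (gval p m \<sigma> i j A) l r = snd (gval p m' \<sigma>' i' j' A') l r" using eq by simp
      then show ?thesis using True r ends by (simp add: path_value_def a_def b_def split: if_splits)
    next
      case False
      then consider "l = a" | "l = b" | "l < a" | "b < l" by linarith
      then show ?thesis
      proof cases
        case 1 then show ?thesis using bA(1)[OF r] bA'(1)[OF r] ends(1) by (simp add: a_def)
      next
        case 2 then show ?thesis using bA(2)[OF r] bA'(2)[OF r] ends(2) by (simp add: b_def)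
      next
        case 3 then show ?thesis using bA(3)[OF r, of l] bA'(3)[OF r, of l] ends(1) unfolding a_def by linarith
      next
        case 4 then show ?thesis using bA(3)[OF r, of l] bA'(3)[OF r, of l] ends(2) unfolding b_def by linarith
      qed
    qed
    then show ?thesis by blast
  qed
  obtain \<kappa> where k: "\<kappa> \<in> pob K (b - a)" "e (b - a) \<kappa> = (\<lambda>l\<in>{..b - a}. a + l, restrict (lab m \<sigma>) {a<..b})"
    using interval_simplex[OF ab x] by blast
  \<comment> \<open>The chain of images, shifted so that the interval starts at \<open>0\<close>.\<close>
  define T where "T = (\<lambda>r\<in>{..p}. {l. a + l \<in> ver m \<sigma> ` A r})"
  have shift: "(+) a ` T r = ver m \<sigma> ` A r" if r: "r \<le> p" for r
  proof
    show "(+) a ` T r \<subseteq> ver m \<sigma> ` A r" using r by (auto simp: T_def)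
    show "ver m \<sigma> ` A r \<subseteq> (+) a ` T r"
    proof
      fix l assume l: "l \<in> ver m \<sigma> ` A r"
      then have "l = a + (l - a)" using bA(3)[OF r, of l] by (simp add: a_def)
      then show "l \<in> (+) a ` T r" using l r by (intro image_eqI[of _ _ "l - a"]) (simp_all add: T_def)
    qed
  qed
  have T: "T \<in> pob (EHom (coherent_simplex (b - a)) 0 (b - a)) p"
    unfolding coh_hom
  proof (intro conjI allI impI)
    fix r assume r: "r \<le> p"
    show "0 \<in> T r" "b - a \<in> T r" using bA(1,2)[OF r] r ab by (simp_all add: T_def a_def b_def)
    show "T r \<subseteq> {0..b - a}" using bA(3)[OF r] r by (force simp: T_def a_def b_def)
  next
    fix r q assume rq: "r \<le> q" "q \<le> p"
    then have "A r \<subseteq> A q" using A unfolding coh_hom by blast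
    then show "T r \<subseteq> T q" using rq by (auto simp: T_def)
  qed (simp add: T_def)
  have "gen m \<sigma> i j p A = gen (b - a) \<kappa> 0 (b - a) p T"
    by (rule gen_interval[OF s ij A a_def b_def k T shift])
  moreover have "gen m' \<sigma>' i' j' p A' = gen (b - a) \<kappa> 0 (b - a) p T"
    by (rule gen_interval[OF s' ij' A' ends(1)[folded a_def] ends(2)[folded b_def] k(1) _ T])
      (simp_all only: k(2) x' img shift)
  ultimately show ?thesis by simp
qed

text \<open>Over a simplex that visits every vertex of an interval once, a chain of vertex sets can be read
  off from the coordinates of a cube, so every morphism along its path occurs as a value.\<close>

lemma gval_surj:
  assumes s: "\<rho> \<in> pob K N" "e N \<rho> = (\<lambda>l\<in>{..N}. c + l, z)" and ij: "i \<le> j" "j \<le> N"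
    and f: "f \<in> pob (EHom (linear_scat n S) (c + i) (c + j)) p" 
    and z: "\<And>l. c + i < l \<Longrightarrow> l \<le> c + j \<Longrightarrow> z l = fst f l"
  obtains A where "A \<in> pob (EHom (coherent_simplex N) i j) p" "gval p N \<rho> i j A = f"
proof -
  define A where "A = (\<lambda>r\<in>{..p}. {l. i \<le> l \<and> l \<le> j \<and> (l = i \<or> l = j \<or> snd f (c + l) r = 1)})"
  have d: "snd f l \<in> delta_hom p 1" if "c + i < l" "l < c + j" for l using f that by (simp add: linear_hom)
  have A: "A \<in> pob (EHom (coherent_simplex N) i j) p"
    unfolding coh_hom
  proof (intro conjI allI impI)
    fix r q assume rq: "r \<le> q" "q \<le> p"
    show "A r \<subseteq> A q"
    proof
      fix l assume l: "l \<in> A r"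
      show "l \<in> A q"
      proof (cases "l = i \<or> l = j")
        case False
        then have *: "i < l" "l < j" "snd f (c + l) r = 1" using l rq by (auto simp: A_def)
        then have "c + i < c + l" "c + l < c + j" by simp_all
        from delta_homD(1)[OF d[OF this] rq(2)] delta_homD(2)[OF d[OF this] rq] have "snd f (c + l) q = 1"
          using *(3) by simp
        then show ?thesis using * rq by (simp add: A_def)
      qed (use rq ij in \<open>auto simp: A_def\<close>)
    qed
  qed (use ij in \<open>auto simp: A_def\<close>)
  have "gval p N \<rho> i j A = f"
  proof (rule linear_eqI[OF _ f])
    have "gval p N \<rho> i j A \<in> pob (EHom (linear_scat n S) (ver N \<rho> i) (ver N \<rho> j)) p"
      by (rule path_value_in[OF e_in[OF s(1)] A ij(2)])
    then show "gval p N \<rho> i j A \<in> pob (EHom (linear_scat n S) (c + i) (c + j)) p" using ij by (simp add: s(2))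
    show "fst (gval p N \<rho> i j A) l = fst f l" if "c + i < l" "l \<le> c + j" for l
      using that z ij by (simp add: s(2) path_value_def)
    fix l r assume l: "c + i < l" "l < c + j" and r: "r \<le> p"
    then obtain k where k: "l = c + k" "i < k" "k < j" by (metis add_less_cancel_left le_Suc_ex less_imp_le_nat add_leE)
    have "l \<in> (\<lambda>l\<in>{..N}. c + l) ` A r \<longleftrightarrow> snd f l r = 1"
      using k r ij by (auto simp: A_def image_iff)
    moreover have "snd f l r = 0 \<or> snd f l r = 1" using delta_homD(1)[OF d[OF l] r] by auto
    ultimately show "snd (gval p N \<rho> i j A) l r = snd f l r"
      using l r ij by (auto simp: s(2) path_value_def)
  qed
  then show ?thesis using that A by blast
qed

text \<open>Words of generators collapse to single generators: two composable generators equal generators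
  of the simplex on the concatenation of their paths, where they can be composed.\<close>

lemma morphism_gen:
  assumes "B \<in> pob (EHom (rigidify K) v w) p"
  obtains m \<sigma> i j A where "\<sigma> \<in> pob K m" "i \<le> m" "j \<le> m" "A \<in> pob (EHom (coherent_simplex m) i j) p"
    "v = vertex K m \<sigma> i" "w = vertex K m \<sigma> j" "B = gen m \<sigma> i j p A"
proof -
  have *: "\<exists>m \<sigma> i j A. \<sigma> \<in> pob K m \<and> i \<le> m \<and> j \<le> m \<and> A \<in> pob (EHom (coherent_simplex m) i j) p \<and>
    v = vertex K m \<sigma> i \<and> w = vertex K m \<sigma> j \<and> word_class K p v w ws = gen m \<sigma> i j p A"
    if "is_word K p v w ws" for v ws
    using that
  proof (induction ws arbitrary: v)
    case Nil
    then have v: "v \<in> pob K 0" "w = v" by auto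
    have v0: "vertex K 0 v 0 = v"
      by (rule vertex_inj[OF vertex_in[OF K v(1)] v(1)]) (simp_all add: ver_vertex[OF v(1)])
    define I where "I = EId (coherent_simplex 0) 0 p"
    have "I \<in> pob (EHom (coherent_simplex 0) 0 0) p" unfolding I_def by (simp add: coh_id)
    moreover have "gen 0 v 0 0 p I = word_class K p v v []"
      using efunctorsD(3)[OF rigidify_unit_efunctor[OF K v(1)], of 0 p]
      by (simp add: I_def unit_simps(1)[OF v(1)] v0 rigidify_EId)
    ultimately show ?case using v v0
      by - (rule exI[of _ 0], rule exI[of _ v], rule exI[of _ 0], rule exI[of _ 0], rule exI[of _ I], simp)
  next
    case (Cons g ws)
    obtain m \<sigma> i j A where g: "g = (m, \<sigma>, i, j, A)" by (cases g)
    have s: "\<sigma> \<in> pob K m" "i \<le> m" "j \<le> m" and A: "A \<in> pob (EHom (coherent_simplex m) i j) p"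
      and v: "v = vertex K m \<sigma> i" and ws: "is_word K p (vertex K m \<sigma> j) w ws"
      using Cons.prems by (simp_all add: g generators_iff)
    obtain m' \<sigma>' i' j' A' where s': "\<sigma>' \<in> pob K m'" "i' \<le> m'" "j' \<le> m'" and A': "A' \<in> pob (EHom (coherent_simplex m') i' j') p"
      and v': "vertex K m \<sigma> j = vertex K m' \<sigma>' i'" and w: "w = vertex K m' \<sigma>' j'"
      and c': "word_class K p (vertex K m \<sigma> j) w ws = gen m' \<sigma>' i' j' p A'"
      using Cons.IH[OF ws] by blast
    define a b d where "a = ver m \<sigma> i" and "b = ver m \<sigma> j" and "d = ver m' \<sigma>' j'"
    have b': "b = ver m' \<sigma>' i'"
      using ver_vertex[OF s(1,3)] ver_vertex[OF s'(1,2)] v' by (simp add: b_def)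
    have f: "gval p m \<sigma> i j A \<in> pob (EHom (linear_scat n S) a b) p"
      unfolding a_def b_def by (rule path_value_in[OF e_in[OF s(1)] A s(3)])
    have f': "gval p m' \<sigma>' i' j' A' \<in> pob (EHom (linear_scat n S) b d) p"
      unfolding b' d_def by (rule path_value_in[OF e_in[OF s'(1)] A' s'(3)])
    have le: "a \<le> b" "b \<le> d" "d \<le> n" using f f' delta_homD(1)[OF ver[OF s'(1)] s'(3)] by (simp_all add: linear_hom d_def)
    \<comment> \<open>The concatenated path and its simplex \<open>\<rho>\<close>.\<close>
    define z where "z = (\<lambda>l\<in>{a<..d}. if l \<le> b then fst (gval p m \<sigma> i j A) l else fst (gval p m' \<sigma>' i' j' A') l)"
    have "z \<in> (\<Pi>\<^sub>E l\<in>{a<..d}. S l)" using f f' by (auto simp: z_def linear_hom)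
    then obtain \<rho> where r: "\<rho> \<in> pob K (d - a)" "e (d - a) \<rho> = (\<lambda>l\<in>{..d - a}. a + l, z)"
      using interval_simplex[of a d z] le by auto
    obtain B where B: "B \<in> pob (EHom (coherent_simplex (d - a)) 0 (b - a)) p" "gval p (d - a) \<rho> 0 (b - a) B = gval p m \<sigma> i j A"
      using gval_surj[OF r, of 0 "b - a" "gval p m \<sigma> i j A" p] f le by (force simp: z_def)
    obtain B' where B': "B' \<in> pob (EHom (coherent_simplex (d - a)) (b - a) (d - a)) p" "gval p (d - a) \<rho> (b - a) (d - a) B' = gval p m' \<sigma>' i' j' A'"
      using gval_surj[OF r, of "b - a" "d - a" "gval p m' \<sigma>' i' j' A'" p] f' le by (force simp: z_def)
    have vr: "ver (d - a) \<rho> l = a + l" if "l \<le> d - a" for l using that by (simp add: r(2))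
    have G: "gen m \<sigma> i j p A = gen (d - a) \<rho> 0 (b - a) p B"
      using le vr B(2) by (intro gen_determined[OF s A r(1) _ _ B(1)]) (simp_all add: a_def[symmetric] b_def[symmetric])
    have G': "gen m' \<sigma>' i' j' p A' = gen (d - a) \<rho> (b - a) (d - a) p B'"
      using le vr B'(2) by (intro gen_determined[OF s' A' r(1) _ _ B'(1)]) (simp_all add: b'[symmetric] d_def[symmetric])
    have same: "vertex K (d - a) \<rho> l = vertex K k \<tau> q" if "\<tau> \<in> pob K k" "q \<le> k" "l \<le> d - a" "ver k \<tau> q = a + l" for l k \<tau> q
      using that by (intro vertex_inj vertex_in[OF K]) (simp_all add: r(1) ver_vertex vr)
    have V: "vertex K (d - a) \<rho> 0 = v" "vertex K (d - a) \<rho> (b - a) = vertex K m \<sigma> j" "vertex K (d - a) \<rho> (d - a) = w"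
      using same[OF s(1,2)] same[OF s(1,3)] same[OF s'(1,3)] le v w by (simp_all add: a_def[symmetric] b_def[symmetric] d_def[symmetric])
    define U where "U = EComp (coherent_simplex (d - a)) 0 (b - a) (d - a) p B B'"
    have U: "U \<in> pob (EHom (coherent_simplex (d - a)) 0 (d - a)) p"
      unfolding U_def using coh_comp[OF B(1) B'(1)] by simp
    have one: "is_word K p v (vertex K m \<sigma> j) [(m, \<sigma>, i, j, A)]"
      using s A v vertex_in[OF K s(1,3)] by (simp add: generators_iff)
    have "word_class K p v w (g # ws) = EComp (rigidify K) v (vertex K m \<sigma> j) w p (gen m \<sigma> i j p A) (gen m' \<sigma>' i' j' p A')"
      using rigidify_EComp[OF K one ws] by (simp add: g c' unit_simps(2)[OF s A] v)
    also have "\<dots> = gen (d - a) \<rho> 0 (d - a) p U" unfolding U_def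
      using efunctorsD(4)[OF rigidify_unit_efunctor[OF K r(1)] _ _ _ _ B(1) B'(1)] le
      by (simp add: G G' unit_simps(1)[OF r(1)] V del: coh_simps(3))
    finally show ?case
      using U r(1) V
      by - (rule exI[of _ "d - a"], rule exI[of _ \<rho>], rule exI[of _ 0], rule exI[of _ "d - a"],
          rule exI[of _ U], simp)
  qed
  from assms obtain ws where "is_word K p v w ws" "B = word_class K p v w ws" unfolding rigidify_hom by blast
  with *[of v ws] that show ?thesis by blast
qed

lemma lift_bij_ob: "bij_betw (fst lift) (pob K 0) {..n}"
proof (rule bij_betwI')
  fix v w assume "v \<in> pob K 0" "w \<in> pob K 0"
  then show "fst lift v = fst lift w \<longleftrightarrow> v = w" using vertex_inj by (auto simp: lift_ob)
next
  fix v assume "v \<in> pob K 0"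
  then show "fst lift v \<in> {..n}" using delta_homD(1)[OF ver] by (simp add: lift_ob)
next
  fix i assume "i \<in> {..n}"
  then obtain \<kappa> where "\<kappa> \<in> pob K 0" "e 0 \<kappa> = (\<lambda>l\<in>{..0}. i + l, \<lambda>_. undefined)"
    using interval_simplex[of i i "\<lambda>_. undefined"] by auto
  then show "\<exists>v\<in>pob K 0. i = fst lift v" by (auto simp: lift_ob intro!: bexI[of _ \<kappa>])
qed

text \<open>Morphisms are single generators, so injectivity says that generators are determined by their
  values, and surjectivity that every value is attained over some path.\<close>

lemma lift_bij_hom:
  assumes v: "v \<in> pob K 0" and w: "w \<in> pob K 0"
  shows "bij_betw (snd lift v w p) (pob (EHom (rigidify K) v w) p) (pob (EHom (linear_scat n S) (fst lift v) (fst lift w)) p)"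
proof (rule bij_betwI')
  fix B B' assume B: "B \<in> pob (EHom (rigidify K) v w) p" and B': "B' \<in> pob (EHom (rigidify K) v w) p"
  obtain m \<sigma> i j A where g: "\<sigma> \<in> pob K m" "i \<le> m" "j \<le> m" "A \<in> pob (EHom (coherent_simplex m) i j) p"
    "v = vertex K m \<sigma> i" "w = vertex K m \<sigma> j" "B = gen m \<sigma> i j p A" using B by (rule morphism_gen)
  obtain m' \<sigma>' i' j' A' where g': "\<sigma>' \<in> pob K m'" "i' \<le> m'" "j' \<le> m'" "A' \<in> pob (EHom (coherent_simplex m') i' j') p"
    "v = vertex K m' \<sigma>' i'" "w = vertex K m' \<sigma>' j'" "B' = gen m' \<sigma>' i' j' p A'" using B' by (rule morphism_gen)
  have "ver m \<sigma> i = ver m' \<sigma>' i'" "ver m \<sigma> j = ver m' \<sigma>' j'"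
    using ver_vertex[OF g(1,2)] ver_vertex[OF g(1,3)] ver_vertex[OF g'(1,2)] ver_vertex[OF g'(1,3)] g(5,6) g'(5,6) by metis+
  then have "gval p m \<sigma> i j A = gval p m' \<sigma>' i' j' A' \<Longrightarrow> B = B'"
    unfolding g(7) g'(7) by (rule gen_determined[OF g(1-4) g'(1-4)])
  moreover have "snd lift v w p B = gval p m \<sigma> i j A" using lift_gen[OF g(1-4)] by (simp add: g(5-7))
  moreover have "snd lift v w p B' = gval p m' \<sigma>' i' j' A'" using lift_gen[OF g'(1-4)] unfolding g'(7) g'(5)[symmetric] g'(6)[symmetric] .
  ultimately show "snd lift v w p B = snd lift v w p B' \<longleftrightarrow> B = B'" by auto
next
  fix B assume "B \<in> pob (EHom (rigidify K) v w) p"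
  then show "snd lift v w p B \<in> pob (EHom (linear_scat n S) (fst lift v) (fst lift w)) p"
    using efunctorsE(1)[OF lift_efunctor, of v w p B] v w by simp
next
  fix f assume f: "f \<in> pob (EHom (linear_scat n S) (fst lift v) (fst lift w)) p"
  define a b where "a = fst lift v" and "b = fst lift w"
  have ab: "a \<le> b" "b \<le> n" using f lift_bij_ob w by (auto simp: linear_hom a_def b_def bij_betw_def)
  have "fst f \<in> (\<Pi>\<^sub>E l\<in>{a<..b}. S l)" using f by (simp add: linear_hom a_def b_def PiE_iff)
  then obtain \<rho> where r: "\<rho> \<in> pob K (b - a)" "e (b - a) \<rho> = (\<lambda>l\<in>{..b - a}. a + l, fst f)"
    using interval_simplex[OF ab] by blast
  obtain A where A: "A \<in> pob (EHom (coherent_simplex (b - a)) 0 (b - a)) p" "gval p (b - a) \<rho> 0 (b - a) A = f"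
    using gval_surj[OF r, of 0 "b - a" f p] f ab by (auto simp: a_def b_def)
  have vw: "ver 0 v 0 = a" "ver 0 w 0 = b" using v w by (simp_all add: a_def b_def lift_ob)
  have V: "vertex K (b - a) \<rho> 0 = v" "vertex K (b - a) \<rho> (b - a) = w"
    using ab by (intro vertex_inj[OF vertex_in[OF K r(1)]] v w; simp add: ver_vertex[OF r(1)] r(2) vw)+
  have "gen (b - a) \<rho> 0 (b - a) p A \<in> pob (EHom (rigidify K) v w) p"
    using efunctorsE(1)[OF rigidify_unit_efunctor[OF K r(1)] _ _ _ A(1)] by (simp add: unit_simps(1)[OF r(1)] V)
  moreover have "f = snd lift v w p (gen (b - a) \<rho> 0 (b - a) p A)"
    using lift_gen[OF r(1) _ _ A(1)] by (simp add: V A(2))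
  ultimately show "\<exists>B\<in>pob (EHom (rigidify K) v w) p. f = snd lift v w p B" by blast
qed

end

section \<open>Comparison of the two functors\<close>

definition linear_map where
  "linear_map n S \<phi> = (\<lambda>i\<in>{..n}. i, \<lambda>i\<in>{..n}. \<lambda>j\<in>{..n}. \<lambda>p. \<lambda>f\<in>pob (EHom (linear_scat n S) i j) p.
     (\<lambda>l\<in>{i<..j}. \<phi> l (fst f l), snd f))"

lemma linear_map_simps:
  "i \<le> n \<Longrightarrow> fst (linear_map n S \<phi>) i = i"
  "i \<le> n \<Longrightarrow> j \<le> n \<Longrightarrow> f \<in> pob (EHom (linear_scat n S) i j) p \<Longrightarrow>
     snd (linear_map n S \<phi>) i j p f = (\<lambda>l\<in>{i<..j}. \<phi> l (fst f l), snd f)"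
  by (simp_all add: linear_map_def)

lemma linear_map_in:
  assumes \<phi>: "\<And>l x. 1 \<le> l \<Longrightarrow> l \<le> n \<Longrightarrow> x \<in> S l \<Longrightarrow> \<phi> l x \<in> S' l"
  shows "linear_map n S \<phi> \<in> efunctors Delta (linear_scat n S) (linear_scat n S')"
proof -
  let ?L' = "linear_scat n S'"
  let ?L = "linear_scat n S"
  let ?F = "linear_map n S \<phi>"
  have v: "(\<lambda>l\<in>{i<..j}. \<phi> l (fst f l), snd f) \<in> pob (EHom (?L') i j) p"
    if "j \<le> n" "f \<in> pob (EHom ?L i j) p" for i j f p
    using that \<phi> by (simp add: linear_hom)
  show ?thesis
  proof (rule efunctorsI)
    fix i j assume "i \<in> EOb ?L" "j \<in> EOb ?L"
    then have ij: "i \<le> n" "j \<le> n" by simp_all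
    show "snd ?F i j \<in> psh_hom Delta (EHom ?L i j)
      (EHom (?L') (fst ?F i) (fst ?F j))"
      unfolding psh_hom_Delta
    proof (intro conjI allI impI)
      fix p show "snd ?F i j p \<in> pob (EHom ?L i j) p \<rightarrow>\<^sub>E
          pob (EHom (?L') (fst ?F i) (fst ?F j)) p"
        using ij v by (simp add: linear_map_def PiE_iff)
    next
      fix q p \<theta> f assume t: "\<theta> \<in> delta_hom q p" and f: "f \<in> pob (EHom ?L i j) p"
      show "snd ?F i j q (pmap (EHom ?L i j) (q, \<theta>, p) f) =
        pmap (EHom (?L') (fst ?F i) (fst ?F j)) (q, \<theta>, p) (snd ?F i j p f)"
        using ij f linear_map_simps(2)[OF ij linear_pmap_in[OF f t], of \<phi>] by (simp add: linear_map_simps linear_pmap)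
    qed
  next
    fix i p assume "i \<in> EOb ?L"
    then show "snd ?F i i p (EId ?L i p) = EId (?L') (fst ?F i) p"
      by (simp add: linear_map_simps linear_id_in) (simp add: linear_id restrict_def)
  next
    fix i j k p f g assume "i \<in> EOb ?L" "j \<in> EOb ?L" "k \<in> EOb ?L"
      and fg: "f \<in> pob (EHom ?L i j) p" "g \<in> pob (EHom ?L j k) p"
    moreover have "i \<le> j" "j \<le> k" using fg by (simp_all add: linear_hom)
    ultimately show "snd ?F i k p (EComp ?L i j k p f g) =
       EComp (?L') (fst ?F i) (fst ?F j) (fst ?F k) p 
         (snd ?F i j p f) (snd ?F j k p g)"
      by (simp add: linear_map_simps linear_comp_in) (auto simp: linear_comp fun_eq_iff)
  qed (simp_all add: linear_map_def)
qed

lemma Q_simps: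
  "EOb (Q_ob (n, X)) = {..n}"
  "f \<in> pob (EHom (Q_ob (n, X)) i j) (p, c) \<longleftrightarrow> f \<in> pob (EHom (linear_scat n (\<lambda>l. pob (X l) c)) i j) p"
  "pmap (EHom (Q_ob (n, X)) i j) ((q, \<theta>, p), u) f =
     (\<lambda>l\<in>{i<..j}. pmap (X l) u (fst f l), \<lambda>l\<in>{i<..<j}. compose {..q} (snd f l) \<theta>)"
  "EId (Q_ob (n, X)) i (p, c) = EId (linear_scat n S) i p"
  "EComp (Q_ob (n, X)) i j k (p, c) f g = EComp (linear_scat n S) i j k p f g"
  by (cases f, cases g, auto simp: Q_ob_def Q_hom_def linear_scat_def psh_prod_def std_simplex_def)+

lemma Q_levelwise:
  assumes C: "category C" and X: "\<And>l. 1 \<le> l \<Longrightarrow> l \<le> n \<Longrightarrow> presheaf C (X l)"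
  shows "levelwise C (Q_ob (n, X)) (\<lambda>c. linear_scat n (\<lambda>l. pob (X l) c))
    (\<lambda>u. linear_map n (\<lambda>l. pob (X l) (Cod C u)) (\<lambda>l. pmap (X l) u))"
proof
  fix u assume u: "u \<in> Ar C"
  show "linear_map n (\<lambda>l. pob (X l) (Cod C u)) (\<lambda>l. pmap (X l) u) \<in> 
    efunctors Delta (linear_scat n (\<lambda>l. pob (X l) (Cod C u))) (linear_scat n (\<lambda>l. pob (X l) (Dom C u)))"
    by (rule linear_map_in) (rule presheafE(1)[OF X u])
  fix \<theta> q p i j f
  assume "\<theta> \<in> delta_hom q p" "i \<in> EOb (Q_ob (n, X))" "j \<in> EOb (Q_ob (n, X))"
    and f: "f \<in> pob (EHom (linear_scat n (\<lambda>l. pob (X l) (Cod C u))) i j) p"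
  then show "pmap (EHom (Q_ob (n, X)) i j) ((q, \<theta>, p), u) f = pmap (EHom (linear_scat n (\<lambda>l. pob (X l) (Dom C u))) i j) (q, \<theta>, p)
        (snd (linear_map n (\<lambda>l. pob (X l) (Cod C u)) (\<lambda>l. pmap (X l) u)) i j p f)"
    by (simp add: Q_simps linear_map_simps linear_pmap)
next
  fix c i j f p assume c: "c \<in> Ob C" and ij: "i \<in> EOb (Q_ob (n, X))" "j \<in> EOb (Q_ob (n, X))"
    and f: "f \<in> pob (EHom (linear_scat n (\<lambda>l. pob (X l) c)) i j) p"
  have "pmap (X l) (Idn C c) (fst f l) = fst f l" if "i < l" "l \<le> j" for l
    using presheafE(2)[OF X c, of l "fst f l"] that ij f by (simp add: linear_hom Q_simps)
  then have "(\<lambda>l\<in>{i<..j}. pmap (X l) (Idn C c) (fst f l)) = fst f"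
    using f by (intro extensionalityI[where A = "{i<..j}"]) (simp_all add: linear_hom)
  then show "snd (linear_map n (\<lambda>l. pob (X l) (Cod C (Idn C c))) (\<lambda>l. pmap (X l) (Idn C c))) i j p f = f"
    using ij f c by (simp add: Q_simps linear_map_simps categoryE[OF C])
next
  fix u v i j f p assume u: "u \<in> Ar C" "v \<in> Ar C" "Cod C u = Dom C v" and ij: "i \<in> EOb (Q_ob (n, X))" "j \<in> EOb (Q_ob (n, X))"
    and f: "f \<in> pob (EHom (linear_scat n (\<lambda>l. pob (X l) (Cod C v))) i j) p"
  have *: "(\<lambda>l\<in>{i<..j}. pmap (X l) v (fst f l), snd f) \<in> pob (EHom (linear_scat n (\<lambda>l. pob (X l) (Dom C v))) i j) p"
    using f ij presheafE(1)[OF X u(2)] by (simp add: linear_hom Q_simps)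
  have "pmap (X l) (Cmp C v u) (fst f l) = pmap (X l) u (pmap (X l) v (fst f l))" if "i < l" "l \<le> j" for l
    using presheafE(3)[OF X u, of l "fst f l"] that ij f by (simp add: linear_hom Q_simps)
  then show "snd (linear_map n (\<lambda>l. pob (X l) (Cod C (Cmp C v u))) (\<lambda>l. pmap (X l) (Cmp C v u))) i j p f =
    snd (linear_map n (\<lambda>l. pob (X l) (Cod C u)) (\<lambda>l. pmap (X l) u)) i j p
      (snd (linear_map n (\<lambda>l. pob (X l) (Cod C v)) (\<lambda>l. pmap (X l) v)) i j p f)"
    using ij f u * by (simp add: Q_simps linear_map_simps categoryE[OF C] cong: restrict_cong)
qed (auto simp: C linear_enriched Q_simps linear_map_simps)

text \<open>By the Yoneda lemma a simplex of the slice of \<open>V\<close> at \<open>c\<close> is a monotone map together with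
  elements of the presheaves at \<open>c\<close>, namely the images of the identity of \<open>c\<close>.\<close>

definition label where
  "label C c m \<phi> = (\<lambda>l\<in>{fst \<phi> 0<..fst \<phi> m}. snd \<phi> (block m (fst \<phi>) l) c (Idn C c) l)"

definition coordinates where
  "coordinates C X c = (\<lambda>m. \<lambda>\<phi>\<in>wreath_hom C (k_ob C (m, c)) X. (fst \<phi>, label C c m \<phi>))"

lemma label_in:
  assumes C: "category C" and c: "c \<in> Ob C" and p: "\<phi> \<in> wreath_hom C (k_ob C (m, c)) (n, X)"
    and l: "fst \<phi> 0 < l" "l \<le> fst \<phi> m"
  shows "label C c m \<phi> l \<in> pob (X l) c"
proof -
  note p' = p[unfolded k_ob_eq]
  note b = block[OF wreath_homD(1)[OF p'] l le0 order_refl]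
  show ?thesis
    using wreath_homE(4)[OF p' b(3,4) c _ b(5,6)] l categoryD(1)[OF C c] b(3,4) by (simp add: label_def yoneda_simps)
qed

text \<open>By naturality of the components, restriction along the diagonal functor changes the labels only by the action of
  the arrow of \<open>C\<close>. The case of an identity arrow gives the simplicial structure of a slice, the
  case of an identity operator gives the transition between slices.\<close>

lemma label_restrict:
  assumes C: "category C" and u: "u \<in> Ar C" and t: "\<theta> \<in> delta_hom k m"
    and p: "\<phi> \<in> wreath_hom C (k_ob C (m, Cod C u)) (n, X)"
    and l: "fst \<phi> (\<theta> 0) < l" "l \<le> fst \<phi> (\<theta> k)"
  shows "label C (Dom C u) k (wreath_comp C (k_ob C (k, Dom C u)) (k_ob C (m, Cod C u)) \<phi> (k_hom C k \<theta> u)) l =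
    pmap (X l) u (label C (Cod C u) m \<phi> l)"
proof -
  note p' = p[unfolded k_ob_eq]
  note g = wreath_homD(1)[OF p'] and c = categoryE(1,2)[OF C u]
  note tk = delta_homD(1)[OF t, of 0] delta_homD(1)[OF t, of k]
  have ord: "fst \<phi> 0 \<le> fst \<phi> (\<theta> 0)" "fst \<phi> (\<theta> k) \<le> fst \<phi> m" using delta_homD(2)[OF g] tk by simp_all
  define b where "b = block m (fst \<phi>) l"
  note b = block[OF g l tk(1)[simplified] tk(2)[simplified], folded b_def]
  note b' = block[OF t b(1,2) le0 order_refl]
  have bb: "block k (compose {..k} (fst \<phi>) \<theta>) l = block k \<theta> b"
    unfolding b_def by (rule block_compose[OF t g l le0 order_refl])
  have id: "Idn C (Dom C u) \<in> arrows C (Dom C u) (Dom C u)" "Idn C (Cod C u) \<in> arrows C (Cod C u) (Cod C u)"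
    using categoryD(1)[OF C] c by simp_all
  have u': "u \<in> arrows C (Dom C u) (Cod C u)" using u by (simp add: arrows_def)
  have ord': "fst \<phi> (\<theta> (block k \<theta> b - 1)) < l" "l \<le> fst \<phi> (\<theta> (block k \<theta> b))"
  proof -
    have "fst \<phi> (\<theta> (block k \<theta> b - 1)) \<le> fst \<phi> (b - 1)" using b'(5) b(4) by (intro delta_homD(2)[OF g]) auto
    then show "fst \<phi> (\<theta> (block k \<theta> b - 1)) < l" using b(5) by simp
    have "fst \<phi> b \<le> fst \<phi> (\<theta> (block k \<theta> b))" using b'(6) delta_homD(1)[OF t b'(4)] by (intro delta_homD(2)[OF g])
    then show "l \<le> fst \<phi> (\<theta> (block k \<theta> b))" using b(6) by simp
  qed
  have "label C (Dom C u) k (wreath_comp C (k_ob C (k, Dom C u)) (k_ob C (m, Cod C u)) \<phi> (k_hom C k \<theta> u)) l =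
    snd \<phi> b (Dom C u) (snd (k_hom C k \<theta> u) (block k \<theta> b) (Dom C u) (Idn C (Dom C u)) b) l"
    using l ord' b'(3,4) c id by (simp add: label_def k_ob_eq wreath_comp_simps bb[unfolded compose_def] k_hom_def yoneda_simps compose_def b_def)
  also have "\<dots> = snd \<phi> b (Dom C u) u l"
    using b'(3-6) k_hom_eval[where u = u and \<theta> = \<theta>, OF b'(3,4) c(1) id(1)] categoryD(4)[OF C u'] by simp
  also have "\<dots> = pmap (X l) u (snd \<phi> b (Cod C u) (Idn C (Cod C u)) l)"
    using wreath_homE(5)[OF p' b(3,4) u _ b(5,6), of "Idn C (Cod C u)"] id b(3,4) categoryD(5)[OF C u']
    by (simp add: yoneda_simps)
  finally show ?thesis using l ord by (simp add: label_def b_def)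
qed

lemma label_determines:
  assumes C: "category C" and c: "c \<in> Ob C" and p: "\<phi> \<in> wreath_hom C (k_ob C (m, c)) (n, X)"
    and i: "1 \<le> i" "i \<le> m" and v: "v \<in> arrows C b c" and l: "fst \<phi> (i - 1) < l" "l \<le> fst \<phi> i"
  shows "snd \<phi> i b v l = pmap (X l) v (label C c m \<phi> l)"
proof -
  note p' = p[unfolded k_ob_eq]
  note g = wreath_homD(1)[OF p']
  have v': "v \<in> Ar C" "Dom C v = b" "Cod C v = c" using v by (simp_all add: arrows_def)
  have "fst \<phi> 0 \<le> fst \<phi> (i - 1)" "fst \<phi> i \<le> fst \<phi> m" using delta_homD(2)[OF g] i by simp_all
  then have "label C c m \<phi> l = snd \<phi> i c (Idn C c) l"
    using l block_eqI[OF g i l] by (simp add: label_def)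
  then show ?thesis
    using wreath_homE(5)[OF p' i v'(1) _ l, of "Idn C c"] i v' categoryD(1)[OF C c] categoryD(5)[OF C v]
    by (simp add: yoneda_simps)
qed

text \<open>Naturality recovers every component from its value at the identity of \<open>c\<close>, and any choice of
  these values extends.\<close>

lemma slice_V_linear_nerve:
  assumes C: "category C" and X: "\<And>l. 1 \<le> l \<Longrightarrow> l \<le> n \<Longrightarrow> presheaf C (X l)" and c: "c \<in> Ob C"
  shows "linear_nerve (slice C (V_ob C (n, X)) c) n (\<lambda>l. pob (X l) c) (coordinates C (n, X) c)"
proof
  let ?K = "slice C (V_ob C (n, X)) c" and ?S = "\<lambda>l. pob (X l) c" and ?e = "coordinates C (n, X) c"
  have K: "pob ?K m = wreath_hom C (k_ob C (m, c)) (n, X)" for m by (simp add: slice_simps)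
  have D: "fst \<phi> \<in> delta_hom m n" if "\<phi> \<in> pob ?K m" for m \<phi>
    using wreath_homD(1)[OF that[unfolded K k_ob_eq]] .
  show "presheaf Delta ?K" by (rule slice_presheaf[OF C V_ob_presheaf[OF C] c])
  have e: "?e m \<phi> = (fst \<phi>, label C c m \<phi>)" if "\<phi> \<in> pob ?K m" for m \<phi> using that by (simp add: coordinates_def K)
  have ein: "?e m \<phi> \<in> pob (path_nerve n ?S) m" if "\<phi> \<in> pob ?K m" for m \<phi>
    using label_in[OF C c that[unfolded K]] D[OF that] unfolding e[OF that] by (simp add: path_nerve_simps PiE_iff) (simp add: label_def)
  show "?e \<in> psh_hom Delta ?K (path_nerve n ?S)"
    unfolding psh_hom_Delta
  proof (intro conjI allI impI)
    fix m show "?e m \<in> pob ?K m \<rightarrow>\<^sub>E pob (path_nerve n ?S) m"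
      using ein by (simp add: PiE_iff) (simp add: coordinates_def K)
  next
    fix k m \<theta> \<phi> assume t: "\<theta> \<in> delta_hom k m" and p: "\<phi> \<in> pob ?K m"
    note i = categoryE(3-5)[OF C c]
    let ?q = "wreath_comp C (k_ob C (k, c)) (k_ob C (m, c)) \<phi> (k_hom C k \<theta> (Idn C c))"
    have q: "pmap ?K (k, \<theta>, m) \<phi> = ?q" using i by (simp add: slice_simps k_ar_eq)
    have "?q \<in> pob ?K k" using presheafD(1)[OF slice_presheaf[OF C V_ob_presheaf[OF C] c] t p] q by simp
    moreover have f: "fst ?q = compose {..k} (fst \<phi>) \<theta>" by (simp add: k_ob_eq wreath_comp_simps k_hom_def)
    moreover have "label C c k ?q = restrict (label C c m \<phi>) {fst \<phi> (\<theta> 0)<..fst \<phi> (\<theta> k)}"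
    proof (rule extensionalityI[where A = "{fst \<phi> (\<theta> 0)<..fst \<phi> (\<theta> k)}"])
      show "label C c k ?q \<in> extensional {fst \<phi> (\<theta> 0)<..fst \<phi> (\<theta> k)}"
        unfolding label_def f by (simp add: compose_def)
      fix l assume l: "l \<in> {fst \<phi> (\<theta> 0)<..fst \<phi> (\<theta> k)}"
      have b: "fst \<phi> 0 \<le> fst \<phi> (\<theta> 0)" "fst \<phi> (\<theta> k) \<le> fst \<phi> m" "fst \<phi> m \<le> n"
        using delta_homD[OF D[OF p]] delta_homD(1)[OF t] by simp_all
      have "label C c m \<phi> l \<in> pob (X l) c" using label_in[OF C c p[unfolded K], of l] l b by simp
      then show "label C c k ?q l = restrict (label C c m \<phi>) {fst \<phi> (\<theta> 0)<..fst \<phi> (\<theta> k)} l"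
        using label_restrict[OF C i(1) t, of \<phi> n X l] p l b i presheafE(2)[OF X c, of l] by (simp add: K)
    qed simp
    ultimately show "?e k (pmap ?K (k, \<theta>, m) \<phi>) = pmap (path_nerve n ?S) (k, \<theta>, m) (?e m \<phi>)"
      by (simp add: q e e[OF p] path_nerve_simps)
  qed
  fix m show "bij_betw (?e m) (pob ?K m) (pob (path_nerve n ?S) m)"
  proof (rule bij_betw_imageI)
    show "inj_on (?e m) (pob ?K m)"
    proof (rule inj_onI)
      fix \<phi> \<psi> assume p: "\<phi> \<in> pob ?K m" and q: "\<psi> \<in> pob ?K m" and "?e m \<phi> = ?e m \<psi>"
      then have eq: "fst \<phi> = fst \<psi>" "label C c m \<phi> = label C c m \<psi>" by (simp_all add: e)
      show "\<phi> = \<psi>"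
      proof (rule wreath_hom_eqI[OF p[unfolded K k_ob_eq] q[unfolded K k_ob_eq]])
        fix i b v l assume i: "1 \<le> i" "i \<le> m" and "v \<in> pob ((\<lambda>i\<in>{1..m}. yoneda C c) i) b" and l: "fst \<phi> (i - 1) < l" "l \<le> fst \<phi> i"
        then have v: "v \<in> arrows C b c" by (simp add: yoneda_simps)
        show "snd \<phi> i b v l = snd \<psi> i b v l"
          using label_determines[OF C c p[unfolded K] i v l] label_determines[OF C c q[unfolded K] i v] l eq by simp
      qed (simp add: eq)
    qed
    have "\<exists>\<phi>\<in>pob ?K m. ?e m \<phi> = \<sigma>" if s: "\<sigma> \<in> pob (path_nerve n ?S) m" for \<sigma>
    proof -
      define \<gamma> x where "\<gamma> = fst \<sigma>" and "x = snd \<sigma>"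
      have g: "\<gamma> \<in> delta_hom m n" and x: "x \<in> (\<Pi>\<^sub>E l\<in>{\<gamma> 0<..\<gamma> m}. pob (X l) c)"
        using s by (simp_all add: path_nerve_simps \<gamma>_def x_def)
      define \<phi> where "\<phi> = (\<gamma>, \<lambda>i\<in>{1..m}. \<lambda>b\<in>Ob C. \<lambda>v\<in>arrows C b c. \<lambda>l\<in>{\<gamma> (i - 1)<..\<gamma> i}. pmap (X l) v (x l))"
      have ord: "\<gamma> 0 \<le> \<gamma> (i - 1)" "\<gamma> i \<le> \<gamma> m" "\<gamma> i \<le> n" if "i \<le> m" for i
        using that delta_homD(1,2)[OF g] by simp_all
      have xl: "x l \<in> pob (X l) c" "presheaf C (X l)" if "i \<le> m" "\<gamma> (i - 1) < l" "l \<le> \<gamma> i" for i l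
        using x X[of l] ord[OF that(1)] that(2,3) by (auto simp: PiE_iff)
      have p: "\<phi> \<in> wreath_hom C (k_ob C (m, c)) (n, X)"
        unfolding k_ob_eq
      proof (rule wreath_homI[OF C])
        fix i b v l assume i: "1 \<le> i" "i \<le> m" and b: "b \<in> Ob C" "v \<in> pob ((\<lambda>i\<in>{1..m}. yoneda C c) i) b"
          and l: "fst \<phi> (i - 1) < l" "l \<le> fst \<phi> i"
        then show "snd \<phi> i b v l \<in> pob (X l) b"
          using xl[OF i(2), of l] presheaf_arrowsD(1)[OF C xl(2)[OF i(2)], of l v b c "x l"] by (simp add: \<phi>_def yoneda_simps)
      next
        fix i u v l assume i: "1 \<le> i" "i \<le> m" and u: "u \<in> Ar C" "v \<in> pob ((\<lambda>i\<in>{1..m}. yoneda C c) i) (Cod C u)"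
          and l: "fst \<phi> (i - 1) < l" "l \<le> fst \<phi> i"
        have u': "u \<in> arrows C (Dom C u) (Cod C u)" and v: "v \<in> arrows C (Cod C u) c"
          using u i by (simp_all add: arrows_def yoneda_def)
        show "snd \<phi> i (Dom C u) (pmap ((\<lambda>i\<in>{1..m}. yoneda C c) i) u v) l = pmap (X l) u (snd \<phi> i (Cod C u) v l)"
          using presheaf_arrowsD(3)[OF C xl(2)[OF i(2)] u' v, of l] xl[OF i(2), of l] i l u' v categoryE(1,2)[OF C u(1)] categoryD(3)[OF C u' v]
          by (simp add: \<phi>_def yoneda_simps)
      qed (use g in \<open>simp_all add: \<phi>_def yoneda_presheaf[OF C] yoneda_simps\<close>)
      have "label C c m \<phi> = x"
      proof (rule extensionalityI[where A = "{\<gamma> 0<..\<gamma> m}"])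
        fix l assume l: "l \<in> {\<gamma> 0<..\<gamma> m}"
        then have b: "1 \<le> block m \<gamma> l" "block m \<gamma> l \<le> m" "\<gamma> (block m \<gamma> l - 1) < l" "l \<le> \<gamma> (block m \<gamma> l)"
          using block[OF g, of 0 l m] by simp_all
        then show "label C c m \<phi> l = x l"
          using l presheafE(2)[OF xl(2)[OF b(2-4)] c xl(1)[OF b(2-4)]] categoryD(1)[OF C c] c by (simp add: label_def \<phi>_def)
      qed (use x in \<open>simp_all add: label_def \<phi>_def PiE_iff\<close>)
      then have "?e m \<phi> = \<sigma>" using p by (simp add: e K) (simp add: \<phi>_def \<gamma>_def x_def)
      then show ?thesis using p K by blast
    qed
    then show "?e m ` pob ?K m = pob (path_nerve n ?S) m" using ein by blast
  qed
qed

lemma rigidify_map_gen: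
  assumes K: "presheaf Delta K" and h: "h \<in> psh_hom Delta K L" and s: "\<sigma> \<in> pob K m" and ij: "i \<le> m" "j \<le> m"
    and A: "A \<in> pob (EHom (coherent_simplex m) i j) p"
  shows "snd (rigidify_map K L h) (vertex K m \<sigma> i) (vertex K m \<sigma> j) p (snd (rigidify_unit K m \<sigma>) i j p A) =
    snd (rigidify_unit L m (h m \<sigma>)) i j p A"
proof -
  have w: "is_word K p (vertex K m \<sigma> i) (vertex K m \<sigma> j) [(m, \<sigma>, i, j, A)]"
    using ij s A vertex_in[OF K s] by (simp add: generators_iff)
  have "A \<in> extensional {..p}" using A by (simp add: coh_hom)
  then show ?thesis
    using psh_homD(1)[OF h s]
    by (simp add: unit_simps(2)[OF s ij A] unit_simps(2)[OF _ ij A] rigidify_map_simps(2)[OF h K w] gen_map_def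
        compose_id_ext vertex_map[OF h s] ij)
qed

text \<open>The comparison: an object, that is a map from \<open>[0]\<close> to \<open>[n]\<close>, goes to the vertex that it
  selects, and morphisms are compared slice by slice.\<close>

definition Psi where
  "Psi C X = assemble C (realization_ob C (V_ob C X)) (\<lambda>v. fst v 0)
     (\<lambda>c. linear_nerve.lift (slice C (V_ob C X) c) (fst X) (\<lambda>l. pob (snd X l) c) (coordinates C X c))"

text \<open>Naturality in \<open>C\<close> only has to be checked on generators. There it says that the values of the
  restricted simplex are obtained by restricting the path and keeping the cube coordinates. The object \<open>t\<close>
  supplies a slice whose vertices identify the objects.\<close>

lemma Psi_iso:
  assumes C: "category C" and t: "t \<in> Ob C" and X: "wreath_object C X"
  shows "enriched_iso (prod_cat Delta C) (realization_ob C (V_ob C X)) (Q_ob X) (Psi C X)"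
proof -
  obtain n Y where XY: "X = (n, Y)" by (cases X)
  have Y: "presheaf C (Y l)" if "1 \<le> l" "l \<le> n" for l using X that by (simp add: XY wreath_object_def)
  let ?V = "V_ob C (n, Y)" and ?S = "\<lambda>c l. pob (Y l) c" and ?e = "coordinates C (n, Y)"
  let ?K = "slice C ?V"
  let ?F = "\<lambda>c. linear_nerve.lift (?K c) n (?S c) (?e c)"
  have LN: "linear_nerve (?K c) n (?S c) (?e c)" if "c \<in> Ob C" for c
    using Y that by (intro slice_V_linear_nerve[OF C])
  note L = realization_levelwise[OF C V_ob_presheaf[OF C, of "(n, Y)"]]
  have L': "levelwise C (Q_ob (n, Y)) (\<lambda>c. linear_scat n (?S c)) (\<lambda>u. linear_map n (?S (Cod C u)) (\<lambda>l. pmap (Y l) u))"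
    using Y by (intro Q_levelwise[OF C])
  interpret L: levelwise C "realization_ob C ?V" "\<lambda>c. rigidify (?K c)" "transition C ?V" by (rule L)
  interpret L': levelwise C "Q_ob (n, Y)" "\<lambda>c. linear_scat n (\<lambda>l. pob (Y l) c)"
    "\<lambda>u. linear_map n (\<lambda>l. pob (Y l) (Cod C u)) (\<lambda>l. pmap (Y l) u)" by (rule L')
  have ob: "EOb (realization_ob C ?V) = pob (?K c) 0" for c
    by (simp add: realization_ob_def slice_simps k_ob_zero)
  have Kpob: "pob (?K c) m = wreath_hom C (k_ob C (m, c)) (n, Y)" for c m by (simp add: slice_simps)
  have Fob: "fst (?F c) v = fst v 0" if "c \<in> Ob C" "v \<in> EOb (realization_ob C ?V)" for c v
    using linear_nerve.lift_ob[OF LN[OF that(1)], of v] that(2) unfolding ob[of c] by (simp add: coordinates_def Kpob)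
  have Psi: "Psi C X = assemble C (realization_ob C ?V) (\<lambda>v. fst v 0) ?F" by (simp add: Psi_def XY)
  have in': "Psi C X \<in> efunctors (prod_cat Delta C) (realization_ob C ?V) (Q_ob (n, Y))"
    unfolding Psi
  proof (rule assemble_efunctor[OF L[unfolded transition_def] L'])
    show "?F c \<in> efunctors Delta (rigidify (?K c)) (linear_scat n (?S c))" if "c \<in> Ob C" for c
      by (rule linear_nerve.lift_efunctor[OF LN[OF that]])
    show "fst v 0 \<in> EOb (Q_ob (n, Y))" if "v \<in> EOb (realization_ob C ?V)" for v
      using that delta_homD(1)[OF wreath_homD(1), of v C 0 _ n Y 0] unfolding ob[of undefined] Kpob k_ob_eq by (simp add: Q_simps)
  next
    fix u v w p f assume u: "u \<in> Ar C" and v: "v \<in> EOb (realization_ob C ?V)" and w: "w \<in> EOb (realization_ob C ?V)"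
      and f: "f \<in> pob (EHom (rigidify (?K (Cod C u))) v w) p"
    note c = categoryE(1,2)[OF C u]
    interpret c: linear_nerve "?K (Cod C u)" n "?S (Cod C u)" "?e (Cod C u)" by (rule LN[OF c(2)])
    interpret d: linear_nerve "?K (Dom C u)" n "?S (Dom C u)" "?e (Dom C u)" by (rule LN[OF c(1)])
    obtain m \<sigma> i j A where s: "\<sigma> \<in> pob (?K (Cod C u)) m" and ij: "i \<le> m" "j \<le> m" and A: "A \<in> pob (EHom (coherent_simplex m) i j) p"
      and vw: "v = vertex (?K (Cod C u)) m \<sigma> i" "w = vertex (?K (Cod C u)) m \<sigma> j" and f': "f = c.gen m \<sigma> i j p A"
      using f by (rule c.morphism_gen)
    let ?r = "slice_restrict C ?V u"
    note r = slice_restrict_hom[OF C V_ob_presheaf[OF C] u, of "(n, Y)"]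
    note rs = psh_homD(1)[OF r s]
    have rv: "?r 0 x = x" if "x \<in> EOb (realization_ob C ?V)" for x
      using L.trans_ob[OF u that] by (simp add: transition_def rigidify_map_def)
    have vw': "vertex (?K (Dom C u)) m (?r m \<sigma>) i = v" "vertex (?K (Dom C u)) m (?r m \<sigma>) j = w"
      using vertex_map[OF r s] ij vw rv[OF v] rv[OF w] by simp_all
    have g: "fst \<sigma> \<in> delta_hom m n" using wreath_homD(1)[OF s[unfolded Kpob k_ob_eq]] .
    have req: "?r m \<sigma> = wreath_comp C (k_ob C (m, Dom C u)) (k_ob C (m, Cod C u)) \<sigma> (k_hom C m (\<lambda>i\<in>{..m}. i) u)"
      using s by (simp add: slice_restrict_simps Kpob k_ar_eq)
    have fr: "fst (?r m \<sigma>) = fst \<sigma>"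
      unfolding req by (simp add: k_ob_eq wreath_comp_simps k_hom_def compose_id_ext[OF delta_homD(4)[OF g]])
    have lr: "label C (Dom C u) m (?r m \<sigma>) l = pmap (Y l) u (label C (Cod C u) m \<sigma> l)" if "fst \<sigma> i < l" "l \<le> fst \<sigma> j" for l
    proof -
      have "fst \<sigma> 0 \<le> fst \<sigma> i" "fst \<sigma> j \<le> fst \<sigma> m" using delta_homD(2)[OF g] ij by simp_all
      then show ?thesis
        unfolding req using that s by (intro label_restrict[OF C u delta_hom_id]) (simp_all add: Kpob)
    qed
    have es: "?e (Cod C u) m \<sigma> = (fst \<sigma>, label C (Cod C u) m \<sigma>)" "?e (Dom C u) m (?r m \<sigma>) = (fst \<sigma>, label C (Dom C u) m (?r m \<sigma>))"
      using s rs by (simp_all add: coordinates_def Kpob fr)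
    have "snd (?F (Dom C u)) v w p (snd (rigidify_map (?K (Cod C u)) (?K (Dom C u)) ?r) v w p f) =
      snd (?F (Dom C u)) v w p (d.gen m (?r m \<sigma>) i j p A)"
      using rigidify_map_gen[OF c.K r s ij A] by (simp add: f' vw)
    also have "\<dots> = path_value p (fst \<sigma>) (label C (Dom C u) m (?r m \<sigma>)) i j A"
      using d.lift_gen[OF rs ij A] by (simp add: vw' es)
    also have "\<dots> = (\<lambda>l\<in>{fst \<sigma> i<..fst \<sigma> j}. pmap (Y l) u (fst (path_value p (fst \<sigma>) (label C (Cod C u) m \<sigma>) i j A) l),
       snd (path_value p (fst \<sigma>) (label C (Cod C u) m \<sigma>) i j A))"
      by (simp add: path_value_def lr cong: restrict_cong)
    also have "\<dots> = snd (linear_map n (?S (Cod C u)) (\<lambda>l. pmap (Y l) u)) (fst \<sigma> i) (fst \<sigma> j) p (path_value p (fst \<sigma>) (label C (Cod C u) m \<sigma>) i j A)"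
      using path_value_in[OF c.e_in[OF s] A ij(2)] delta_homD(1)[OF g] ij by (simp add: linear_map_simps es)
    also have "path_value p (fst \<sigma>) (label C (Cod C u) m \<sigma>) i j A = snd (?F (Cod C u)) v w p f"
      using c.lift_gen[OF s ij A] by (simp add: vw f' es)
    also have "fst \<sigma> i = fst v 0" 
      using c.ver_vertex[OF s ij(1)] v s unfolding ob[of "Cod C u"] vw Kpob by (simp add: coordinates_def)
    also have "fst \<sigma> j = fst w 0"
      using c.ver_vertex[OF s ij(2)] w s unfolding ob[of "Cod C u"] vw Kpob by (simp add: coordinates_def)
    finally show "snd (?F (Dom C u)) v w p (snd (rigidify_map (?K (Cod C u)) (?K (Dom C u)) ?r) v w p f) =
       snd (linear_map n (?S (Cod C u)) (\<lambda>l. pmap (Y l) u)) (fst v 0) (fst w 0) p (snd (?F (Cod C u)) v w p f)" .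
  qed (rule Fob)
  have B: "category (prod_cat Delta C)" by (rule prod_cat_category[OF category_Delta C])
  show ?thesis
    unfolding XY
  proof (rule enriched_iso_bij[OF L.enriched B in'[unfolded XY]])
    have "fst (Psi C (n, Y)) v = fst (?F t) v" if "v \<in> EOb (realization_ob C ?V)" for v
      using Fob[OF t that] that by (simp add: Psi[unfolded XY] assemble_simps)
    then have "bij_betw (fst (Psi C (n, Y))) (EOb (realization_ob C ?V)) {..n} \<longleftrightarrow> bij_betw (fst (?F t)) (EOb (realization_ob C ?V)) {..n}"
      by (rule bij_betw_cong)
    then show "bij_betw (fst (Psi C (n, Y))) (EOb (realization_ob C ?V)) (EOb (Q_ob (n, Y)))"
      unfolding Q_simps(1) using linear_nerve.lift_bij_ob[OF LN[OF t]] unfolding ob[of t] by blast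
  next
    fix v w b assume v: "v \<in> EOb (realization_ob C ?V)" and w: "w \<in> EOb (realization_ob C ?V)" and "b \<in> Ob (prod_cat Delta C)"
    then obtain p c where b: "b = (p, c)" and c: "c \<in> Ob C" by auto
    have "pob (EHom (Q_ob (n, Y)) i j) (p, c) = pob (EHom (linear_scat n (?S c)) i j) p" for i j
      by (simp add: set_eq_iff Q_simps(2))
    then show "bij_betw (snd (Psi C (n, Y)) v w b) (pob (EHom (realization_ob C ?V) v w) b)
        (pob (EHom (Q_ob (n, Y)) (fst (Psi C (n, Y)) v) (fst (Psi C (n, Y)) w)) b)"
      using linear_nerve.lift_bij_hom[OF LN[OF c], of v w p] v w c Fob[OF c v] Fob[OF c w]
      by (simp add: b Psi[unfolded XY] assemble_simps L.hom ob[of c])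
  qed
qed

lemma Psi_ob: "v \<in> wreath_hom C (cell C 0 undefined) X \<Longrightarrow> fst (Psi C X) v = fst v 0"
  by (simp add: Psi_def assemble_simps realization_ob_def)

lemma Psi_gen:
  assumes C: "category C" and X: "wreath_object C X" and c: "c \<in> Ob C"
    and s: "\<sigma> \<in> wreath_hom C (k_ob C (m, c)) X" and ij: "i \<le> m" "j \<le> m"
    and A: "A \<in> pob (EHom (coherent_simplex m) i j) p"
  defines "K \<equiv> slice C (V_ob C X) c"
  shows "snd (Psi C X) (vertex K m \<sigma> i) (vertex K m \<sigma> j) (p, c) (snd (rigidify_unit K m \<sigma>) i j p A) =
    path_value p (fst \<sigma>) (label C c m \<sigma>) i j A"
proof -
  interpret linear_nerve K "fst X" "\<lambda>l. pob (snd X l) c" "coordinates C X c"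
    using slice_V_linear_nerve[OF C _ c, of "fst X" "snd X"] X by (simp add: wreath_object_def K_def)
  have s': "\<sigma> \<in> pob K m" using s by (simp add: K_def slice_simps)
  have "vertex K m \<sigma> i \<in> EOb (realization_ob C (V_ob C X))" "vertex K m \<sigma> j \<in> EOb (realization_ob C (V_ob C X))"
    using vertex_in[OF K s'] ij by (simp_all add: realization_ob_def K_def slice_simps k_ob_zero)
  then show ?thesis
    using lift_gen[OF s' ij A] c s by (simp add: Psi_def assemble_simps K_def coordinates_def)
qed

lemma label_V:
  assumes C: "category C" and c: "c \<in> Ob C" and p: "\<phi> \<in> wreath_hom C (k_ob C (m, c)) (n, X)"
    and w: "w \<in> wreath_hom C (n, X) (k, Y)"
    and l: "fst w (fst \<phi> 0) < l" "l \<le> fst w (fst \<phi> m)"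
  shows "label C c m (wreath_comp C (k_ob C (m, c)) (n, X) w \<phi>) l =
    snd w (block n (fst w) l) c (label C c m \<phi> (block n (fst w) l)) l"
proof -
  note p' = p[unfolded k_ob_eq]
  note g = wreath_homD(1)[OF p'] and d = wreath_homD(1)[OF w]
  define b where "b = block n (fst w) l"
  note b = block[OF d l delta_homD(1)[OF g le0] delta_homD(1)[OF g order_refl], folded b_def]
  define b' where "b' = block m (fst \<phi>) b"
  note b' = block[OF g b(1,2) le0 order_refl, folded b'_def]
  have bb: "block m (compose {..m} (fst w) (fst \<phi>)) l = b'"
    unfolding b_def b'_def by (rule block_compose[OF g d l le0 order_refl])
  have "fst w (fst \<phi> (b' - 1)) \<le> fst w (b - 1)" using b'(5) b(4) by (intro delta_homD(2)[OF d]) auto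
  then have 1: "fst w (fst \<phi> (b' - 1)) < l" using b(5) by simp
  have "fst w b \<le> fst w (fst \<phi> b')" using b'(6) delta_homD(1)[OF g b'(4)] by (intro delta_homD(2)[OF d])
  then have 2: "l \<le> fst w (fst \<phi> b')" using b(6) by simp
  have "label C c m (wreath_comp C (k_ob C (m, c)) (n, X) w \<phi>) l = snd w b c (snd \<phi> b' c (Idn C c) b) l"
    using l b'(3,4) 1 2 c categoryD(1)[OF C c]
    by (simp add: label_def k_ob_eq wreath_comp_simps bb[unfolded compose_def] yoneda_simps compose_def b_def)
  then show ?thesis using b(1,2) by (simp add: label_def b_def b'_def)
qed

text \<open>The maximum in the action of \<open>Q\<close> on cubes is an existential quantifier, since coordinates are
  indicators.\<close>

lemma Max_indicator:
  assumes "\<And>k. i < k \<Longrightarrow> k < j \<Longrightarrow> t k = (if P k then 1 else 0::nat)"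
  shows "Max (insert 0 {t k | k. i < k \<and> k < (j::nat) \<and> \<delta> k = l}) = (if \<exists>k. i < k \<and> k < j \<and> \<delta> k = l \<and> P k then 1 else 0)"
proof -
  have sub: "{t k | k. i < k \<and> k < j \<and> \<delta> k = l} \<subseteq> {0, 1}" using assms by (auto split: if_splits)
  show ?thesis
  proof (cases "\<exists>k. i < k \<and> k < j \<and> \<delta> k = l \<and> P k")
    case True
    then have "1 \<in> {t k | k. i < k \<and> k < j \<and> \<delta> k = l}" using assms by force
    then have "insert 0 {t k | k. i < k \<and> k < j \<and> \<delta> k = l} = {0, 1}" using sub by auto
    then show ?thesis using True by simp
  next
    case False
    have "t k = 0" if "i < k" "k < j" "\<delta> k = l" for k using that False assms[OF that(1,2)] by auto
    then have eq: "insert 0 {t k | k. i < k \<and> k < j \<and> \<delta> k = l} = {0}" by auto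
    show ?thesis unfolding eq using False by simp
  qed
qed

text \<open>The functor part of \<^const>\<open>Q_ar\<close>, with projections in place of tuple patterns.\<close>

definition Q_map where
  "Q_map C X w = (fst w, \<lambda>i\<in>{..fst X}. \<lambda>j\<in>{..fst X}. \<lambda>b\<in>Ob (prod_cat Delta C). \<lambda>f\<in>pob (EHom (Q_ob X) i j) b.
     (\<lambda>l\<in>{fst w i<..fst w j}. snd w (block (fst X) (fst w) l) (snd b) (fst f (block (fst X) (fst w) l)) l,
      \<lambda>l\<in>{fst w i<..<fst w j}. \<lambda>r\<in>{..fst b}. Max (insert 0 {snd f k r | k. i < k \<and> k < j \<and> fst w k = l})))"

lemma Q_ar_eq: "Q_ar C (X, w, Y) = (Q_ob X, Q_map C X w, Q_ob Y)"
  by (cases X, cases w) (simp add: Q_ar_def Q_map_def Q_ob_def case_prod_unfold)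

lemma Q_map_ext:
  shows "snd (Q_map C X w) \<in> extensional {..fst X}"
    and "i \<le> fst X \<Longrightarrow> snd (Q_map C X w) i \<in> extensional {..fst X}"
    and "i \<le> fst X \<Longrightarrow> j \<le> fst X \<Longrightarrow> snd (Q_map C X w) i j \<in> extensional (Ob (prod_cat Delta C))"
    and "i \<le> fst X \<Longrightarrow> j \<le> fst X \<Longrightarrow> b \<in> Ob (prod_cat Delta C) \<Longrightarrow>
      snd (Q_map C X w) i j b \<in> extensional (pob (EHom (Q_ob X) i j) b)"
  by (simp_all add: Q_map_def)

text \<open>On values of simplices \<open>Q\<close> acts by composition of monotone maps. On cube coordinates this holds
  because a vertex \<open>l\<close> lies in the image of a chain under the composite iff some preimage of \<open>l\<close> lies in the
  image under the first map; strictly between the images of the end points, such preimages are themselves intermediate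
  vertices.\<close>

lemma Q_ar_path_value:
  assumes C: "category C" and c: "c \<in> Ob C" and s: "\<sigma> \<in> wreath_hom C (k_ob C (m, c)) (n, X)"
    and X: "\<And>l. 1 \<le> l \<Longrightarrow> l \<le> n \<Longrightarrow> presheaf C (X l)"
    and w: "w \<in> wreath_hom C (n, X) (k, Y)" and ij: "i \<le> m" "j \<le> m"
    and A: "A \<in> pob (EHom (coherent_simplex m) i j) p"
  defines "\<tau> \<equiv> wreath_comp C (k_ob C (m, c)) (n, X) w \<sigma>"
  shows "snd (Q_map C (n, X) w) (fst \<sigma> i) (fst \<sigma> j) (p, c) (path_value p (fst \<sigma>) (label C c m \<sigma>) i j A) =
    path_value p (fst \<tau>) (label C c m \<tau>) i j A"
proof -
  interpret linear_nerve "slice C (V_ob C (n, X)) c" n "\<lambda>l. pob (X l) c" "coordinates C (n, X) c"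
    by (rule slice_V_linear_nerve[OF C X c])
  note g = wreath_homD(1)[OF s[unfolded k_ob_eq]] and d = wreath_homD(1)[OF w]
  define v where "v = path_value p (fst \<sigma>) (label C c m \<sigma>) i j A"
  have "v \<in> pob (EHom (linear_scat n (\<lambda>l. pob (X l) c)) (fst \<sigma> i) (fst \<sigma> j)) p"
    using path_value_in[OF e_in A ij(2), of \<sigma>] s by (simp add: v_def slice_simps coordinates_def)
  then have v: "v \<in> pob (EHom (Q_ob (n, X)) (fst \<sigma> i) (fst \<sigma> j)) (p, c)" by (simp add: Q_simps)
  note gi = delta_homD(1)[OF g ij(1)] delta_homD(1)[OF g ij(2)]
  have ft: "fst \<tau> = compose {..m} (fst w) (fst \<sigma>)" by (simp add: \<tau>_def k_ob_eq wreath_comp_simps)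
  have ft': "fst \<tau> i = fst w (fst \<sigma> i)" "fst \<tau> j = fst w (fst \<sigma> j)" using ij by (simp_all add: ft compose_def)
  have "fst \<sigma> 0 \<le> fst \<sigma> i" "fst \<sigma> j \<le> fst \<sigma> m" using delta_homD(2)[OF g] ij by simp_all
  then have ord: "fst w (fst \<sigma> 0) \<le> fst w (fst \<sigma> i)" "fst w (fst \<sigma> j) \<le> fst w (fst \<sigma> m)"
    using gi delta_homD(1)[OF g, of m] delta_homD(2)[OF d] by simp_all
  have 1: "snd w (block n (fst w) l) c (fst v (block n (fst w) l)) l = label C c m \<tau> l"
    if l: "fst w (fst \<sigma> i) < l" "l \<le> fst w (fst \<sigma> j)" for l
    using label_V[OF C c s w, of l] l ord block(1,2)[OF d l gi] by (simp add: \<tau>_def v_def path_value_def)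
  have 2: "Max (insert 0 {snd v q r | q. fst \<sigma> i < q \<and> q < fst \<sigma> j \<and> fst w q = l}) = (if l \<in> fst \<tau> ` A r then 1 else 0)"
    if l: "fst w (fst \<sigma> i) < l" "l < fst w (fst \<sigma> j)" and r: "r \<le> p" for l r
  proof -
    note bA = coh_image_bounds[OF A g ij(2) r]
    have "A r \<subseteq> {..m}"
      using A r ij unfolding coh_hom by (meson atLeastAtMost_iff atMost_iff le_trans subsetD subsetI)
    then have img: "fst \<tau> ` A r = fst w ` fst \<sigma> ` A r" by (force simp: ft compose_def image_image)
    have "(\<exists>q. fst \<sigma> i < q \<and> q < fst \<sigma> j \<and> fst w q = l \<and> q \<in> fst \<sigma> ` A r) \<longleftrightarrow> l \<in> fst \<tau> ` A r"
    proof
      assume "l \<in> fst \<tau> ` A r"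
      then obtain q where q: "q \<in> fst \<sigma> ` A r" "fst w q = l" unfolding img by blast
      then have "q \<noteq> fst \<sigma> i" "q \<noteq> fst \<sigma> j" using l by auto
      then show "\<exists>q. fst \<sigma> i < q \<and> q < fst \<sigma> j \<and> fst w q = l \<and> q \<in> fst \<sigma> ` A r"
        using bA(3)[OF q(1)] q by (metis le_neq_implies_less)
    qed (auto simp: img)
    then show ?thesis
      using Max_indicator[of "fst \<sigma> i" "fst \<sigma> j" "\<lambda>q. snd v q r" "\<lambda>q. q \<in> fst \<sigma> ` A r" "fst w" l] r
      by (simp add: v_def path_value_def)
  qed
  show ?thesis
    unfolding v_def[symmetric] using gi c v
    by (simp add: Q_map_def path_value_def ft' 1 2 cong: restrict_cong)
qed

text \<open>Every morphism is a single generator, and on a generator the square is the previous lemma.\<close>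

lemma Psi_square:
  assumes C: "category C" and X: "wreath_object C X" and Z: "wreath_object C Z" and w: "w \<in> wreath_hom C X Z"
  defines "E \<equiv> realization_ob C (V_ob C X)"
  shows "efun_comp (prod_cat Delta C) E (Q_map C X w) (Psi C X) =
    efun_comp (prod_cat Delta C) E (Psi C Z) (realization_map C (V_ob C X) (V_ob C Z) (V_map C X Z w))"
proof -
  let ?B = "prod_cat Delta C"
  obtain n Y where XY: "X = (n, Y)" by (cases X)
  obtain k W where ZW: "Z = (k, W)" by (cases Z)
  have Y: "presheaf C (Y l)" if "1 \<le> l" "l \<le> n" for l using X that by (simp add: XY wreath_object_def)
  let ?h = "V_map C X Z w"
  let ?r = "realization_map C (V_ob C X) (V_ob C Z) ?h"
  note h = V_map_in[OF C X w]
  interpret L: levelwise C E "\<lambda>c. rigidify (slice C (V_ob C X) c)"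
    "transition C (V_ob C X)"
    unfolding E_def by (rule realization_levelwise[OF C V_ob_presheaf[OF C]])
  have ob: "EOb E = wreath_hom C (cell C 0 undefined) X" by (simp add: E_def realization_ob_def)
  have cell0: "fst (cell C 0 undefined) = 0" by (simp add: cell_def)
  have hv: "?h (cell C 0 undefined) v = wreath_comp C (cell C 0 undefined) X w v" if "v \<in> EOb E" for v
    using that cell_zero_in[of C undefined] by (simp add: V_map_def ob)
  note hE = efunctorsD(1)[OF realization_map_in[OF C V_ob_presheaf[OF C] V_ob_presheaf[OF C] h], folded E_def]
  have Rv: "fst ?r v = ?h (cell C 0 undefined) v" if "v \<in> EOb E" for v
    using that by (simp add: realization_map_def assemble_simps E_def)
  have Rin: "?h (cell C 0 undefined) v \<in> wreath_hom C (cell C 0 undefined) Z" if "v \<in> EOb E" for v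
    using hE[OF that] Rv[OF that] by (simp add: realization_ob_def)
  show ?thesis
  proof (rule efun_eqI[where E = E and B = "?B"])
    fix v assume v: "v \<in> EOb E"
    have "fst (wreath_comp C (cell C 0 undefined) X w v) 0 = fst w (fst v 0)"
      by (simp add: cell_def XY wreath_comp_simps compose_def)
    then show "fst (efun_comp ?B E (Q_map C X w) (Psi C X)) v =
      fst (efun_comp ?B E (Psi C Z) ?r) v"
      using v Psi_ob[of v C X] Psi_ob[OF Rin[OF v]] Rv[OF v] hv[OF v]
      by (simp add: efun_comp_simps ob) (simp add: XY Q_map_def)
  next
    fix v v' b f assume v: "v \<in> EOb E" and v': "v' \<in> EOb E" and b: "b \<in> Ob ?B" and f: "f \<in> pob (EHom E v v') b"
    obtain p c where pc: "b = (p, c)" and c: "c \<in> Ob C" using b by auto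
    let ?K = "slice C (V_ob C X) c" and ?L = "slice C (V_ob C Z) c"
    interpret K: linear_nerve ?K n "\<lambda>l. pob (Y l) c" "coordinates C X c"
      unfolding XY by (rule slice_V_linear_nerve[OF C Y c])
    have "f \<in> pob (EHom (rigidify ?K) v v') p" using f v v' c by (simp add: pc L.hom)
    then obtain m \<sigma> i j A where s: "\<sigma> \<in> pob ?K m" and ij: "i \<le> m" "j \<le> m" and A: "A \<in> pob (EHom (coherent_simplex m) i j) p"
      and vv: "v = vertex ?K m \<sigma> i" "v' = vertex ?K m \<sigma> j" and f': "f = K.gen m \<sigma> i j p A"
      by (rule K.morphism_gen)
    have s': "\<sigma> \<in> wreath_hom C (k_ob C (m, c)) X" using s by (simp add: slice_simps)
    define \<tau> where "\<tau> = wreath_comp C (k_ob C (m, c)) X w \<sigma>"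
    have t: "\<tau> \<in> wreath_hom C (k_ob C (m, c)) Z"
      unfolding \<tau>_def by (rule wreath_laws(2)[OF C conjunct2[OF Theta_object[OF C k_ob_in[OF c]]] s' w])
    note sm = slice_map_hom[OF C h c]
    have st: "slice_map C ?h c m \<sigma> = \<tau>" using s' k_ob_in[OF c] by (simp add: slice_map_def V_map_def \<tau>_def)
    have vt: "vertex ?L m \<tau> i = ?h (cell C 0 undefined) v" "vertex ?L m \<tau> j = ?h (cell C 0 undefined) v'"
      using vertex_map[OF sm s ij(1)] vertex_map[OF sm s ij(2)] by (simp_all add: st vv slice_map_zero)
    have fi: "fst v 0 = fst \<sigma> i" "fst v' 0 = fst \<sigma> j"
      using K.ver_vertex[OF s ij(1)] K.ver_vertex[OF s ij(2)] v v' s' unfolding vv ob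
      by (simp_all add: coordinates_def k_ob_zero)
    have "snd (efun_comp ?B E (Psi C Z) ?r) v v' b f =
      snd (Psi C Z) (vertex ?L m \<tau> i) (vertex ?L m \<tau> j) (p, c) (snd (rigidify_unit ?L m \<tau>) i j p A)"
      using v v' b f c rigidify_map_gen[OF K.K sm s ij A]
      by (simp add: efun_comp_simps pc Rv vt st vv[symmetric] f'[symmetric]) (simp add: realization_map_def assemble_simps E_def)
    also have "\<dots> = path_value p (fst \<tau>) (label C c m \<tau>) i j A"
      by (rule Psi_gen[OF C Z c t ij A])
    also have "\<dots> = snd (Q_map C X w) (fst \<sigma> i) (fst \<sigma> j) (p, c) (path_value p (fst \<sigma>) (label C c m \<sigma>) i j A)"
      using Q_ar_path_value[OF C c s'[unfolded XY] Y w[unfolded XY ZW] ij A] by (simp add: \<tau>_def XY ZW)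
    also have "\<dots> = snd (efun_comp ?B E (Q_map C X w) (Psi C X)) v v' b f"
      using v v' b f Psi_gen[OF C X c s' ij A] Psi_ob[of v C X] Psi_ob[of v' C X] fi
      by (simp add: efun_comp_simps pc vv[symmetric] f'[symmetric] ob)
    finally show "snd (efun_comp ?B E (Q_map C X w) (Psi C X)) v v' b f =
      snd (efun_comp ?B E (Psi C Z) ?r) v v' b f" ..
  qed (simp_all add: efun_comp_ext del: prod_cat_simps(1))
qed

theorem proposition2p1p10:
  fixes C :: "('o, 'a) cat" and P M :: "'a set" and dim :: "'o \<Rightarrow> nat"
  assumes "regular_cartesian_reedy C P M dim"
    and "\<exists>t. terminal_object C t"
  shows "is_functor (wreath C :: (('o, 'a, 's) wob, ('o, 'a, 's) war) cat)
           (psh_cat (Theta C)) (V_functor C) \<and>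
         is_functor (psh_cat (Theta C) :: (('o, 'a, ('o, 'a, 's) wmor) cellular_set, _) cat)
           (ecat_cat (prod_cat Delta C)) (realization C) \<and>
         naturally_isomorphic (prod_cat Delta C)
           (wreath C :: (('o, 'a, 's) wob, ('o, 'a, 's) war) cat)
           (Q_functor C) (functor_comp (realization C) (V_functor C))"
proof (intro conjI)
  have C: "category C"
    using assms(1) by (simp add: regular_cartesian_reedy_def regular_skeletal_def skeletal_def)
  obtain t where t: "t \<in> Ob C" using assms(2) by (auto simp: terminal_object_def)
  let ?A = "wreath C :: (('o, 'a, 's) wob, ('o, 'a, 's) war) cat"
  let ?B = "prod_cat Delta C"
  let ?G = "functor_comp (realization C) (V_functor C) :: (('o, 'a, 's) wob \<Rightarrow> _) \<times> _"
  show V: "is_functor ?A (psh_cat (Theta C)) (V_functor C)" by (rule V_is_functor[OF C])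
  show R: "is_functor (psh_cat (Theta C) :: (('o, 'a, ('o, 'a, 's) wmor) cellular_set, _) cat) (ecat_cat ?B) (realization C)"
    by (rule realization_is_functor[OF C])
  have B: "category ?B" by (rule prod_cat_category[OF category_Delta C])
  have Gob: "fst ?G X = realization_ob C (V_ob C X)" for X by (simp add: functor_comp_def realization_def V_functor_def)
  have QE: "enriched_category ?B (Q_ob X)" if "wreath_object C X" for X :: "('o, 'a, 's) wob"
    using levelwise.enriched[OF Q_levelwise[OF C, of "fst X" "snd X"]] that by (simp add: wreath_object_def)
  show "naturally_isomorphic ?B ?A (Q_functor C) ?G"
    unfolding Q_functor_def
  proof (rule naturally_isomorphic_transport[where P = "Psi C" and f = "\<lambda>u. fst (snd (Q_ar C u))", OF B functor_comp_is_functor[OF V R]])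
    fix X :: "('o, 'a, 's) wob" assume "X \<in> Ob ?A"
    then have X: "wreath_object C X" by simp
    show "enriched_category ?B (Q_ob X)" by (rule QE[OF X])
    show "enriched_iso ?B (fst ?G X) (Q_ob X) (Psi C X)" unfolding Gob by (rule Psi_iso[OF C t X])
  next
    fix u assume u: "u \<in> Ar ?A"
    obtain X w Z where u': "u = (X, w, Z)" by (metis prod.collapse)
    have w: "w \<in> wreath_hom C X Z" and X: "wreath_object C X" and Z: "wreath_object C Z" using u by (simp_all add: u')
    have g: "fst w \<in> extensional {..fst X}"
      using delta_homD(4)[OF wreath_homD(1), of w C "fst X" "snd X" "fst Z" "snd Z"] w by simp
    have E: "EOb (Q_ob X) = {..fst X}" by (simp add: Q_ob_def)
    note ext = efun_comp_ext[where B = ?B and E = "Q_ob X", unfolded E]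
    show "Q_ar C u = (Q_ob (Dom ?A u), fst (snd (Q_ar C u)), Q_ob (Cod ?A u))" by (simp add: u' Q_ar_eq)
    have "efun_comp ?B (Q_ob X) (Q_map C X w) (efun_id ?B (Q_ob X)) = Q_map C X w"
    proof (rule efun_eqI[where E = "Q_ob X" and B = ?B])
      have "fst (Q_map C X w) = fst w" by (simp add: Q_map_def)
      then show "fst (Q_map C X w) \<in> extensional (EOb (Q_ob X))" using g by (simp add: E)
    qed (simp_all add: E ext Q_map_ext efun_comp_simps efun_id_simps psh_id_apply del: prod_cat_simps(1))
    then show "efun_comp ?B (Q_ob (Dom ?A u)) (fst (snd (Q_ar C u))) (efun_id ?B (Q_ob (Dom ?A u))) = fst (snd (Q_ar C u))"
      by (simp add: u' Q_ar_eq)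
    note h = V_map_in[OF C X w]
    show "efun_comp ?B (fst ?G (Dom ?A u)) (fst (snd (Q_ar C u))) (Psi C (Dom ?A u)) =
        efun_comp ?B (fst ?G (Dom ?A u)) (Psi C (Cod ?A u)) (fst (snd (snd ?G u)))"
      using Psi_square[OF C X Z w] 
      by (simp add: Gob u' Q_ar_eq) (simp add: functor_comp_def realization_def V_functor_def V_ar_eq realization_ar_eq[OF h])
  qed
qed

end
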